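(* Let $\mu\in\mathcal M_a(\mathcal N')$ be a non-degenerate probability measure and let $\beta\in[0,1)$. The $S_\mu$-transform is a topological isomorphism from $(\mathcal N)^{-\beta}_\mu$ onto $\mathcal E_{\max}^{2/(1-\beta)}(\mathcal N_{\mathbb C})$.
   Context: Nuclear triple: $\mathcal H$ is a real separable Hilbert space with norm $|\cdot|$; $\mathcal N\subset\mathcal H$ is a separable nuclear Fréchet space, densely and continuously embedded, $\mathcal N=\bigcap_{p\in\mathbb N}\mathcal H_p$ with the projective limit topology, where the $\mathcal H_p$ are Hilbert spaces with norms $|\cdot|_p$, $|\cdot|\le|\cdot|_p\le|\cdot|_q$ for $p<q$, and for every $p$ there is $p'>p$ such that the embedding $\mathcal H_{p'}\hookrightarrow\mathcal H_p$ is Hilbert–Schmidt. $\mathcal N'=\bigcup_p\mathcal H_{-p}$ is the dual, $\mathcal H_{-p}$ being the dual of $\mathcal H_p$ with respect to $\mathcal H$, with norm $|\cdot|_{-p}$; $\langle\cdot,\cdot\rangle$ is the bilinear dual pairing. A subscript $\mathbb C$ denotes complexification, $\hat\otimes$ the symmetric tensor product; $|\cdot|_{\pm p}$ also denotes the norm on $\mathcal H_{\pm p,\mathbb C}^{\hat\otimes n}$ (complex modulus if $n=0$); $\mathcal N_{\mathbb C}^{\hat\otimes n}$ is the projective limit of the $\mathcal H_{p,\mathbb C}^{\hat\otimes n}$, and its dual is the inductive limit of the $\mathcal H_{-p,\mathbb C}^{\hat\otimes n}$. Measures: $\mathcal M_a(\mathcal N')$ is the set of measures $\mu$ on the cylinder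 $\sigma$-algebra of $\mathcal N'$ whose Laplace transform $l_\mu(\theta)=\int_{\mathcal N'}e^{\langle x,\theta\rangle}\,d\mu(x)$ is holomorphic in a neighborhood of $0\in\mathcal N_{\mathbb C}$ (holomorphic = Gâteaux-holomorphic and locally bounded). $\mathcal P(\mathcal N')$ is the set of functions $\varphi(x)=\sum_{n=0}^N\langle x^{\otimes n},\tilde\varphi^{(n)}\rangle$ on $\mathcal N'$ with $\tilde\varphi^{(n)}\in\mathcal N_{\mathbb C}^{\hat\otimes n}$, topologized as the topological direct sum $\bigoplus_n\mathcal N_{\mathbb C}^{\hat\otimes n}$; $\mu$ is non-degenerate if $\varphi\in\mathcal P(\mathcal N')$, $\varphi=0$ $\mu$-a.e. implies $\varphi\equiv0$. Appell system: $e_\mu(\theta;z)=e^{\langle z,\theta\rangle}/l_\mu(\theta)=\sum_{n}\frac1{n!}\langle P_n^\mu(z),\theta^{\otimes n}\rangle$ ($\theta$ near $0$ in $\mathcal N_{\mathbb C}$, $z\in\mathcal N'_{\mathbb C}$) defines $P_n^\mu(z)\in(\mathcal N_{\mathbb C}^{\hat\otimes n})'$. Every $\varphi\in\mathcal P(\mathcal N')$ is uniquely $\sum_{n=0}^N\langle P_n^\mu,\varphi^{(n)}\rangle$ with $\varphi^{(n)}\in\mathcal N_{\mathbb C}^{\hat\otimes n}$. $\mathcal P'_\mu(\mathcal N')$ is the dual of $\mathcal P(\mathcal N')$, with bilinear pairing $\langle\!\langle\cdot,\cdot\rangle\!\rangle_\mu$ extending $\langle\!\langle f,\varphi\rangle\!\rangle_\mu=\int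 f\varphi\,d\mu$ ($f\in L^2(\mu)$). Every $\Phi\in\mathcal P'_\mu(\mathcal N')$ is uniquely of the form $\Phi=\sum_nQ_n^\mu(\Phi^{(n)})$, $\Phi^{(n)}\in(\mathcal N_{\mathbb C}^{\hat\otimes n})'$, acting by $\langle\!\langle\Phi,\varphi\rangle\!\rangle_\mu=\sum_nn!\langle\Phi^{(n)},\varphi^{(n)}\rangle$. Distributions: for $\beta\in[0,1]$, $(\mathcal H_{-p})^{-\beta}_{-q,\mu}$ is the Hilbert space of $\Phi\in\mathcal P'_\mu(\mathcal N')$ with $\sum_n(n!)^{1-\beta}2^{-qn}|\Phi^{(n)}|_{-p}^2<\infty$ (square of the norm), and $(\mathcal N)^{-\beta}_\mu=\bigcup_{p,q\in\mathbb N}(\mathcal H_{-p})^{-\beta}_{-q,\mu}$ with the inductive limit topology. $S_\mu$-transform: $S_\mu\Phi(\theta)=\langle\!\langle\Phi,e_\mu(\theta;\cdot)\rangle\!\rangle_\mu=\sum_n\langle\Phi^{(n)},\theta^{\otimes n}\rangle$ (for $\Phi\in(\mathcal N)_\mu^{-\beta}$, $\beta<1$, the function $S_\mu\Phi$ is understood as given by this series). Entire functions: for $k\ge1$, $\mathcal E^k_{2^{l}}(\mathcal H_{p,\mathbb C})$ is the space of entire functions $F$ on $\mathcal H_{p,\mathbb C}$ with finite norm $\sup_{\theta\in\mathcal H_{p,\mathbb C}}|F(\theta)|\exp(-2^{l}|\theta|_{p}^k)$; $\mathcal E^k_{\max}(\mathcal N_{\mathbb C})$ is the inductive limit of these spaces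 over $p,l\in\mathbb N$ (entire functions on $\mathcal N_{\mathbb C}$ of growth $k$ and finite type). *)

theory Defs
  imports "HOL-Probability.Probability"
begin

text \<open>Conventions. A function living on a set \<open>A\<close> of some type (a functional on a space of
  functions, a polynomial on the dual space, an entire function on a subspace, a tensor, \<dots>) is a
  total function that vanishes outside \<open>A\<close>, so that equality of such objects is equality
  in HOL. The complexification of a real subspace \<open>X\<close> is \<open>X \<times> X\<close>, the pair \<open>(u, v)\<close> standing
  for \<open>u + i v\<close>.\<close>


section \<open>Locally convex topologies on subspaces\<close>

text \<open>The topology on \<open>X\<close> defined by the set \<open>Q\<close> of seminorms. With the increasing sequence of
  norms of a projective limit as \<open>Q\<close>, this is the projective limit topology.\<close>

definition seminorm_topology :: "'a::minus set \<Rightarrow> ('a \<Rightarrow> real) set \<Rightarrow> 'a topology" where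
  "seminorm_topology X Q = topology (\<lambda>W. W \<subseteq> X \<and>
     (\<forall>f\<in>W. \<exists>F \<epsilon>. finite F \<and> F \<subseteq> Q \<and> 0 < \<epsilon> \<and>
        (\<forall>g\<in>X. (\<forall>q\<in>F. q (g - f) < \<epsilon>) \<longrightarrow> g \<in> W)))"

definition absolutely_convex :: "('x \<Rightarrow> complex) set \<Rightarrow> bool" where
  "absolutely_convex U \<longleftrightarrow>
     (\<forall>u\<in>U. \<forall>v\<in>U. \<forall>a b. cmod a + cmod b \<le> 1 \<longrightarrow> (\<lambda>x. a * u x + b * v x) \<in> U)"

text \<open>The finest locally convex topology on \<open>V\<close> for which all the linear maps
  \<open>j i\<close> from \<open>topspace (T i)\<close> to \<open>V\<close> are continuous; \<open>V\<close> is the linear span of their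
  images. The basic neighbourhoods of zero are the absolutely convex sets whose preimages under
  all \<open>j i\<close> are neighbourhoods of zero.\<close>

definition lc_inductive_topology ::
  "('x \<Rightarrow> complex) set \<Rightarrow> ('i \<Rightarrow> ('y \<Rightarrow> complex) topology) \<Rightarrow>
   ('i \<Rightarrow> ('y \<Rightarrow> complex) \<Rightarrow> ('x \<Rightarrow> complex)) \<Rightarrow> ('x \<Rightarrow> complex) topology" where
  "lc_inductive_topology V T j = topology (\<lambda>W. W \<subseteq> V \<and>
     (\<forall>f\<in>W. \<exists>U. U \<subseteq> V \<and> absolutely_convex U \<and>
        (\<forall>i. \<exists>G. openin (T i) G \<and> (\<lambda>_. 0) \<in> G \<and> j i ` G \<subseteq> U) \<and>
        (\<forall>g\<in>V. g - f \<in> U \<longrightarrow> g \<in> W)))"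

definition complex_linear_on :: "('x \<Rightarrow> complex) set \<Rightarrow> (('x \<Rightarrow> complex) \<Rightarrow> ('y \<Rightarrow> complex)) \<Rightarrow> bool" where
  "complex_linear_on X L \<longleftrightarrow>
     (\<forall>f\<in>X. \<forall>g\<in>X. \<forall>a b. L (\<lambda>x. a * f x + b * g x) = (\<lambda>y. a * L f y + b * L g y))"

definition topological_isomorphism ::
  "('x \<Rightarrow> complex) set \<Rightarrow> ('x \<Rightarrow> complex) topology \<Rightarrow> ('y \<Rightarrow> complex) set \<Rightarrow> ('y \<Rightarrow> complex) topology \<Rightarrow>
   (('x \<Rightarrow> complex) \<Rightarrow> ('y \<Rightarrow> complex)) \<Rightarrow> bool" where
  "topological_isomorphism A \<tau> B \<sigma> L \<longleftrightarrow>
     topspace \<tau> = A \<and> topspace \<sigma> = B \<and>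
     complex_linear_on A L \<and> bij_betw L A B \<and> homeomorphic_map \<tau> \<sigma> L"

definition dual_space :: "('x \<Rightarrow> complex) topology \<Rightarrow> (('x \<Rightarrow> complex) \<Rightarrow> complex) set" where
  "dual_space \<tau> = {K.
     (\<forall>f\<in>topspace \<tau>. \<forall>g\<in>topspace \<tau>. \<forall>a b. K (\<lambda>x. a * f x + b * g x) = a * K f + b * K g) \<and>
     continuous_map \<tau> euclidean K \<and> (\<forall>f. f \<notin> topspace \<tau> \<longrightarrow> K f = 0)}"

lemma istopology_seminorm:
  "istopology (\<lambda>W. W \<subseteq> X \<and>
     (\<forall>f\<in>W. \<exists>F \<epsilon>. finite F \<and> F \<subseteq> Q \<and> 0 < (\<epsilon>::real) \<and>
        (\<forall>g\<in>X. (\<forall>q\<in>F. q (g - f) < \<epsilon>) \<longrightarrow> g \<in> W)))"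
  (is "istopology ?P")
  unfolding istopology_def
proof (intro conjI allI impI)
  fix S T assume S: "?P S" and T: "?P T"
  show "S \<inter> T \<subseteq> X" using S by blast
  show "\<forall>f\<in>S \<inter> T. \<exists>F \<epsilon>. finite F \<and> F \<subseteq> Q \<and> 0 < \<epsilon> \<and>
        (\<forall>g\<in>X. (\<forall>q\<in>F. q (g - f) < \<epsilon>) \<longrightarrow> g \<in> S \<inter> T)"
  proof
    fix f assume f: "f \<in> S \<inter> T"
    obtain F1 e1 where 1: "finite F1" "F1 \<subseteq> Q" "0 < e1"
        "\<forall>g\<in>X. (\<forall>q\<in>F1. q (g - f) < e1) \<longrightarrow> g \<in> S" using S f by (elim conjE IntE) (drule bspec, assumption, elim exE conjE, rule that)
    obtain F2 e2 where 2: "finite F2" "F2 \<subseteq> Q" "0 < e2"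
        "\<forall>g\<in>X. (\<forall>q\<in>F2. q (g - f) < e2) \<longrightarrow> g \<in> T" using T f by (elim conjE IntE) (drule bspec, assumption, elim exE conjE, rule that)
    show "\<exists>F \<epsilon>. finite F \<and> F \<subseteq> Q \<and> 0 < \<epsilon> \<and>
        (\<forall>g\<in>X. (\<forall>q\<in>F. q (g - f) < \<epsilon>) \<longrightarrow> g \<in> S \<inter> T)"
      using 1 2 by (intro exI[of _ "F1 \<union> F2"] exI[of _ "min e1 e2"]) auto
  qed
next
  fix \<K> assume K: "\<forall>K\<in>\<K>. ?P K"
  show "\<Union>\<K> \<subseteq> X" using K by blast
  show "\<forall>f\<in>\<Union>\<K>. \<exists>F \<epsilon>. finite F \<and> F \<subseteq> Q \<and> 0 < \<epsilon> \<and>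
        (\<forall>g\<in>X. (\<forall>q\<in>F. q (g - f) < \<epsilon>) \<longrightarrow> g \<in> \<Union>\<K>)"
  proof
    fix f assume "f \<in> \<Union>\<K>"
    then obtain K' where K': "K' \<in> \<K>" "f \<in> K'" by blast
    have "?P K'" using K K'(1) by (rule bspec)
    then obtain F e where "finite F" "F \<subseteq> Q" "0 < e"
        "\<forall>g\<in>X. (\<forall>q\<in>F. q (g - f) < e) \<longrightarrow> g \<in> K'"
      using K'(2) by (elim conjE) (drule bspec, assumption, elim exE conjE, rule that)
    then show "\<exists>F \<epsilon>. finite F \<and> F \<subseteq> Q \<and> 0 < \<epsilon> \<and>
        (\<forall>g\<in>X. (\<forall>q\<in>F. q (g - f) < \<epsilon>) \<longrightarrow> g \<in> \<Union>\<K>)"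
      using K'(1) by (intro exI[of _ F] exI[of _ e]) auto
  qed
qed

lemma openin_seminorm_topology:
  "openin (seminorm_topology X Q) W \<longleftrightarrow> W \<subseteq> X \<and>
     (\<forall>f\<in>W. \<exists>F \<epsilon>. finite F \<and> F \<subseteq> Q \<and> 0 < \<epsilon> \<and>
        (\<forall>g\<in>X. (\<forall>q\<in>F. q (g - f) < \<epsilon>) \<longrightarrow> g \<in> W))"
  unfolding seminorm_topology_def topology_inverse'[OF istopology_seminorm] ..

lemma topspace_seminorm_topology [simp]: "topspace (seminorm_topology X Q) = X"
proof
  show "topspace (seminorm_topology X Q) \<subseteq> X"
    using openin_seminorm_topology[of X Q "topspace (seminorm_topology X Q)"] by auto
  have "openin (seminorm_topology X Q) X"
    unfolding openin_seminorm_topology by (auto intro!: exI[of _ "{}"] exI[of _ "1::real"])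
  then show "X \<subseteq> topspace (seminorm_topology X Q)" by (rule openin_subset)
qed

lemma istopology_lc_inductive:
  "istopology (\<lambda>W. W \<subseteq> V \<and>
     (\<forall>f\<in>W. \<exists>U. U \<subseteq> V \<and> absolutely_convex U \<and>
        (\<forall>i. \<exists>G. openin (T i) G \<and> (\<lambda>_. 0) \<in> G \<and> j i ` G \<subseteq> U) \<and>
        (\<forall>g\<in>V. g - f \<in> U \<longrightarrow> g \<in> W)))"
  (is "istopology ?P")
  unfolding istopology_def
proof (intro conjI allI impI)
  fix S R assume S: "?P S" and R: "?P R"
  show "S \<inter> R \<subseteq> V" using S by blast
  show "\<forall>f\<in>S \<inter> R. \<exists>U. U \<subseteq> V \<and> absolutely_convex U \<and>
        (\<forall>i. \<exists>G. openin (T i) G \<and> (\<lambda>_. 0) \<in> G \<and> j i ` G \<subseteq> U) \<and>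
        (\<forall>g\<in>V. g - f \<in> U \<longrightarrow> g \<in> S \<inter> R)"
  proof
    fix f assume f: "f \<in> S \<inter> R"
    obtain U1 where 1: "U1 \<subseteq> V" "absolutely_convex U1"
        "\<forall>i. \<exists>G. openin (T i) G \<and> (\<lambda>_. 0) \<in> G \<and> j i ` G \<subseteq> U1"
        "\<forall>g\<in>V. g - f \<in> U1 \<longrightarrow> g \<in> S" using S f by (elim conjE IntE) (drule bspec, assumption, elim exE conjE, rule that)
    obtain U2 where 2: "U2 \<subseteq> V" "absolutely_convex U2"
        "\<forall>i. \<exists>G. openin (T i) G \<and> (\<lambda>_. 0) \<in> G \<and> j i ` G \<subseteq> U2"
        "\<forall>g\<in>V. g - f \<in> U2 \<longrightarrow> g \<in> R" using R f by (elim conjE IntE) (drule bspec, assumption, elim exE conjE, rule that)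
    have "\<exists>G. openin (T i) G \<and> (\<lambda>_. 0) \<in> G \<and> j i ` G \<subseteq> U1 \<inter> U2" for i
    proof -
      obtain G1 G2 where "openin (T i) G1" "(\<lambda>_. 0) \<in> G1" "j i ` G1 \<subseteq> U1"
          "openin (T i) G2" "(\<lambda>_. 0) \<in> G2" "j i ` G2 \<subseteq> U2"
        using 1(3) 2(3) by meson
      then show ?thesis by (intro exI[of _ "G1 \<inter> G2"]) (auto intro: openin_Int)
    qed
    moreover have "absolutely_convex (U1 \<inter> U2)"
      using 1(2) 2(2) unfolding absolutely_convex_def by blast
    ultimately show "\<exists>U. U \<subseteq> V \<and> absolutely_convex U \<and>
        (\<forall>i. \<exists>G. openin (T i) G \<and> (\<lambda>_. 0) \<in> G \<and> j i ` G \<subseteq> U) \<and>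
        (\<forall>g\<in>V. g - f \<in> U \<longrightarrow> g \<in> S \<inter> R)"
      using 1 2 by (intro exI[of _ "U1 \<inter> U2"]) auto
  qed
next
  fix \<K> assume K: "\<forall>K\<in>\<K>. ?P K"
  show "\<Union>\<K> \<subseteq> V" using K by blast
  show "\<forall>f\<in>\<Union>\<K>. \<exists>U. U \<subseteq> V \<and> absolutely_convex U \<and>
        (\<forall>i. \<exists>G. openin (T i) G \<and> (\<lambda>_. 0) \<in> G \<and> j i ` G \<subseteq> U) \<and>
        (\<forall>g\<in>V. g - f \<in> U \<longrightarrow> g \<in> \<Union>\<K>)"
  proof
    fix f assume "f \<in> \<Union>\<K>"
    then obtain K' where K': "K' \<in> \<K>" "f \<in> K'" by blast
    have "?P K'" using K K'(1) by (rule bspec)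
    then obtain U where "U \<subseteq> V" "absolutely_convex U"
        "\<forall>i. \<exists>G. openin (T i) G \<and> (\<lambda>_. 0) \<in> G \<and> j i ` G \<subseteq> U"
        "\<forall>g\<in>V. g - f \<in> U \<longrightarrow> g \<in> K'"
      using K'(2) by (elim conjE) (drule bspec, assumption, elim exE conjE, rule that)
    then show "\<exists>U. U \<subseteq> V \<and> absolutely_convex U \<and>
        (\<forall>i. \<exists>G. openin (T i) G \<and> (\<lambda>_. 0) \<in> G \<and> j i ` G \<subseteq> U) \<and>
        (\<forall>g\<in>V. g - f \<in> U \<longrightarrow> g \<in> \<Union>\<K>)"
      using K'(1) by (intro exI[of _ U]) blast
  qed
qed

lemma openin_lc_inductive_topology:
  "openin (lc_inductive_topology V T j) W \<longleftrightarrow> W \<subseteq> V \<and>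
     (\<forall>f\<in>W. \<exists>U. U \<subseteq> V \<and> absolutely_convex U \<and>
        (\<forall>i. \<exists>G. openin (T i) G \<and> (\<lambda>_. 0) \<in> G \<and> j i ` G \<subseteq> U) \<and>
        (\<forall>g\<in>V. g - f \<in> U \<longrightarrow> g \<in> W))"
  unfolding lc_inductive_topology_def topology_inverse'[OF istopology_lc_inductive] ..

lemma topspace_lc_inductive_topology:
  assumes "absolutely_convex V"
    and "\<And>i. (\<lambda>_. 0) \<in> topspace (T i)" and "\<And>i. j i ` topspace (T i) \<subseteq> V"
  shows "topspace (lc_inductive_topology V T j) = V"
proof
  show "topspace (lc_inductive_topology V T j) \<subseteq> V"
    using openin_lc_inductive_topology[of V T j "topspace (lc_inductive_topology V T j)"] by auto
  have "openin (lc_inductive_topology V T j) V"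
    unfolding openin_lc_inductive_topology
    using assms openin_topspace by blast
  then show "V \<subseteq> topspace (lc_inductive_topology V T j)" by (rule openin_subset)
qed


section \<open>Complexification and holomorphy\<close>

definition cscale :: "complex \<Rightarrow> 'h::real_vector \<times> 'h \<Rightarrow> 'h \<times> 'h" where
  "cscale c \<theta> = (Re c *\<^sub>R fst \<theta> - Im c *\<^sub>R snd \<theta>, Re c *\<^sub>R snd \<theta> + Im c *\<^sub>R fst \<theta>)"

text \<open>Holomorphy (Gateaux-holomorphic and locally bounded) on an open set \<open>U\<close> of the
  complexified topological vector space \<open>topspace \<tau>\<close>.\<close>

definition holomorphic_in ::
  "('h::real_vector \<times> 'h) topology \<Rightarrow> ('h \<times> 'h) set \<Rightarrow> ('h \<times> 'h \<Rightarrow> complex) \<Rightarrow> bool" where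
  "holomorphic_in \<tau> U F \<longleftrightarrow> openin \<tau> U \<and>
     (\<forall>\<theta>\<in>U. \<forall>\<eta>\<in>topspace \<tau>. \<exists>r>0. (\<lambda>\<zeta>. F (\<theta> + cscale \<zeta> \<eta>)) holomorphic_on ball 0 r) \<and>
     (\<forall>\<theta>\<in>U. \<exists>G. openin \<tau> G \<and> \<theta> \<in> G \<and> G \<subseteq> U \<and> bounded (F ` G))"


section \<open>Chains of Hilbert spaces\<close>

text \<open>The central Hilbert space is the type \<open>'h\<close>. The space with index \<open>p\<close> is the subspace \<open>H p\<close>
  with the inner product \<open>ip p\<close>, which is meaningful only on \<open>H p\<close>.\<close>

locale hilbert_chain =
  fixes H :: "nat \<Rightarrow> 'h::{real_inner, banach, second_countable_topology} set"
    and ip :: "nat \<Rightarrow> 'h \<Rightarrow> 'h \<Rightarrow> real"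
begin

definition nrm :: "nat \<Rightarrow> 'h \<Rightarrow> real" where
  "nrm p u = sqrt (ip p u u)"

definition orthonormal :: "nat \<Rightarrow> 'h set \<Rightarrow> bool" where
  "orthonormal p E \<longleftrightarrow> E \<subseteq> H p \<and> (\<forall>e\<in>E. \<forall>f\<in>E. ip p e f = (if e = f then 1 else 0))"

definition orthonormal_basis :: "nat \<Rightarrow> 'h set \<Rightarrow> bool" where
  "orthonormal_basis p E \<longleftrightarrow> orthonormal p E \<and>
     (\<forall>u\<in>H p. \<forall>\<epsilon>>0. \<exists>v\<in>span E. nrm p (u - v) < \<epsilon>)"

definition hilbert_schmidt_embedding :: "nat \<Rightarrow> nat \<Rightarrow> bool" where
  "hilbert_schmidt_embedding p' p \<longleftrightarrow> H p' \<subseteq> H p \<and>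
     (\<exists>E. orthonormal_basis p' E \<and> (\<lambda>e. (nrm p e)\<^sup>2) summable_on E)"

definition nuc :: "'h set" where
  "nuc = (\<Inter>p. H p)"

definition nuc_topology :: "'h topology" where
  "nuc_topology = seminorm_topology nuc (range nrm)"

definition nrmC :: "nat \<Rightarrow> 'h \<times> 'h \<Rightarrow> real" where
  "nrmC p \<theta> = sqrt ((nrm p (fst \<theta>))\<^sup>2 + (nrm p (snd \<theta>))\<^sup>2)"

definition HC :: "nat \<Rightarrow> ('h \<times> 'h) set" where
  "HC p = H p \<times> H p"

definition HC_topology :: "nat \<Rightarrow> ('h \<times> 'h) topology" where
  "HC_topology p = seminorm_topology (HC p) {nrmC p}"

definition nucC :: "('h \<times> 'h) set" where
  "nucC = nuc \<times> nuc"

definition nucC_topology :: "('h \<times> 'h) topology" where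
  "nucC_topology = seminorm_topology nucC (range nrmC)"

definition nuc_dual :: "('h \<Rightarrow> real) set" where
  "nuc_dual = {x.
     (\<forall>u\<in>nuc. \<forall>v\<in>nuc. \<forall>a b. x (a *\<^sub>R u + b *\<^sub>R v) = a * x u + b * x v) \<and>
     continuous_map nuc_topology euclidean x \<and> (\<forall>u. u \<notin> nuc \<longrightarrow> x u = 0)}"

definition pairing :: "('h \<Rightarrow> real) \<Rightarrow> 'h \<times> 'h \<Rightarrow> complex" where
  "pairing x \<theta> = Complex (x (fst \<theta>)) (x (snd \<theta>))"

text \<open>The pairing for the complexified dual, \<open>(x, y)\<close> standing for \<open>x + i y\<close>.\<close>

definition pairingC :: "('h \<Rightarrow> real) \<times> ('h \<Rightarrow> real) \<Rightarrow> 'h \<times> 'h \<Rightarrow> complex" where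
  "pairingC z \<theta> = pairing (fst z) \<theta> + \<i> * pairing (snd z) \<theta>"


subsection \<open>Symmetric tensor powers\<close>

text \<open>The embedding of \<open>H p\<close> into the dual space given by the inner product. By the Riesz theorem
  it is an isometry onto the dual of \<open>H p\<close>.\<close>

definition riesz :: "nat \<Rightarrow> 'h \<Rightarrow> 'h \<Rightarrow> real" where
  "riesz p e = (\<lambda>u. if u \<in> nuc then ip p e u else 0)"

text \<open>The Hilbert tensor power of the complexification of \<open>H p\<close> is realised, as usual, as the space
  of Hilbert-Schmidt \<open>n\<close>-linear complex functionals on the (real) dual of \<open>H p\<close>,
  \<open>u\<^sub>1 \<otimes> \<dots> \<otimes> u\<^sub>n\<close> being the functional that maps \<open>[x\<^sub>1, \<dots>, x\<^sub>n]\<close> to the product of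
  the \<open>\<langle>x\<^sub>k, u\<^sub>k\<rangle>\<close>. In general \<open>t [x\<^sub>1, \<dots>, x\<^sub>n]\<close> is the pairing of \<open>x\<^sub>1 \<otimes> \<dots> \<otimes> x\<^sub>n\<close> with \<open>t\<close>.
  The square of the Hilbert-Schmidt norm is the sum of \<open>|t [x\<^sub>1, \<dots>, x\<^sub>n]|\<^sup>2\<close>, all \<open>x\<^sub>k\<close> running
  through an orthonormal basis of the dual of \<open>H p\<close>. Written as the supremum over all finite
  orthonormal systems it is independent of a basis, and its finiteness entails the boundedness
  of \<open>t\<close>.\<close>

definition tensor_norm_sq :: "nat \<Rightarrow> nat \<Rightarrow> (('h \<Rightarrow> real) list \<Rightarrow> complex) \<Rightarrow> ennreal" where
  "tensor_norm_sq p n t = (SUP E\<in>{E. finite E \<and> orthonormal p E}.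
     \<Sum>es\<in>{es. set es \<subseteq> E \<and> length es = n}. ennreal ((cmod (t (map (riesz p) es)))\<^sup>2))"

definition tensor_norm :: "nat \<Rightarrow> nat \<Rightarrow> (('h \<Rightarrow> real) list \<Rightarrow> complex) \<Rightarrow> real" where
  "tensor_norm p n t = sqrt (enn2real (tensor_norm_sq p n t))"

text \<open>The \<open>n\<close>-th symmetric tensor power of the complexified nuclear space: the intersection of the
  symmetric tensor powers of all \<open>HC p\<close>. As the dual space is the union of the duals of
  the \<open>H p\<close>, its elements are functionals on \<open>n\<close>-tuples from the dual space.\<close>

definition tensors :: "nat \<Rightarrow> (('h \<Rightarrow> real) list \<Rightarrow> complex) set" where
  "tensors n = {t.
     (\<forall>xs. \<not> (length xs = n \<and> set xs \<subseteq> nuc_dual) \<longrightarrow> t xs = 0) \<and>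
     (\<forall>xs k x y a b. length xs = n \<and> set xs \<subseteq> nuc_dual \<and> k < n \<and> x \<in> nuc_dual \<and> y \<in> nuc_dual \<longrightarrow>
        t (xs[k := (\<lambda>u. a * x u + b * y u)]) =
          complex_of_real a * t (xs[k := x]) + complex_of_real b * t (xs[k := y])) \<and>
     (\<forall>xs ys. mset xs = mset ys \<longrightarrow> t xs = t ys) \<and>
     (\<forall>p. tensor_norm_sq p n t < \<infinity>)}"

definition tensors_topology :: "nat \<Rightarrow> (('h \<Rightarrow> real) list \<Rightarrow> complex) topology" where
  "tensors_topology n = seminorm_topology (tensors n) (range (\<lambda>p. tensor_norm p n))"

definition tensors_dual :: "nat \<Rightarrow> ((('h \<Rightarrow> real) list \<Rightarrow> complex) \<Rightarrow> complex) set" where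
  "tensors_dual n = dual_space (tensors_topology n)"

text \<open>The norm with index \<open>-p\<close> on the dual of the tensor power. It is infinite outside the
  dual of the tensor power of \<open>HC p\<close>.\<close>

definition tensor_dual_norm :: "nat \<Rightarrow> nat \<Rightarrow> ((('h \<Rightarrow> real) list \<Rightarrow> complex) \<Rightarrow> complex) \<Rightarrow> ennreal" where
  "tensor_dual_norm p n K = (SUP t\<in>{t \<in> tensors n. tensor_norm p n t \<le> 1}. ennreal (cmod (K t)))"

definition tensor_power :: "nat \<Rightarrow> 'h \<times> 'h \<Rightarrow> ('h \<Rightarrow> real) list \<Rightarrow> complex" where
  "tensor_power n \<theta> = (\<lambda>xs. if length xs = n \<and> set xs \<subseteq> nuc_dual
     then prod_list (map (\<lambda>x. pairing x \<theta>) xs) else 0)"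


subsection \<open>Polynomials and their dual\<close>

definition monomial :: "nat \<Rightarrow> (('h \<Rightarrow> real) list \<Rightarrow> complex) \<Rightarrow> ('h \<Rightarrow> real) \<Rightarrow> complex" where
  "monomial n t = (\<lambda>x. if x \<in> nuc_dual then t (replicate n x) else 0)"

definition polynomials :: "(('h \<Rightarrow> real) \<Rightarrow> complex) set" where
  "polynomials = {\<phi>. \<exists>m c. (\<forall>n\<le>m. c n \<in> tensors n) \<and> \<phi> = (\<lambda>x. \<Sum>n\<le>m. monomial n (c n) x)}"

definition polynomials_topology :: "(('h \<Rightarrow> real) \<Rightarrow> complex) topology" where
  "polynomials_topology = lc_inductive_topology polynomials tensors_topology monomial"

definition polynomials_dual :: "((('h \<Rightarrow> real) \<Rightarrow> complex) \<Rightarrow> complex) set" where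
  "polynomials_dual = dual_space polynomials_topology"


subsection \<open>Measures\<close>

definition cylinder_sets :: "('h \<Rightarrow> real) set set" where
  "cylinder_sets = sigma_sets nuc_dual
     {{x \<in> nuc_dual. x \<theta> \<in> B} | \<theta> B. \<theta> \<in> nuc \<and> B \<in> sets borel}"

definition laplace :: "('h \<Rightarrow> real) measure \<Rightarrow> 'h \<times> 'h \<Rightarrow> complex" where
  "laplace \<mu> \<theta> = (LINT x|\<mu>. exp (pairing x \<theta>))"

definition analytic_measures :: "('h \<Rightarrow> real) measure set" where
  "analytic_measures = {\<mu>. space \<mu> = nuc_dual \<and> sets \<mu> = cylinder_sets \<and>
     (\<exists>U. 0 \<in> U \<and> (\<forall>\<theta>\<in>U. integrable \<mu> (\<lambda>x. exp (pairing x \<theta>))) \<and>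
        holomorphic_in nucC_topology U (laplace \<mu>))}"

definition nondegenerate :: "('h \<Rightarrow> real) measure \<Rightarrow> bool" where
  "nondegenerate \<mu> \<longleftrightarrow>
     (\<forall>\<phi>\<in>polynomials. (AE x in \<mu>. \<phi> x = 0) \<longrightarrow> (\<forall>x\<in>nuc_dual. \<phi> x = 0))"


subsection \<open>The Appell system\<close>

definition normalized_exponential ::
  "('h \<Rightarrow> real) measure \<Rightarrow> 'h \<times> 'h \<Rightarrow> ('h \<Rightarrow> real) \<times> ('h \<Rightarrow> real) \<Rightarrow> complex" where
  "normalized_exponential \<mu> \<theta> z = exp (pairingC z \<theta>) / laplace \<mu> \<theta>"

text \<open>The sequence \<open>(P\<^sub>n(z))\<^sub>n\<close>, for \<open>z\<close> in the complexified dual space.\<close>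

definition appell :: "('h \<Rightarrow> real) measure \<Rightarrow> ('h \<Rightarrow> real) \<times> ('h \<Rightarrow> real) \<Rightarrow>
    nat \<Rightarrow> (('h \<Rightarrow> real) list \<Rightarrow> complex) \<Rightarrow> complex" where
  "appell \<mu> z = (THE P. (\<forall>n. P n \<in> tensors_dual n) \<and>
     (\<exists>U. openin nucC_topology U \<and> 0 \<in> U \<and>
        (\<forall>\<theta>\<in>U. (\<lambda>n. P n (tensor_power n \<theta>) / fact n) sums normalized_exponential \<mu> \<theta> z)))"

definition appell_monomial ::
  "('h \<Rightarrow> real) measure \<Rightarrow> nat \<Rightarrow> (('h \<Rightarrow> real) list \<Rightarrow> complex) \<Rightarrow> ('h \<Rightarrow> real) \<Rightarrow> complex" where
  "appell_monomial \<mu> n t = (\<lambda>x. if x \<in> nuc_dual then appell \<mu> (x, \<lambda>_. 0) n t else 0)"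

text \<open>The sequence \<open>(\<Phi>\<^sup>(\<^sup>n\<^sup>))\<^sub>n\<close> of kernels of \<open>\<Phi> = \<Sum>\<^sub>n Q\<^sub>n(\<Phi>\<^sup>(\<^sup>n\<^sup>))\<close>.\<close>

definition kernels :: "('h \<Rightarrow> real) measure \<Rightarrow> ((('h \<Rightarrow> real) \<Rightarrow> complex) \<Rightarrow> complex) \<Rightarrow>
    nat \<Rightarrow> (('h \<Rightarrow> real) list \<Rightarrow> complex) \<Rightarrow> complex" where
  "kernels \<mu> \<Phi> = (THE K. (\<forall>n. K n \<in> tensors_dual n) \<and>
     (\<forall>m c. (\<forall>n\<le>m. c n \<in> tensors n) \<longrightarrow>
        \<Phi> (\<lambda>x. \<Sum>n\<le>m. appell_monomial \<mu> n (c n) x) = (\<Sum>n\<le>m. fact n * K n (c n))))"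


subsection \<open>Distributions and their transform\<close>

definition dist_norm_sq :: "('h \<Rightarrow> real) measure \<Rightarrow> real \<Rightarrow> nat \<Rightarrow> nat \<Rightarrow>
    ((('h \<Rightarrow> real) \<Rightarrow> complex) \<Rightarrow> complex) \<Rightarrow> ennreal" where
  "dist_norm_sq \<mu> \<beta> p q \<Phi> = (\<Sum>n. ennreal (fact n powr (1 - \<beta>) * 2 powr (- real (q * n))) *
     (tensor_dual_norm p n (kernels \<mu> \<Phi> n))\<^sup>2)"

definition dist_step :: "('h \<Rightarrow> real) measure \<Rightarrow> real \<Rightarrow> nat \<Rightarrow> nat \<Rightarrow>
    ((('h \<Rightarrow> real) \<Rightarrow> complex) \<Rightarrow> complex) set" where
  "dist_step \<mu> \<beta> p q = {\<Phi> \<in> polynomials_dual. dist_norm_sq \<mu> \<beta> p q \<Phi> < \<infinity>}"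

definition dist_step_topology :: "('h \<Rightarrow> real) measure \<Rightarrow> real \<Rightarrow> nat \<Rightarrow> nat \<Rightarrow>
    ((('h \<Rightarrow> real) \<Rightarrow> complex) \<Rightarrow> complex) topology" where
  "dist_step_topology \<mu> \<beta> p q =
     seminorm_topology (dist_step \<mu> \<beta> p q) {\<lambda>\<Phi>. sqrt (enn2real (dist_norm_sq \<mu> \<beta> p q \<Phi>))}"

definition distributions :: "('h \<Rightarrow> real) measure \<Rightarrow> real \<Rightarrow> ((('h \<Rightarrow> real) \<Rightarrow> complex) \<Rightarrow> complex) set" where
  "distributions \<mu> \<beta> = (\<Union>p q. dist_step \<mu> \<beta> p q)"

definition distributions_topology :: "('h \<Rightarrow> real) measure \<Rightarrow> real \<Rightarrow>
    ((('h \<Rightarrow> real) \<Rightarrow> complex) \<Rightarrow> complex) topology" where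
  "distributions_topology \<mu> \<beta> =
     lc_inductive_topology (distributions \<mu> \<beta>) (\<lambda>(p, q). dist_step_topology \<mu> \<beta> p q) (\<lambda>_ \<Phi>. \<Phi>)"

definition S_transform :: "('h \<Rightarrow> real) measure \<Rightarrow> ((('h \<Rightarrow> real) \<Rightarrow> complex) \<Rightarrow> complex) \<Rightarrow>
    'h \<times> 'h \<Rightarrow> complex" where
  "S_transform \<mu> \<Phi> = (\<lambda>\<theta>. if \<theta> \<in> nucC then \<Sum>n. kernels \<mu> \<Phi> n (tensor_power n \<theta>) else 0)"


subsection \<open>Entire functions of given growth\<close>

definition entire_step :: "real \<Rightarrow> nat \<Rightarrow> nat \<Rightarrow> ('h \<times> 'h \<Rightarrow> complex) set" where
  "entire_step k p l = {F. holomorphic_in (HC_topology p) (HC p) F \<and>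
     (\<forall>\<theta>. \<theta> \<notin> HC p \<longrightarrow> F \<theta> = 0) \<and>
     bdd_above ((\<lambda>\<theta>. cmod (F \<theta>) * exp (- (2 ^ l * nrmC p \<theta> powr k))) ` HC p)}"

definition entire_norm :: "real \<Rightarrow> nat \<Rightarrow> nat \<Rightarrow> ('h \<times> 'h \<Rightarrow> complex) \<Rightarrow> real" where
  "entire_norm k p l F = (SUP \<theta>\<in>HC p. cmod (F \<theta>) * exp (- (2 ^ l * nrmC p \<theta> powr k)))"

definition entire_step_topology :: "real \<Rightarrow> nat \<Rightarrow> nat \<Rightarrow> ('h \<times> 'h \<Rightarrow> complex) topology" where
  "entire_step_topology k p l = seminorm_topology (entire_step k p l) {entire_norm k p l}"

definition restrict_nucC :: "('h \<times> 'h \<Rightarrow> complex) \<Rightarrow> 'h \<times> 'h \<Rightarrow> complex" where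
  "restrict_nucC F = (\<lambda>\<theta>. if \<theta> \<in> nucC then F \<theta> else 0)"

definition entire_max :: "real \<Rightarrow> ('h \<times> 'h \<Rightarrow> complex) set" where
  "entire_max k = (\<Union>p l. restrict_nucC ` entire_step k p l)"

definition entire_max_topology :: "real \<Rightarrow> ('h \<times> 'h \<Rightarrow> complex) topology" where
  "entire_max_topology k =
     lc_inductive_topology (entire_max k) (\<lambda>(p, l). entire_step_topology k p l) (\<lambda>_. restrict_nucC)"

end


text \<open>Density of \<open>nuc\<close> in every \<open>H p\<close> is what makes the dual of \<open>H p\<close> a subspace of the dual of
  \<open>nuc\<close>.\<close>

locale nuclear_triple = hilbert_chain H ip
  for H :: "nat \<Rightarrow> 'h::{real_inner, banach, second_countable_topology} set"
    and ip :: "nat \<Rightarrow> 'h \<Rightarrow> 'h \<Rightarrow> real" +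
  assumes subspace_H: "subspace (H p)"
    and ip_add: "\<lbrakk>u \<in> H p; v \<in> H p; w \<in> H p\<rbrakk> \<Longrightarrow> ip p (u + v) w = ip p u w + ip p v w"
    and ip_scale: "\<lbrakk>u \<in> H p; w \<in> H p\<rbrakk> \<Longrightarrow> ip p (a *\<^sub>R u) w = a * ip p u w"
    and ip_commute: "\<lbrakk>u \<in> H p; v \<in> H p\<rbrakk> \<Longrightarrow> ip p u v = ip p v u"
    and ip_pos: "\<lbrakk>u \<in> H p; u \<noteq> 0\<rbrakk> \<Longrightarrow> 0 < ip p u u"
    and complete_H: "\<lbrakk>\<forall>n. s n \<in> H p; \<forall>\<epsilon>>0. \<exists>M. \<forall>m\<ge>M. \<forall>n\<ge>M. nrm p (s m - s n) < \<epsilon>\<rbrakk>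
        \<Longrightarrow> \<exists>u\<in>H p. (\<lambda>n. nrm p (s n - u)) \<longlonglongrightarrow> 0"
    and norm_le_nrm: "u \<in> H p \<Longrightarrow> norm u \<le> nrm p u"
    and H_antimono: "p < q \<Longrightarrow> H q \<subseteq> H p"
    and nrm_mono: "\<lbrakk>p < q; u \<in> H q\<rbrakk> \<Longrightarrow> nrm p u \<le> nrm q u"
    and hilbert_schmidt: "\<exists>p'>p. hilbert_schmidt_embedding p' p"
    and nuc_dense: "closure nuc = UNIV"
    and nuc_dense_H: "\<lbrakk>u \<in> H p; 0 < \<epsilon>\<rbrakk> \<Longrightarrow> \<exists>v\<in>nuc. nrm p (u - v) < \<epsilon>"
    and nuc_separable: "\<exists>D. countable D \<and> D \<subseteq> nuc \<and> nuc_topology closure_of D = nuc"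

end

theory Submission
  imports Defs "HOL-Complex_Analysis.Complex_Analysis"
begin

text \<open>
  The kernels \<open>\<Phi>\<^sup>(\<^sup>n\<^sup>)\<close> of \<open>\<Phi>\<close> are the Taylor kernels of \<open>S\<^sub>\<mu>\<Phi>\<close> at \<open>0\<close>, so both spaces are described by the decay
  of these kernels. If \<open>|\<Phi>\<^sup>(\<^sup>n\<^sup>)|\<^sub>-\<^sub>p \<le> C R\<^sup>n (n!)\<^bsup>-(1-\<beta>)/2\<^esup>\<close>, then the power series converges to a function bounded
  by \<open>C' exp (2\<^sup>l |\<theta>|\<^sub>p\<^bsup>2/(1-\<beta>)\<^esup>)\<close>, which extends from \<open>\<N>\<^sub>\<complex>\<close> to \<open>\<H>\<^sub>p\<^sub>,\<^sub>\<complex>\<close> by local Lipschitz continuity and density.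
  Conversely, for an entire function of this growth the Cauchy estimates on the ball of radius
  \<open>(n + 1)\<^bsup>(1-\<beta>)/2\<^esup>\<close> bound the \<open>n\<close>-th differential at \<open>0\<close>; summing over an orthonormal basis of a space \<open>\<H>\<^sub>p\<^sub>'\<close> whose
  embedding into \<open>\<H>\<^sub>p\<close> is Hilbert--Schmidt turns the differential into a kernel with the required decay.
  The Appell polynomials are triangular in the monomials, hence every sequence of kernels comes from exactly one
  \<open>\<Phi>\<close> in the dual of the polynomials. Both estimates are linear in the norms, so \<open>S\<^sub>\<mu>\<close> and its inverse
  are continuous on every step and therefore for the inductive limit topologies.
\<close>

text \<open>Kernels and Appell polynomials are given by definite descriptions, and the norm of a
  tensor is a supremum over finite orthonormal systems. Two facts therefore carry the proof. A power
  series in tensor powers determines its kernels, because the powers of the real vectors of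
  \<open>nuc\<close> span a dense subspace of every tensor power: tensors are truncated to finitely
  many coordinates, and polarization writes a truncation through powers. And the kernel estimate
  must come with an index and a constant that depend on \<open>p\<close> alone, valid for all radii
  at once, since the radius is later a function of \<open>n\<close>. The exponent
  \<open>2 / (1 - \<beta>)\<close> is the one for which both directions match. With
  \<open>s = 1 - \<beta>\<close> and \<open>y = x powr (2 / s)\<close>, the term
  \<open>(n!)^(-s/2) x^n\<close> equals \<open>(y^n / n!)^(s/2)\<close>, which is at most
  exponential in \<open>y\<close>. Conversely, at the radius \<open>(n + 1) powr (s / 2)\<close> the
  allowed growth \<open>exp (2^l r powr (2 / s))\<close> is only geometric in \<open>n\<close>,
  while the radius to the power \<open>n\<close> dominates \<open>(n!)^(s/2)\<close>.\<close>

context nuclear_triple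
begin

section \<open>Inner product geometry of the spaces \<open>H p\<close>\<close>

lemma H_zero [simp]: "0 \<in> H p"
  using subspace_H by (rule subspace_0)

lemma H_add: "u \<in> H p \<Longrightarrow> v \<in> H p \<Longrightarrow> u + v \<in> H p"
  using subspace_H by (rule subspace_add)

lemma H_scale: "u \<in> H p \<Longrightarrow> a *\<^sub>R u \<in> H p"
  using subspace_H by (rule subspace_scale)

lemma H_diff: "u \<in> H p \<Longrightarrow> v \<in> H p \<Longrightarrow> u - v \<in> H p"
  using subspace_H by (rule subspace_diff)

lemma H_sum: "(\<And>i. i \<in> I \<Longrightarrow> f i \<in> H p) \<Longrightarrow> (\<Sum>i\<in>I. f i) \<in> H p"
  using subspace_H by (rule subspace_sum)

lemma H_span: "B \<subseteq> H p \<Longrightarrow> span B \<subseteq> H p"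
  using subspace_H by (rule span_minimal[rotated])

lemma H_mono: "p \<le> q \<Longrightarrow> H q \<subseteq> H p"
  using H_antimono[of p q] by (cases "p = q") auto

lemma nuc_sub_H: "nuc \<subseteq> H p"
  by (auto simp: nuc_def)

lemma subspace_nuc: "subspace nuc"
  unfolding nuc_def using subspace_H by (auto intro!: subspace_Inter)

lemma nrm_mono_le: "p \<le> q \<Longrightarrow> u \<in> H q \<Longrightarrow> nrm p u \<le> nrm q u"
  using nrm_mono[of p q u] by (cases "p = q") auto

lemma ip_add_right: "u \<in> H p \<Longrightarrow> v \<in> H p \<Longrightarrow> w \<in> H p \<Longrightarrow> ip p w (u + v) = ip p w u + ip p w v"
  using ip_add[of u p v w] ip_commute[of w p] H_add by simp

lemma ip_scale_right: "u \<in> H p \<Longrightarrow> w \<in> H p \<Longrightarrow> ip p w (a *\<^sub>R u) = a * ip p w u"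
  using ip_scale[of u p w a] ip_commute[of w p] H_scale by simp

lemma ip_zero_left [simp]: "w \<in> H p \<Longrightarrow> ip p 0 w = 0"
  using ip_scale[of 0 p w 0] by simp

lemma ip_zero_right [simp]: "w \<in> H p \<Longrightarrow> ip p w 0 = 0"
  using ip_scale_right[of 0 p w 0] by simp

lemma ip_diff: "u \<in> H p \<Longrightarrow> v \<in> H p \<Longrightarrow> w \<in> H p \<Longrightarrow> ip p (u - v) w = ip p u w - ip p v w"
  using ip_add[of u p "(-1) *\<^sub>R v" w] ip_scale[of v p w "-1"] H_scale[of v p "-1"] by simp

lemma ip_diff_right: "u \<in> H p \<Longrightarrow> v \<in> H p \<Longrightarrow> w \<in> H p \<Longrightarrow> ip p w (u - v) = ip p w u - ip p w v"
  using ip_diff[of u p v w] ip_commute[of w p] H_diff by simp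

lemma ip_sum:
  assumes "\<And>i. i \<in> I \<Longrightarrow> f i \<in> H p" "w \<in> H p"
  shows "ip p (\<Sum>i\<in>I. f i) w = (\<Sum>i\<in>I. ip p (f i) w)"
  using assms
proof (induction I rule: infinite_finite_induct)
  case (insert i I)
  then have "(\<Sum>i\<in>I. f i) \<in> H p" by (intro H_sum) auto
  then show ?case using insert by (simp add: ip_add)
qed auto

lemma ip_sum_right:
  assumes "\<And>i. i \<in> I \<Longrightarrow> f i \<in> H p" "w \<in> H p"
  shows "ip p w (\<Sum>i\<in>I. f i) = (\<Sum>i\<in>I. ip p w (f i))"
proof -
  have "ip p w (\<Sum>i\<in>I. f i) = ip p (\<Sum>i\<in>I. f i) w"
    using assms by (intro ip_commute H_sum) auto
  also have "\<dots> = (\<Sum>i\<in>I. ip p (f i) w)" using assms by (rule ip_sum)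
  also have "\<dots> = (\<Sum>i\<in>I. ip p w (f i))" using assms by (intro sum.cong ip_commute) auto
  finally show ?thesis .
qed

lemma ip_self_nonneg: "u \<in> H p \<Longrightarrow> 0 \<le> ip p u u"
  using ip_pos[of u p] by (cases "u = 0") auto

lemma nrm_nonneg: "u \<in> H p \<Longrightarrow> 0 \<le> nrm p u"
  unfolding nrm_def using ip_self_nonneg by simp

lemma nrm_sq: "u \<in> H p \<Longrightarrow> (nrm p u)\<^sup>2 = ip p u u"
  unfolding nrm_def using ip_self_nonneg by simp

lemma nrm_zero [simp]: "nrm p 0 = 0"
  by (simp add: nrm_def)

lemma nrm_eq_0: "u \<in> H p \<Longrightarrow> nrm p u = 0 \<longleftrightarrow> u = 0"
  using ip_pos[of u p] by (cases "u = 0") (auto simp: nrm_def)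

lemma nrm_scale: "u \<in> H p \<Longrightarrow> nrm p (a *\<^sub>R u) = \<bar>a\<bar> * nrm p u"
  by (simp add: nrm_def ip_scale ip_scale_right H_scale real_sqrt_mult flip: mult.assoc)

lemma nrm_minus_commute: "u \<in> H p \<Longrightarrow> v \<in> H p \<Longrightarrow> nrm p (u - v) = nrm p (v - u)"
  using nrm_scale[of "u - v" p "-1"] H_diff by simp

lemma ip_cauchy_schwarz:
  assumes "u \<in> H p" "v \<in> H p"
  shows "\<bar>ip p u v\<bar> \<le> nrm p u * nrm p v"
proof (cases "v = 0")
  case False
  then have v: "0 < ip p v v" using ip_pos assms by auto
  define a where "a = ip p u v / ip p v v"
  have m: "a *\<^sub>R v \<in> H p" "u - a *\<^sub>R v \<in> H p" using assms by (auto intro: H_scale H_diff)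
  have "0 \<le> ip p (u - a *\<^sub>R v) (u - a *\<^sub>R v)" using m by (intro ip_self_nonneg)
  also have "\<dots> = ip p u u - a * ip p u v - a * (ip p u v - a * ip p v v)"
    using assms m by (simp add: ip_diff ip_diff_right ip_scale ip_scale_right ip_commute[of v p u] algebra_simps)
  also have "\<dots> = ip p u u - (ip p u v)\<^sup>2 / ip p v v"
    using v by (simp add: a_def power2_eq_square)
  finally have "(ip p u v)\<^sup>2 \<le> ip p u u * ip p v v" using v by (simp add: field_simps)
  then have "sqrt ((ip p u v)\<^sup>2) \<le> sqrt (ip p u u * ip p v v)" by (rule real_sqrt_le_mono)
  then show ?thesis by (simp add: nrm_def real_sqrt_mult)
qed (use assms in simp)

lemma nrm_triangle:
  assumes "u \<in> H p" "v \<in> H p"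
  shows "nrm p (u + v) \<le> nrm p u + nrm p v"
proof -
  have "(nrm p (u + v))\<^sup>2 = (nrm p u)\<^sup>2 + 2 * ip p u v + (nrm p v)\<^sup>2"
    using assms by (simp add: nrm_sq H_add ip_add ip_add_right ip_commute[of v p u])
  also have "\<dots> \<le> (nrm p u + nrm p v)\<^sup>2"
    using ip_cauchy_schwarz[OF assms] by (simp add: power2_sum)
  finally show ?thesis
    by (rule power2_le_imp_le) (simp add: assms nrm_nonneg)
qed

lemma nrm_triangle_diff:
  assumes "u \<in> H p" "v \<in> H p" "w \<in> H p"
  shows "nrm p (u - w) \<le> nrm p (u - v) + nrm p (v - w)"
  using nrm_triangle[of "u - v" p "v - w"] assms H_diff by simp

subsection \<open>Orthonormal systems\<close>

definition proj :: "nat \<Rightarrow> 'h set \<Rightarrow> 'h \<Rightarrow> 'h" where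
  "proj p B u = (\<Sum>b\<in>B. ip p b u *\<^sub>R b)"

lemma orthonormalD:
  "orthonormal p B \<Longrightarrow> B \<subseteq> H p"
  "orthonormal p B \<Longrightarrow> b \<in> B \<Longrightarrow> b \<in> H p"
  "orthonormal p B \<Longrightarrow> b \<in> B \<Longrightarrow> c \<in> B \<Longrightarrow> ip p b c = (if b = c then 1 else 0)"
  by (auto simp: orthonormal_def)

lemma orthonormal_subset: "orthonormal p B \<Longrightarrow> A \<subseteq> B \<Longrightarrow> orthonormal p A"
  unfolding orthonormal_def by blast

lemma orthonormal_combination:
  assumes "orthonormal p B" "finite B"
  shows "b \<in> B \<Longrightarrow> ip p b (\<Sum>c\<in>B. a c *\<^sub>R c) = a b"
    and "(nrm p (\<Sum>c\<in>B. a c *\<^sub>R c))\<^sup>2 = (\<Sum>c\<in>B. (a c)\<^sup>2)"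
    and "(\<Sum>c\<in>B. a c *\<^sub>R c) \<in> H p"
proof -
  note B = orthonormalD[OF assms(1)]
  have 1: "ip p b (\<Sum>c\<in>B. a c *\<^sub>R c) = a b" if b: "b \<in> B" for b
  proof -
    have "ip p b (\<Sum>c\<in>B. a c *\<^sub>R c) = (\<Sum>c\<in>B. ip p b (a c *\<^sub>R c))"
      using B b by (intro ip_sum_right) (auto intro: H_scale)
    also have "\<dots> = (\<Sum>c\<in>B. if b = c then a c else 0)"
      using B b by (intro sum.cong) (auto simp: ip_scale_right)
    finally show ?thesis using b assms(2) by simp
  qed
  then show "b \<in> B \<Longrightarrow> ip p b (\<Sum>c\<in>B. a c *\<^sub>R c) = a b" .
  show m: "(\<Sum>c\<in>B. a c *\<^sub>R c) \<in> H p" using B by (auto intro!: H_sum H_scale)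
  have "(nrm p (\<Sum>c\<in>B. a c *\<^sub>R c))\<^sup>2 = ip p (\<Sum>c\<in>B. a c *\<^sub>R c) (\<Sum>c\<in>B. a c *\<^sub>R c)"
    using m by (rule nrm_sq)
  also have "\<dots> = (\<Sum>b\<in>B. ip p (a b *\<^sub>R b) (\<Sum>c\<in>B. a c *\<^sub>R c))"
    using B m by (intro ip_sum) (auto intro: H_scale)
  also have "\<dots> = (\<Sum>b\<in>B. (a b)\<^sup>2)"
    using B m 1 by (intro sum.cong) (auto simp: ip_scale power2_eq_square)
  finally show "(nrm p (\<Sum>c\<in>B. a c *\<^sub>R c))\<^sup>2 = (\<Sum>c\<in>B. (a c)\<^sup>2)" .
qed

lemma proj_in_H: "orthonormal p B \<Longrightarrow> proj p B u \<in> H p"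
  unfolding proj_def by (intro H_sum H_scale) (auto dest: orthonormalD)

lemma proj_in_subspace: "subspace X \<Longrightarrow> B \<subseteq> X \<Longrightarrow> proj p B u \<in> X"
  unfolding proj_def by (intro subspace_sum subspace_scale) auto

lemma proj_span: "proj p B u \<in> span B"
  unfolding proj_def by (intro span_sum span_scale span_base)

lemma ip_proj:
  assumes "orthonormal p B" "finite B" "b \<in> B"
  shows "ip p b (proj p B u) = ip p b u"
  unfolding proj_def using orthonormal_combination(1)[OF assms] by simp

lemma ip_proj_residual:
  assumes "orthonormal p B" "finite B" "u \<in> H p" "v \<in> span B"
  shows "ip p v (u - proj p B u) = 0"
proof -
  let ?r = "u - proj p B u"
  have r: "?r \<in> H p" using assms proj_in_H H_diff by simp
  have "subspace {v \<in> H p. ip p v ?r = 0}"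
    using r by (auto intro!: subspaceI H_add H_scale simp: ip_add ip_scale)
  moreover have "ip p x ?r = 0" if "x \<in> B" for x
    using ip_proj[OF assms(1,2) that, of u] orthonormalD(2)[OF assms(1) that] assms(3)
      proj_in_H[OF assms(1)] by (simp add: ip_diff_right)
  ultimately have "span B \<subseteq> {v \<in> H p. ip p v ?r = 0}"
    using orthonormalD(1)[OF assms(1)] by (intro span_minimal) auto
  then show ?thesis using assms(4) by auto
qed

lemma nrm_pythagoras:
  assumes "orthonormal p B" "finite B" "u \<in> H p" "v \<in> span B"
  shows "(nrm p (u - v))\<^sup>2 = (nrm p (u - proj p B u))\<^sup>2 + (nrm p (proj p B u - v))\<^sup>2"
proof -
  define a where "a = u - proj p B u"
  define b where "b = proj p B u - v"
  have v: "v \<in> H p" using assms(4) H_span orthonormalD(1)[OF assms(1)] by blast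
  have m: "a \<in> H p" "b \<in> H p" unfolding a_def b_def using assms v proj_in_H H_diff by auto
  have s: "b \<in> span B" unfolding b_def using proj_span assms(4) by (rule span_diff)
  have o: "ip p b a = 0" unfolding a_def using ip_proj_residual[OF assms(1-3) s] .
  have "(nrm p (a + b))\<^sup>2 = ip p a a + ip p b b"
    using m o by (simp add: nrm_sq H_add ip_add ip_add_right ip_commute[of a p b])
  moreover have "a + b = u - v" by (simp add: a_def b_def)
  ultimately show ?thesis using m by (simp add: nrm_sq flip: a_def b_def)
qed

lemma proj_best:
  assumes "orthonormal p B" "finite B" "u \<in> H p" "v \<in> span B"
  shows "nrm p (u - proj p B u) \<le> nrm p (u - v)"
proof -
  have "v \<in> H p" using assms(4) H_span orthonormalD(1)[OF assms(1)] by blast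
  then have "0 \<le> nrm p (u - v)" using assms(3) by (intro nrm_nonneg H_diff)
  moreover have "(nrm p (u - proj p B u))\<^sup>2 \<le> (nrm p (u - v))\<^sup>2"
    unfolding nrm_pythagoras[OF assms] by simp
  ultimately show ?thesis by (rule power2_le_imp_le[rotated])
qed

lemma proj_eq_self:
  assumes "orthonormal p B" "finite B" "u \<in> span B"
  shows "proj p B u = u"
proof -
  have u: "u \<in> H p" using assms(3) H_span orthonormalD(1)[OF assms(1)] by blast
  have "nrm p (u - proj p B u) \<le> 0" using proj_best[OF assms(1,2) u assms(3)] by simp
  then have "nrm p (u - proj p B u) = 0"
    using nrm_nonneg[of "u - proj p B u" p] u proj_in_H[OF assms(1)] H_diff by force
  then show ?thesis using nrm_eq_0[of "u - proj p B u" p] u proj_in_H[OF assms(1)] H_diff by simp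
qed

lemma nrm_proj_sq:
  assumes "orthonormal p B" "finite B"
  shows "(nrm p (proj p B u))\<^sup>2 = (\<Sum>b\<in>B. (ip p b u)\<^sup>2)"
  unfolding proj_def by (rule orthonormal_combination(2)[OF assms])

lemma bessel:
  assumes "orthonormal p B" "finite B" "u \<in> H p"
  shows "(\<Sum>b\<in>B. (ip p b u)\<^sup>2) \<le> (nrm p u)\<^sup>2"
  using nrm_pythagoras[OF assms span_zero] nrm_proj_sq[OF assms(1,2), of u] by simp

lemma parseval_span:
  assumes "orthonormal p B" "finite B" "u \<in> span B"
  shows "(\<Sum>b\<in>B. (ip p b u)\<^sup>2) = (nrm p u)\<^sup>2"
  using nrm_proj_sq[OF assms(1,2), of u] proj_eq_self[OF assms] by simp

text \<open>One Gram-Schmidt step. The clause \<open>B' \<subseteq> span (insert w B)\<close> keeps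
  the new system inside every subspace that contains \<open>w\<close> and \<open>B\<close>, in
  particular inside \<open>nuc\<close>.\<close>

lemma orthonormal_extend:
  assumes "orthonormal p B" "finite B" "w \<in> H p"
  obtains B' where "B \<subseteq> B'" "finite B'" "orthonormal p B'" "w \<in> span B'" "B' \<subseteq> span (insert w B)"
proof (cases "w \<in> span B")
  case True
  moreover have "B \<subseteq> span (insert w B)" using span_superset[of "insert w B"] by blast
  ultimately show ?thesis using assms by (intro that[of B]) blast+
next
  case False
  define r where "r = w - proj p B w"
  have r: "r \<in> H p" unfolding r_def using assms proj_in_H H_diff by auto
  have r0: "r \<noteq> 0" using False proj_span[of p B w] by (auto simp: r_def)
  then have n: "nrm p r \<noteq> 0" using nrm_eq_0[OF r] by simp
  define e where "e = inverse (nrm p r) *\<^sub>R r"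
  have e: "e \<in> H p" unfolding e_def using r by (rule H_scale)
  have "nrm p e = 1" unfolding e_def using r n nrm_nonneg[OF r] by (simp add: nrm_scale)
  then have ee: "ip p e e = 1" using nrm_sq[OF e] by simp
  have be: "ip p b e = 0" if "b \<in> B" for b
    unfolding e_def using ip_proj_residual[OF assms(1-3) span_base[OF that]] r that orthonormalD(2)[OF assms(1) that]
    by (simp add: ip_scale_right r_def)
  have eB: "ip p e b = 0" if "b \<in> B" for b
    using be[OF that] ip_commute[OF e orthonormalD(2)[OF assms(1) that]] by simp
  have w: "w = proj p B w + nrm p r *\<^sub>R e" using n by (simp add: e_def r_def)
  have "proj p B w + nrm p r *\<^sub>R e \<in> span (insert e B)"
    using proj_span[of p B w] span_mono[of B "insert e B"]
    by (intro span_add span_scale span_base[of e]) auto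
  then have "w \<in> span (insert e B)" using w by simp
  moreover have "orthonormal p (insert e B)"
    using assms(1) e ee be eB unfolding orthonormal_def by auto
  moreover have "e \<in> span (insert w B)"
  proof -
    have "proj p B w \<in> span (insert w B)" using proj_span span_mono[of B "insert w B"] by blast
    moreover have "w \<in> span (insert w B)" by (rule span_base) simp
    ultimately show ?thesis unfolding e_def r_def by (intro span_scale span_diff)
  qed
  moreover have "B \<subseteq> span (insert w B)" using span_superset[of "insert w B"] by blast
  ultimately show ?thesis using assms(2) by (intro that[of "insert e B"]) blast+
qed

lemma orthonormal_extend_finite:
  assumes "finite W" "W \<subseteq> H p" "orthonormal p B" "finite B"
  shows "\<exists>B'. B \<subseteq> B' \<and> finite B' \<and> orthonormal p B' \<and> W \<subseteq> span B'"
  using assms(1,2)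
proof (induction W)
  case empty
  show ?case using assms(3,4) by (intro exI[of _ B]) simp
next
  case (insert w W)
  have w: "w \<in> H p" "W \<subseteq> H p" using insert.prems by simp_all
  obtain B1 where 1: "B \<subseteq> B1" "finite B1" "orthonormal p B1" "W \<subseteq> span B1"
    using insert.IH[OF w(2)] by (elim exE conjE)
  obtain B2 where 2: "B1 \<subseteq> B2" "finite B2" "orthonormal p B2" "w \<in> span B2"
    by (rule orthonormal_extend[OF 1(3,2) w(1)])
  have "W \<subseteq> span B2" using 1(4) span_mono[OF 2(1)] by (rule subset_trans)
  then show ?case using 1(1) 2 by (intro exI[of _ B2]) simp
qed

lemma orthonormal_empty [simp]: "orthonormal p {}"
  by (simp add: orthonormal_def)

lemma orthonormal_spanning:
  assumes "finite W" "W \<subseteq> H p"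
  obtains B where "finite B" "orthonormal p B" "W \<subseteq> span B"
  using orthonormal_extend_finite[OF assms orthonormal_empty finite.emptyI] by blast

text \<open>One sequence is dense in all the spaces \<open>H p\<close> simultaneously:
  \<open>u\<close> is first approximated by some \<open>w\<close> in \<open>nuc\<close>, and then
  \<open>w\<close> by a member of the countable dense set, because balls of \<open>nrm p\<close> are
  open in the nuclear topology.\<close>

lemma nuc_dense_sequence:
  obtains d :: "nat \<Rightarrow> 'h" where "range d \<subseteq> nuc"
    "\<And>p u \<epsilon>. u \<in> H p \<Longrightarrow> 0 < \<epsilon> \<Longrightarrow> \<exists>n. nrm p (u - d n) < \<epsilon>"
proof -
  obtain D where D: "countable D" "D \<subseteq> nuc" "nuc_topology closure_of D = nuc"
    using nuc_separable by blast
  have z: "0 \<in> nuc" using subspace_nuc by (rule subspace_0)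
  have ne: "D \<noteq> {}" using D(3) z by auto
  have dense: "\<exists>v\<in>D. nrm p (u - v) < \<epsilon>" if u: "u \<in> H p" and e: "0 < \<epsilon>" for p u \<epsilon>
  proof -
    obtain w where w: "w \<in> nuc" "nrm p (u - w) < \<epsilon> / 2" using nuc_dense_H[OF u, of "\<epsilon>/2"] e by auto
    let ?W = "{v \<in> nuc. nrm p (v - w) < \<epsilon> / 2}"
    have "openin nuc_topology ?W"
      unfolding nuc_topology_def openin_seminorm_topology
    proof (intro conjI ballI)
      fix f assume f: "f \<in> ?W"
      show "\<exists>F \<delta>. finite F \<and> F \<subseteq> range nrm \<and> 0 < \<delta> \<and> (\<forall>g\<in>nuc. (\<forall>q\<in>F. q (g - f) < \<delta>) \<longrightarrow> g \<in> ?W)"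
      proof (intro exI[of _ "{nrm p}"] exI[of _ "\<epsilon>/2 - nrm p (f - w)"] conjI ballI impI)
        fix g assume g: "g \<in> nuc" "\<forall>q\<in>{nrm p}. q (g - f) < \<epsilon>/2 - nrm p (f - w)"
        have "nrm p (g - w) \<le> nrm p (g - f) + nrm p (f - w)"
          using g f w nuc_sub_H[of p] by (intro nrm_triangle_diff) auto
        then show "g \<in> ?W" using g by auto
      qed (use f in auto)
    qed auto
    moreover have "w \<in> ?W" using w e by simp
    moreover have "\<forall>T. w \<in> T \<and> openin nuc_topology T \<longrightarrow> (\<exists>y. y \<in> D \<and> y \<in> T)"
      using w(1) D(3) in_closure_of[of w nuc_topology D] by simp
    ultimately have "\<exists>y. y \<in> D \<and> y \<in> ?W" by (elim allE[of _ ?W] impE) simp_all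
    then obtain v where v: "v \<in> D" "v \<in> ?W" by (elim exE conjE)
    have "nrm p (u - v) \<le> nrm p (u - w) + nrm p (w - v)"
      using u w v nuc_sub_H[of p] by (intro nrm_triangle_diff) auto
    also have "nrm p (w - v) = nrm p (v - w)"
      using w v nuc_sub_H[of p] by (intro nrm_minus_commute) auto
    finally show ?thesis using v w by (intro bexI[of _ v]) auto
  qed
  show ?thesis
  proof (rule that[of "from_nat_into D"])
    show "range (from_nat_into D) \<subseteq> nuc" using from_nat_into[OF ne] D(2) by auto
    fix p u and \<epsilon> :: real assume "u \<in> H p" "0 < \<epsilon>"
    then obtain v where "v \<in> D" "nrm p (u - v) < \<epsilon>" using dense by blast
    then show "\<exists>n. nrm p (u - from_nat_into D n) < \<epsilon>"
      using from_nat_into_to_nat_on[OF D(1)] by (intro exI[of _ "to_nat_on D v"]) simp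
  qed
qed

text \<open>A stand-in for an orthonormal basis of \<open>H p\<close>, kept as an increasing
  sequence of finite systems. The systems lie in \<open>nuc\<close> so that every functional in
  \<open>nuc_dual\<close> and every derivative along \<open>nuc\<close> can be evaluated on basis
  vectors.\<close>

definition exhaustion :: "nat \<Rightarrow> (nat \<Rightarrow> 'h set) \<Rightarrow> bool" where
  "exhaustion p B \<longleftrightarrow> (\<forall>n. finite (B n) \<and> orthonormal p (B n) \<and> B n \<subseteq> nuc) \<and> mono B \<and>
     (\<forall>u\<in>H p. (\<lambda>n. nrm p (u - proj p (B n) u)) \<longlonglongrightarrow> 0)"

lemma exhaustionD:
  assumes "exhaustion p B"
  shows "finite (B n)" "orthonormal p (B n)" "B n \<subseteq> nuc" "mono B"
    "u \<in> H p \<Longrightarrow> (\<lambda>n. nrm p (u - proj p (B n) u)) \<longlonglongrightarrow> 0"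
  using assms by (simp_all add: exhaustion_def)

text \<open>Gram--Schmidt is applied to a dense sequence of \<open>nuc\<close>, so that the basis of \<open>H p\<close> lies in
  \<open>nuc\<close>.\<close>

lemma exhaustion_exists: "\<exists>B. exhaustion p B"
proof -
  obtain d :: "nat \<Rightarrow> 'h" where d: "range d \<subseteq> nuc"
    "\<And>p u \<epsilon>. u \<in> H p \<Longrightarrow> 0 < \<epsilon> \<Longrightarrow> \<exists>n. nrm p (u - d n) < \<epsilon>"
    using nuc_dense_sequence by blast
  have "\<exists>B. \<forall>n. (finite (B n) \<and> orthonormal p (B n) \<and> B n \<subseteq> nuc) \<and> (B n \<subseteq> B (Suc n) \<and> d n \<in> span (B (Suc n)))"
  proof (rule dependent_nat_choice)
    show "\<exists>x. finite x \<and> orthonormal p x \<and> x \<subseteq> nuc" by (intro exI[of _ "{}"]) auto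
    fix A n assume A: "finite A \<and> orthonormal p A \<and> A \<subseteq> nuc"
    have dn: "d n \<in> nuc" using d(1) by auto
    then obtain B where B: "A \<subseteq> B" "finite B" "orthonormal p B" "d n \<in> span B" "B \<subseteq> span (insert (d n) A)"
      using orthonormal_extend[of p A "d n"] A nuc_sub_H[of p] by blast
    have "span (insert (d n) A) \<subseteq> nuc" using A dn by (intro span_minimal subspace_nuc) auto
    then show "\<exists>y. (finite y \<and> orthonormal p y \<and> y \<subseteq> nuc) \<and> A \<subseteq> y \<and> d n \<in> span y"
      using B by (intro exI[of _ B]) auto
  qed
  then obtain B where B: "\<And>n. finite (B n)" "\<And>n. orthonormal p (B n)" "\<And>n. B n \<subseteq> nuc"
      "\<And>n. B n \<subseteq> B (Suc n)" "\<And>n. d n \<in> span (B (Suc n))" by blast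
  have mono: "mono B" using B(4) by (intro incseq_SucI)
  have "(\<lambda>n. nrm p (u - proj p (B n) u)) \<longlonglongrightarrow> 0" if u: "u \<in> H p" for u
  proof (rule LIMSEQ_I)
    fix \<epsilon> :: real assume "0 < \<epsilon>"
    then obtain k where k: "nrm p (u - d k) < \<epsilon>" using d(2)[OF u] by blast
    have "norm (nrm p (u - proj p (B n) u) - 0) < \<epsilon>" if n: "n \<ge> Suc k" for n
    proof -
      have "d k \<in> span (B n)" using B(5)[of k] span_mono[OF monoD[OF mono n]] by blast
      then have "nrm p (u - proj p (B n) u) \<le> nrm p (u - d k)"
        using proj_best[OF B(2,1) u] by blast
      moreover have "0 \<le> nrm p (u - proj p (B n) u)"
        using u proj_in_H[OF B(2)] by (intro nrm_nonneg H_diff)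
      ultimately show ?thesis using k by simp
    qed
    then show "\<exists>N. \<forall>n\<ge>N. norm (nrm p (u - proj p (B n) u) - 0) < \<epsilon>" by blast
  qed
  with B(1-3) mono have "exhaustion p B" by (simp add: exhaustion_def)
  then show ?thesis by blast
qed

end

subsection \<open>Linear maps on spaces with seminorm topologies\<close>

lemma seminorm_topology_continuous:
  fixes K :: "'a::minus \<Rightarrow> 'b::real_normed_vector"
  assumes "q \<in> Q" "0 \<le> C"
    and le: "\<And>f g. f \<in> X \<Longrightarrow> g \<in> X \<Longrightarrow> norm (K g - K f) \<le> C * q (g - f)"
  shows "continuous_map (seminorm_topology X Q) euclidean K"
  unfolding continuous_map
proof (intro conjI allI impI)
  fix W :: "'b set" assume "openin euclidean W"
  then have W: "open W" by simp
  show "openin (seminorm_topology X Q) {x \<in> topspace (seminorm_topology X Q). K x \<in> W}"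
    unfolding openin_seminorm_topology topspace_seminorm_topology
  proof (intro conjI ballI)
    fix f assume f: "f \<in> {x \<in> X. K x \<in> W}"
    obtain e where e: "0 < e" "\<And>y. dist y (K f) < e \<Longrightarrow> y \<in> W"
      using W f unfolding open_dist by auto
    show "\<exists>F \<epsilon>. finite F \<and> F \<subseteq> Q \<and> 0 < \<epsilon> \<and>
        (\<forall>g\<in>X. (\<forall>q\<in>F. q (g - f) < \<epsilon>) \<longrightarrow> g \<in> {x \<in> X. K x \<in> W})"
    proof (intro exI[of _ "{q}"] exI[of _ "e / (C + 1)"] conjI ballI impI)
      fix g assume g: "g \<in> X" "\<forall>q\<in>{q}. q (g - f) < e / (C + 1)"
      have "norm (K g - K f) \<le> C * q (g - f)" using le f g by simp
      also have "\<dots> \<le> C * (e / (C + 1))" using g(2) assms(2) by (intro mult_left_mono) auto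
      also have "\<dots> < e" using assms(2) e(1) by (simp add: field_simps)
      finally show "g \<in> {x \<in> X. K x \<in> W}" using e(2)[of "K g"] g by (simp add: dist_norm)
    qed (use assms(1,2) e in auto)
  qed auto
qed auto

text \<open>Monotonicity in the index lets one seminorm replace the finite set of seminorms of a
  basic neighbourhood.\<close>

lemma seminorm_topology_nhd:
  fixes N :: "nat \<Rightarrow> 'a::minus \<Rightarrow> real"
  assumes "openin (seminorm_topology X (range N)) W" "z \<in> W"
    and z: "\<And>g. g \<in> X \<Longrightarrow> g - z = g"
    and mono: "\<And>p q g. p \<le> q \<Longrightarrow> g \<in> X \<Longrightarrow> N p g \<le> N q g"
  shows "\<exists>p \<epsilon>. 0 < \<epsilon> \<and> (\<forall>g\<in>X. N p g < \<epsilon> \<longrightarrow> g \<in> W)"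
proof -
  obtain F \<epsilon> where F: "finite F" "F \<subseteq> range N" "0 < \<epsilon>"
      "\<And>g. g \<in> X \<Longrightarrow> (\<forall>q\<in>F. q (g - z) < \<epsilon>) \<Longrightarrow> g \<in> W"
    using bspec[OF conjunct2[OF iffD1[OF openin_seminorm_topology assms(1)]] assms(2)]
    by (elim exE conjE) (rule that, assumption+, blast)
  obtain P where P: "finite P" "F = N ` P" using finite_subset_image[OF F(1,2)] by (elim exE conjE)
  \<comment> \<open>Inserting 0 keeps \<open>Max\<close> meaningful when the set of seminorms is
    empty.\<close>
  have "g \<in> W" if g: "g \<in> X" "N (Max (insert 0 P)) g < \<epsilon>" for g
  proof (rule F(4)[OF g(1)], rule ballI)
    fix q assume "q \<in> F"
    then obtain i where i: "i \<in> P" "q = N i" using P by auto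
    then have "i \<le> Max (insert 0 P)" using P(1) by simp
    then have "N i g \<le> N (Max (insert 0 P)) g" using g(1) by (rule mono)
    then show "q (g - z) < \<epsilon>" using g z i by simp
  qed
  then show ?thesis using F(3) by (intro exI[of _ "Max (insert 0 P)"] exI[of _ \<epsilon>]) simp
qed

text \<open>A continuous homogeneous map is bounded by one of the seminorms. Scaling by positive
  reals is the abstract operation \<open>sc\<close>, so that the result serves vectors of
  \<open>nuc\<close> and tensors alike.\<close>

lemma seminorm_topology_bounded:
  fixes K :: "'a::minus \<Rightarrow> 'b::real_normed_vector" and N :: "nat \<Rightarrow> 'a \<Rightarrow> real"
  assumes cont: "continuous_map (seminorm_topology X (range N)) euclidean K"
    and z: "z \<in> X" "K z = 0" "\<And>g. g \<in> X \<Longrightarrow> g - z = g"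
    and mono: "\<And>p q g. p \<le> q \<Longrightarrow> g \<in> X \<Longrightarrow> N p g \<le> N q g"
    and nonneg: "\<And>p g. g \<in> X \<Longrightarrow> 0 \<le> N p g"
    and sc: "\<And>a g. 0 < a \<Longrightarrow> g \<in> X \<Longrightarrow> sc a g \<in> X"
      "\<And>p a g. 0 < a \<Longrightarrow> g \<in> X \<Longrightarrow> N p (sc a g) \<le> a * N p g"
      "\<And>a g. 0 < a \<Longrightarrow> g \<in> X \<Longrightarrow> K (sc a g) = a *\<^sub>R K g"
  shows "\<exists>p C. 0 \<le> C \<and> (\<forall>g\<in>X. norm (K g) \<le> C * N p g)"
proof -
  have "openin (seminorm_topology X (range N)) {g \<in> topspace (seminorm_topology X (range N)). K g \<in> ball 0 1}"
    using cont by (intro openin_continuous_map_preimage[of _ euclidean]) auto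
  then have o: "openin (seminorm_topology X (range N)) {g \<in> X. K g \<in> ball 0 1}" by simp
  obtain p \<epsilon> where p: "0 < \<epsilon>" "\<And>g. g \<in> X \<Longrightarrow> N p g < \<epsilon> \<Longrightarrow> g \<in> {g \<in> X. K g \<in> ball 0 1}"
    using seminorm_topology_nhd[OF o _ z(3) mono] z(1,2) by force
  \<comment> \<open>The summand \<open>\<delta>\<close> allows division although
    \<open>N p g\<close> may be 0; it is removed afterwards by letting it tend to 0.\<close>
  have *: "norm (K g) \<le> 2 / \<epsilon> * (N p g + \<delta>)" if g: "g \<in> X" and d: "0 < \<delta>" for g \<delta>
  proof -
    define a where "a = \<epsilon> / (2 * (N p g + \<delta>))"
    have n: "0 < N p g + \<delta>" using nonneg[OF g, of p] d by simp
    have a: "0 < a" using p(1) n by (simp add: a_def)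
    have "N p (sc a g) \<le> a * N p g" using sc(2)[OF a g] .
    also have "\<dots> \<le> a * (N p g + \<delta>)" using a d by simp
    also have "\<dots> = \<epsilon> / 2"
      unfolding a_def times_divide_eq_left using n by (subst mult_divide_mult_cancel_right[of "N p g + \<delta>"]) auto
    also have "\<dots> < \<epsilon>" using p(1) by simp
    finally have "norm (K (sc a g)) < 1" using p(2)[OF sc(1)[OF a g]] by simp
    then have "a * norm (K g) < 1" using sc(3)[OF a g] a by simp
    then show ?thesis using a p(1) n by (simp add: a_def field_simps)
  qed
  have "norm (K g) \<le> 2 / \<epsilon> * N p g" if g: "g \<in> X" for g
  proof (rule field_le_epsilon)
    fix e :: real assume e: "0 < e"
    have "norm (K g) \<le> 2 / \<epsilon> * (N p g + e * \<epsilon> / 2)" using *[OF g, of "e * \<epsilon> / 2"] e p(1) by simp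
    also have "\<dots> = 2 / \<epsilon> * N p g + e" using p(1) by (simp add: field_simps)
    finally show "norm (K g) \<le> 2 / \<epsilon> * N p g + e" .
  qed
  then show ?thesis using p(1) by (intro exI[of _ p] exI[of _ "2 / \<epsilon>"]) simp
qed

lemma sum_sq_weighted_le:
  fixes z :: "'a \<Rightarrow> complex"
  shows "(cmod (\<Sum>b\<in>B. z b * w b))\<^sup>2 \<le> (\<Sum>b\<in>B. (cmod (z b))\<^sup>2) * (\<Sum>b\<in>B. (cmod (w b))\<^sup>2)"
proof -
  have "cmod (\<Sum>b\<in>B. z b * w b) \<le> (\<Sum>b\<in>B. cmod (z b) * cmod (w b))"
    by (rule order_trans[OF norm_sum]) (simp add: norm_mult)
  then have "(cmod (\<Sum>b\<in>B. z b * w b))\<^sup>2 \<le> (\<Sum>b\<in>B. cmod (z b) * cmod (w b))\<^sup>2"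
    by (rule power_mono) simp
  also have "\<dots> \<le> (\<Sum>b\<in>B. (cmod (z b))\<^sup>2) * (\<Sum>b\<in>B. (cmod (w b))\<^sup>2)"
    by (rule Cauchy_Schwarz_ineq_sum)
  finally show ?thesis .
qed

subsection \<open>Lists of given length\<close>

definition lists_len :: "'a set \<Rightarrow> nat \<Rightarrow> 'a list set" where
  "lists_len E n = {es. set es \<subseteq> E \<and> length es = n}"

lemma lists_len_0 [simp]: "lists_len E 0 = {[]}"
  by (auto simp: lists_len_def)

lemma finite_lists_len [simp]: "finite E \<Longrightarrow> finite (lists_len E n)"
  unfolding lists_len_def by (rule finite_lists_length_eq)

lemma lists_len_Suc: "lists_len E (Suc n) = (\<lambda>(e, es). e # es) ` (E \<times> lists_len E n)"
  by (force simp: lists_len_def length_Suc_conv)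

lemma Cons_in_lists_len [simp]: "e # es \<in> lists_len E (Suc n) \<longleftrightarrow> e \<in> E \<and> es \<in> lists_len E n"
  by (auto simp: lists_len_def)

lemma sum_lists_len_Suc:
  "(\<Sum>es\<in>lists_len E (Suc n). f es) = (\<Sum>e\<in>E. \<Sum>es\<in>lists_len E n. f (e # es))"
proof -
  have "inj_on (\<lambda>(e, es). e # es) (E \<times> lists_len E n)" by (auto simp: inj_on_def)
  then show ?thesis
    unfolding lists_len_Suc by (simp add: sum.reindex sum.cartesian_product case_prod_unfold o_def)
qed

lemma lists_len_mono: "A \<subseteq> B \<Longrightarrow> lists_len A n \<subseteq> lists_len B n"
  by (auto simp: lists_len_def)

context nuclear_triple
begin

subsection \<open>The dual of the nuclear space\<close>

lemma nuc_dualD: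
  assumes "x \<in> nuc_dual"
  shows "u \<in> nuc \<Longrightarrow> v \<in> nuc \<Longrightarrow> x (a *\<^sub>R u + b *\<^sub>R v) = a * x u + b * x v"
    and "u \<notin> nuc \<Longrightarrow> x u = 0"
  using assms by (auto simp: nuc_dual_def)

lemma nuc_dual_zero: "x \<in> nuc_dual \<Longrightarrow> x 0 = 0"
  using nuc_dualD(1)[of x 0 0 0 0] subspace_0[OF subspace_nuc] by simp

lemma nuc_dual_diff: "x \<in> nuc_dual \<Longrightarrow> u \<in> nuc \<Longrightarrow> v \<in> nuc \<Longrightarrow> x (u - v) = x u - x v"
  using nuc_dualD(1)[of x u v 1 "-1"] by simp

lemma nuc_dual_scale: "x \<in> nuc_dual \<Longrightarrow> u \<in> nuc \<Longrightarrow> x (a *\<^sub>R u) = a * x u"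
  using nuc_dualD(1)[of x u u a 0] by simp

lemma nuc_dual_add: "x \<in> nuc_dual \<Longrightarrow> u \<in> nuc \<Longrightarrow> v \<in> nuc \<Longrightarrow> x (u + v) = x u + x v"
  using nuc_dualD(1)[of x u v 1 1] by simp

lemma nuc_dual_sum:
  assumes "x \<in> nuc_dual" "\<And>i. i \<in> I \<Longrightarrow> f i \<in> nuc"
  shows "x (\<Sum>i\<in>I. f i) = (\<Sum>i\<in>I. x (f i))"
  using assms(2)
proof (induction I rule: infinite_finite_induct)
  case (insert i I)
  then have "(\<Sum>i\<in>I. f i) \<in> nuc" by (intro subspace_sum subspace_nuc) auto
  then show ?case using insert assms(1) by (simp add: nuc_dual_add)
qed (auto simp: nuc_dual_zero[OF assms(1)])

lemma nuc_dual_bounded: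
  assumes "x \<in> nuc_dual"
  shows "\<exists>p C. 0 \<le> C \<and> (\<forall>u\<in>nuc. \<bar>x u\<bar> \<le> C * nrm p u)"
proof -
  have c: "continuous_map (seminorm_topology nuc (range nrm)) euclidean x"
    using assms by (simp add: nuc_dual_def nuc_topology_def)
  have "0 \<in> nuc" using subspace_nuc by (rule subspace_0)
  moreover have "x 0 = 0" using assms by (rule nuc_dual_zero)
  moreover have "\<And>u. u \<in> nuc \<Longrightarrow> u - 0 = u" by simp
  moreover have "\<And>p q u. p \<le> q \<Longrightarrow> u \<in> nuc \<Longrightarrow> nrm p u \<le> nrm q u"
    using nuc_sub_H by (intro nrm_mono_le) auto
  moreover have "\<And>p u. u \<in> nuc \<Longrightarrow> 0 \<le> nrm p u" using nuc_sub_H by (intro nrm_nonneg) auto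
  moreover have "\<And>a u. 0 < (a::real) \<Longrightarrow> u \<in> nuc \<Longrightarrow> a *\<^sub>R u \<in> nuc"
    by (rule subspace_scale[OF subspace_nuc])
  moreover have "\<And>p a u. 0 < a \<Longrightarrow> u \<in> nuc \<Longrightarrow> nrm p (a *\<^sub>R u) \<le> a * nrm p u"
    using nuc_sub_H by (subst nrm_scale) auto
  moreover have "\<And>a u. 0 < (a::real) \<Longrightarrow> u \<in> nuc \<Longrightarrow> x (a *\<^sub>R u) = a *\<^sub>R x u"
    using nuc_dual_scale[OF assms] by simp
  ultimately have "\<exists>p C. 0 \<le> C \<and> (\<forall>u\<in>nuc. norm (x u) \<le> C * nrm p u)"
    by (rule seminorm_topology_bounded[OF c])
  then show ?thesis by simp
qed

lemma nuc_dualI: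
  assumes lin: "\<And>u v a b. u \<in> nuc \<Longrightarrow> v \<in> nuc \<Longrightarrow> x (a *\<^sub>R u + b *\<^sub>R v) = a * x u + b * x v"
    and out: "\<And>u. u \<notin> nuc \<Longrightarrow> x u = 0"
    and C: "0 \<le> C" "\<And>u. u \<in> nuc \<Longrightarrow> \<bar>x u\<bar> \<le> C * nrm p u"
  shows "x \<in> nuc_dual"
proof -
  have "continuous_map nuc_topology euclidean x"
    unfolding nuc_topology_def
  proof (rule seminorm_topology_continuous[of "nrm p" _ C])
    fix f g assume f: "f \<in> nuc" "g \<in> nuc"
    have "x g - x f = x (g - f)" using lin[OF f(2,1), of 1 "-1"] by simp
    then show "norm (x g - x f) \<le> C * nrm p (g - f)"
      using C(2)[of "g - f"] f subspace_diff[OF subspace_nuc] by simp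
  qed (use C in auto)
  then show ?thesis using lin out by (auto simp: nuc_dual_def)
qed

lemma riesz_in_dual: "e \<in> H p \<Longrightarrow> riesz p e \<in> nuc_dual"
proof (rule nuc_dualI[where C = "nrm p e" and p = p])
  assume e: "e \<in> H p"
  note s = subspace_add[OF subspace_nuc] subspace_scale[OF subspace_nuc]
  show "riesz p e (a *\<^sub>R u + b *\<^sub>R v) = a * riesz p e u + b * riesz p e v"
    if "u \<in> nuc" "v \<in> nuc" for u v a b
    using that e s nuc_sub_H[of p]
    by (auto simp: riesz_def ip_add_right ip_scale_right subset_iff H_scale)
  show "0 \<le> nrm p e" using e by (rule nrm_nonneg)
  show "\<bar>riesz p e u\<bar> \<le> nrm p e * nrm p u" if "u \<in> nuc" for u
    using that e nuc_sub_H[of p] by (auto simp: riesz_def intro!: ip_cauchy_schwarz)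
qed (simp add: riesz_def)

lemma nuc_dual_combination:
  assumes "x \<in> nuc_dual" "y \<in> nuc_dual"
  shows "(\<lambda>u. a * x u + b * y u) \<in> nuc_dual"
proof -
  obtain p C where a1: "0 \<le> C" "\<forall>u\<in>nuc. \<bar>x u\<bar> \<le> C * nrm p u"
    using nuc_dual_bounded[OF assms(1)] by (elim exE conjE)
  note 1 = a1(1) a1(2)[rule_format]
  obtain q D where a2: "0 \<le> D" "\<forall>u\<in>nuc. \<bar>y u\<bar> \<le> D * nrm q u"
    using nuc_dual_bounded[OF assms(2)] by (elim exE conjE)
  note 2 = a2(1) a2(2)[rule_format]
  show ?thesis
  proof (rule nuc_dualI[where C = "\<bar>a\<bar> * C + \<bar>b\<bar> * D" and p = "max p q"])
    show "\<bar>a * x u + b * y u\<bar> \<le> (\<bar>a\<bar> * C + \<bar>b\<bar> * D) * nrm (max p q) u" if u: "u \<in> nuc" for u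
    proof -
      have "\<bar>x u\<bar> \<le> C * nrm (max p q) u"
        using u nuc_sub_H by (intro order_trans[OF 1(2)] mult_left_mono nrm_mono_le 1(1)) auto
      moreover have "\<bar>y u\<bar> \<le> D * nrm (max p q) u"
        using u nuc_sub_H by (intro order_trans[OF 2(2)] mult_left_mono nrm_mono_le 2(1)) auto
      ultimately have "\<bar>a\<bar> * \<bar>x u\<bar> + \<bar>b\<bar> * \<bar>y u\<bar> \<le> \<bar>a\<bar> * (C * nrm (max p q) u) + \<bar>b\<bar> * (D * nrm (max p q) u)"
        by (intro add_mono mult_left_mono) auto
      then show ?thesis using abs_triangle_ineq[of "a * x u" "b * y u"]
        by (simp add: abs_mult algebra_simps)
    qed
  qed (use assms 1(1) 2(1) in \<open>auto simp: nuc_dualD algebra_simps\<close>)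
qed

lemma zero_in_nuc_dual [simp]: "(\<lambda>_. 0) \<in> nuc_dual"
  by (rule nuc_dualI[where C = 0]) auto

lemma nuc_dual_lincomb:
  assumes "\<And>b. b \<in> B \<Longrightarrow> y b \<in> nuc_dual"
  shows "(\<lambda>u. \<Sum>b\<in>B. a b * y b u) \<in> nuc_dual"
  using assms
proof (induction B rule: infinite_finite_induct)
  case (insert b B)
  then show ?case using nuc_dual_combination[of "y b" "\<lambda>u. \<Sum>b\<in>B. a b * y b u" "a b" 1] by simp
qed auto

lemma riesz_lincomb:
  assumes "\<And>b. b \<in> B \<Longrightarrow> f b \<in> H p"
  shows "riesz p (\<Sum>b\<in>B. a b *\<^sub>R f b) = (\<lambda>u. \<Sum>b\<in>B. a b * riesz p (f b) u)"
proof
  fix u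
  show "riesz p (\<Sum>b\<in>B. a b *\<^sub>R f b) u = (\<Sum>b\<in>B. a b * riesz p (f b) u)"
  proof (cases "u \<in> nuc")
    case True
    then have u: "u \<in> H p" using nuc_sub_H by auto
    have "ip p (\<Sum>b\<in>B. a b *\<^sub>R f b) u = (\<Sum>b\<in>B. ip p (a b *\<^sub>R f b) u)"
      using assms u by (intro ip_sum H_scale)
    also have "\<dots> = (\<Sum>b\<in>B. a b * ip p (f b) u)" using assms u by (intro sum.cong) (auto simp: ip_scale)
    finally show ?thesis using True by (simp add: riesz_def)
  qed (simp add: riesz_def)
qed

text \<open>The Fourier partial sums \<open>s n\<close> of \<open>x\<close> along an exhaustion have
  increasing and bounded squared norms \<open>a n\<close>, hence form a Cauchy sequence.
  Completeness of \<open>H p\<close> gives the limit \<open>h\<close>, and both \<open>x\<close> and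
  the inner product with \<open>h\<close> are limits of their values on projections.\<close>

lemma riesz_representation:
  assumes x: "x \<in> nuc_dual" and C: "0 \<le> C" "\<And>u. u \<in> nuc \<Longrightarrow> \<bar>x u\<bar> \<le> C * nrm p u"
  obtains h where "h \<in> H p" "x = riesz p h"
proof -
  obtain B where ex: "exhaustion p B" using exhaustion_exists[of p] by (elim exE)
  note B = exhaustionD[OF ex]
  define s where "s n = (\<Sum>b\<in>B n. x b *\<^sub>R b)" for n
  define a where "a n = (\<Sum>b\<in>B n. (x b)\<^sup>2)" for n
  have sH: "s n \<in> H p" for n unfolding s_def using orthonormal_combination(3)[OF B(2,1)] .
  have ns: "(nrm p (s n))\<^sup>2 = a n" for n
    unfolding s_def a_def using orthonormal_combination(2)[OF B(2,1)] .
  have sn: "s n \<in> nuc" for n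
    unfolding s_def using B(3) by (intro subspace_sum subspace_scale subspace_nuc) auto
  have xp: "x (\<Sum>b\<in>B n. c b *\<^sub>R b) = (\<Sum>b\<in>B n. c b * x b)" for c n
  proof -
    have "x (\<Sum>b\<in>B n. c b *\<^sub>R b) = (\<Sum>b\<in>B n. x (c b *\<^sub>R b))"
      using B(3)[of n] x by (intro nuc_dual_sum subspace_scale subspace_nuc) auto
    also have "\<dots> = (\<Sum>b\<in>B n. c b * x b)" using B(3)[of n] x by (intro sum.cong) (auto simp: nuc_dual_scale)
    finally show ?thesis .
  qed
  \<comment> \<open>\<open>a n = x (s n) \<le> C * nrm p (s n)\<close>, and
    \<open>nrm p (s n)\<close> is the root of \<open>a n\<close>, so one factor cancels.\<close>
  have ab: "a n \<le> C\<^sup>2" for n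
  proof -
    have "a n = x (s n)" unfolding s_def xp a_def by (simp add: power2_eq_square)
    also have "\<dots> \<le> C * nrm p (s n)" using C(2)[OF sn[of n]] by linarith
    finally have "(nrm p (s n))\<^sup>2 \<le> C * nrm p (s n)" using ns by simp
    then have "nrm p (s n) \<le> C" using nrm_nonneg[OF sH[of n]] C(1)
      by (cases "nrm p (s n) = 0") (auto simp: power2_eq_square)
    then have "(nrm p (s n))\<^sup>2 \<le> C\<^sup>2" using nrm_nonneg[OF sH[of n]] by (intro power_mono)
    then show ?thesis using ns by simp
  qed
  have "incseq a" unfolding a_def incseq_def using B(1) monoD[OF B(4)]
    by (auto intro!: sum_mono2)
  then obtain L where "a \<longlonglongrightarrow> L" using incseq_convergent[of a "C\<^sup>2"] ab by blast
  then have "convergent a" by (rule convergentI)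
  then have cau: "Cauchy a" by (rule convergent_Cauchy)
  have df: "(nrm p (s m - s n))\<^sup>2 = a m - a n" if "n \<le> m" for m n
  proof -
    have sub: "B n \<subseteq> B m" using monoD[OF B(4) that] .
    have "s m - s n = (\<Sum>b\<in>B m - B n. x b *\<^sub>R b)" "a m - a n = (\<Sum>b\<in>B m - B n. (x b)\<^sup>2)"
      unfolding s_def a_def using sub B(1) by (simp_all add: sum_diff)
    then show ?thesis
      using orthonormal_combination(2)[OF orthonormal_subset[OF B(2)], of "B m - B n" m x] B(1)[of m]
      by auto
  qed
  have df': "(nrm p (s m - s n))\<^sup>2 = \<bar>a m - a n\<bar>" for m n
  proof (cases "n \<le> m")
    case True
    have "0 \<le> a m - a n" unfolding df[OF True, symmetric] by simp
    then show ?thesis using df[OF True] by simp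
  next
    case False
    then have d: "(nrm p (s n - s m))\<^sup>2 = a n - a m" using df[of m n] by simp
    have "0 \<le> a n - a m" unfolding d[symmetric] by simp
    then show ?thesis using d nrm_minus_commute[OF sH sH, of m n] by simp
  qed
  have "\<forall>\<epsilon>>0. \<exists>M. \<forall>m\<ge>M. \<forall>n\<ge>M. nrm p (s m - s n) < \<epsilon>"
  proof (intro allI impI)
    fix \<epsilon> :: real assume e: "0 < \<epsilon>"
    then obtain M where M: "\<And>m n. m \<ge> M \<Longrightarrow> n \<ge> M \<Longrightarrow> dist (a m) (a n) < \<epsilon>\<^sup>2"
      using metric_CauchyD[OF cau, of "\<epsilon>\<^sup>2"] by auto
    have "nrm p (s m - s n) < \<epsilon>" if "m \<ge> M" "n \<ge> M" for m n
    proof -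
      have "(nrm p (s m - s n))\<^sup>2 < \<epsilon>\<^sup>2" using M[OF that] df' by (simp add: dist_real_def)
      then show ?thesis using e by (simp add: power2_less_imp_less)
    qed
    then show "\<exists>M. \<forall>m\<ge>M. \<forall>n\<ge>M. nrm p (s m - s n) < \<epsilon>" by (intro exI[of _ M]) simp
  qed
  then obtain h where h: "h \<in> H p" "(\<lambda>n. nrm p (s n - h)) \<longlonglongrightarrow> 0"
    using complete_H[of s p] sH by auto
  have "x u = ip p h u" if u: "u \<in> nuc" for u
  proof -
    have uH: "u \<in> H p" using u nuc_sub_H by auto
    have pn: "proj p (B n) u \<in> nuc" for n using B(3) by (rule proj_in_subspace[OF subspace_nuc])
    have e: "ip p (s n) u = x (proj p (B n) u)" for n
    proof -
      have "ip p (s n) u = (\<Sum>b\<in>B n. ip p (x b *\<^sub>R b) u)"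
        unfolding s_def using uH orthonormalD(2)[OF B(2)] by (intro ip_sum H_scale) auto
      also have "\<dots> = (\<Sum>b\<in>B n. ip p b u * x b)"
        using uH orthonormalD(2)[OF B(2)] by (intro sum.cong) (auto simp: ip_scale)
      finally show ?thesis unfolding proj_def xp .
    qed
    have "(\<lambda>n. ip p (s n) u) \<longlonglongrightarrow> ip p h u"
    proof (rule Lim_null_comparison[THEN LIM_zero_cancel])
      show "\<forall>\<^sub>F n in sequentially. norm (ip p (s n) u - ip p h u) \<le> nrm p (s n - h) * nrm p u"
        using ip_cauchy_schwarz[OF H_diff[OF sH h(1)] uH] ip_diff[OF sH h(1) uH] by simp
      show "(\<lambda>n. nrm p (s n - h) * nrm p u) \<longlonglongrightarrow> 0" using tendsto_mult_left_zero[OF h(2)] .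
    qed
    moreover have "(\<lambda>n. x (proj p (B n) u)) \<longlonglongrightarrow> x u"
    proof (rule Lim_null_comparison[THEN LIM_zero_cancel])
      show "\<forall>\<^sub>F n in sequentially. norm (x (proj p (B n) u) - x u) \<le> C * nrm p (u - proj p (B n) u)"
      proof (intro always_eventually allI)
        fix n
        have "\<bar>x (u - proj p (B n) u)\<bar> \<le> C * nrm p (u - proj p (B n) u)"
          using u pn by (intro C(2) subspace_diff subspace_nuc)
        then show "norm (x (proj p (B n) u) - x u) \<le> C * nrm p (u - proj p (B n) u)"
          using nuc_dual_diff[OF x u pn] by (simp add: abs_minus_commute)
      qed
      show "(\<lambda>n. C * nrm p (u - proj p (B n) u)) \<longlonglongrightarrow> 0" using tendsto_mult_right_zero[OF B(5)[OF uH]] .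
    qed
    ultimately show ?thesis unfolding e by (rule LIMSEQ_unique[rotated])
  qed
  then have "x = riesz p h" using nuc_dualD(2)[OF x] by (auto simp: riesz_def)
  with h(1) show ?thesis by (rule that)
qed

text \<open>Stated for all large \<open>p\<close>, so that finitely many functionals can be
  represented in one common space \<open>H p\<close>.\<close>

lemma riesz_representation_large:
  assumes x: "x \<in> nuc_dual"
  shows "\<exists>p0. \<forall>p\<ge>p0. \<exists>h\<in>H p. x = riesz p h"
proof -
  obtain p0 C where C': "0 \<le> C" "\<forall>u\<in>nuc. \<bar>x u\<bar> \<le> C * nrm p0 u"
    using nuc_dual_bounded[OF x] by (elim exE conjE)
  note C = C'(1) C'(2)[rule_format]
  have "\<exists>h\<in>H p. x = riesz p h" if p: "p0 \<le> p" for p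
  proof -
    have le: "\<bar>x u\<bar> \<le> C * nrm p u" if u: "u \<in> nuc" for u
      using u p nuc_sub_H by (intro order_trans[OF C(2)] mult_left_mono nrm_mono_le C(1)) auto
    obtain h where "h \<in> H p" "x = riesz p h" by (rule riesz_representation[OF x C(1) le])
    then show ?thesis by blast
  qed
  then show ?thesis by (intro exI[of _ p0]) simp
qed


subsection \<open>Multilinear functionals on the dual space\<close>

text \<open>The algebraic half of \<open>tensors\<close>. Contraction and projection estimates need
  only these conditions, and finiteness of the norms can then be derived from them for newly
  constructed tensors.\<close>

definition mtens :: "nat \<Rightarrow> (('h \<Rightarrow> real) list \<Rightarrow> complex) set" where
  "mtens n = {t.
     (\<forall>xs. \<not> (length xs = n \<and> set xs \<subseteq> nuc_dual) \<longrightarrow> t xs = 0) \<and>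
     (\<forall>xs k x y a b. length xs = n \<and> set xs \<subseteq> nuc_dual \<and> k < n \<and> x \<in> nuc_dual \<and> y \<in> nuc_dual \<longrightarrow>
        t (xs[k := (\<lambda>u. a * x u + b * y u)]) =
          complex_of_real a * t (xs[k := x]) + complex_of_real b * t (xs[k := y])) \<and>
     (\<forall>xs ys. mset xs = mset ys \<longrightarrow> t xs = t ys)}"

lemma tensors_iff: "t \<in> tensors n \<longleftrightarrow> t \<in> mtens n \<and> (\<forall>p. tensor_norm_sq p n t < \<infinity>)"
  unfolding tensors_def mtens_def mem_Collect_eq by (simp only: conj_assoc)

lemma mtensD:
  assumes "t \<in> mtens n"
  shows "\<not> (length xs = n \<and> set xs \<subseteq> nuc_dual) \<Longrightarrow> t xs = 0"
    "length xs = n \<Longrightarrow> set xs \<subseteq> nuc_dual \<Longrightarrow> k < n \<Longrightarrow> x \<in> nuc_dual \<Longrightarrow> y \<in> nuc_dual \<Longrightarrow>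
        t (xs[k := (\<lambda>u. a * x u + b * y u)]) =
          complex_of_real a * t (xs[k := x]) + complex_of_real b * t (xs[k := y])"
    "mset xs = mset ys \<Longrightarrow> t xs = t ys"
  using assms unfolding mtens_def mem_Collect_eq by (elim conjE, blast)+

lemma mtensI:
  assumes "\<And>xs. \<not> (length xs = n \<and> set xs \<subseteq> nuc_dual) \<Longrightarrow> t xs = 0"
    "\<And>xs k x y a b. length xs = n \<Longrightarrow> set xs \<subseteq> nuc_dual \<Longrightarrow> k < n \<Longrightarrow> x \<in> nuc_dual \<Longrightarrow> y \<in> nuc_dual \<Longrightarrow>
        t (xs[k := (\<lambda>u. a * x u + b * y u)]) =
          complex_of_real a * t (xs[k := x]) + complex_of_real b * t (xs[k := y])"
    "\<And>xs ys. length xs = n \<Longrightarrow> set xs \<subseteq> nuc_dual \<Longrightarrow> mset xs = mset ys \<Longrightarrow> t xs = t ys"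
  shows "t \<in> mtens n"
  unfolding mtens_def mem_Collect_eq
proof (intro conjI allI impI)
  fix xs ys :: "('h \<Rightarrow> real) list" assume m: "mset xs = mset ys"
  show "t xs = t ys"
  proof (cases "length xs = n \<and> set xs \<subseteq> nuc_dual")
    case True
    then show ?thesis using assms(3) m by blast
  next
    case False
    have "length xs = length ys" "set xs = set ys" using m by (metis size_mset, metis set_mset_mset)
    then show ?thesis using False assms(1)[of xs] assms(1)[of ys] by simp
  qed
qed (use assms(1,2) in blast)+

lemma mtens_Cons:
  assumes t: "t \<in> mtens (Suc n)" and x: "x \<in> nuc_dual"
  shows "(\<lambda>ys. t (x # ys)) \<in> mtens n"
proof (rule mtensI)
  fix xs assume "\<not> (length xs = n \<and> set xs \<subseteq> nuc_dual)"
  then show "t (x # xs) = 0" using x by (intro mtensD(1)[OF t]) auto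
next
  fix xs k y z a b
  assume "length xs = n" "set xs \<subseteq> nuc_dual" "k < n" "y \<in> nuc_dual" "z \<in> nuc_dual"
  then show "t (x # xs[k := (\<lambda>u. a * y u + b * z u)]) =
      complex_of_real a * t (x # xs[k := y]) + complex_of_real b * t (x # xs[k := z])"
    using mtensD(2)[OF t, of "x # xs" "Suc k" y z a b] x by simp
next
  fix xs ys :: "('h \<Rightarrow> real) list" assume "mset xs = mset ys"
  then show "t (x # xs) = t (x # ys)" by (intro mtensD(3)[OF t]) simp
qed

lemma mtens_slot:
  assumes t: "t \<in> mtens (Suc n)" and "x \<in> nuc_dual" "y \<in> nuc_dual" "set zs \<subseteq> nuc_dual" "length zs = n"
  shows "t ((\<lambda>u. a * x u + b * y u) # zs) = complex_of_real a * t (x # zs) + complex_of_real b * t (y # zs)"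
  using mtensD(2)[OF t, of "x # zs" 0 x y a b] assms(2-) by simp

lemma mtens_slot_sum:
  assumes t: "t \<in> mtens (Suc n)" and "set zs \<subseteq> nuc_dual" "length zs = n"
    and "\<And>b. b \<in> B \<Longrightarrow> y b \<in> nuc_dual"
  shows "t ((\<lambda>u. \<Sum>b\<in>B. a b * y b u) # zs) = (\<Sum>b\<in>B. complex_of_real (a b) * t (y b # zs))"
  using assms(4)
proof (induction B rule: infinite_finite_induct)
  case (insert b B)
  have "t ((\<lambda>u. a b * y b u + 1 * (\<Sum>b\<in>B. a b * y b u)) # zs) =
      complex_of_real (a b) * t (y b # zs) + complex_of_real 1 * t ((\<lambda>u. \<Sum>b\<in>B. a b * y b u) # zs)"
    using insert.prems assms(2,3) by (intro mtens_slot[OF t] nuc_dual_lincomb) auto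
  then show ?case using insert by simp
qed (use mtens_slot[OF t zero_in_nuc_dual zero_in_nuc_dual assms(2,3), of 0 0] in simp_all)

lemma mtens_combination:
  assumes "s \<in> mtens n" "t \<in> mtens n"
  shows "(\<lambda>xs. a * s xs + b * t xs) \<in> mtens n"
proof (rule mtensI)
  fix xs assume *: "\<not> (length xs = n \<and> set xs \<subseteq> nuc_dual)"
  show "a * s xs + b * t xs = 0" using mtensD(1)[OF assms(1) *] mtensD(1)[OF assms(2) *] by simp
next
  fix xs k x y c d
  assume "length xs = n" "set xs \<subseteq> nuc_dual" "k < n" "x \<in> nuc_dual" "y \<in> nuc_dual"
  note * = mtensD(2)[OF assms(1) this, of c d] mtensD(2)[OF assms(2) this, of c d]
  show "a * s (xs[k := \<lambda>u. c * x u + d * y u]) + b * t (xs[k := \<lambda>u. c * x u + d * y u]) =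
       complex_of_real c * (a * s (xs[k := x]) + b * t (xs[k := x])) +
       complex_of_real d * (a * s (xs[k := y]) + b * t (xs[k := y]))"
    unfolding * by (simp add: algebra_simps)
next
  fix xs ys :: "('h \<Rightarrow> real) list" assume "mset xs = mset ys"
  then show "a * s xs + b * t xs = a * s ys + b * t ys"
    using mtensD(3)[OF assms(1), of xs ys] mtensD(3)[OF assms(2), of xs ys] by simp
qed

text \<open>Induction on the slots: the contraction of coefficient vectors acts in one slot while
  the others are fixed. As the matrix \<open>a\<close> is real, \<open>contr\<close> is applied
  separately to the real and the imaginary parts of the values of \<open>t\<close>.\<close>

lemma hs_contraction:
  fixes a :: "'g \<Rightarrow> 'b \<Rightarrow> real"
  assumes "finite G" "finite B" and y: "\<And>b. b \<in> B \<Longrightarrow> y b \<in> nuc_dual"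
    and x: "\<And>g. g \<in> G \<Longrightarrow> x g = (\<lambda>u. \<Sum>b\<in>B. a g b * y b u)"
    and contr: "\<And>v. (\<Sum>g\<in>G. (\<Sum>b\<in>B. a g b * v b)\<^sup>2) \<le> (\<Sum>b\<in>B. (v b)\<^sup>2)"
    and "t \<in> mtens n"
  shows "(\<Sum>gs\<in>lists_len G n. (cmod (t (map x gs)))\<^sup>2) \<le> (\<Sum>bs\<in>lists_len B n. (cmod (t (map y bs)))\<^sup>2)"
  using assms(6)
proof (induction n arbitrary: t)
  case (Suc n)
  have xd: "x g \<in> nuc_dual" if "g \<in> G" for g
    using x[OF that] y by (auto intro: nuc_dual_lincomb)
  have "(\<Sum>gs\<in>lists_len G (Suc n). (cmod (t (map x gs)))\<^sup>2) =
      (\<Sum>g\<in>G. \<Sum>gs\<in>lists_len G n. (cmod (t (x g # map x gs)))\<^sup>2)"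
    by (simp add: sum_lists_len_Suc)
  also have "\<dots> \<le> (\<Sum>g\<in>G. \<Sum>bs\<in>lists_len B n. (cmod (t (x g # map y bs)))\<^sup>2)"
    using Suc.IH[OF mtens_Cons[OF Suc.prems xd]] by (intro sum_mono)
  also have "\<dots> = (\<Sum>bs\<in>lists_len B n. \<Sum>g\<in>G. (cmod (t (x g # map y bs)))\<^sup>2)"
    by (rule sum.swap)
  also have "\<dots> \<le> (\<Sum>bs\<in>lists_len B n. \<Sum>b\<in>B. (cmod (t (y b # map y bs)))\<^sup>2)"
  proof (rule sum_mono)
    fix bs assume bs: "bs \<in> lists_len B n"
    have e: "t (x g # map y bs) = (\<Sum>b\<in>B. complex_of_real (a g b) * t (y b # map y bs))" if "g \<in> G" for g
      unfolding x[OF that] using bs y by (intro mtens_slot_sum[OF Suc.prems]) (auto simp: lists_len_def)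
    define l where "l b = t (y b # map y bs)" for b
    have "(\<Sum>g\<in>G. (cmod (t (x g # map y bs)))\<^sup>2) =
       (\<Sum>g\<in>G. (\<Sum>b\<in>B. a g b * Re (l b))\<^sup>2) + (\<Sum>g\<in>G. (\<Sum>b\<in>B. a g b * Im (l b))\<^sup>2)"
      by (simp add: e l_def cmod_power2 sum.distrib cong: sum.cong)
    also have "\<dots> \<le> (\<Sum>b\<in>B. (Re (l b))\<^sup>2) + (\<Sum>b\<in>B. (Im (l b))\<^sup>2)"
      by (intro add_mono contr)
    also have "\<dots> = (\<Sum>b\<in>B. (cmod (t (y b # map y bs)))\<^sup>2)"
      by (simp add: l_def cmod_power2 sum.distrib)
    finally show "(\<Sum>g\<in>G. (cmod (t (x g # map y bs)))\<^sup>2) \<le> (\<Sum>b\<in>B. (cmod (t (y b # map y bs)))\<^sup>2)" .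
  qed
  also have "\<dots> = (\<Sum>bs\<in>lists_len B (Suc n). (cmod (t (map y bs)))\<^sup>2)"
    unfolding sum_lists_len_Suc by (subst sum.swap) simp
  finally show ?case .
qed simp

subsection \<open>Hilbert--Schmidt norms\<close>

definition hsq :: "nat \<Rightarrow> 'h set \<Rightarrow> nat \<Rightarrow> (('h \<Rightarrow> real) list \<Rightarrow> complex) \<Rightarrow> real" where
  "hsq p E n t = (\<Sum>es\<in>lists_len E n. (cmod (t (map (riesz p) es)))\<^sup>2)"

lemma hsq_nonneg: "0 \<le> hsq p E n t"
  by (simp add: hsq_def sum_nonneg)

lemma hsq_Suc: "hsq p E (Suc n) t = (\<Sum>e\<in>E. hsq p E n (\<lambda>ys. t (riesz p e # ys)))"
  by (simp add: hsq_def sum_lists_len_Suc)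

lemma tensor_norm_sq_eq:
  "tensor_norm_sq p n t = (SUP E\<in>{E. finite E \<and> orthonormal p E}. ennreal (hsq p E n t))"
  unfolding tensor_norm_sq_def hsq_def lists_len_def by (simp add: sum_ennreal)

lemma tensor_bounded:
  assumes "\<And>E. finite E \<Longrightarrow> orthonormal p E \<Longrightarrow> hsq p E n t \<le> c" "0 \<le> c"
  shows "tensor_norm_sq p n t < \<infinity>" "(tensor_norm p n t)\<^sup>2 \<le> c"
proof -
  have le: "tensor_norm_sq p n t \<le> ennreal c"
    unfolding tensor_norm_sq_eq using assms by (intro SUP_least ennreal_leI) auto
  then show "tensor_norm_sq p n t < \<infinity>" by (auto intro: order_le_less_trans)
  have "enn2real (tensor_norm_sq p n t) \<le> c"
    using enn2real_mono[OF le] assms(2) by simp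
  then show "(tensor_norm p n t)\<^sup>2 \<le> c" by (simp add: tensor_norm_def)
qed

lemma tensor_norm_nonneg: "0 \<le> tensor_norm p n t"
  by (simp add: tensor_norm_def)

lemma hsq_le_tensor_norm:
  assumes "tensor_norm_sq p n t < \<infinity>" "finite E" "orthonormal p E"
  shows "hsq p E n t \<le> (tensor_norm p n t)\<^sup>2"
proof -
  have "ennreal (hsq p E n t) \<le> tensor_norm_sq p n t"
    unfolding tensor_norm_sq_eq using assms by (intro SUP_upper) auto
  then have "enn2real (ennreal (hsq p E n t)) \<le> enn2real (tensor_norm_sq p n t)"
    using assms(1) by (intro enn2real_mono) auto
  then show ?thesis using hsq_nonneg by (simp add: tensor_norm_def)
qed

lemma tensor_norm_leI:
  assumes "\<And>E. finite E \<Longrightarrow> orthonormal p E \<Longrightarrow> hsq p E n t \<le> c\<^sup>2" "0 \<le> c"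
  shows "tensor_norm p n t \<le> c"
  by (rule power2_le_imp_le[OF tensor_bounded(2)[OF assms(1)] assms(2)]) simp_all

text \<open>The coefficient matrix \<open>ip p b g\<close> is a contraction by Bessel's inequality
  for \<open>G\<close>, applied to the vector \<open>w\<close> with coordinates \<open>v\<close> in
  the system \<open>B\<close>.\<close>

lemma hsq_proj:
  assumes "t \<in> mtens n" "finite G" "orthonormal p G" "finite B" "orthonormal p B"
  shows "(\<Sum>gs\<in>lists_len G n. (cmod (t (map (\<lambda>g. riesz p (proj p B g)) gs)))\<^sup>2) \<le> hsq p B n t"
  unfolding hsq_def
proof (rule hs_contraction[where a = "\<lambda>g b. ip p b g"])
  show "riesz p b \<in> nuc_dual" if "b \<in> B" for b using riesz_in_dual orthonormalD(2)[OF assms(5) that] .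
  show "riesz p (proj p B g) = (\<lambda>u. \<Sum>b\<in>B. ip p b g * riesz p b u)" if "g \<in> G" for g
    unfolding proj_def using orthonormalD(2)[OF assms(5)] by (rule riesz_lincomb)
  fix v :: "'h \<Rightarrow> real"
  define w where "w = (\<Sum>b\<in>B. v b *\<^sub>R b)"
  have w: "w \<in> H p" "(nrm p w)\<^sup>2 = (\<Sum>b\<in>B. (v b)\<^sup>2)"
    unfolding w_def using orthonormal_combination(2,3)[OF assms(5,4)] by auto
  have "ip p g w = (\<Sum>b\<in>B. ip p b g * v b)" if "g \<in> G" for g
  proof -
    have g: "g \<in> H p" using that orthonormalD(2)[OF assms(3)] by blast
    have "ip p g w = (\<Sum>b\<in>B. ip p g (v b *\<^sub>R b))"
      unfolding w_def using g orthonormalD(2)[OF assms(5)] by (intro ip_sum_right H_scale) auto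
    also have "\<dots> = (\<Sum>b\<in>B. ip p b g * v b)"
      using g orthonormalD(2)[OF assms(5)] by (intro sum.cong) (auto simp: ip_scale_right ip_commute)
    finally show ?thesis .
  qed
  then show "(\<Sum>g\<in>G. (\<Sum>b\<in>B. ip p b g * v b)\<^sup>2) \<le> (\<Sum>b\<in>B. (v b)\<^sup>2)"
    using bessel[OF assms(3,2) w(1)] w(2) by simp
qed (use assms in auto)

text \<open>Vectors of \<open>span B\<close> are fixed by the projection, so the Hilbert-Schmidt sum
  is monotone in the span of the system, and finite systems may be enlarged at will.\<close>

lemma hsq_span:
  assumes "t \<in> mtens n" "finite G" "orthonormal p G" "finite B" "orthonormal p B" "G \<subseteq> span B"
  shows "hsq p G n t \<le> hsq p B n t"
proof -
  have e: "map (\<lambda>g. riesz p (proj p B g)) gs = map (riesz p) gs" if "gs \<in> lists_len G n" for gs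
    using that assms(6) proj_eq_self[OF assms(5,4)] by (auto simp: lists_len_def)
  then have "hsq p G n t = (\<Sum>gs\<in>lists_len G n. (cmod (t (map (\<lambda>g. riesz p (proj p B g)) gs)))\<^sup>2)"
    unfolding hsq_def by (intro sum.cong refl) (simp only: e)
  then show ?thesis using hsq_proj[OF assms(1-5)] by simp
qed

text \<open>Both sides are continuous in \<open>u\<close> for \<open>nrm q\<close>, since
  \<open>nrm p\<close> is smaller, and they agree on the dense subspace \<open>nuc\<close>.\<close>

lemma ip_eq_on_H:
  assumes "p \<le> q" "g \<in> H p" "h \<in> H q" "riesz p g = riesz q h" "u \<in> H q"
  shows "ip p g u = ip q h u"
proof -
  have eq: "ip p g v = ip q h v" if "v \<in> nuc" for v
    using fun_cong[OF assms(4), of v] that by (simp add: riesz_def)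
  have "\<bar>ip p g u - ip q h u\<bar> \<le> 0 + e" if e: "0 < e" for e
  proof -
    define C where "C = nrm p g + nrm q h + 1"
    have C: "0 < C" using assms nrm_nonneg[of g p] nrm_nonneg[of h q] by (simp add: C_def)
    obtain v where v: "v \<in> nuc" "nrm q (u - v) < e / C" using nuc_dense_H[OF assms(5)] e C by (meson divide_pos_pos)
    have vH: "v \<in> H q" "v \<in> H p" "u \<in> H p" using v nuc_sub_H H_mono[OF assms(1)] assms(5) by auto
    have d: "u - v \<in> H q" "u - v \<in> H p" using vH assms(5) H_diff by auto
    have "ip p g u - ip q h u = ip p g (u - v) - ip q h (u - v)"
      using vH assms eq[OF v(1)] by (simp add: ip_diff_right)
    also have "\<bar>\<dots>\<bar> \<le> nrm p g * nrm p (u - v) + nrm q h * nrm q (u - v)"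
      using ip_cauchy_schwarz[OF assms(2) d(2)] ip_cauchy_schwarz[OF assms(3) d(1)] by linarith
    also have "\<dots> \<le> nrm p g * nrm q (u - v) + nrm q h * nrm q (u - v)"
      using nrm_mono_le[OF assms(1) d(1)] nrm_nonneg[OF assms(2)] by (intro add_mono mult_left_mono order_refl)
    also have "\<dots> \<le> C * nrm q (u - v)" using nrm_nonneg[OF d(1)] by (simp add: C_def algebra_simps)
    also have "\<dots> \<le> e" using v(2) C by (simp add: field_simps)
    finally show ?thesis by simp
  qed
  then have "\<bar>ip p g u - ip q h u\<bar> \<le> 0" by (rule field_le_epsilon)
  then show ?thesis by simp
qed

text \<open>The inclusion of the dual of \<open>H p\<close> into the dual of \<open>H q\<close> is a
  contraction. In \<open>H q\<close> the functional of \<open>g\<close> is represented by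
  \<open>h g\<close>, and the coordinates of the \<open>h g\<close> satisfy the hypothesis of
  \<open>hs_contraction\<close> by Bessel's inequality in \<open>H p\<close> and
  \<open>nrm p w \<le> nrm q w\<close>.\<close>

lemma hsq_mono_index:
  assumes "t \<in> mtens n" "p \<le> q" "finite G" "orthonormal p G"
  shows "\<exists>B. finite B \<and> orthonormal q B \<and> hsq p G n t \<le> hsq q B n t"
proof -
  have "\<exists>h\<in>H q. riesz p g = riesz q h" if "g \<in> G" for g
  proof -
    have g: "g \<in> H p" using that orthonormalD(2)[OF assms(4)] by blast
    have "\<bar>riesz p g u\<bar> \<le> nrm p g * nrm q u" if u: "u \<in> nuc" for u
    proof -
      have "\<bar>ip p g u\<bar> \<le> nrm p g * nrm p u" using u g nuc_sub_H by (intro ip_cauchy_schwarz) auto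
      also have "\<dots> \<le> nrm p g * nrm q u"
        using u nuc_sub_H nrm_nonneg[OF g] assms(2) by (intro mult_left_mono nrm_mono_le) auto
      finally show ?thesis using u by (simp add: riesz_def)
    qed
    then obtain h where "h \<in> H q" "riesz p g = riesz q h"
      by (rule riesz_representation[OF riesz_in_dual[OF g] nrm_nonneg[OF g]])
    then show ?thesis by blast
  qed
  then obtain h where h: "\<forall>g\<in>G. h g \<in> H q \<and> riesz p g = riesz q (h g)" by metis
  obtain B where B: "finite B" "orthonormal q B" "h ` G \<subseteq> span B"
    using orthonormal_spanning[of "h ` G" q] assms(3) h by blast
  have "hsq p G n t \<le> hsq q B n t"
    unfolding hsq_def
  proof (rule hs_contraction[where a = "\<lambda>g b. ip q b (h g)"])
    show "riesz q b \<in> nuc_dual" if "b \<in> B" for b using riesz_in_dual orthonormalD(2)[OF B(2) that] .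
    show "riesz p g = (\<lambda>u. \<Sum>b\<in>B. ip q b (h g) * riesz q b u)" if "g \<in> G" for g
      using riesz_lincomb[of B "\<lambda>b. b" q "\<lambda>b. ip q b (h g)"] orthonormalD(2)[OF B(2)]
        proj_eq_self[OF B(2,1), of "h g"] that B(3) h unfolding proj_def by auto
    fix v :: "'h \<Rightarrow> real"
    define w where "w = (\<Sum>b\<in>B. v b *\<^sub>R b)"
    have w: "w \<in> H q" "(nrm q w)\<^sup>2 = (\<Sum>b\<in>B. (v b)\<^sup>2)"
      unfolding w_def using orthonormal_combination(2,3)[OF B(2,1)] by auto
    have wp: "w \<in> H p" using w(1) H_mono[OF assms(2)] by blast
    have "ip p g w = (\<Sum>b\<in>B. ip q b (h g) * v b)" if "g \<in> G" for g
    proof -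
      have g: "g \<in> H p" "h g \<in> H q" using that orthonormalD(2)[OF assms(4)] h by blast+
      have "ip p g w = ip q (h g) w" using h that g w(1) by (intro ip_eq_on_H assms(2)) auto
      also have "\<dots> = (\<Sum>b\<in>B. ip q (h g) (v b *\<^sub>R b))"
        unfolding w_def using g orthonormalD(2)[OF B(2)] by (intro ip_sum_right H_scale) auto
      also have "\<dots> = (\<Sum>b\<in>B. ip q b (h g) * v b)"
        using g orthonormalD(2)[OF B(2)] by (intro sum.cong) (auto simp: ip_scale_right ip_commute)
      finally show ?thesis .
    qed
    then have "(\<Sum>g\<in>G. (\<Sum>b\<in>B. ip q b (h g) * v b)\<^sup>2) \<le> (nrm p w)\<^sup>2"
      using bessel[OF assms(4,3) wp] by simp
    also have "\<dots> \<le> (nrm q w)\<^sup>2" using nrm_mono_le[OF assms(2) w(1)] nrm_nonneg[OF wp] by (intro power_mono)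
    finally show "(\<Sum>g\<in>G. (\<Sum>b\<in>B. ip q b (h g) * v b)\<^sup>2) \<le> (\<Sum>b\<in>B. (v b)\<^sup>2)" using w(2) by simp
  qed (use assms B in auto)
  then show ?thesis using B by blast
qed

lemma tensor_norm_mono_mtens:
  assumes "t \<in> mtens n" "p \<le> q" "tensor_norm_sq q n t < \<infinity>"
  shows "tensor_norm_sq p n t < \<infinity>" "tensor_norm p n t \<le> tensor_norm q n t"
proof -
  have *: "hsq p G n t \<le> (tensor_norm q n t)\<^sup>2" if "finite G" "orthonormal p G" for G
    using hsq_mono_index[OF assms(1,2) that] hsq_le_tensor_norm[OF assms(3)] by force
  show "tensor_norm_sq p n t < \<infinity>" using tensor_bounded(1)[of p n t "(tensor_norm q n t)\<^sup>2"] * by simp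
  show "tensor_norm p n t \<le> tensor_norm q n t" using * by (intro tensor_norm_leI tensor_norm_nonneg)
qed

lemma tensor_norm_mono: "t \<in> tensors n \<Longrightarrow> p \<le> q \<Longrightarrow> tensor_norm p n t \<le> tensor_norm q n t"
  using tensor_norm_mono_mtens(2)[of t n p q] by (simp add: tensors_iff)

text \<open>First \<open>h\<close> and \<open>G\<close> are placed in the span of one orthonormal
  system \<open>B\<close>. Expanding \<open>riesz p h\<close> in \<open>B\<close> and Cauchy-Schwarz
  in the first slot then give the factor \<open>nrm p h\<close>.\<close>

lemma hsq_Cons_riesz:
  assumes "t \<in> mtens (Suc n)" "tensor_norm_sq p (Suc n) t < \<infinity>" "h \<in> H p" "finite G" "orthonormal p G"
  shows "hsq p G n (\<lambda>ys. t (riesz p h # ys)) \<le> (nrm p h * tensor_norm p (Suc n) t)\<^sup>2"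
proof -
  have G: "G \<subseteq> H p" using orthonormalD(1)[OF assms(5)] .
  obtain B where B: "finite B" "orthonormal p B" "insert h G \<subseteq> span B"
    using orthonormal_spanning[of "insert h G" p] assms(3,4) G by blast
  have rd: "riesz p b \<in> nuc_dual" if "b \<in> B" for b using riesz_in_dual orthonormalD(2)[OF B(2) that] .
  have rh: "riesz p h = (\<lambda>u. \<Sum>b\<in>B. ip p b h * riesz p b u)"
    using riesz_lincomb[of B "\<lambda>b. b" p "\<lambda>b. ip p b h"] orthonormalD(2)[OF B(2)]
        proj_eq_self[OF B(2,1), of h] B(3) unfolding proj_def by auto
  have "hsq p G n (\<lambda>ys. t (riesz p h # ys)) \<le> hsq p B n (\<lambda>ys. t (riesz p h # ys))"
    using assms B mtens_Cons[OF assms(1) riesz_in_dual[OF assms(3)]] by (intro hsq_span) auto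
  also have "\<dots> \<le> (\<Sum>bs\<in>lists_len B n. (nrm p h)\<^sup>2 * (\<Sum>b\<in>B. (cmod (t (riesz p b # map (riesz p) bs)))\<^sup>2))"
    unfolding hsq_def
  proof (rule sum_mono)
    fix bs assume bs: "bs \<in> lists_len B n"
    have "t (riesz p h # map (riesz p) bs) = (\<Sum>b\<in>B. complex_of_real (ip p b h) * t (riesz p b # map (riesz p) bs))"
      unfolding rh using bs rd by (intro mtens_slot_sum[OF assms(1)]) (auto simp: lists_len_def)
    then have "(cmod (t (riesz p h # map (riesz p) bs)))\<^sup>2 \<le>
       (\<Sum>b\<in>B. (cmod (complex_of_real (ip p b h)))\<^sup>2) * (\<Sum>b\<in>B. (cmod (t (riesz p b # map (riesz p) bs)))\<^sup>2)"
      using sum_sq_weighted_le[of "\<lambda>b. complex_of_real (ip p b h)" "\<lambda>b. t (riesz p b # map (riesz p) bs)" B] by simp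
    then show "(cmod (t (riesz p h # map (riesz p) bs)))\<^sup>2 \<le>
        (nrm p h)\<^sup>2 * (\<Sum>b\<in>B. (cmod (t (riesz p b # map (riesz p) bs)))\<^sup>2)"
      using parseval_span[OF B(2,1), of h] B(3) by simp
  qed
  also have "\<dots> = (nrm p h)\<^sup>2 * hsq p B (Suc n) t"
    unfolding hsq_Suc unfolding hsq_def by (subst sum.swap[of _ "lists_len B n" B]) (simp add: sum_distrib_left)
  also have "\<dots> \<le> (nrm p h)\<^sup>2 * (tensor_norm p (Suc n) t)\<^sup>2"
    using hsq_le_tensor_norm[OF assms(2) B(1,2)] by (intro mult_left_mono) auto
  finally show ?thesis by (simp add: power_mult_distrib)
qed

lemma tensors_Cons:
  assumes t: "t \<in> tensors (Suc n)" and x: "x \<in> nuc_dual"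
  shows "(\<lambda>ys. t (x # ys)) \<in> tensors n"
proof -
  have m: "t \<in> mtens (Suc n)" and f: "\<And>p. tensor_norm_sq p (Suc n) t < \<infinity>" using t by (auto simp: tensors_iff)
  have m': "(\<lambda>ys. t (x # ys)) \<in> mtens n" using mtens_Cons[OF m x] .
  obtain p0 where p0: "\<forall>p\<ge>p0. \<exists>h\<in>H p. x = riesz p h" using riesz_representation_large[OF x] by blast
  have "tensor_norm_sq p n (\<lambda>ys. t (x # ys)) < \<infinity>" for p
  proof -
    \<comment> \<open>For \<open>p < p0\<close> the functional \<open>x\<close> may be unbounded for
      \<open>nrm p\<close>; the norm with the larger index is finite and dominates.\<close>
    obtain h where h: "h \<in> H (max p p0)" "x = riesz (max p p0) h" using p0 by (meson max.cobounded2)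
    have "tensor_norm_sq (max p p0) n (\<lambda>ys. t (x # ys)) < \<infinity>"
      using hsq_Cons_riesz[OF m f h(1)] unfolding h(2)
      by (intro tensor_bounded(1)[where c = "(nrm (max p p0) h * tensor_norm (max p p0) (Suc n) t)\<^sup>2"]) auto
    then show ?thesis using tensor_norm_mono_mtens(1)[OF m'] by (meson max.cobounded1)
  qed
  then show ?thesis using m' by (simp add: tensors_iff)
qed

lemma tensor_norm_Cons_riesz:
  assumes "t \<in> tensors (Suc n)" "h \<in> H p"
  shows "tensor_norm p n (\<lambda>ys. t (riesz p h # ys)) \<le> nrm p h * tensor_norm p (Suc n) t"
proof (rule tensor_norm_leI)
  have m: "t \<in> mtens (Suc n)" "tensor_norm_sq p (Suc n) t < \<infinity>" using assms(1) by (simp_all add: tensors_iff)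
  show "hsq p E n (\<lambda>ys. t (riesz p h # ys)) \<le> (nrm p h * tensor_norm p (Suc n) t)\<^sup>2"
    if "finite E" "orthonormal p E" for E
    by (rule hsq_Cons_riesz[OF m assms(2) that])
  show "0 \<le> nrm p h * tensor_norm p (Suc n) t"
    by (intro mult_nonneg_nonneg nrm_nonneg[OF assms(2)] tensor_norm_nonneg)
qed

lemma tensor_riesz_bound:
  assumes "t \<in> tensors n" "set hs \<subseteq> H p" "length hs = n"
  shows "cmod (t (map (riesz p) hs)) \<le> tensor_norm p n t * prod_list (map (nrm p) hs)"
  using assms
proof (induction n arbitrary: t hs)
  case 0
  then have "hsq p {} 0 t \<le> (tensor_norm p 0 t)\<^sup>2" by (intro hsq_le_tensor_norm) (auto simp: tensors_iff)
  then have "(cmod (t []))\<^sup>2 \<le> (tensor_norm p 0 t)\<^sup>2" by (simp add: hsq_def)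
  then have "cmod (t []) \<le> tensor_norm p 0 t" by (rule power2_le_imp_le[OF _ tensor_norm_nonneg])
  then show ?case using 0 by simp
next
  case (Suc n)
  then obtain h gs where hs: "hs = h # gs" by (cases hs) auto
  have h: "h \<in> H p" "set gs \<subseteq> H p" "length gs = n" using Suc.prems hs by auto
  have pn: "0 \<le> prod_list (map (nrm p) gs)"
    using h(2) by (intro prod_list_nonneg) (auto intro: nrm_nonneg)
  have "cmod (t (riesz p h # map (riesz p) gs)) \<le> tensor_norm p n (\<lambda>ys. t (riesz p h # ys)) * prod_list (map (nrm p) gs)"
    using Suc.IH[OF tensors_Cons[OF Suc.prems(1) riesz_in_dual[OF h(1)]] h(2,3)] .
  also have "\<dots> \<le> nrm p h * tensor_norm p (Suc n) t * prod_list (map (nrm p) gs)"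
    using tensor_norm_Cons_riesz[OF Suc.prems(1) h(1)] pn by (rule mult_right_mono)
  finally show ?case by (simp add: hs mult_ac)
qed

end

subsection \<open>Polarization\<close>

text \<open>The alternating sum is the expansion of a product of factors \<open>1 + (- 1)\<close>
  over \<open>N - T\<close>, which is empty exactly when \<open>T = N\<close>.\<close>

lemma sum_signs_between:
  assumes "finite N" "T \<subseteq> N"
  shows "(\<Sum>S\<in>{S. T \<subseteq> S \<and> S \<subseteq> N}. (- 1) ^ card (N - S)) = (if T = N then 1 else 0 :: complex)"
proof -
  have "(\<Sum>S\<in>{S. T \<subseteq> S \<and> S \<subseteq> N}. (- 1) ^ card (N - S)) = (\<Sum>U\<in>Pow (N - T). (- 1 :: complex) ^ card ((N - T) - U))"
    by (rule sum.reindex_bij_witness[where i = "\<lambda>U. T \<union> U" and j = "\<lambda>S. S - T"])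
      (use assms in \<open>auto intro!: arg_cong[where f = "\<lambda>X. (- 1) ^ card X"]\<close>)
  also have "\<dots> = (\<Prod>i\<in>N - T. 1 + (- 1))"
    using assms by (subst prod_add) (auto simp: prod_constant)
  also have "\<dots> = (if T = N then 1 else 0)"
    using assms by (auto simp: prod_zero_iff power_0_left finite_subset)
  finally show ?thesis .
qed

text \<open>The permutations of \<open>{..<n}\<close> written as words; the length and the full
  range force the entries to be distinct.\<close>

definition perm_lists :: "nat \<Rightarrow> nat list set" where
  "perm_lists n = {fs. length fs = n \<and> set fs = {..<n}}"

lemma perm_lists_mset:
  assumes "fs \<in> perm_lists n" shows "mset fs = mset [0..<n]"
proof -
  have "distinct fs" using assms by (intro card_distinct) (auto simp: perm_lists_def)
  moreover have "set fs = set [0..<n]" using assms by (simp add: perm_lists_def atLeast0LessThan)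
  ultimately show ?thesis using set_eq_iff_mset_eq_distinct[of fs "[0..<n]"] by simp
qed

lemma card_perm_lists: "card (perm_lists n) = fact n"
proof -
  have "perm_lists n = permutations_of_set {..<n}"
  proof (intro equalityI subsetI)
    fix fs assume f: "fs \<in> perm_lists n"
    then have "distinct fs" by (intro card_distinct) (auto simp: perm_lists_def)
    then show "fs \<in> permutations_of_set {..<n}" using f by (simp add: permutations_of_set_def perm_lists_def)
  next
    fix fs assume f: "fs \<in> permutations_of_set {..<n}"
    then have "length fs = card {..<n}" by (metis distinct_card permutations_of_setD)
    then show "fs \<in> perm_lists n" using f by (simp add: permutations_of_set_def perm_lists_def)
  qed
  then show ?thesis by simp
qed

text \<open>Inclusion-exclusion: a word with range \<open>T\<close> is counted for every
  \<open>S\<close> containing \<open>T\<close>, and the signed count vanishes unless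
  \<open>T\<close> is all of \<open>{..<n}\<close>.\<close>

lemma polarization_sum:
  fixes g :: "nat list \<Rightarrow> complex"
  shows "(\<Sum>S\<in>Pow {..<n}. (- 1) ^ card ({..<n} - S) * (\<Sum>fs\<in>lists_len S n. g fs)) = (\<Sum>fs\<in>perm_lists n. g fs)"
proof -
  let ?N = "{..<n}"
  have "(\<Sum>S\<in>Pow ?N. (- 1) ^ card (?N - S) * (\<Sum>fs\<in>lists_len S n. g fs)) =
      (\<Sum>S\<in>Pow ?N. \<Sum>fs\<in>lists_len ?N n. if set fs \<subseteq> S then (- 1) ^ card (?N - S) * g fs else 0)"
  proof (rule sum.cong[OF refl])
    fix S assume "S \<in> Pow ?N"
    then have "lists_len S n = {fs \<in> lists_len ?N n. set fs \<subseteq> S}" by (auto simp: lists_len_def)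
    then show "(- 1) ^ card (?N - S) * (\<Sum>fs\<in>lists_len S n. g fs) =
        (\<Sum>fs\<in>lists_len ?N n. if set fs \<subseteq> S then (- 1) ^ card (?N - S) * g fs else 0)"
      by (simp add: sum_distrib_left sum.inter_filter) (intro sum.cong refl, simp)
  qed
  also have "\<dots> = (\<Sum>fs\<in>lists_len ?N n. \<Sum>S\<in>Pow ?N. if set fs \<subseteq> S then (- 1) ^ card (?N - S) * g fs else 0)"
    by (rule sum.swap)
  also have "\<dots> = (\<Sum>fs\<in>lists_len ?N n. if set fs = ?N then g fs else 0)"
  proof (rule sum.cong[OF refl])
    fix fs assume "fs \<in> lists_len ?N n"
    then have fs: "set fs \<subseteq> ?N" by (simp add: lists_len_def)
    have "(\<Sum>S\<in>Pow ?N. if set fs \<subseteq> S then (- 1) ^ card (?N - S) * g fs else 0) =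
        (\<Sum>S\<in>{S \<in> Pow ?N. set fs \<subseteq> S}. (- 1) ^ card (?N - S) * g fs)"
      by (rule sum.inter_filter[symmetric]) simp
    also have "{S \<in> Pow ?N. set fs \<subseteq> S} = {S. set fs \<subseteq> S \<and> S \<subseteq> ?N}" by auto
    also have "(\<Sum>S\<in>{S. set fs \<subseteq> S \<and> S \<subseteq> ?N}. (- 1) ^ card (?N - S) * g fs) = (if set fs = ?N then g fs else 0)"
      unfolding sum_distrib_right[symmetric] sum_signs_between[OF finite_lessThan fs] by simp
    finally show "(\<Sum>S\<in>Pow ?N. if set fs \<subseteq> S then (- 1) ^ card (?N - S) * g fs else 0) =
        (if set fs = ?N then g fs else 0)" .
  qed
  also have "\<dots> = (\<Sum>fs\<in>{fs \<in> lists_len ?N n. set fs = ?N}. g fs)" by (simp add: sum.inter_filter)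
  also have "{fs \<in> lists_len ?N n. set fs = ?N} = perm_lists n" by (auto simp: lists_len_def perm_lists_def)
  finally show ?thesis .
qed

lemma prod_sum_lists:
  fixes a :: "'i \<Rightarrow> nat \<Rightarrow> 'c::comm_ring_1"
  shows "(\<Prod>j<n. \<Sum>i\<in>S. a i j) = (\<Sum>fs\<in>lists_len S n. \<Prod>j<n. a (fs ! j) j)"
proof (induction n arbitrary: a)
  case (Suc n)
  have "(\<Prod>j<Suc n. \<Sum>i\<in>S. a i j) = (\<Sum>i\<in>S. a i 0) * (\<Prod>j<n. \<Sum>i\<in>S. a i (Suc j))"
    by (rule prod.lessThan_Suc_shift)
  also have "(\<Prod>j<n. \<Sum>i\<in>S. a i (Suc j)) = (\<Sum>fs\<in>lists_len S n. \<Prod>j<n. a (fs ! j) (Suc j))"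
    by (rule Suc.IH)
  also have "(\<Sum>i\<in>S. a i 0) * \<dots> = (\<Sum>fs\<in>lists_len S (Suc n). \<Prod>j<Suc n. a (fs ! j) j)"
    by (simp add: sum_lists_len_Suc prod.lessThan_Suc_shift sum_product del: prod.lessThan_Suc)
  finally show ?case .
qed simp

text \<open>Reading a word through a permutation of the positions is a bijection of
  \<open>lists_len B n\<close>; it keeps the multiset of letters and therefore the value of
  \<open>c\<close>.\<close>

lemma sum_permuted_lists:
  fixes c :: "'e list \<Rightarrow> complex" and a :: "'e \<Rightarrow> nat \<Rightarrow> complex"
  assumes "finite B" "fs \<in> perm_lists n" and sym: "\<And>es es'. mset es = mset es' \<Longrightarrow> c es = c es'"
  shows "(\<Sum>es\<in>lists_len B n. c es * (\<Prod>j<n. a (es ! (fs ! j)) j)) = (\<Sum>es\<in>lists_len B n. c es * (\<Prod>j<n. a (es ! j) j))"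
proof -
  let ?\<pi> = "\<lambda>es. map ((!) es) fs"
  have fs: "length fs = n" "set fs = {..<n}" using assms(2) by (auto simp: perm_lists_def)
  have ms: "mset (?\<pi> es) = mset es" if "length es = n" for es
  proof -
    have "mset (?\<pi> es) = image_mset ((!) es) (mset fs)" by simp
    also have "\<dots> = mset (map ((!) es) [0..<n])" using perm_lists_mset[OF assms(2)] by simp
    also have "map ((!) es) [0..<n] = es" using that map_nth by metis
    finally show ?thesis .
  qed
  have inj: "inj_on ?\<pi> (lists_len B n)"
  proof (rule inj_onI)
    fix es es' assume e: "es \<in> lists_len B n" "es' \<in> lists_len B n" "?\<pi> es = ?\<pi> es'"
    then have "\<forall>i\<in>set fs. es ! i = es' ! i" by (simp add: map_eq_conv)
    then show "es = es'" using e fs by (intro nth_equalityI) (auto simp: lists_len_def)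
  qed
  have into: "?\<pi> ` lists_len B n \<subseteq> lists_len B n"
    using fs by (auto simp: lists_len_def subset_iff)
  have "?\<pi> ` lists_len B n = lists_len B n"
    using into inj assms(1) by (intro endo_inj_surj) auto
  then have "(\<Sum>es\<in>lists_len B n. c es * (\<Prod>j<n. a (es ! j) j)) =
      (\<Sum>es\<in>lists_len B n. c (?\<pi> es) * (\<Prod>j<n. a (?\<pi> es ! j) j))"
    using sum.reindex[OF inj, of "\<lambda>es. c es * (\<Prod>j<n. a (es ! j) j)"] by (simp add: o_def)
  also have "\<dots> = (\<Sum>es\<in>lists_len B n. c es * (\<Prod>j<n. a (es ! (fs ! j)) j))"
    using ms fs by (intro sum.cong refl arg_cong2[where f = "(*)"] sym prod.cong) (auto simp: lists_len_def)
  finally show ?thesis by simp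
qed

context nuclear_triple
begin

text \<open>At the sum of the \<open>xs ! i\<close> over \<open>S\<close>, the diagonal value of
  \<open>t\<close> expands into the words in \<open>S\<close>. The signed sum over all
  \<open>S\<close> keeps only the permutations, which by symmetry contribute
  \<open>fact n * t xs\<close>.\<close>

lemma mtens_polarization:
  assumes t: "t \<in> mtens n" and z: "\<And>x. x \<in> nuc_dual \<Longrightarrow> t (replicate n x) = 0"
  shows "t xs = 0"
proof (cases "length xs = n \<and> set xs \<subseteq> nuc_dual")
  case True
  have expand: "s (replicate m (\<lambda>u. \<Sum>i\<in>S. (xs ! i) u)) = (\<Sum>fs\<in>lists_len S m. s (map ((!) xs) fs))"
    if "s \<in> mtens m" "S \<subseteq> {..<n}" for s m S
    using that(1)
  proof (induction m arbitrary: s)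
    case (Suc m)
    have y: "xs ! i \<in> nuc_dual" if "i \<in> S" for i using that \<open>S \<subseteq> {..<n}\<close> True by (meson lessThan_iff nth_mem subsetD)
    let ?w = "\<lambda>u. \<Sum>i\<in>S. (xs ! i) u"
    have w: "?w \<in> nuc_dual" using nuc_dual_lincomb[of S "\<lambda>i. xs ! i" "\<lambda>_. 1"] y by simp
    have "s (?w # replicate m ?w) = (\<Sum>i\<in>S. s (xs ! i # replicate m ?w))"
      using mtens_slot_sum[OF Suc.prems, of "replicate m ?w" S "\<lambda>i. xs ! i" "\<lambda>_. 1"] w y
      by (simp add: set_replicate_conv_if)
    also have "\<dots> = (\<Sum>i\<in>S. \<Sum>fs\<in>lists_len S m. s (xs ! i # map ((!) xs) fs))"
      using Suc.IH[OF mtens_Cons[OF Suc.prems y]] by (intro sum.cong) auto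
    finally show ?case by (simp add: sum_lists_len_Suc)
  qed simp
  have "(\<Sum>fs\<in>perm_lists n. t (map ((!) xs) fs)) =
      (\<Sum>S\<in>Pow {..<n}. (- 1) ^ card ({..<n} - S) * t (replicate n (\<lambda>u. \<Sum>i\<in>S. (xs ! i) u)))"
    unfolding polarization_sum[symmetric] using expand[OF t] by (intro sum.cong) auto
  also have "\<dots> = 0"
  proof (rule sum.neutral, rule ballI)
    fix S assume "S \<in> Pow {..<n}"
    then have "xs ! i \<in> nuc_dual" if "i \<in> S" for i using that True by (metis PowD lessThan_iff nth_mem subsetD)
    then have "(\<lambda>u. \<Sum>i\<in>S. (xs ! i) u) \<in> nuc_dual" using nuc_dual_lincomb[of S "\<lambda>i. xs ! i" "\<lambda>_. 1"] by simp
    then show "(- 1) ^ card ({..<n} - S) * t (replicate n (\<lambda>u. \<Sum>i\<in>S. (xs ! i) u)) = 0" using z by simp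
  qed
  also have "(\<Sum>fs\<in>perm_lists n. t (map ((!) xs) fs)) = (\<Sum>fs\<in>perm_lists n. t xs)"
  proof (rule sum.cong[OF refl])
    fix fs assume f: "fs \<in> perm_lists n"
    have "mset (map ((!) xs) fs) = mset (map ((!) xs) [0..<n])" using perm_lists_mset[OF f] by simp
    also have "map ((!) xs) [0..<n] = xs" using True map_nth by metis
    finally show "t (map ((!) xs) fs) = t xs" by (rule mtensD(3)[OF t])
  qed
  finally show ?thesis by (simp add: card_perm_lists)
qed (use mtensD(1)[OF t] in blast)

subsection \<open>The space of tensors\<close>

lemma tensors_combination:
  assumes "s \<in> tensors n" "t \<in> tensors n"
  shows "(\<lambda>xs. a * s xs + b * t xs) \<in> tensors n"
  unfolding tensors_iff
proof (intro conjI allI)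
  show "(\<lambda>xs. a * s xs + b * t xs) \<in> mtens n" using assms by (auto simp: tensors_iff intro: mtens_combination)
  fix p
  let ?c = "2 * ((cmod a)\<^sup>2 * (tensor_norm p n s)\<^sup>2) + 2 * ((cmod b)\<^sup>2 * (tensor_norm p n t)\<^sup>2)"
  have "hsq p E n (\<lambda>xs. a * s xs + b * t xs) \<le> ?c" if E: "finite E" "orthonormal p E" for E
  proof -
    have sq: "(cmod (x + y))\<^sup>2 \<le> 2 * (cmod x)\<^sup>2 + 2 * (cmod y)\<^sup>2" for x y
    proof -
      have "(cmod (x + y))\<^sup>2 \<le> (cmod x + cmod y)\<^sup>2" by (intro power_mono norm_triangle_ineq) simp
      also have "\<dots> \<le> 2 * (cmod x)\<^sup>2 + 2 * (cmod y)\<^sup>2"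
        using sum_squares_bound[of "cmod x" "cmod y"] by (simp add: power2_sum)
      finally show ?thesis .
    qed
    have "hsq p E n (\<lambda>xs. a * s xs + b * t xs) \<le> 2 * ((cmod a)\<^sup>2 * hsq p E n s) + 2 * ((cmod b)\<^sup>2 * hsq p E n t)"
      unfolding hsq_def sum_distrib_left sum.distrib[symmetric]
      by (intro sum_mono order_trans[OF sq]) (simp add: norm_mult power_mult_distrib)
    also have "\<dots> \<le> ?c"
      using assms E by (intro add_mono mult_left_mono hsq_le_tensor_norm) (auto simp: tensors_iff)
    finally show ?thesis .
  qed
  then show "tensor_norm_sq p n (\<lambda>xs. a * s xs + b * t xs) < \<infinity>" by (intro tensor_bounded(1)[where c = ?c]) auto
qed

lemma zero_in_tensors [simp]: "(\<lambda>_. 0) \<in> tensors n"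
proof -
  have "(\<lambda>_. 0) \<in> mtens n" by (rule mtensI) auto
  moreover have "tensor_norm_sq p n (\<lambda>_. 0) < \<infinity>" for p
    by (rule tensor_bounded(1)[where c = 0]) (auto simp: hsq_def)
  ultimately show ?thesis by (simp add: tensors_iff)
qed

lemma tensors_scale: "t \<in> tensors n \<Longrightarrow> (\<lambda>xs. c * t xs) \<in> tensors n"
  using tensors_combination[of t n t c 0] by simp

lemma tensors_diff: "s \<in> tensors n \<Longrightarrow> t \<in> tensors n \<Longrightarrow> s - t \<in> tensors n"
  using tensors_combination[of s n t 1 "-1"] by (simp add: fun_diff_def)

lemma tensors_lincomb:
  assumes "\<And>i. i \<in> I \<Longrightarrow> t i \<in> tensors n"
  shows "(\<lambda>xs. \<Sum>i\<in>I. c i * t i xs) \<in> tensors n"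
  using assms
proof (induction I rule: infinite_finite_induct)
  case (insert i I)
  then show ?case using tensors_combination[of "t i" n "\<lambda>xs. \<Sum>i\<in>I. c i * t i xs" "c i" 1] by simp
qed auto

lemma tensor_norm_scale_le:
  assumes "t \<in> tensors n"
  shows "tensor_norm p n (\<lambda>xs. c * t xs) \<le> cmod c * tensor_norm p n t"
proof (rule tensor_norm_leI)
  fix E assume E: "finite E" "orthonormal p E"
  have "hsq p E n (\<lambda>xs. c * t xs) = (cmod c)\<^sup>2 * hsq p E n t"
    by (simp add: hsq_def sum_distrib_left norm_mult power_mult_distrib)
  also have "\<dots> \<le> (cmod c)\<^sup>2 * (tensor_norm p n t)\<^sup>2"
    using assms E by (intro mult_left_mono hsq_le_tensor_norm) (auto simp: tensors_iff)
  finally show "hsq p E n (\<lambda>xs. c * t xs) \<le> (cmod c * tensor_norm p n t)\<^sup>2" by (simp add: power_mult_distrib)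
qed (simp add: tensor_norm_nonneg)

section \<open>Norms of tensor powers\<close>

lemma nrmC_sq: "(nrmC p \<theta>)\<^sup>2 = (nrm p (fst \<theta>))\<^sup>2 + (nrm p (snd \<theta>))\<^sup>2"
  by (simp add: nrmC_def)

lemma nrmC_nonneg: "0 \<le> nrmC p \<theta>"
  by (simp add: nrmC_def)

lemma tensor_power_Cons:
  "x \<in> nuc_dual \<Longrightarrow> tensor_power (Suc n) \<theta> (x # xs) = pairing x \<theta> * tensor_power n \<theta> xs"
  by (simp add: tensor_power_def)

lemma pairing_combination: "pairing (\<lambda>u. a * x u + b * y u) \<theta> = of_real a * pairing x \<theta> + of_real b * pairing y \<theta>"
  by (simp add: pairing_def complex_eq_iff)

text \<open>The sum factorises over the slots, and each factor is bounded through Bessel's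
  inequality for the real and the imaginary part of \<open>\<theta>\<close>.\<close>

lemma hsq_tensor_power:
  assumes "\<theta> \<in> HC p" "fst \<theta> \<in> nuc" "snd \<theta> \<in> nuc" "finite E" "orthonormal p E"
  shows "hsq p E n (tensor_power n \<theta>) \<le> ((nrmC p \<theta>) ^ n)\<^sup>2"
proof (induction n)
  case 0
  then show ?case by (simp add: hsq_def tensor_power_def)
next
  case (Suc n)
  have E: "e \<in> E \<Longrightarrow> riesz p e \<in> nuc_dual" for e using riesz_in_dual orthonormalD(2)[OF assms(5)] by blast
  have "(\<Sum>e\<in>E. (cmod (pairing (riesz p e) \<theta>))\<^sup>2) = (\<Sum>e\<in>E. (ip p e (fst \<theta>))\<^sup>2) + (\<Sum>e\<in>E. (ip p e (snd \<theta>))\<^sup>2)"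
    using assms(2,3) by (simp add: pairing_def cmod_power2 riesz_def sum.distrib)
  also have "\<dots> \<le> (nrmC p \<theta>)\<^sup>2"
    unfolding nrmC_sq using assms nuc_sub_H by (intro add_mono bessel) auto
  finally have le: "(\<Sum>e\<in>E. (cmod (pairing (riesz p e) \<theta>))\<^sup>2) \<le> (nrmC p \<theta>)\<^sup>2" .
  have "hsq p E (Suc n) (tensor_power (Suc n) \<theta>) = (\<Sum>e\<in>E. (cmod (pairing (riesz p e) \<theta>))\<^sup>2 * hsq p E n (tensor_power n \<theta>))"
    unfolding hsq_Suc using E
    by (intro sum.cong) (auto simp: hsq_def tensor_power_Cons norm_mult power_mult_distrib sum_distrib_left)
  also have "\<dots> = (\<Sum>e\<in>E. (cmod (pairing (riesz p e) \<theta>))\<^sup>2) * hsq p E n (tensor_power n \<theta>)"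
    by (simp add: sum_distrib_right)
  also have "\<dots> \<le> (nrmC p \<theta>)\<^sup>2 * ((nrmC p \<theta>) ^ n)\<^sup>2"
    using le Suc.IH hsq_nonneg by (intro mult_mono) auto
  finally show ?case by (simp add: power_mult_distrib)
qed

lemma nucC_D: "\<theta> \<in> nucC \<Longrightarrow> fst \<theta> \<in> nuc" "\<theta> \<in> nucC \<Longrightarrow> snd \<theta> \<in> nuc" "\<theta> \<in> nucC \<Longrightarrow> \<theta> \<in> HC p"
  using nuc_sub_H[of p] by (auto simp: nucC_def HC_def)

lemma tensor_power_in_tensors:
  assumes "\<theta> \<in> nucC" shows "tensor_power n \<theta> \<in> tensors n"
  unfolding tensors_iff
proof (intro conjI allI)
  show "tensor_power n \<theta> \<in> mtens n"
  proof (rule mtensI)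
    fix xs k x y a b
    assume xs: "length xs = n" "set xs \<subseteq> nuc_dual" "k < n" "x \<in> nuc_dual" "y \<in> nuc_dual"
    have s: "set (xs[k := z]) \<subseteq> nuc_dual" if "z \<in> nuc_dual" for z
      using set_update_subset_insert[of xs k z] xs that by blast
    have u: "tensor_power n \<theta> (xs[k := z]) = prod_list (map (\<lambda>x. pairing x \<theta>) (take k xs)) * (pairing z \<theta> * prod_list (map (\<lambda>x. pairing x \<theta>) (drop (Suc k) xs)))"
      if "z \<in> nuc_dual" for z
      using s[OF that] xs by (simp add: tensor_power_def upd_conv_take_nth_drop)
    show "tensor_power n \<theta> (xs[k := \<lambda>u. a * x u + b * y u]) =
       complex_of_real a * tensor_power n \<theta> (xs[k := x]) + complex_of_real b * tensor_power n \<theta> (xs[k := y])"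
      unfolding u[OF nuc_dual_combination[OF xs(4,5)]] u[OF xs(4)] u[OF xs(5)] pairing_combination
      by (simp add: algebra_simps)
  next
    fix xs ys :: "('h \<Rightarrow> real) list" assume xs: "length xs = n" "set xs \<subseteq> nuc_dual" and m: "mset xs = mset ys"
    have "length xs = length ys" "set xs = set ys" using m by (metis size_mset, metis set_mset_mset)
    moreover have "prod_list (map (\<lambda>x. pairing x \<theta>) xs) = prod_list (map (\<lambda>x. pairing x \<theta>) ys)"
      using m by (metis mset_map prod_mset_prod_list)
    ultimately show "tensor_power n \<theta> xs = tensor_power n \<theta> ys" by (simp add: tensor_power_def)
  qed (auto simp: tensor_power_def)
  fix p show "tensor_norm_sq p n (tensor_power n \<theta>) < \<infinity>"
    using hsq_tensor_power nucC_D[OF assms] by (intro tensor_bounded(1)[where c = "((nrmC p \<theta>) ^ n)\<^sup>2"]) auto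
qed

lemma tensor_norm_tensor_power:
  assumes "\<theta> \<in> nucC" shows "tensor_norm p n (tensor_power n \<theta>) \<le> (nrmC p \<theta>) ^ n"
  using nucC_D[OF assms] by (intro tensor_norm_leI hsq_tensor_power) (auto simp: nrmC_nonneg)

subsection \<open>The dual of the space of tensors\<close>

lemma tensors_dualI:
  assumes lin: "\<And>s t a b. s \<in> tensors n \<Longrightarrow> t \<in> tensors n \<Longrightarrow> K (\<lambda>xs. a * s xs + b * t xs) = a * K s + b * K t"
    and out: "\<And>t. t \<notin> tensors n \<Longrightarrow> K t = 0"
    and C: "0 \<le> C" "\<And>t. t \<in> tensors n \<Longrightarrow> cmod (K t) \<le> C * tensor_norm p n t"
  shows "K \<in> tensors_dual n"
proof -
  have "continuous_map (tensors_topology n) euclidean K"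
    unfolding tensors_topology_def
  proof (rule seminorm_topology_continuous[of "tensor_norm p n" _ C])
    fix f g assume f: "f \<in> tensors n" "g \<in> tensors n"
    have "K g - K f = K (g - f)" using lin[OF f(2,1), of 1 "-1"] by (simp add: fun_diff_def)
    then show "norm (K g - K f) \<le> C * tensor_norm p n (g - f)"
      using C(2)[OF tensors_diff[OF f(2,1)]] by simp
  qed (use C in auto)
  then show ?thesis
    using lin out by (auto simp: tensors_dual_def dual_space_def tensors_topology_def)
qed

lemma tensors_dualD:
  assumes "K \<in> tensors_dual n"
  shows "s \<in> tensors n \<Longrightarrow> t \<in> tensors n \<Longrightarrow> K (\<lambda>xs. a * s xs + b * t xs) = a * K s + b * K t"
    and "t \<notin> tensors n \<Longrightarrow> K t = 0"
  using assms by (auto simp: tensors_dual_def dual_space_def tensors_topology_def)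

lemma tensors_dual_scale: "K \<in> tensors_dual n \<Longrightarrow> t \<in> tensors n \<Longrightarrow> K (\<lambda>xs. a * t xs) = a * K t"
  using tensors_dualD(1)[of K n t t a 0] by simp

lemma tensors_dual_zero: "K \<in> tensors_dual n \<Longrightarrow> K (\<lambda>_. 0) = 0"
  using tensors_dual_scale[of K n "\<lambda>_. 0" 0] by simp

lemma tensors_dual_diff: "K \<in> tensors_dual n \<Longrightarrow> s \<in> tensors n \<Longrightarrow> t \<in> tensors n \<Longrightarrow> K (s - t) = K s - K t"
  using tensors_dualD(1)[of K n s t 1 "-1"] by (simp add: fun_diff_def)

lemma tensors_dual_lincomb:
  assumes "K \<in> tensors_dual n" "\<And>i. i \<in> I \<Longrightarrow> t i \<in> tensors n"
  shows "K (\<lambda>xs. \<Sum>i\<in>I. c i * t i xs) = (\<Sum>i\<in>I. c i * K (t i))"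
  using assms(2)
proof (induction I rule: infinite_finite_induct)
  case (insert i I)
  then show ?case
    using tensors_dualD(1)[OF assms(1), of "t i" "\<lambda>xs. \<Sum>i\<in>I. c i * t i xs" "c i" 1] tensors_lincomb[of I t n c] by simp
qed (use tensors_dual_zero[OF assms(1)] in auto)

lemma tensors_dual_bounded:
  assumes "K \<in> tensors_dual n"
  shows "\<exists>p C. 0 \<le> C \<and> (\<forall>t\<in>tensors n. cmod (K t) \<le> C * tensor_norm p n t)"
proof (rule seminorm_topology_bounded[where z = "\<lambda>_. 0" and sc = "\<lambda>a t xs. complex_of_real a * t xs"])
  show "continuous_map (seminorm_topology (tensors n) (range (\<lambda>p. tensor_norm p n))) euclidean K"
    using assms by (simp add: tensors_dual_def dual_space_def tensors_topology_def)
  show "tensor_norm p n (\<lambda>xs. complex_of_real a * g xs) \<le> a * tensor_norm p n g" if "0 < a" "g \<in> tensors n" for p a g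
    using tensor_norm_scale_le[OF that(2), of p "complex_of_real a"] that(1) by simp
  show "K (\<lambda>xs. complex_of_real a * g xs) = a *\<^sub>R K g" if "0 < a" "g \<in> tensors n" for a g
    using tensors_dual_scale[OF assms that(2), of "complex_of_real a"] by (simp add: scaleR_conv_of_real)
  show "g - (\<lambda>_. 0) = g" for g :: "('h \<Rightarrow> real) list \<Rightarrow> complex" by (simp add: fun_diff_def)
qed (use tensors_dual_zero[OF assms] in \<open>auto intro: tensors_scale tensor_norm_mono tensor_norm_nonneg\<close>)


subsection \<open>Density of the tensor powers\<close>

lemma nrm_proj_le:
  assumes "orthonormal p B" "finite B" "u \<in> H p"
  shows "nrm p (proj p B u) \<le> nrm p u"
  using bessel[OF assms] nrm_proj_sq[OF assms(1,2), of u] nrm_nonneg[OF assms(3)]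
  by (intro power2_le_imp_le[of "nrm p (proj p B u)" "nrm p u"]) simp_all

lemma prod_list_mono:
  fixes f g :: "'b \<Rightarrow> real"
  assumes "\<And>x. x \<in> set xs \<Longrightarrow> 0 \<le> f x \<and> f x \<le> g x"
  shows "prod_list (map f xs) \<le> prod_list (map g xs) \<and> 0 \<le> prod_list (map f xs)"
  using assms
proof (induction xs)
  case (Cons x xs)
  then have *: "0 \<le> f x" "f x \<le> g x" "prod_list (map f xs) \<le> prod_list (map g xs)" "0 \<le> prod_list (map f xs)" by auto
  then show ?case by (auto intro!: mult_mono)
qed simp

text \<open>The slots are replaced one at a time. The error made in the first slot is controlled by
  \<open>tensor_riesz_bound\<close>, where the projections in the other slots do not increase the
  norms.\<close>

lemma tendsto_tensor_proj:
  assumes ex: "exhaustion p B" and "t \<in> tensors n" "set hs \<subseteq> H p" "length hs = n"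
  shows "(\<lambda>k. t (map (\<lambda>h. riesz p (proj p (B k) h)) hs)) \<longlonglongrightarrow> t (map (riesz p) hs)"
  using assms(2-)
proof (induction hs arbitrary: t n)
  case (Cons h gs)
  note B = exhaustionD[OF ex]
  obtain m where n: "n = Suc m" "length gs = m" using Cons.prems by auto
  have t: "t \<in> tensors (Suc m)" "t \<in> mtens (Suc m)" using Cons.prems n by (auto simp: tensors_iff)
  have h: "h \<in> H p" "set gs \<subseteq> H p" using Cons.prems by auto
  have P: "proj p (B k) u \<in> H p" for k u using proj_in_H[OF B(2)] .
  let ?P = "\<lambda>k. map (\<lambda>h. riesz p (proj p (B k) h)) gs"
  have Pd: "set (?P k) \<subseteq> nuc_dual" "length (?P k) = m" for k
    using riesz_in_dual[OF P] n by auto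
  have eq: "t (riesz p (proj p (B k) h) # ?P k) = t (riesz p h # ?P k) - t (riesz p (h - proj p (B k) h) # ?P k)" for k
  proof -
    have "riesz p (h - proj p (B k) h) = (\<lambda>u. 1 * riesz p h u + (- 1) * riesz p (proj p (B k) h) u)"
      using h(1) P nuc_sub_H[of p] by (auto simp: riesz_def ip_diff subset_iff)
    then show ?thesis
      using mtens_slot[OF t(2) riesz_in_dual[OF h(1)] riesz_in_dual[OF P] Pd, where a = 1 and b = "-1"] by simp
  qed
  have "(\<lambda>k. t (riesz p (h - proj p (B k) h) # ?P k)) \<longlonglongrightarrow> 0"
  proof (rule Lim_null_comparison)
    define c where "c = tensor_norm p (Suc m) t * prod_list (map (nrm p) gs)"
    show "\<forall>\<^sub>F k in sequentially. norm (t (riesz p (h - proj p (B k) h) # ?P k)) \<le> c * nrm p (h - proj p (B k) h)"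
    proof (intro always_eventually allI)
      fix k
      have d: "h - proj p (B k) h \<in> H p" using h(1) P H_diff by blast
      have "cmod (t (map (riesz p) ((h - proj p (B k) h) # map (proj p (B k)) gs))) \<le>
         tensor_norm p (Suc m) t * prod_list (map (nrm p) ((h - proj p (B k) h) # map (proj p (B k)) gs))"
        using d P n by (intro tensor_riesz_bound[OF t(1)]) auto
      also have "\<dots> = tensor_norm p (Suc m) t * nrm p (h - proj p (B k) h) * prod_list (map (\<lambda>g. nrm p (proj p (B k) g)) gs)"
        by (simp add: o_def)
      also have "\<dots> \<le> tensor_norm p (Suc m) t * nrm p (h - proj p (B k) h) * prod_list (map (nrm p) gs)"
      proof (intro mult_left_mono)
        show "prod_list (map (\<lambda>g. nrm p (proj p (B k) g)) gs) \<le> prod_list (map (nrm p) gs)"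
          using h(2) P by (intro conjunct1[OF prod_list_mono] conjI nrm_nonneg nrm_proj_le B(1,2)) auto
        show "0 \<le> tensor_norm p (Suc m) t * nrm p (h - proj p (B k) h)"
          using d by (intro mult_nonneg_nonneg tensor_norm_nonneg nrm_nonneg)
      qed
      finally show "norm (t (riesz p (h - proj p (B k) h) # ?P k)) \<le> c * nrm p (h - proj p (B k) h)"
        by (simp add: c_def o_def mult_ac)
    qed
    show "(\<lambda>k. c * nrm p (h - proj p (B k) h)) \<longlonglongrightarrow> 0" using tendsto_mult_right_zero[OF B(5)[OF h(1)]] .
  qed
  moreover have "(\<lambda>k. t (riesz p h # ?P k)) \<longlonglongrightarrow> t (riesz p h # map (riesz p) gs)"
    using Cons.IH[OF tensors_Cons[OF t(1) riesz_in_dual[OF h(1)]] h(2) n(2)] .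
  ultimately have "(\<lambda>k. t (riesz p h # ?P k) - t (riesz p (h - proj p (B k) h) # ?P k)) \<longlonglongrightarrow> t (riesz p h # map (riesz p) gs) - 0"
    by (intro tendsto_diff)
  then show ?case by (simp add: eq)
qed simp

text \<open>The norm is a supremum over all finite orthonormal systems, yet one exhaustion suffices:
  a nearly optimal \<open>G\<close> is projected onto the span of \<open>B k\<close>, the projected
  sums converge to the sum over \<open>G\<close>, and \<open>hsq_proj\<close> bounds them by the sum
  over \<open>B k\<close>.\<close>

lemma hsq_exhaustion:
  assumes ex: "exhaustion p B" and t: "t \<in> tensors n" and e: "0 < e"
  shows "\<exists>k. (tensor_norm p n t)\<^sup>2 - e < hsq p (B k) n t"
proof -
  note B = exhaustionD[OF ex]
  have m: "t \<in> mtens n" using t by (simp add: tensors_iff)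
  have "\<exists>G. finite G \<and> orthonormal p G \<and> (tensor_norm p n t)\<^sup>2 - e < hsq p G n t"
  proof (rule ccontr)
    assume "\<not> ?thesis"
    then have *: "hsq p G n t \<le> (tensor_norm p n t)\<^sup>2 - e" if "finite G" "orthonormal p G" for G
      using that by force
    have "0 \<le> (tensor_norm p n t)\<^sup>2 - e" using *[of "{}"] hsq_nonneg[of p "{}" n t] by simp
    then have "(tensor_norm p n t)\<^sup>2 \<le> (tensor_norm p n t)\<^sup>2 - e" using * by (intro tensor_bounded(2)) auto
    then show False using e by simp
  qed
  then obtain G where G: "finite G" "orthonormal p G" "(tensor_norm p n t)\<^sup>2 - e < hsq p G n t" by blast
  let ?f = "\<lambda>k. \<Sum>gs\<in>lists_len G n. (cmod (t (map (\<lambda>g. riesz p (proj p (B k) g)) gs)))\<^sup>2"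
  have "?f \<longlonglongrightarrow> hsq p G n t"
    unfolding hsq_def using G orthonormalD(1)[OF G(2)]
    by (intro tendsto_intros tendsto_tensor_proj[OF ex t]) (auto simp: lists_len_def)
  then have "\<forall>\<^sub>F k in sequentially. (tensor_norm p n t)\<^sup>2 - e < ?f k" using G(3) by (rule order_tendstoD(1))
  then obtain k where k: "(tensor_norm p n t)\<^sup>2 - e < ?f k" by (auto simp: eventually_sequentially)
  have "?f k \<le> hsq p (B k) n t" using hsq_proj[OF m G(1,2) B(1,2)] .
  then show ?thesis using k by (intro exI[of _ k]) linarith
qed

text \<open>The orthogonal projection of \<open>t\<close> onto the \<open>n\<close>-th tensor power
  of \<open>span B\<close>: the coordinate of \<open>t\<close> at the word \<open>es\<close>
  multiplies the elementary tensor of \<open>es\<close>, here evaluated at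
  \<open>xs\<close>.\<close>

definition truncation :: "nat \<Rightarrow> 'h set \<Rightarrow> nat \<Rightarrow> (('h \<Rightarrow> real) list \<Rightarrow> complex) \<Rightarrow> ('h \<Rightarrow> real) list \<Rightarrow> complex" where
  "truncation p B n t = (\<lambda>xs. if length xs = n \<and> set xs \<subseteq> nuc_dual
     then \<Sum>es\<in>lists_len B n. t (map (riesz p) es) * (\<Prod>j<n. complex_of_real ((xs ! j) (es ! j))) else 0)"

text \<open>Since \<open>t\<close> is symmetric, the elementary tensors may be symmetrised, and
  polarization turns the symmetrised ones into powers of the sums of the \<open>es ! i\<close> over
  \<open>S\<close>. Only real vectors \<open>(u, 0)\<close> occur.\<close>

lemma truncation_eq:
  assumes "t \<in> mtens n" "finite B" "B \<subseteq> nuc"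
  shows "truncation p B n t = (\<lambda>xs. \<Sum>(es, S)\<in>lists_len B n \<times> Pow {..<n}.
     (t (map (riesz p) es) * (- 1) ^ card ({..<n} - S) / fact n) * tensor_power n (\<Sum>i\<in>S. es ! i, 0) xs)"
    (is "_ = ?R")
proof
  fix xs
  show "truncation p B n t xs = ?R xs"
  proof (cases "length xs = n \<and> set xs \<subseteq> nuc_dual")
    case False
    then have "tensor_power n \<theta> xs = 0" for \<theta> by (auto simp: tensor_power_def)
    moreover have "truncation p B n t xs = 0" unfolding truncation_def using False by (rule if_not_P)
    ultimately show ?thesis by (simp add: case_prod_unfold)
  next
    case True
    let ?c = "\<lambda>es. t (map (riesz p) es)"
    let ?a = "\<lambda>e j. complex_of_real ((xs ! j) e)"
    have sym: "?c es = ?c es'" if "mset es = mset es'" for es es'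
      using that by (intro mtensD(3)[OF assms(1)]) simp
    have pw: "tensor_power n (\<Sum>i\<in>S. es ! i, 0) xs = (\<Sum>fs\<in>lists_len S n. \<Prod>j<n. ?a (es ! (fs ! j)) j)"
      if es: "es \<in> lists_len B n" and S: "S \<subseteq> {..<n}" for es S
    proof -
      have en: "es ! i \<in> nuc" if "i \<in> S" for i
        using that es S assms(3) nth_mem[of i es] by (auto simp: lists_len_def simp del: nth_mem)
      have "tensor_power n (\<Sum>i\<in>S. es ! i, 0) xs = (\<Prod>j<n. pairing (xs ! j) (\<Sum>i\<in>S. es ! i, 0))"
        using True by (simp add: tensor_power_def prod.list_conv_set_nth atLeast0LessThan)
      also have "\<dots> = (\<Prod>j<n. \<Sum>i\<in>S. ?a (es ! i) j)"
      proof (rule prod.cong[OF refl])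
        fix j assume "j \<in> {..<n}"
        then have x: "xs ! j \<in> nuc_dual" using True by (metis lessThan_iff nth_mem subsetD)
        have "(xs ! j) (\<Sum>i\<in>S. es ! i) = (\<Sum>i\<in>S. (xs ! j) (es ! i))" using nuc_dual_sum[OF x en] .
        then show "pairing (xs ! j) (\<Sum>i\<in>S. es ! i, 0) = (\<Sum>i\<in>S. ?a (es ! i) j)"
          using nuc_dual_zero[OF x] by (simp add: pairing_def complex_eq_iff)
      qed
      also have "\<dots> = (\<Sum>fs\<in>lists_len S n. \<Prod>j<n. ?a (es ! (fs ! j)) j)"
        by (rule prod_sum_lists)
      finally show ?thesis .
    qed
    have pl: "(\<Sum>fs\<in>perm_lists n. \<Sum>es\<in>lists_len B n. ?c es * (\<Prod>j<n. ?a (es ! (fs ! j)) j)) =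
        (\<Sum>fs\<in>perm_lists n. \<Sum>es\<in>lists_len B n. ?c es * (\<Prod>j<n. ?a (es ! j) j))"
      by (rule sum.cong[OF refl], rule sum_permuted_lists[OF assms(2)]) (use sym in blast)+
    have "?R xs = (\<Sum>es\<in>lists_len B n. \<Sum>S\<in>Pow {..<n}. (?c es * (- 1) ^ card ({..<n} - S) / fact n) * tensor_power n (\<Sum>i\<in>S. es ! i, 0) xs)"
      by (simp add: sum.cartesian_product)
    also have "\<dots> = (\<Sum>es\<in>lists_len B n. ?c es / fact n * (\<Sum>S\<in>Pow {..<n}. (- 1) ^ card ({..<n} - S) * (\<Sum>fs\<in>lists_len S n. \<Prod>j<n. ?a (es ! (fs ! j)) j)))"
      unfolding sum_distrib_left[of "_ / _"] using pw by (intro sum.cong refl) auto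
    also have "\<dots> = (\<Sum>es\<in>lists_len B n. ?c es / fact n * (\<Sum>fs\<in>perm_lists n. \<Prod>j<n. ?a (es ! (fs ! j)) j))"
      unfolding polarization_sum ..
    also have "\<dots> = (\<Sum>fs\<in>perm_lists n. (\<Sum>es\<in>lists_len B n. ?c es * (\<Prod>j<n. ?a (es ! (fs ! j)) j))) / fact n"
      by (subst sum.swap) (simp add: sum_distrib_left sum_divide_distrib)
    also have "\<dots> = (\<Sum>fs\<in>perm_lists n. (\<Sum>es\<in>lists_len B n. ?c es * (\<Prod>j<n. ?a (es ! j) j))) / fact n"
      unfolding pl ..
    also have "\<dots> = truncation p B n t xs"
      using True by (simp add: card_perm_lists truncation_def)
    finally show ?thesis by simp
  qed
qed

lemma truncation_in_tensors:
  assumes "t \<in> mtens n" "finite B" "B \<subseteq> nuc"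
  shows "truncation p B n t \<in> tensors n"
    and "\<And>K. K \<in> tensors_dual n \<Longrightarrow> (\<And>u. u \<in> nuc \<Longrightarrow> K (tensor_power n (u, 0)) = 0) \<Longrightarrow> K (truncation p B n t) = 0"
proof -
  have u: "(\<Sum>i\<in>S. es ! i, 0) \<in> nucC" if "es \<in> lists_len B n" "S \<subseteq> {..<n}" for es S
  proof -
    have "es ! i \<in> nuc" if "i \<in> S" for i
      using that \<open>es \<in> lists_len B n\<close> \<open>S \<subseteq> {..<n}\<close> assms(3) nth_mem[of i es]
      by (auto simp: lists_len_def simp del: nth_mem)
    then show ?thesis using subspace_0[OF subspace_nuc] by (auto simp: nucC_def intro!: subspace_sum[OF subspace_nuc])
  qed
  have i: "case z of (es, S) \<Rightarrow> tensor_power n (\<Sum>i\<in>S. es ! i, 0) \<in> tensors n" if "z \<in> lists_len B n \<times> Pow {..<n}" for z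
    using that u by (auto intro!: tensor_power_in_tensors)
  show "truncation p B n t \<in> tensors n"
    unfolding truncation_eq[OF assms] case_prod_unfold
    using i by (intro tensors_lincomb) (auto simp: case_prod_unfold)
  fix K assume K: "K \<in> tensors_dual n" "\<And>u. u \<in> nuc \<Longrightarrow> K (tensor_power n (u, 0)) = 0"
  show "K (truncation p B n t) = 0"
    unfolding truncation_eq[OF assms] case_prod_unfold
    using i u by (subst tensors_dual_lincomb[OF K(1)]) (auto simp: case_prod_unfold nucC_def intro!: sum.neutral K(2))
qed

text \<open>Pythagoras: in a system \<open>B'\<close> that extends \<open>B\<close> and spans
  \<open>G\<close>, the truncation removes exactly the coordinates at words in \<open>B\<close>, and
  the remaining ones sum to the difference of the two Hilbert-Schmidt sums.\<close>

lemma tensor_norm_truncation: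
  assumes "t \<in> tensors n" "finite B" "orthonormal p B" "B \<subseteq> nuc"
  shows "(tensor_norm p n (t - truncation p B n t))\<^sup>2 \<le> (tensor_norm p n t)\<^sup>2 - hsq p B n t"
proof (rule tensor_bounded(2))
  have m: "t \<in> mtens n" "tensor_norm_sq p n t < \<infinity>" using assms(1) by (auto simp: tensors_iff)
  show "0 \<le> (tensor_norm p n t)\<^sup>2 - hsq p B n t" using hsq_le_tensor_norm[OF m(2) assms(2,3)] by simp
  fix G assume G: "finite G" "orthonormal p G"
  obtain B' where B': "B \<subseteq> B'" "finite B'" "orthonormal p B'" "G \<subseteq> span B'"
    using orthonormal_extend_finite[OF G(1) orthonormalD(1)[OF G(2)] assms(3,2)] by blast
  have dm: "t - truncation p B n t \<in> mtens n"
    using tensors_diff[OF assms(1) truncation_in_tensors(1)[OF m(1) assms(2,4)]] by (auto simp: tensors_iff)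
  have ev: "truncation p B n t (map (riesz p) es) = (if es \<in> lists_len B n then t (map (riesz p) es) else 0)"
    if es: "es \<in> lists_len B' n" for es
  proof -
    have r: "riesz p e \<in> nuc_dual" if "e \<in> B'" for e using riesz_in_dual orthonormalD(2)[OF B'(3) that] .
    have "set (map (riesz p) es) \<subseteq> nuc_dual" "length (map (riesz p) es) = n" using r es by (auto simp: lists_len_def)
    then have "truncation p B n t (map (riesz p) es) =
        (\<Sum>fs\<in>lists_len B n. t (map (riesz p) fs) * (\<Prod>j<n. complex_of_real ((map (riesz p) es ! j) (fs ! j))))"
      by (simp add: truncation_def)
    also have "\<dots> = (\<Sum>fs\<in>lists_len B n. if fs = es then t (map (riesz p) fs) else 0)"
    proof (rule sum.cong[OF refl])
      fix fs assume fs: "fs \<in> lists_len B n"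
      have v: "(map (riesz p) es ! j) (fs ! j) = (if es ! j = fs ! j then 1 else 0)" if "j < n" for j
      proof -
        have "es ! j \<in> B'" "fs ! j \<in> B" using that es fs by (auto simp: lists_len_def)
        then show ?thesis using that es assms(4) B'(1) orthonormalD(3)[OF B'(3), of "es ! j" "fs ! j"]
          by (auto simp: riesz_def lists_len_def)
      qed
      show "t (map (riesz p) fs) * (\<Prod>j<n. complex_of_real ((map (riesz p) es ! j) (fs ! j))) = (if fs = es then t (map (riesz p) fs) else 0)"
      proof (cases "fs = es")
        case True
        then show ?thesis using v by simp
      next
        case False
        then obtain j where j: "j < n" "es ! j \<noteq> fs ! j"
          using es fs nth_equalityI[of es fs] by (auto simp: lists_len_def)
        then have "(\<Prod>j<n. complex_of_real ((map (riesz p) es ! j) (fs ! j))) = 0"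
          using v[OF j(1)] by (intro prod_zero) auto
        then show ?thesis using False by simp
      qed
    qed
    finally show ?thesis using assms(2) by simp
  qed
  have "hsq p G n (t - truncation p B n t) \<le> hsq p B' n (t - truncation p B n t)"
    by (rule hsq_span[OF dm G B'(2,3,4)])
  also have "\<dots> = (\<Sum>es\<in>lists_len B' n - lists_len B n. (cmod (t (map (riesz p) es)))\<^sup>2)"
    unfolding hsq_def using B'(2) ev by (intro sum.mono_neutral_cong_right) (auto simp: lists_len_mono)
  also have "\<dots> = hsq p B' n t - hsq p B n t"
    unfolding hsq_def using B'(2) lists_len_mono[OF B'(1)] by (intro sum_diff) auto
  also have "\<dots> \<le> (tensor_norm p n t)\<^sup>2 - hsq p B n t"
    using hsq_le_tensor_norm[OF m(2) B'(2,3)] by simp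
  finally show "hsq p G n (t - truncation p B n t) \<le> (tensor_norm p n t)\<^sup>2 - hsq p B n t" .
qed

text \<open>The powers of real vectors are total. In the norm that bounds \<open>K\<close>,
  \<open>t\<close> is a limit of truncations along an exhaustion, and every truncation is a
  combination of such powers.\<close>

lemma tensors_dual_eq_0:
  assumes K: "K \<in> tensors_dual n" "\<And>u. u \<in> nuc \<Longrightarrow> K (tensor_power n (u, 0)) = 0"
  shows "K t = 0"
proof (cases "t \<in> tensors n")
  case True
  have m: "t \<in> mtens n" using True by (simp add: tensors_iff)
  obtain p C where C: "0 \<le> C" "\<forall>t\<in>tensors n. cmod (K t) \<le> C * tensor_norm p n t"
    using tensors_dual_bounded[OF K(1)] by blast
  obtain B where ex: "exhaustion p B" using exhaustion_exists by blast
  note B = exhaustionD[OF ex]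
  have "cmod (K t) \<le> 0 + e" if e: "0 < e" for e
  proof -
    define d where "d = e / (C + 1)"
    have d: "0 < d" using e C(1) by (simp add: d_def)
    obtain k where k: "(tensor_norm p n t)\<^sup>2 - d\<^sup>2 < hsq p (B k) n t"
      using hsq_exhaustion[OF ex True, of "d\<^sup>2"] d by auto
    let ?s = "truncation p (B k) n t"
    have s: "?s \<in> tensors n" "K ?s = 0"
      using truncation_in_tensors[OF m B(1,3)] K by auto
    have "(tensor_norm p n (t - ?s))\<^sup>2 \<le> d\<^sup>2"
      using tensor_norm_truncation[OF True B(1,2,3), of k] k by linarith
    then have n: "tensor_norm p n (t - ?s) \<le> d" by (rule power2_le_imp_le) (use d in simp)
    have "cmod (K t) = cmod (K (t - ?s))" using tensors_dual_diff[OF K(1) True s(1)] s(2) by simp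
    also have "\<dots> \<le> C * tensor_norm p n (t - ?s)" using C(2) tensors_diff[OF True s(1)] by simp
    also have "\<dots> \<le> C * d" using n C(1) by (rule mult_left_mono)
    also have "\<dots> \<le> e" using e C(1) by (simp add: d_def field_simps)
    finally show ?thesis by simp
  qed
  then have "cmod (K t) \<le> 0" by (rule field_le_epsilon)
  then show ?thesis by simp
qed (use tensors_dualD(2)[OF K(1)] in simp)

subsection \<open>The Hilbert--Schmidt embeddings\<close>

text \<open>The comparison behind the independence of a Hilbert-Schmidt norm from the basis: both
  sides are expanded in an orthonormal system \<open>G\<close> of \<open>H p\<close> that spans
  \<open>A\<close>, and the order of summation is exchanged.\<close>

lemma hs_proj_bound:
  assumes "p \<le> q" "finite A" "orthonormal q A" "finite E" "orthonormal q E"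
  shows "(\<Sum>e\<in>E. (nrm p (proj q A e))\<^sup>2) \<le> (\<Sum>a\<in>A. (nrm p a)\<^sup>2)"
proof -
  have Aq: "a \<in> H q" "a \<in> H p" if "a \<in> A" for a
    using orthonormalD(2)[OF assms(3) that] H_mono[OF assms(1)] by auto
  have Eq: "e \<in> H q" if "e \<in> E" for e using orthonormalD(2)[OF assms(5) that] .
  obtain G where G: "finite G" "orthonormal p G" "A \<subseteq> span G"
    using orthonormal_spanning[of A p] assms(2) Aq(2) by blast
  have Gp: "g \<in> H p" if "g \<in> G" for g using orthonormalD(2)[OF G(2) that] .
  \<comment> \<open>The adjoint of the inclusion of \<open>span A\<close>, with the inner product of
    \<open>H q\<close>, into \<open>H p\<close>, applied to \<open>g\<close>; \<open>e1\<close> is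
    the adjoint relation.\<close>
  define v where "v g = (\<Sum>a\<in>A. ip p g a *\<^sub>R a)" for g
  have v: "v g \<in> H q" "(nrm q (v g))\<^sup>2 = (\<Sum>a\<in>A. (ip p g a)\<^sup>2)" for g
    unfolding v_def using orthonormal_combination(2,3)[OF assms(3,2)] by auto
  have e1: "ip p g (proj q A e) = ip q e (v g)" if "g \<in> G" "e \<in> E" for g e
  proof -
    have "ip p g (proj q A e) = (\<Sum>a\<in>A. ip p g (ip q a e *\<^sub>R a))"
      unfolding proj_def using that Gp Aq by (intro ip_sum_right H_scale) auto
    also have "\<dots> = (\<Sum>a\<in>A. ip q e (ip p g a *\<^sub>R a))"
      using that Gp Aq Eq by (intro sum.cong refl) (auto simp: ip_scale_right ip_commute[of _ q e])
    also have "\<dots> = ip q e (v g)"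
      unfolding v_def using that Aq Eq by (intro ip_sum_right[symmetric] H_scale) auto
    finally show ?thesis .
  qed
  have sp: "proj q A e \<in> span G" for e
    using proj_span[of q A e] span_minimal[OF G(3) subspace_span] by blast
  have "(\<Sum>e\<in>E. (nrm p (proj q A e))\<^sup>2) = (\<Sum>e\<in>E. \<Sum>g\<in>G. (ip q e (v g))\<^sup>2)"
  proof (rule sum.cong[OF refl])
    fix e assume e: "e \<in> E"
    have "(nrm p (proj q A e))\<^sup>2 = (\<Sum>g\<in>G. (ip p g (proj q A e))\<^sup>2)" using parseval_span[OF G(2,1) sp] by simp
    also have "\<dots> = (\<Sum>g\<in>G. (ip q e (v g))\<^sup>2)" using e1[OF _ e] by (intro sum.cong refl) simp
    finally show "(nrm p (proj q A e))\<^sup>2 = (\<Sum>g\<in>G. (ip q e (v g))\<^sup>2)" .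
  qed
  also have "\<dots> = (\<Sum>g\<in>G. \<Sum>e\<in>E. (ip q e (v g))\<^sup>2)" by (rule sum.swap)
  also have "\<dots> \<le> (\<Sum>g\<in>G. \<Sum>a\<in>A. (ip p g a)\<^sup>2)"
    using bessel[OF assms(5,4) v(1)] v(2) by (intro sum_mono) simp
  also have "\<dots> = (\<Sum>a\<in>A. \<Sum>g\<in>G. (ip p g a)\<^sup>2)" by (rule sum.swap)
  also have "\<dots> = (\<Sum>a\<in>A. (nrm p a)\<^sup>2)"
    using parseval_span[OF G(2,1)] G(3) by (intro sum.cong refl) auto
  finally show ?thesis .
qed

text \<open>The embedding hypothesis speaks of one orthonormal basis \<open>E0\<close>. A bound for
  all finite orthonormal systems follows by projecting each \<open>e\<close> onto the span of a
  finite part \<open>A\<close> of \<open>E0\<close>, with arbitrarily small error.\<close>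

lemma hilbert_schmidt_bound:
  "\<exists>q>p. \<exists>c\<ge>0. \<forall>E. finite E \<longrightarrow> orthonormal q E \<longrightarrow> (\<Sum>e\<in>E. (nrm p e)\<^sup>2) \<le> c\<^sup>2"
proof -
  obtain q E0 where q: "p < q" "orthonormal_basis q E0" "(\<lambda>e. (nrm p e)\<^sup>2) summable_on E0"
    using hilbert_schmidt[of p] unfolding hilbert_schmidt_embedding_def by blast
  define S where "S = infsum (\<lambda>e. (nrm p e)\<^sup>2) E0"
  have S: "(\<Sum>a\<in>A. (nrm p a)\<^sup>2) \<le> S" if "finite A" "A \<subseteq> E0" for A
    unfolding S_def using that q(3) by (intro finite_sum_le_infsum) auto
  have S0: "0 \<le> S" using S[of "{}"] by simp
  have o: "orthonormal q E0" using q(2) by (simp add: orthonormal_basis_def)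
  have "(\<Sum>e\<in>E. (nrm p e)\<^sup>2) \<le> S" if E: "finite E" "orthonormal q E" for E
  proof (rule field_le_epsilon)
    fix \<epsilon> :: real assume eps: "0 < \<epsilon>"
    \<comment> \<open>For \<open>x\<close> and \<open>d\<close> in \<open>[0, 1]\<close> the square
      of \<open>x + d\<close> exceeds that of \<open>x\<close> by at most \<open>3 * d\<close>; the
      choice keeps the total of these errors over \<open>E\<close> below
      \<open>\<epsilon>\<close>.\<close>
    define d where "d = min 1 (\<epsilon> / (3 * (real (card E) + 1)))"
    have d: "0 < d" "d \<le> 1" using eps by (auto simp: d_def)
    have d3: "3 * d * real (card E) \<le> \<epsilon>"
    proof -
      have "d \<le> \<epsilon> / (3 * (real (card E) + 1))" by (simp add: d_def)
      then have "d * (3 * (real (card E) + 1)) \<le> \<epsilon>" by (simp add: pos_le_divide_eq)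
      then show ?thesis using d by (simp add: algebra_simps)
    qed
    have Eq: "e \<in> H q" if "e \<in> E" for e using orthonormalD(2)[OF E(2) that] .
    have "\<exists>A. finite A \<and> A \<subseteq> E0 \<and> (\<exists>v\<in>span A. nrm q (e - v) < d)" if e: "e \<in> E" for e
    proof -
      obtain v where v: "v \<in> span E0" "nrm q (e - v) < d"
        using q(2) Eq[OF e] d(1) unfolding orthonormal_basis_def by blast
      obtain A r where A: "finite A" "A \<subseteq> E0" "v = (\<Sum>a\<in>A. r a *\<^sub>R a)"
        using v(1) unfolding span_explicit by blast
      have "v \<in> span A" unfolding A(3) by (intro span_sum span_scale span_base)
      then show ?thesis using A v by blast
    qed
    then obtain A0 where A0: "\<forall>e\<in>E. finite (A0 e) \<and> A0 e \<subseteq> E0 \<and> (\<exists>v\<in>span (A0 e). nrm q (e - v) < d)" by metis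
    define A where "A = (\<Union>e\<in>E. A0 e)"
    have A: "finite A" "A \<subseteq> E0" using A0 E(1) by (auto simp: A_def)
    have oA: "orthonormal q A" using orthonormal_subset[OF o A(2)] .
    have le: "(nrm p e)\<^sup>2 \<le> (nrm p (proj q A e))\<^sup>2 + 3 * d" if e: "e \<in> E" for e
    proof -
      obtain v where v: "v \<in> span (A0 e)" "nrm q (e - v) < d" using A0 e by blast
      have "v \<in> span A" using v(1) span_mono[of "A0 e" A] e by (auto simp: A_def)
      then have r: "nrm q (e - proj q A e) \<le> d" using proj_best[OF oA A(1) Eq[OF e]] v(2) by fastforce
      have P: "proj q A e \<in> H q" "proj q A e \<in> H p" "e \<in> H p"
        using proj_in_H[OF oA] H_mono[of p q] q(1) Eq[OF e] by auto
      have D: "e - proj q A e \<in> H q" using P(1) Eq[OF e] H_diff by blast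
      have e1: "nrm q e = 1" using orthonormalD(3)[OF E(2) e e] by (simp add: nrm_def)
      have a1: "nrm p (proj q A e) \<le> 1"
        using nrm_mono[OF q(1) P(1)] nrm_proj_le[OF oA A(1) Eq[OF e]] e1 by linarith
      have a0: "0 \<le> nrm p (proj q A e)" using nrm_nonneg[OF P(2)] .
      have "nrm p e \<le> nrm p (e - proj q A e) + nrm p (proj q A e)"
        using nrm_triangle[of "e - proj q A e" p "proj q A e"] P H_diff by simp
      also have "nrm p (e - proj q A e) \<le> d" using nrm_mono[OF q(1) D] r by linarith
      finally have "nrm p e \<le> nrm p (proj q A e) + d" by simp
      then have "(nrm p e)\<^sup>2 \<le> (nrm p (proj q A e) + d)\<^sup>2" using nrm_nonneg[OF P(3)] by (rule power_mono)
      also have "\<dots> = (nrm p (proj q A e))\<^sup>2 + (2 * nrm p (proj q A e) * d + d * d)"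
        by (simp add: power2_eq_square algebra_simps)
      also have "2 * nrm p (proj q A e) * d + d * d \<le> 2 * 1 * d + 1 * d"
        using a1 a0 d by (intro add_mono mult_right_mono mult_left_mono) auto
      finally show ?thesis by simp
    qed
    have "(\<Sum>e\<in>E. (nrm p e)\<^sup>2) \<le> (\<Sum>e\<in>E. (nrm p (proj q A e))\<^sup>2 + 3 * d)" by (intro sum_mono le)
    also have "\<dots> = (\<Sum>e\<in>E. (nrm p (proj q A e))\<^sup>2) + 3 * d * real (card E)" by (simp add: sum.distrib)
    also have "\<dots> \<le> (\<Sum>a\<in>A. (nrm p a)\<^sup>2) + \<epsilon>"
      using hs_proj_bound[OF _ A(1) oA E, of p] q(1) d3 by (intro add_mono) auto
    also have "\<dots> \<le> S + \<epsilon>" using S[OF A] by simp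
    finally show "(\<Sum>e\<in>E. (nrm p e)\<^sup>2) \<le> S + \<epsilon>" .
  qed
  then show ?thesis using q(1) S0 by (intro exI[of _ q] conjI exI[of _ "sqrt S"]) auto
qed

end

subsection \<open>Bounded holomorphic functions on a ball of a complexified space\<close>

lemma cscale_simps [simp]:
  "cscale 0 \<theta> = 0" "cscale 1 \<theta> = \<theta>" "cscale c 0 = 0"
  by (simp_all add: cscale_def zero_prod_def)

lemma cscale_add_left: "cscale (a + b) \<theta> = cscale a \<theta> + cscale b \<theta>"
  by (simp add: cscale_def algebra_simps)

lemma cscale_diff_left: "cscale (a - b) \<theta> = cscale a \<theta> - cscale b \<theta>"
  by (simp add: cscale_def algebra_simps)

lemma cscale_add_right: "cscale a (\<theta> + \<eta>) = cscale a \<theta> + cscale a \<eta>"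
  by (simp add: cscale_def algebra_simps)

lemma cscale_diff_right: "cscale a (\<theta> - \<eta>) = cscale a \<theta> - cscale a \<eta>"
  by (simp add: cscale_def algebra_simps)

lemma cscale_cscale: "cscale a (cscale b \<theta>) = cscale (a * b) \<theta>"
  by (simp add: cscale_def algebra_simps)

lemma cscale_minus_one: "cscale (- 1) \<theta> = - \<theta>"
  by (simp add: cscale_def prod_eq_iff)

definition dirD :: "'h::real_vector \<times> 'h \<Rightarrow> ('h \<times> 'h \<Rightarrow> complex) \<Rightarrow> 'h \<times> 'h \<Rightarrow> complex" where
  "dirD \<eta> F \<theta> = deriv (\<lambda>\<zeta>. F (\<theta> + cscale \<zeta> \<eta>)) 0"

lemma dirD_line: "dirD \<eta> F (\<theta> + cscale z \<eta>) = deriv (\<lambda>\<zeta>. F (\<theta> + cscale \<zeta> \<eta>)) z"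
proof -
  have "deriv (\<lambda>\<zeta>. F (\<theta> + cscale \<zeta> \<eta>)) z = deriv ((\<lambda>\<zeta>. F (\<theta> + cscale \<zeta> \<eta>)) \<circ> (+) z) 0"
    by (rule deriv_shift_0)
  also have "(\<lambda>\<zeta>. F (\<theta> + cscale \<zeta> \<eta>)) \<circ> (+) z = (\<lambda>\<zeta>. F (\<theta> + cscale z \<eta> + cscale \<zeta> \<eta>))"
    by (simp add: fun_eq_iff cscale_add_left add.assoc)
  finally show ?thesis by (simp add: dirD_def)
qed

lemma dirD_zero: "dirD 0 F \<theta> = 0"
  by (simp add: dirD_def)

fun iterD :: "('h::real_vector \<times> 'h \<Rightarrow> complex) \<Rightarrow> ('h \<times> 'h) list \<Rightarrow> complex" where
  "iterD F [] = F 0"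
| "iterD F (\<theta> # \<theta>s) = iterD (dirD \<theta> F) \<theta>s"

lemma iterD_replicate: "(deriv ^^ n) (\<lambda>\<zeta>. F (cscale \<zeta> \<theta>)) 0 = iterD F (replicate n \<theta>)"
proof (induction n arbitrary: F)
  case (Suc n)
  have "deriv (\<lambda>\<zeta>. F (cscale \<zeta> \<theta>)) = (\<lambda>\<zeta>. dirD \<theta> F (cscale \<zeta> \<theta>))"
    using dirD_line[of \<theta> F 0] by simp
  then show ?case using Suc.IH[of "dirD \<theta> F"] by (simp add: funpow_swap1 del: funpow.simps add: funpow_Suc_right)
qed simp

text \<open>Interpreted for \<open>HC p\<close> and for \<open>nucC\<close> with each norm
  \<open>nrmC p\<close>. The latter is in general incomplete for a single norm, so bounded
  Gateaux-holomorphic functions are treated by one-variable Cauchy estimates along complex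
  lines.\<close>

locale complex_normed =
  fixes X :: "('h::real_vector \<times> 'h) set" and N :: "'h \<times> 'h \<Rightarrow> real"
  assumes X_zero: "0 \<in> X"
    and X_add: "\<theta> \<in> X \<Longrightarrow> \<eta> \<in> X \<Longrightarrow> \<theta> + \<eta> \<in> X"
    and X_scale: "\<theta> \<in> X \<Longrightarrow> cscale c \<theta> \<in> X"
    and N_nonneg: "\<theta> \<in> X \<Longrightarrow> 0 \<le> N \<theta>"
    and N_triangle: "\<theta> \<in> X \<Longrightarrow> \<eta> \<in> X \<Longrightarrow> N (\<theta> + \<eta>) \<le> N \<theta> + N \<eta>"
    and N_scale: "\<theta> \<in> X \<Longrightarrow> N (cscale c \<theta>) = cmod c * N \<theta>"
    and N_eq_0: "\<theta> \<in> X \<Longrightarrow> N \<theta> = 0 \<Longrightarrow> \<theta> = 0"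
begin

text \<open>Radius and bound belong to the predicate because the kernel estimates need explicit
  constants. Differentiability is asked along complex lines only; the uniform bound on the ball
  makes up for the rest.\<close>

definition hol :: "real \<Rightarrow> real \<Rightarrow> ('h \<times> 'h \<Rightarrow> complex) \<Rightarrow> bool" where
  "hol r C F \<longleftrightarrow> (\<forall>\<theta>\<in>X. N \<theta> < r \<longrightarrow> cmod (F \<theta>) \<le> C) \<and>
     (\<forall>\<theta>\<in>X. \<forall>\<eta>\<in>X. N \<theta> < r \<longrightarrow> (\<lambda>\<zeta>. F (\<theta> + cscale \<zeta> \<eta>)) field_differentiable at 0)"

lemma holD:
  assumes "hol r C F" "\<theta> \<in> X" "N \<theta> < r"
  shows "cmod (F \<theta>) \<le> C" "\<eta> \<in> X \<Longrightarrow> (\<lambda>\<zeta>. F (\<theta> + cscale \<zeta> \<eta>)) field_differentiable at 0"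
  using assms by (auto simp: hol_def)

lemma N_zero [simp]: "N 0 = 0"
  using N_scale[OF X_zero, of 0] by simp

lemma X_diff: "\<theta> \<in> X \<Longrightarrow> \<eta> \<in> X \<Longrightarrow> \<theta> - \<eta> \<in> X"
  using X_add[OF _ X_scale[of \<eta> "-1"], of \<theta>] by (simp add: cscale_minus_one)

lemma X_line: "\<theta> \<in> X \<Longrightarrow> \<eta> \<in> X \<Longrightarrow> \<theta> + cscale \<zeta> \<eta> \<in> X"
  by (intro X_add X_scale)

lemma N_line: "\<theta> \<in> X \<Longrightarrow> \<eta> \<in> X \<Longrightarrow> N (\<theta> + cscale \<zeta> \<eta>) \<le> N \<theta> + cmod \<zeta> * N \<eta>"
  using N_triangle[OF _ X_scale, of \<theta> \<eta> \<zeta>] N_scale by simp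

lemma N_minus_commute: "\<theta> \<in> X \<Longrightarrow> \<eta> \<in> X \<Longrightarrow> N (\<theta> - \<eta>) = N (\<eta> - \<theta>)"
  using N_scale[OF X_diff, of \<theta> \<eta> "-1"] by (simp add: cscale_minus_one)

lemma N_pos: "\<theta> \<in> X \<Longrightarrow> \<theta> \<noteq> 0 \<Longrightarrow> 0 < N \<theta>"
  using N_nonneg[of \<theta>] N_eq_0[of \<theta>] by fastforce

lemma X_sum: "(\<And>i. i \<in> I \<Longrightarrow> f i \<in> X) \<Longrightarrow> (\<Sum>i\<in>I. f i) \<in> X"
  by (induction I rule: infinite_finite_induct) (auto intro: X_zero X_add)

lemma hol_line_at:
  assumes "hol r C F" "\<theta> \<in> X" "\<eta> \<in> X" "N (\<theta> + cscale z \<eta>) < r"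
  shows "(\<lambda>\<zeta>. F (\<theta> + cscale \<zeta> \<eta>)) field_differentiable at z"
proof -
  have "(\<lambda>\<zeta>. F ((\<theta> + cscale z \<eta>) + cscale \<zeta> \<eta>)) field_differentiable at (z - z)"
    using holD(2)[OF assms(1) X_line[OF assms(2,3)] assms(4,3)] by simp
  moreover have "(\<lambda>\<zeta>. \<zeta> - z) field_differentiable at z" by (intro derivative_intros)
  ultimately have "((\<lambda>\<zeta>. F ((\<theta> + cscale z \<eta>) + cscale \<zeta> \<eta>)) \<circ> (\<lambda>\<zeta>. \<zeta> - z)) field_differentiable at z"
    by (intro field_differentiable_compose)
  then show ?thesis by (simp add: o_def cscale_diff_left)
qed

lemma hol_line:
  assumes "hol r C F" "\<theta> \<in> X" "\<eta> \<in> X" "\<And>\<zeta>. \<zeta> \<in> S \<Longrightarrow> N (\<theta> + cscale \<zeta> \<eta>) < r"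
  shows "(\<lambda>\<zeta>. F (\<theta> + cscale \<zeta> \<eta>)) holomorphic_on S"
  unfolding holomorphic_on_def
  using hol_line_at[OF assms(1-3)] assms(4) field_differentiable_at_within by blast

lemma dirD_deriv:
  assumes "hol r C F" "\<theta> \<in> X" "\<eta> \<in> X" "N (\<theta> + cscale z \<eta>) < r"
  shows "((\<lambda>\<zeta>. F (\<theta> + cscale \<zeta> \<eta>)) has_field_derivative dirD \<eta> F (\<theta> + cscale z \<eta>)) (at z)"
  unfolding dirD_line using hol_line_at[OF assms] by (simp add: field_differentiable_derivI)

text \<open>Cauchy's inequality on the disc of radius \<open>\<delta> / N \<eta>\<close>, which the
  line through \<open>\<theta>\<close> maps into the ball of radius
  \<open>N \<theta> + \<delta>\<close> up to its boundary.\<close>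

lemma dirD_bound:
  assumes F: "hol r C F" and X: "\<theta> \<in> X" "\<eta> \<in> X" and d: "0 < \<delta>" "N \<theta> + \<delta> < r"
  shows "cmod (dirD \<eta> F \<theta>) \<le> C * N \<eta> / \<delta>"
proof (cases "\<eta> = 0")
  case False
  then have n: "0 < N \<eta>" using X N_pos by blast
  define R where "R = \<delta> / N \<eta>"
  have R: "0 < R" using n d by (simp add: R_def)
  have in_ball: "N (\<theta> + cscale \<zeta> \<eta>) < r" if "\<zeta> \<in> cball 0 R" for \<zeta>
  proof -
    have "cmod \<zeta> * N \<eta> \<le> R * N \<eta>" using that n by (intro mult_right_mono) auto
    then show ?thesis using N_line[OF X, of \<zeta>] d n by (simp add: R_def)
  qed
  have h: "(\<lambda>\<zeta>. F (\<theta> + cscale \<zeta> \<eta>)) holomorphic_on cball 0 R"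
    using in_ball by (rule hol_line[OF F X])
  have "norm ((deriv ^^ 1) (\<lambda>\<zeta>. F (\<theta> + cscale \<zeta> \<eta>)) 0) \<le> fact 1 * C / R ^ 1"
  proof (rule Cauchy_inequality)
    show "(\<lambda>\<zeta>. F (\<theta> + cscale \<zeta> \<eta>)) holomorphic_on ball 0 R" using holomorphic_on_subset[OF h ball_subset_cball] .
    show "continuous_on (cball 0 R) (\<lambda>\<zeta>. F (\<theta> + cscale \<zeta> \<eta>))" using h by (rule holomorphic_on_imp_continuous_on)
    show "norm (F (\<theta> + cscale x \<eta>)) \<le> C" if "norm (0 - x) = R" for x
      using that in_ball X by (intro holD(1)[OF F] X_line) auto
  qed (rule R)
  then show ?thesis using n by (simp add: dirD_def R_def)
qed (simp add: dirD_zero)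

text \<open>Taylor's formula on a line, the remainder being controlled by Cauchy's inequality for
  the second derivative. Around every point of the disc of radius \<open>\<delta> / N \<eta>\<close>
  another disc of that radius has to fit, whence \<open>2 * \<delta>\<close>. The bound is uniform
  in \<open>\<theta>\<close>, which makes difference quotients converge uniformly.\<close>

lemma second_order:
  assumes F: "hol r C F" and X: "\<theta> \<in> X" "\<eta> \<in> X" "\<eta> \<noteq> 0"
    and d: "0 < \<delta>" "N \<theta> + 2 * \<delta> < r" and h: "cmod h * N \<eta> \<le> \<delta>"
  shows "cmod (F (\<theta> + cscale h \<eta>) - F \<theta> - h * dirD \<eta> F \<theta>) \<le> 2 * C * (N \<eta> / \<delta>)\<^sup>2 * (cmod h)\<^sup>2"
proof -
  have n: "0 < N \<eta>" using X N_pos by blast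
  define f where "f = (\<lambda>\<zeta>. F (\<theta> + cscale \<zeta> \<eta>))"
  define R where "R = \<delta> / N \<eta>"
  define V where "V = ball (0::complex) ((r - N \<theta>) / N \<eta>)"
  have R: "0 < R" using n d by (simp add: R_def)
  have in_ball: "N (\<theta> + cscale \<zeta> \<eta>) < r" if "\<zeta> \<in> V" for \<zeta>
  proof -
    have "cmod \<zeta> * N \<eta> < r - N \<theta>" using that n by (simp add: V_def pos_less_divide_eq)
    then show ?thesis using N_line[OF X(1,2), of \<zeta>] by linarith
  qed
  have fV: "f holomorphic_on V" unfolding f_def using in_ball by (rule hol_line[OF F X(1,2)])
  have oV: "open V" by (simp add: V_def)
  have dfV: "deriv f holomorphic_on V" using fV oV by (rule holomorphic_deriv)
  have sub: "cball x R \<subseteq> V" if "x \<in> cball 0 R" for x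
  proof
    fix y assume "y \<in> cball x R"
    then have "cmod y \<le> 2 * R" using that norm_triangle_sub[of y x] by (auto simp: dist_norm norm_minus_commute)
    also have "\<dots> < (r - N \<theta>) / N \<eta>" using n d by (simp add: R_def field_simps)
    finally show "y \<in> V" by (simp add: V_def)
  qed
  have S: "cball 0 R \<subseteq> V" using sub[of 0] R by simp
  have der: "(g has_field_derivative deriv g x) (at x within cball 0 R)" if "g holomorphic_on V" "x \<in> cball 0 R" for g x
    using holomorphic_derivI[OF that(1) oV] S that(2) has_field_derivative_at_within by blast
  define g where "g i = (deriv ^^ i) f" for i :: nat
  have "cmod (g 0 h - (\<Sum>i\<le>1. g i 0 * (h - 0) ^ i / fact i)) \<le> (2 * C / R\<^sup>2) * cmod (h - 0) ^ Suc 1 / fact 1"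
  proof (rule complex_Taylor[where S = "cball 0 R"])
    show "(g i has_field_derivative g (Suc i) x) (at x within cball 0 R)" if "x \<in> cball 0 R" "i \<le> 1" for i x
    proof -
      consider "i = 0" | "i = 1" using \<open>i \<le> 1\<close> by linarith
      then show ?thesis by cases (use der[OF fV that(1)] der[OF dfV that(1)] in \<open>simp_all add: g_def\<close>)
    qed
    show "cmod (g (Suc 1) x) \<le> 2 * C / R\<^sup>2" if x: "x \<in> cball 0 R" for x
    proof -
      have "norm ((deriv ^^ 2) f x) \<le> fact 2 * C / R ^ 2"
      proof (rule Cauchy_inequality)
        show "f holomorphic_on ball x R" using holomorphic_on_subset[OF fV] sub[OF x] ball_subset_cball by blast
        show "continuous_on (cball x R) f"
          using holomorphic_on_imp_continuous_on[OF holomorphic_on_subset[OF fV sub[OF x]]] .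
        show "norm (f y) \<le> C" if "norm (x - y) = R" for y
          unfolding f_def using that sub[OF x] X by (intro holD(1)[OF F] X_line in_ball) (auto simp: dist_norm)
      qed (rule R)
      then show ?thesis by (simp add: g_def numeral_2_eq_2)
    qed
    show "h \<in> cball 0 R" using h n by (simp add: R_def pos_le_divide_eq)
  qed (use R in auto)
  then show ?thesis
    using n by (simp add: g_def f_def dirD_def R_def power_divide field_simps numeral_2_eq_2)
qed

text \<open>A directional derivative is differentiable along every other line: on a disc of that
  line it is the uniform limit of difference quotients, each of them holomorphic there. The
  uniformity comes from \<open>second_order\<close>.\<close>

lemma dirD_hol:
  assumes F: "hol r C F" and eta: "\<eta> \<in> X" and d: "0 < \<delta>"
  shows "hol (r - \<delta>) (C * N \<eta> / \<delta>) (dirD \<eta> F)"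
  unfolding hol_def
proof (intro conjI ballI impI)
  show "cmod (dirD \<eta> F \<theta>) \<le> C * N \<eta> / \<delta>" if "\<theta> \<in> X" "N \<theta> < r - \<delta>" for \<theta>
    using that d by (intro dirD_bound[OF F _ eta]) auto
  fix \<theta> \<xi> assume X: "\<theta> \<in> X" "\<xi> \<in> X" and th: "N \<theta> < r - \<delta>"
  show "(\<lambda>\<zeta>. dirD \<eta> F (\<theta> + cscale \<zeta> \<xi>)) field_differentiable at 0"
  proof (cases "\<eta> = 0")
    case True
    then show ?thesis by (simp add: dirD_zero)
  next
    case False
    then have n: "0 < N \<eta>" using eta N_pos by blast
    \<comment> \<open>A quarter of the distance to the sphere: moving along \<open>\<xi>\<close>
      costs at most \<open>e\<close>, and \<open>second_order\<close> asks for a further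
      \<open>2 * e\<close>.\<close>
    define e where "e = (r - N \<theta>) / 4"
    have e: "0 < e" using th d by (simp add: e_def)
    have re: "r = N \<theta> + 4 * e" by (simp add: e_def field_simps)
    define \<rho> where "\<rho> = e / (N \<xi> + 1)"
    have nx: "0 \<le> N \<xi>" using N_nonneg[OF X(2)] .
    have rho: "0 < \<rho>" using e nx by (simp add: \<rho>_def)
    have rx: "\<rho> * N \<xi> \<le> e" using e nx by (simp add: \<rho>_def field_simps)
    have line: "N (\<sigma> + cscale \<omega> \<xi>) \<le> N \<sigma> + e" if "\<omega> \<in> cball 0 \<rho>" "\<sigma> \<in> X" for \<omega> \<sigma>
    proof -
      have "cmod \<omega> * N \<xi> \<le> \<rho> * N \<xi>" using that nx by (intro mult_right_mono) auto
      then show ?thesis using N_line[OF that(2) X(2), of \<omega>] rx by linarith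
    qed
    define h where "h k = inverse (real (Suc k))" for k
    have h0: "h \<longlonglongrightarrow> 0" unfolding h_def by (rule LIMSEQ_inverse_real_of_nat)
    have hp: "0 < h k" for k by (simp add: h_def)
    define f where "f k = (\<lambda>\<omega>. (F (\<theta> + cscale (h k) \<eta> + cscale \<omega> \<xi>) - F (\<theta> + cscale \<omega> \<xi>)) / complex_of_real (h k))" for k
    define c where "c = 2 * C * (N \<eta> / e)\<^sup>2"
    have small: "\<forall>\<^sub>F k in sequentially. h k * N \<eta> < e"
      using tendsto_mult_left_zero[OF h0, of "N \<eta>"] e by (auto dest: order_tendstoD(2))
    have ev1: "\<forall>\<^sub>F k in sequentially. continuous_on (cball 0 \<rho>) (f k) \<and> (f k) holomorphic_on ball 0 \<rho>"
      using small
    proof eventually_elim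
      case (elim k)
      have s: "\<theta> + cscale (h k) \<eta> \<in> X" using X eta by (intro X_line)
      have "N (\<theta> + cscale (h k) \<eta>) \<le> N \<theta> + e" using N_line[OF X(1) eta, of "h k"] elim hp[of k] by simp
      then have 1: "N (\<theta> + cscale (h k) \<eta> + cscale \<omega> \<xi>) < r" if "\<omega> \<in> cball 0 \<rho>" for \<omega>
        using line[OF that s] e re by linarith
      have 2: "N (\<theta> + cscale \<omega> \<xi>) < r" if "\<omega> \<in> cball 0 \<rho>" for \<omega>
        using line[OF that X(1)] e re by linarith
      have "f k holomorphic_on cball 0 \<rho>"
        unfolding f_def using hp[of k]
        by (intro holomorphic_intros hol_line[OF F s X(2) 1] hol_line[OF F X 2]) auto
      then show ?case using holomorphic_on_imp_continuous_on holomorphic_on_subset ball_subset_cball by blast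
    qed
    have ul: "uniform_limit (cball 0 \<rho>) f (\<lambda>\<omega>. dirD \<eta> F (\<theta> + cscale \<omega> \<xi>)) sequentially"
    proof (rule uniform_limitI)
      fix \<epsilon> :: real assume eps: "0 < \<epsilon>"
      have "\<forall>\<^sub>F k in sequentially. c * h k < \<epsilon>"
        using tendsto_mult_right_zero[OF h0, of c] eps by (auto dest: order_tendstoD(2))
      then show "\<forall>\<^sub>F k in sequentially. \<forall>\<omega>\<in>cball 0 \<rho>. dist (f k \<omega>) (dirD \<eta> F (\<theta> + cscale \<omega> \<xi>)) < \<epsilon>"
        using small
      proof eventually_elim
        case (elim k)
        show ?case
        proof
          fix \<omega> :: complex assume w: "\<omega> \<in> cball 0 \<rho>"
          define \<sigma> where "\<sigma> = \<theta> + cscale \<omega> \<xi>"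
          have s: "\<sigma> \<in> X" unfolding \<sigma>_def using X by (intro X_line)
          have "cmod (F (\<sigma> + cscale (h k) \<eta>) - F \<sigma> - h k * dirD \<eta> F \<sigma>) \<le> 2 * C * (N \<eta> / e)\<^sup>2 * (cmod (h k))\<^sup>2"
            using line[OF w X(1)] e re elim hp[of k] by (intro second_order[OF F s eta False e]) (auto simp: \<sigma>_def)
          also have "\<dots> = (c * h k) * h k" by (simp add: c_def power2_eq_square)
          finally have b: "cmod (F (\<sigma> + cscale (h k) \<eta>) - F \<sigma> - h k * dirD \<eta> F \<sigma>) \<le> (c * h k) * h k" .
          have "f k \<omega> - dirD \<eta> F \<sigma> = (F (\<sigma> + cscale (h k) \<eta>) - F \<sigma> - h k * dirD \<eta> F \<sigma>) / h k"
            using hp[of k] by (simp add: f_def \<sigma>_def diff_divide_distrib add_ac)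
          then have "cmod (f k \<omega> - dirD \<eta> F \<sigma>) = cmod (F (\<sigma> + cscale (h k) \<eta>) - F \<sigma> - h k * dirD \<eta> F \<sigma>) / h k"
            using hp[of k] by (simp add: norm_divide)
          also have "\<dots> \<le> c * h k" using b hp[of k] by (simp add: pos_divide_le_eq)
          finally show "dist (f k \<omega>) (dirD \<eta> F (\<theta> + cscale \<omega> \<xi>)) < \<epsilon>" using elim by (simp add: dist_norm \<sigma>_def)
        qed
      qed
    qed
    obtain "(\<lambda>\<omega>. dirD \<eta> F (\<theta> + cscale \<omega> \<xi>)) holomorphic_on ball 0 \<rho>"
      using holomorphic_uniform_limit[OF ev1 ul] by auto
    then show ?thesis using rho by (intro holomorphic_on_imp_differentiable_at) auto
  qed
qed

lemma deriv_sequence: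
  assumes "(f has_field_derivative D) (at (0::complex))"
  shows "(\<lambda>k. (f (of_real (inverse (real (Suc k)))) - f 0) / of_real (inverse (real (Suc k)))) \<longlonglongrightarrow> D"
proof -
  have 1: "((\<lambda>h. (f (0 + h) - f 0) / h) \<longlongrightarrow> D) (at 0)" using assms unfolding DERIV_def .
  have "filterlim (\<lambda>k. complex_of_real (inverse (real (Suc k)))) (at 0) sequentially"
    unfolding filterlim_at
    using LIMSEQ_inverse_real_of_nat[THEN tendsto_of_real, where 'a = complex]
    by (simp del: of_nat_Suc of_real_inverse)
  from filterlim_compose[OF 1 this] show ?thesis by simp
qed

text \<open>The increment along \<open>\<eta> + \<xi>\<close> is split at
  \<open>\<theta> + cscale (h k) \<eta>\<close>. The quotient of the second part is
  \<open>dirD \<xi> F\<close> at the moved point up to the error \<open>E k\<close>, and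
  \<open>dirD \<xi> F\<close> is continuous along \<open>\<eta>\<close> by
  \<open>dirD_hol\<close>.\<close>

lemma dirD_add:
  assumes F: "hol r C F" and X: "\<theta> \<in> X" "\<eta> \<in> X" "\<xi> \<in> X" and th: "N \<theta> < r"
  shows "dirD (\<eta> + \<xi>) F \<theta> = dirD \<eta> F \<theta> + dirD \<xi> F \<theta>"
proof (cases "\<xi> = 0")
  case False
  define h where "h k = complex_of_real (inverse (real (Suc k)))" for k
  have h0: "h \<longlonglongrightarrow> 0"
    unfolding h_def using LIMSEQ_inverse_real_of_nat[THEN tendsto_of_real, where 'a = complex] by simp
  have hn: "h k \<noteq> 0" for k by (simp add: h_def del: of_nat_Suc of_real_inverse)
  define e where "e = (r - N \<theta>) / 4"
  have e: "0 < e" using th by (simp add: e_def)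
  have re: "r = N \<theta> + 4 * e" by (simp add: e_def field_simps)
  have at0: "((\<lambda>\<zeta>. F (\<theta> + cscale \<zeta> \<sigma>)) has_field_derivative dirD \<sigma> F \<theta>) (at 0)" if "\<sigma> \<in> X" for \<sigma>
    using dirD_deriv[OF F X(1) that, of 0] th by simp
  have l1: "(\<lambda>k. (F (\<theta> + cscale (h k) (\<eta> + \<xi>)) - F \<theta>) / h k) \<longlonglongrightarrow> dirD (\<eta> + \<xi>) F \<theta>"
    using deriv_sequence[OF at0[OF X_add[OF X(2,3)]]] by (simp add: h_def)
  have l2: "(\<lambda>k. (F (\<theta> + cscale (h k) \<eta>) - F \<theta>) / h k) \<longlonglongrightarrow> dirD \<eta> F \<theta>"
    using deriv_sequence[OF at0[OF X(2)]] by (simp add: h_def)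
  have "(\<lambda>\<zeta>. dirD \<xi> F (\<theta> + cscale \<zeta> \<eta>)) field_differentiable at 0"
    using e re by (intro holD(2)[OF dirD_hol[OF F X(3) e] X(1) _ X(2)]) linarith
  then have "isCont (\<lambda>\<zeta>. dirD \<xi> F (\<theta> + cscale \<zeta> \<eta>)) 0"
    by (rule field_differentiable_imp_continuous_at)
  from isCont_tendsto_compose[OF this h0]
  have l3: "(\<lambda>k. dirD \<xi> F (\<theta> + cscale (h k) \<eta>)) \<longlonglongrightarrow> dirD \<xi> F \<theta>" by simp
  define E where "E k = (F (\<theta> + cscale (h k) \<eta> + cscale (h k) \<xi>) - F (\<theta> + cscale (h k) \<eta>) - h k * dirD \<xi> F (\<theta> + cscale (h k) \<eta>)) / h k" for k
  have "E \<longlonglongrightarrow> 0"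
  proof (rule Lim_null_comparison)
    have m: "(\<lambda>k. cmod (h k) * x) \<longlonglongrightarrow> 0" for x
      using tendsto_mult_left_zero[OF tendsto_norm_zero[OF h0]] .
    have "\<forall>\<^sub>F k in sequentially. cmod (h k) * N \<eta> < e" using order_tendstoD(2)[OF m e] .
    moreover have "\<forall>\<^sub>F k in sequentially. cmod (h k) * N \<xi> < e" using order_tendstoD(2)[OF m e] .
    ultimately show "\<forall>\<^sub>F k in sequentially. norm (E k) \<le> cmod (h k) * (2 * C * (N \<xi> / e)\<^sup>2)"
    proof eventually_elim
      case (elim k)
      have s: "\<theta> + cscale (h k) \<eta> \<in> X" using X by (intro X_line)
      have "N (\<theta> + cscale (h k) \<eta>) + 2 * e < r" using N_line[OF X(1,2), of "h k"] elim e re by linarith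
      then have "cmod (F (\<theta> + cscale (h k) \<eta> + cscale (h k) \<xi>) - F (\<theta> + cscale (h k) \<eta>) - h k * dirD \<xi> F (\<theta> + cscale (h k) \<eta>))
          \<le> 2 * C * (N \<xi> / e)\<^sup>2 * (cmod (h k))\<^sup>2"
        using elim by (intro second_order[OF F s X(3) False e]) auto
      then show ?case using hn[of k]
        by (simp add: E_def norm_divide pos_divide_le_eq power2_eq_square mult_ac)
    qed
    show "(\<lambda>k. cmod (h k) * (2 * C * (N \<xi> / e)\<^sup>2)) \<longlonglongrightarrow> 0" by (rule m)
  qed
  then have "(\<lambda>k. E k + dirD \<xi> F (\<theta> + cscale (h k) \<eta>) + (F (\<theta> + cscale (h k) \<eta>) - F \<theta>) / h k) \<longlonglongrightarrow> 0 + dirD \<xi> F \<theta> + dirD \<eta> F \<theta>"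
    by (intro tendsto_add l2 l3)
  moreover have "E k + dirD \<xi> F (\<theta> + cscale (h k) \<eta>) + (F (\<theta> + cscale (h k) \<eta>) - F \<theta>) / h k = (F (\<theta> + cscale (h k) (\<eta> + \<xi>)) - F \<theta>) / h k" for k
    using hn[of k] by (simp add: E_def diff_divide_distrib cscale_add_right add.assoc)
  ultimately have "(\<lambda>k. (F (\<theta> + cscale (h k) (\<eta> + \<xi>)) - F \<theta>) / h k) \<longlonglongrightarrow> dirD \<xi> F \<theta> + dirD \<eta> F \<theta>" by simp
  then show ?thesis using LIMSEQ_unique[OF l1] by simp
qed (simp add: dirD_zero)

lemma dirD_cscale:
  assumes F: "hol r C F" and X: "\<theta> \<in> X" "\<eta> \<in> X" and th: "N \<theta> < r"
  shows "dirD (cscale c \<eta>) F \<theta> = c * dirD \<eta> F \<theta>"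
proof -
  have "((\<lambda>\<zeta>. F (\<theta> + cscale \<zeta> \<eta>)) has_field_derivative dirD \<eta> F \<theta>) (at (0 * c))"
    using dirD_deriv[OF F X, of 0] th by simp
  moreover have "((\<lambda>\<zeta>. \<zeta> * c) has_field_derivative 1 * c) (at 0)" by (rule DERIV_cmult_right[OF DERIV_ident])
  ultimately have "((\<lambda>\<zeta>. F (\<theta> + cscale (\<zeta> * c) \<eta>)) has_field_derivative dirD \<eta> F \<theta> * (1 * c)) (at 0)"
    by (rule DERIV_chain2)
  then have "((\<lambda>\<zeta>. F (\<theta> + cscale \<zeta> (cscale c \<eta>))) has_field_derivative c * dirD \<eta> F \<theta>) (at 0)"
    by (simp add: cscale_cscale mult.commute)
  then show ?thesis unfolding dirD_def[of "cscale c \<eta>"] by (rule DERIV_imp_deriv)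
qed

lemma dirD_combination:
  assumes "hol r C F" "hol r C' G" "\<theta> \<in> X" "\<eta> \<in> X" "N \<theta> < r"
  shows "dirD \<eta> (\<lambda>\<theta>. a * F \<theta> + b * G \<theta>) \<theta> = a * dirD \<eta> F \<theta> + b * dirD \<eta> G \<theta>"
proof -
  have "((\<lambda>\<zeta>. a * F (\<theta> + cscale \<zeta> \<eta>) + b * G (\<theta> + cscale \<zeta> \<eta>)) has_field_derivative a * dirD \<eta> F \<theta> + b * dirD \<eta> G \<theta>) (at 0)"
    using dirD_deriv[OF assms(1,3,4), of 0] dirD_deriv[OF assms(2,3,4), of 0] assms(5)
    by (intro DERIV_add DERIV_cmult) auto
  then show ?thesis unfolding dirD_def[of \<eta> "\<lambda>\<theta>. a * F \<theta> + b * G \<theta>"] by (rule DERIV_imp_deriv)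
qed

lemma iterD_cong:
  assumes "0 < r" "\<And>\<theta>. \<theta> \<in> X \<Longrightarrow> N \<theta> < r \<Longrightarrow> F \<theta> = G \<theta>" "set \<theta>s \<subseteq> X"
  shows "iterD F \<theta>s = iterD G \<theta>s"
  using assms(2,3)
proof (induction \<theta>s arbitrary: F G)
  case Nil
  then show ?case using assms(1) X_zero by simp
next
  case (Cons \<eta> \<theta>s)
  have eta: "\<eta> \<in> X" using Cons.prems by simp
  have "dirD \<eta> F \<theta> = dirD \<eta> G \<theta>" if "\<theta> \<in> X" "N \<theta> < r" for \<theta>
    unfolding dirD_def
  proof (rule deriv_cong_ev)
    define \<rho> where "\<rho> = (r - N \<theta>) / (N \<eta> + 1)"
    have rho: "0 < \<rho>" using that(2) N_nonneg[OF eta] by (simp add: \<rho>_def)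
    have "\<forall>\<^sub>F \<zeta> in nhds 0. \<zeta> \<in> ball 0 \<rho>" using rho by (intro eventually_nhds_in_open) auto
    then show "\<forall>\<^sub>F \<zeta> in nhds 0. F (\<theta> + cscale \<zeta> \<eta>) = G (\<theta> + cscale \<zeta> \<eta>)"
    proof eventually_elim
      case (elim \<zeta>)
      have "cmod \<zeta> * (N \<eta> + 1) < r - N \<theta>"
        using elim N_nonneg[OF eta] by (simp add: \<rho>_def pos_less_divide_eq)
      then have "N \<theta> + cmod \<zeta> * N \<eta> < r" using norm_ge_zero[of \<zeta>] by (simp add: algebra_simps del: norm_ge_zero)
      then have "N (\<theta> + cscale \<zeta> \<eta>) < r" using N_line[OF that(1) eta, of \<zeta>] by linarith
      then show ?case using that eta by (intro Cons.prems X_line)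
    qed
  qed simp
  then show ?case using Cons.IH[of "dirD \<eta> F" "dirD \<eta> G"] Cons.prems(2) by simp
qed

lemma iterD_combination:
  assumes "0 < r" "hol r C F" "hol r C' G" "set \<theta>s \<subseteq> X"
  shows "iterD (\<lambda>\<theta>. a * F \<theta> + b * G \<theta>) \<theta>s = a * iterD F \<theta>s + b * iterD G \<theta>s"
  using assms
proof (induction \<theta>s arbitrary: F G C C' r)
  case (Cons \<eta> \<theta>s)
  have eta: "\<eta> \<in> X" "set \<theta>s \<subseteq> X" using Cons.prems by auto
  have "iterD (dirD \<eta> (\<lambda>\<theta>. a * F \<theta> + b * G \<theta>)) \<theta>s = iterD (\<lambda>\<theta>. a * dirD \<eta> F \<theta> + b * dirD \<eta> G \<theta>) \<theta>s"
    by (rule iterD_cong[OF Cons.prems(1)]) (use dirD_combination[OF Cons.prems(2,3)] eta in auto)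
  also have "\<dots> = a * iterD (dirD \<eta> F) \<theta>s + b * iterD (dirD \<eta> G) \<theta>s"
    using Cons.prems(1) dirD_hol[OF Cons.prems(2) eta(1), of "r / 2"] dirD_hol[OF Cons.prems(3) eta(1), of "r / 2"] eta(2)
    by (intro Cons.IH[of "r / 2"]) auto
  finally show ?case by simp
qed simp

lemma iterD_slot:
  assumes "0 < r" "hol r C F" "\<eta> \<in> X" "\<xi> \<in> X" "set \<theta>s \<subseteq> X"
  shows "iterD F ((cscale a \<eta> + cscale b \<xi>) # \<theta>s) = a * iterD F (\<eta> # \<theta>s) + b * iterD F (\<xi> # \<theta>s)"
proof -
  have "iterD (dirD (cscale a \<eta> + cscale b \<xi>) F) \<theta>s = iterD (\<lambda>\<theta>. a * dirD \<eta> F \<theta> + b * dirD \<xi> F \<theta>) \<theta>s"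
  proof (rule iterD_cong[OF assms(1)])
    fix \<theta> assume t: "\<theta> \<in> X" "N \<theta> < r"
    show "dirD (cscale a \<eta> + cscale b \<xi>) F \<theta> = a * dirD \<eta> F \<theta> + b * dirD \<xi> F \<theta>"
      using dirD_add[OF assms(2) t(1) X_scale[OF assms(3)] X_scale[OF assms(4)] t(2)]
        dirD_cscale[OF assms(2) t(1) assms(3) t(2)] dirD_cscale[OF assms(2) t(1) assms(4) t(2)] by simp
  qed (rule assms(5))
  also have "\<dots> = a * iterD (dirD \<eta> F) \<theta>s + b * iterD (dirD \<xi> F) \<theta>s"
    using assms(1,5) dirD_hol[OF assms(2,3), of "r / 2"] dirD_hol[OF assms(2,4), of "r / 2"]
    by (intro iterD_combination[of "r / 2"]) auto
  finally show ?thesis by simp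
qed

lemma iterD_slot_sum:
  assumes "0 < r" "hol r C F" "\<And>e. e \<in> A \<Longrightarrow> \<psi> e \<in> X" "set \<theta>s \<subseteq> X"
  shows "iterD F ((\<Sum>e\<in>A. cscale (c e) (\<psi> e)) # \<theta>s) = (\<Sum>e\<in>A. c e * iterD F (\<psi> e # \<theta>s))"
proof -
  have z: "iterD F (0 # \<theta>s) = 0" using iterD_slot[OF assms(1,2) X_zero X_zero assms(4), of 0 0] by simp
  show ?thesis using assms(3)
  proof (induction A rule: infinite_finite_induct)
    case (insert e A)
    then have "(\<Sum>e\<in>A. cscale (c e) (\<psi> e)) \<in> X" by (intro X_sum X_scale) auto
    then have "iterD F ((cscale (c e) (\<psi> e) + cscale 1 (\<Sum>e\<in>A. cscale (c e) (\<psi> e))) # \<theta>s) =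
       c e * iterD F (\<psi> e # \<theta>s) + 1 * iterD F ((\<Sum>e\<in>A. cscale (c e) (\<psi> e)) # \<theta>s)"
      using insert.prems by (intro iterD_slot[OF assms(1,2) _ _ assms(4)]) auto
    then show ?case using insert by simp
  qed (use z in \<open>simp_all del: iterD.simps\<close>)
qed

text \<open>Expansion of a differential on the diagonal by multilinearity; additivity is used in the
  head slot only, the recursion passing to the derivative \<open>dirD (\<psi> e) F\<close>.\<close>

lemma iterD_expand:
  assumes "0 < r" "hol r C F" "\<And>e. e \<in> A \<Longrightarrow> \<psi> e \<in> X"
  shows "iterD F (replicate n (\<Sum>e\<in>A. cscale (c e) (\<psi> e))) =
    (\<Sum>es\<in>lists_len A n. prod_list (map c es) * iterD F (map \<psi> es))"
  using assms(1,2)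
proof (induction n arbitrary: F r C)
  case (Suc n)
  let ?w = "\<Sum>e\<in>A. cscale (c e) (\<psi> e)"
  have w: "?w \<in> X" using assms(3) by (intro X_sum X_scale)
  have "iterD F (?w # replicate n ?w) = (\<Sum>e\<in>A. c e * iterD F (\<psi> e # replicate n ?w))"
    using w by (intro iterD_slot_sum[OF Suc.prems assms(3)]) auto
  also have "\<dots> = (\<Sum>e\<in>A. c e * (\<Sum>es\<in>lists_len A n. prod_list (map c es) * iterD (dirD (\<psi> e) F) (map \<psi> es)))"
  proof (rule sum.cong[OF refl])
    fix e assume "e \<in> A"
    then have "iterD (dirD (\<psi> e) F) (replicate n ?w) = (\<Sum>es\<in>lists_len A n. prod_list (map c es) * iterD (dirD (\<psi> e) F) (map \<psi> es))"
      using Suc.prems(1) dirD_hol[OF Suc.prems(2) assms(3), of e "r / 2"] by (intro Suc.IH[of "r / 2"]) auto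
    then show "c e * iterD F (\<psi> e # replicate n ?w) = c e * (\<Sum>es\<in>lists_len A n. prod_list (map c es) * iterD (dirD (\<psi> e) F) (map \<psi> es))"
      by simp
  qed
  finally show ?case by (simp add: sum_lists_len_Suc sum_distrib_left mult.assoc)
qed simp

text \<open>Every differentiation costs \<open>\<delta>\<close> of the radius and a factor
  \<open>N \<eta> / \<delta>\<close>, so that \<open>length \<theta>s\<close> steps of size
  \<open>\<delta>\<close> have to fit below \<open>r\<close>.\<close>

lemma iterD_bound:
  assumes "hol r C F" "set \<theta>s \<subseteq> X" "0 < \<delta>" "real (length \<theta>s) * \<delta> < r"
  shows "cmod (iterD F \<theta>s) \<le> C * prod_list (map N \<theta>s) / \<delta> ^ length \<theta>s"
  using assms(1,2,4)
proof (induction \<theta>s arbitrary: F r C)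
  case Nil
  then show ?case using holD(1)[OF Nil(1) X_zero] by simp
next
  case (Cons \<eta> \<theta>s)
  have "cmod (iterD (dirD \<eta> F) \<theta>s) \<le> (C * N \<eta> / \<delta>) * prod_list (map N \<theta>s) / \<delta> ^ length \<theta>s"
    using Cons.prems assms(3) by (intro Cons.IH[OF dirD_hol[OF Cons.prems(1) _ assms(3)]]) (auto simp: algebra_simps)
  then show ?case by (simp add: mult_ac)
qed

lemma hol_taylor:
  assumes "hol r C F" "\<theta> \<in> X" "N \<theta> < r"
  shows "(\<lambda>n. iterD F (replicate n \<theta>) / fact n) sums F \<theta>"
proof -
  have r: "0 < r" using assms(3) N_nonneg[OF assms(2)] by linarith
  \<comment> \<open>The disc on the line must contain the point 1 in its interior. If
    \<open>N \<theta> = 0\<close>, the whole line stays in the ball, and 2 is an arbitrary radius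
    above 1.\<close>
  define R where "R = (if N \<theta> = 0 then 2 else r / N \<theta>)"
  have R: "1 < R" using assms(3) N_nonneg[OF assms(2)] by (auto simp: R_def)
  have "N (0 + cscale \<zeta> \<theta>) < r" if "\<zeta> \<in> ball 0 R" for \<zeta>
  proof (cases "N \<theta> = 0")
    case False
    then have "0 < N \<theta>" using N_nonneg[OF assms(2)] by simp
    then show ?thesis using that False N_scale[OF assms(2)] by (simp add: R_def pos_less_divide_eq)
  qed (use r N_scale[OF assms(2)] in simp)
  then have "(\<lambda>\<zeta>. F (0 + cscale \<zeta> \<theta>)) holomorphic_on ball 0 R" by (rule hol_line[OF assms(1) X_zero assms(2)])
  then have "(\<lambda>\<zeta>. F (cscale \<zeta> \<theta>)) holomorphic_on ball 0 R" by simp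
  from holomorphic_power_series[OF this, of 1]
  show ?thesis using R by (simp add: iterD_replicate)
qed

lemma hol_lipschitz:
  assumes F: "hol r C F" and X: "\<theta> \<in> X" "\<eta> \<in> X" and d: "0 < \<delta>" "N \<theta> + \<delta> < r" "N \<eta> + \<delta> < r"
  shows "cmod (F \<theta> - F \<eta>) \<le> C / \<delta> * N (\<theta> - \<eta>)"
proof -
  have x: "\<theta> - \<eta> \<in> X" using X X_diff by blast
  let ?f = "\<lambda>\<zeta>. F (\<eta> + cscale \<zeta> (\<theta> - \<eta>))"
  have b: "N (\<eta> + cscale z (\<theta> - \<eta>)) + \<delta> < r" if z: "z \<in> closed_segment 0 1" for z
  proof -
    obtain u where u: "z = complex_of_real u" "0 \<le> u" "u \<le> 1"
      using z by (auto simp: in_segment scaleR_conv_of_real)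
    have "\<eta> + cscale z (\<theta> - \<eta>) = cscale (of_real (1 - u)) \<eta> + cscale (of_real u) \<theta>"
      by (simp add: u(1) cscale_diff_left cscale_diff_right)
    then have "N (\<eta> + cscale z (\<theta> - \<eta>)) \<le> N (cscale (of_real (1 - u)) \<eta>) + N (cscale (of_real u) \<theta>)"
      using X by (auto intro!: N_triangle X_scale)
    also have "\<dots> = (1 - u) * N \<eta> + u * N \<theta>"
      using u X by (simp add: N_scale norm_of_real del: of_real_diff)
    also have "\<dots> \<le> (1 - u) * max (N \<eta>) (N \<theta>) + u * max (N \<eta>) (N \<theta>)"
      using u by (intro add_mono mult_left_mono) auto
    also have "\<dots> = max (N \<eta>) (N \<theta>)" by (simp add: algebra_simps)
    finally show ?thesis using d by linarith
  qed
  have "cmod (?f 1 - ?f 0) \<le> (C * N (\<theta> - \<eta>) / \<delta>) * cmod (1 - 0)"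
  proof (rule field_differentiable_bound[where S = "closed_segment 0 1" and f' = "\<lambda>z. dirD (\<theta> - \<eta>) F (\<eta> + cscale z (\<theta> - \<eta>))"])
    show "(?f has_field_derivative dirD (\<theta> - \<eta>) F (\<eta> + cscale z (\<theta> - \<eta>))) (at z within closed_segment 0 1)"
      if "z \<in> closed_segment 0 1" for z
      using b[OF that] d(1) by (intro has_field_derivative_at_within[OF dirD_deriv[OF F X(2) x]]) linarith
    show "cmod (dirD (\<theta> - \<eta>) F (\<eta> + cscale z (\<theta> - \<eta>))) \<le> C * N (\<theta> - \<eta>) / \<delta>" if "z \<in> closed_segment 0 1" for z
      using X x by (intro dirD_bound[OF F _ x d(1) b[OF that]] X_line)
  qed auto
  then show ?thesis by simp
qed

text \<open>On a small disc the restrictions of \<open>F\<close> to the lines of \<open>s k\<close>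
  and of \<open>\<theta>\<close> differ by a multiple of \<open>N (s k - \<theta>)\<close>, by the
  Lipschitz estimate; Cauchy's inequality passes this on to the derivatives at 0.\<close>

lemma iterD_tendsto:
  assumes F: "hol r C F" "0 < r" and X: "\<theta> \<in> X" "\<And>k. s k \<in> X" and lim: "(\<lambda>k. N (s k - \<theta>)) \<longlonglongrightarrow> 0"
  shows "(\<lambda>k. iterD F (replicate n (s k))) \<longlonglongrightarrow> iterD F (replicate n \<theta>)"
proof (rule Lim_null_comparison[THEN LIM_zero_cancel])
  \<comment> \<open>Since \<open>\<rho> * (N \<theta> + 1) = r / 3\<close>, the scaled points stay
    in the closed ball of radius \<open>r / 3\<close>, which leaves the margin \<open>r / 3\<close>
    for \<open>hol_lipschitz\<close>.\<close>
  define \<rho> where "\<rho> = r / (3 * (N \<theta> + 1))"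
  have nt: "0 \<le> N \<theta>" using N_nonneg[OF X(1)] .
  have rho: "0 < \<rho>" using F(2) nt by (simp add: \<rho>_def)
  have "N \<theta> + 1 \<noteq> 0" using nt by simp
  then have rr: "\<rho> * (N \<theta> + 1) = r / 3" unfolding \<rho>_def times_divide_eq_left
    by (subst mult_divide_mult_cancel_right[of "N \<theta> + 1"]) auto
  have small: "N (cscale \<zeta> \<sigma>) + r / 3 < r" if "\<zeta> \<in> cball 0 \<rho>" "\<sigma> \<in> X" "N \<sigma> \<le> N \<theta> + 1" for \<zeta> \<sigma>
  proof -
    have "cmod \<zeta> * N \<sigma> \<le> \<rho> * (N \<theta> + 1)" using that rho N_nonneg by (intro mult_mono) auto
    then show ?thesis using N_scale[OF that(2)] rr F(2) by simp
  qed
  have "\<forall>\<^sub>F k in sequentially. N (s k - \<theta>) < 1" using order_tendstoD(2)[OF lim, of 1] by simp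
  then show "\<forall>\<^sub>F k in sequentially. norm (iterD F (replicate n (s k)) - iterD F (replicate n \<theta>)) \<le>
      (fact n * (3 * C / r * \<rho>) / \<rho> ^ n) * N (s k - \<theta>)"
  proof eventually_elim
    case (elim k)
    have d: "s k - \<theta> \<in> X" using X X_diff by blast
    have sk: "N (s k) \<le> N \<theta> + 1" using N_triangle[OF d X(1)] elim by simp
    have h: "(\<lambda>\<zeta>. F (cscale \<zeta> \<sigma>)) holomorphic_on cball 0 \<rho>" if "\<sigma> \<in> X" "N \<sigma> \<le> N \<theta> + 1" for \<sigma>
    proof -
      have "(\<lambda>\<zeta>. F (0 + cscale \<zeta> \<sigma>)) holomorphic_on cball 0 \<rho>"
        using small[OF _ that] F(2) by (intro hol_line[OF F(1) X_zero that(1)]) fastforce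
      then show ?thesis by simp
    qed
    note hs = h[OF X(2) sk] and ht = h[OF X(1), simplified]
    have hb: "(\<lambda>\<zeta>. F (cscale \<zeta> (s k))) holomorphic_on ball 0 \<rho>" "(\<lambda>\<zeta>. F (cscale \<zeta> \<theta>)) holomorphic_on ball 0 \<rho>"
      using holomorphic_on_subset[OF hs ball_subset_cball] holomorphic_on_subset[OF ht ball_subset_cball] by auto
    have "(deriv ^^ n) (\<lambda>\<zeta>. F (cscale \<zeta> (s k)) - F (cscale \<zeta> \<theta>)) 0 = iterD F (replicate n (s k)) - iterD F (replicate n \<theta>)"
      using higher_deriv_diff[OF hb open_ball, of 0 n] rho by (simp add: iterD_replicate)
    moreover have "norm ((deriv ^^ n) (\<lambda>\<zeta>. F (cscale \<zeta> (s k)) - F (cscale \<zeta> \<theta>)) 0) \<le> fact n * (3 * C / r * \<rho> * N (s k - \<theta>)) / \<rho> ^ n"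
    proof (rule Cauchy_inequality)
      show "(\<lambda>\<zeta>. F (cscale \<zeta> (s k)) - F (cscale \<zeta> \<theta>)) holomorphic_on ball 0 \<rho>" using hb by (intro holomorphic_on_diff)
      show "continuous_on (cball 0 \<rho>) (\<lambda>\<zeta>. F (cscale \<zeta> (s k)) - F (cscale \<zeta> \<theta>))"
        using hs ht by (intro holomorphic_on_imp_continuous_on holomorphic_on_diff)
      show "norm (F (cscale \<zeta> (s k)) - F (cscale \<zeta> \<theta>)) \<le> 3 * C / r * \<rho> * N (s k - \<theta>)" if "norm (0 - \<zeta>) = \<rho>" for \<zeta>
      proof -
        have z: "\<zeta> \<in> cball 0 \<rho>" using that by simp
        have "cmod (F (cscale \<zeta> (s k)) - F (cscale \<zeta> \<theta>)) \<le> C / (r / 3) * N (cscale \<zeta> (s k) - cscale \<zeta> \<theta>)"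
          using small[OF z X(2) sk] small[OF z X(1)] F(2) X by (intro hol_lipschitz[OF F(1)] X_scale) auto
        also have "N (cscale \<zeta> (s k) - cscale \<zeta> \<theta>) = \<rho> * N (s k - \<theta>)"
          unfolding cscale_diff_right[symmetric] using N_scale[OF d] that by simp
        finally show ?thesis by (simp add: mult_ac)
      qed
    qed (rule rho)
    ultimately show ?case by (simp add: mult_ac)
  qed
  show "(\<lambda>k. (fact n * (3 * C / r * \<rho>) / \<rho> ^ n) * N (s k - \<theta>)) \<longlonglongrightarrow> 0"
    using tendsto_mult_right_zero[OF lim] .
qed

end

text \<open>A crude form of Stirling's formula: the left side divided by \<open>fact n\<close> is a
  single term of the exponential series at \<open>n + 1\<close>.\<close>

lemma power_le_fact_exp: "real (n + 1) ^ n \<le> exp (real (n + 1)) * fact n"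
proof -
  let ?x = "real (n + 1)"
  have s: "(\<lambda>k. ?x ^ k / fact k) sums exp ?x"
    using exp_converges[of ?x] by (simp add: divide_inverse mult.commute scaleR_conv_of_real)
  have "(\<Sum>k\<in>{n}. ?x ^ k / fact k) \<le> (\<Sum>k. ?x ^ k / fact k)"
    by (rule sum_le_suminf[OF sums_summable[OF s]]) auto
  then have "?x ^ n / fact n \<le> exp ?x" using sums_unique[OF s] by simp
  then show ?thesis by (simp add: divide_le_eq)
qed

lemma sum_lists_prod:
  fixes g :: "'a \<Rightarrow> 'c::comm_semiring_1"
  shows "(\<Sum>es\<in>lists_len A n. prod_list (map g es)) = (\<Sum>a\<in>A. g a) ^ n"
  by (induction n) (simp_all add: sum_lists_len_Suc sum_distrib_right flip: sum_distrib_left)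

lemma prod_list_power2: "(prod_list (map f xs))\<^sup>2 = prod_list (map (\<lambda>x. (f x)\<^sup>2) xs)"
  for f :: "'a \<Rightarrow> real"
  by (induction xs) (simp_all add: power_mult_distrib)

context nuclear_triple
begin

section \<open>Norms on the complexified spaces\<close>

lemma HC_D: "\<theta> \<in> HC p \<Longrightarrow> fst \<theta> \<in> H p" "\<theta> \<in> HC p \<Longrightarrow> snd \<theta> \<in> H p"
  by (auto simp: HC_def)

lemma nrmC_triangle:
  assumes "\<theta> \<in> HC p" "\<eta> \<in> HC p"
  shows "nrmC p (\<theta> + \<eta>) \<le> nrmC p \<theta> + nrmC p \<eta>"
proof -
  note m = HC_D[OF assms(1)] HC_D[OF assms(2)]
  have "nrmC p (\<theta> + \<eta>) \<le> sqrt ((nrm p (fst \<theta>) + nrm p (fst \<eta>))\<^sup>2 + (nrm p (snd \<theta>) + nrm p (snd \<eta>))\<^sup>2)"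
    unfolding nrmC_def using m
    by (intro real_sqrt_le_mono add_mono power_mono) (auto intro!: nrm_triangle nrm_nonneg H_add)
  also have "\<dots> \<le> nrmC p \<theta> + nrmC p \<eta>"
    unfolding nrmC_def by (rule real_sqrt_sum_squares_triangle_ineq)
  finally show ?thesis .
qed

lemma nrmC_cscale:
  assumes "\<theta> \<in> HC p"
  shows "nrmC p (cscale c \<theta>) = cmod c * nrmC p \<theta>"
proof -
  obtain u v where t: "\<theta> = (u, v)" by (cases \<theta>)
  have m: "u \<in> H p" "v \<in> H p" using HC_D[OF assms] t by auto
  have sc: "a *\<^sub>R u \<in> H p" "a *\<^sub>R v \<in> H p" for a using m H_scale by auto
  have e1: "(nrm p (Re c *\<^sub>R u - Im c *\<^sub>R v))\<^sup>2 = (Re c)\<^sup>2 * ip p u u - 2 * Re c * Im c * ip p u v + (Im c)\<^sup>2 * ip p v v"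
    unfolding nrm_sq[OF H_diff[OF sc(1) sc(2)]] using m sc by (simp add: H_diff ip_diff ip_diff_right ip_scale ip_scale_right ip_commute[of v p u] power2_eq_square algebra_simps)
  have e2: "(nrm p (Re c *\<^sub>R v + Im c *\<^sub>R u))\<^sup>2 = (Re c)\<^sup>2 * ip p v v + 2 * Re c * Im c * ip p u v + (Im c)\<^sup>2 * ip p u u"
    unfolding nrm_sq[OF H_add[OF sc(2) sc(1)]] using m sc by (simp add: H_add ip_add ip_add_right ip_scale ip_scale_right ip_commute[of v p u] power2_eq_square algebra_simps)
  have "(nrmC p (cscale c \<theta>))\<^sup>2 = (cmod c)\<^sup>2 * (nrmC p \<theta>)\<^sup>2"
    unfolding nrmC_sq cmod_power2 t cscale_def fst_conv snd_conv e1 e2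
    using m by (simp add: nrm_sq algebra_simps)
  then have "(nrmC p (cscale c \<theta>))\<^sup>2 = (cmod c * nrmC p \<theta>)\<^sup>2" by (simp add: power_mult_distrib)
  then show ?thesis by (rule power2_eq_imp_eq) (simp_all add: nrmC_nonneg)
qed

lemma nrmC_mono: "p \<le> q \<Longrightarrow> \<theta> \<in> HC q \<Longrightarrow> nrmC p \<theta> \<le> nrmC q \<theta>"
  unfolding nrmC_def using HC_D[of \<theta> q] H_mono[of p q]
  by (intro real_sqrt_le_mono add_mono power_mono nrm_mono_le nrm_nonneg) auto

lemma nrmC_eq_0:
  assumes "\<theta> \<in> HC p" "nrmC p \<theta> = 0" shows "\<theta> = 0"
proof -
  have "(nrm p (fst \<theta>))\<^sup>2 + (nrm p (snd \<theta>))\<^sup>2 = 0" using assms(2) by (simp add: nrmC_def)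
  then have "nrm p (fst \<theta>) = 0" "nrm p (snd \<theta>) = 0" by (auto simp: add_nonneg_eq_0_iff)
  then show ?thesis using nrm_eq_0 HC_D[OF assms(1)] by (simp add: prod_eq_iff)
qed

lemma HC_closed: "0 \<in> HC p" "\<theta> \<in> HC p \<Longrightarrow> \<eta> \<in> HC p \<Longrightarrow> \<theta> + \<eta> \<in> HC p" "\<theta> \<in> HC p \<Longrightarrow> cscale c \<theta> \<in> HC p"
  by (auto simp: HC_def cscale_def zero_prod_def intro!: H_add H_diff H_scale)

lemma nucC_closed: "0 \<in> nucC" "\<theta> \<in> nucC \<Longrightarrow> \<eta> \<in> nucC \<Longrightarrow> \<theta> + \<eta> \<in> nucC" "\<theta> \<in> nucC \<Longrightarrow> cscale c \<theta> \<in> nucC"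
  by (auto simp: nucC_def cscale_def zero_prod_def subspace_0[OF subspace_nuc]
      intro!: subspace_add[OF subspace_nuc] subspace_diff[OF subspace_nuc] subspace_scale[OF subspace_nuc])

sublocale HC: complex_normed "HC p" "nrmC p" for p
  by unfold_locales (auto intro: HC_closed nrmC_triangle nrmC_nonneg nrmC_eq_0 simp: nrmC_cscale)

sublocale NC: complex_normed nucC "nrmC p" for p
  by unfold_locales
    (auto intro: nucC_closed nrmC_triangle nrmC_nonneg nrmC_eq_0[of _ p] nucC_D simp: nrmC_cscale nucC_D)

subsection \<open>Kernels of holomorphic functions\<close>

lemma pairing_scale_sum:
  assumes "\<theta> \<in> nucC" "finite B" "B \<subseteq> nuc"
  shows "(\<Sum>e\<in>B. cscale (pairing (riesz q e) \<theta>) (e, 0)) = (proj q B (fst \<theta>), proj q B (snd \<theta>))"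
  using nucC_D[OF assms(1)]
  by (auto simp: prod_eq_iff fst_sum snd_sum cscale_def pairing_def riesz_def proj_def)

text \<open>The choice \<open>\<delta> = r / (n + 1)\<close> in \<open>iterD_bound\<close> produces
  \<open>(n + 1) ^ n / fact n\<close>, which \<open>power_le_fact_exp\<close> absorbs. The remaining
  bound is a product over the entries of \<open>es\<close>, so its squares sum to the
  \<open>n\<close>-th power of a Hilbert-Schmidt sum.\<close>

lemma iterD_sum_bound:
  assumes F: "NC.hol p r C F" "0 < r" and B: "finite B" "B \<subseteq> nuc" and c: "0 \<le> c" "(\<Sum>e\<in>B. (nrm p e)\<^sup>2) \<le> c\<^sup>2"
  shows "(\<Sum>es\<in>lists_len B n. (cmod (iterD F (map (\<lambda>e. (e, 0)) es) / fact n))\<^sup>2) \<le> (C * exp (real (n + 1)) * (c / r) ^ n)\<^sup>2"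
proof -
  have C: "0 \<le> C" using NC.holD(1)[OF F(1) NC.X_zero] F(2) norm_ge_zero[of "F 0"] NC.N_zero by (metis order_trans)
  define \<delta> where "\<delta> = r / real (n + 1)"
  have d: "0 < \<delta>" "real n * \<delta> < r" using F(2) by (auto simp: \<delta>_def field_simps)
  define k where "k = C / (fact n * \<delta> ^ n)"
  have k0: "0 \<le> k" using C d by (simp add: k_def)
  have kle: "k * c ^ n \<le> C * exp (real (n + 1)) * (c / r) ^ n"
  proof -
    have "k * c ^ n = C * (real (n + 1) ^ n / fact n) * (c / r) ^ n"
      using F(2) by (simp add: k_def \<delta>_def power_divide)
    also have "\<dots> \<le> C * exp (real (n + 1)) * (c / r) ^ n"
      using power_le_fact_exp[of n] C c(1) F(2) by (intro mult_right_mono mult_left_mono) (auto simp: divide_le_eq)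
    finally show ?thesis .
  qed
  have "(\<Sum>es\<in>lists_len B n. (cmod (iterD F (map (\<lambda>e. (e, 0)) es) / fact n))\<^sup>2) \<le> (\<Sum>es\<in>lists_len B n. k\<^sup>2 * prod_list (map (\<lambda>e. (nrm p e)\<^sup>2) es))"
  proof (rule sum_mono)
    fix es assume es: "es \<in> lists_len B n"
    have X: "set (map (\<lambda>e. (e, 0)) es) \<subseteq> nucC"
      using es B(2) subspace_0[OF subspace_nuc] by (auto simp: lists_len_def nucC_def)
    have "cmod (iterD F (map (\<lambda>e. (e, 0)) es)) \<le> C * prod_list (map (nrmC p) (map (\<lambda>e. (e, 0)) es)) / \<delta> ^ length (map (\<lambda>e. (e, 0::'h)) es)"
      using es d by (intro NC.iterD_bound[OF F(1) X]) (auto simp: lists_len_def)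
    also have "map (nrmC p) (map (\<lambda>e. (e, 0)) es) = map (nrm p) es"
      using es B(2) nuc_sub_H[of p] by (auto simp: lists_len_def nrmC_def intro!: abs_of_nonneg nrm_nonneg)
    finally have "cmod (iterD F (map (\<lambda>e. (e, 0)) es)) / fact n \<le> (C * prod_list (map (nrm p) es) / \<delta> ^ n) / fact n"
      using es by (intro divide_right_mono) (auto simp: lists_len_def)
    then have "cmod (iterD F (map (\<lambda>e. (e, 0)) es) / fact n) \<le> k * prod_list (map (nrm p) es)"
      by (simp add: k_def norm_divide mult_ac)
    then have "(cmod (iterD F (map (\<lambda>e. (e, 0)) es) / fact n))\<^sup>2 \<le> (k * prod_list (map (nrm p) es))\<^sup>2"
      by (rule power_mono) simp
    then show "(cmod (iterD F (map (\<lambda>e. (e, 0)) es) / fact n))\<^sup>2 \<le> k\<^sup>2 * prod_list (map (\<lambda>e. (nrm p e)\<^sup>2) es)"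
      by (simp only: power_mult_distrib prod_list_power2)
  qed
  also have "\<dots> = k\<^sup>2 * (\<Sum>e\<in>B. (nrm p e)\<^sup>2) ^ n"
    by (simp only: sum_lists_prod flip: sum_distrib_left)
  also have "\<dots> \<le> k\<^sup>2 * (c\<^sup>2) ^ n"
    using c(2) by (intro mult_left_mono power_mono sum_nonneg) auto
  also have "\<dots> = (k * c ^ n)\<^sup>2" by (simp add: power_mult_distrib mult.commute flip: power_mult)
  also have "\<dots> \<le> (C * exp (real (n + 1)) * (c / r) ^ n)\<^sup>2"
    using kle k0 c(1) by (intro power_mono) auto
  finally show ?thesis .
qed

text \<open>The order of the quantifiers matters: \<open>q\<close> and \<open>c\<close> depend on
  \<open>p\<close> only, and one sequence \<open>K\<close> serves every admissible pair
  \<open>r\<close>, \<open>C\<close>, so that the radius may later vary with \<open>n\<close>. The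
  kernel sums, over all words in an orthonormal basis of \<open>H q\<close>, the Taylor coefficient
  of \<open>F\<close> at the word times the coordinate of \<open>t\<close>; Cauchy-Schwarz combines
  \<open>iterD_sum_bound\<close> with the norm of \<open>t\<close>.\<close>

lemma kernel_theorem:
  "\<exists>q>p. \<exists>c\<ge>0. \<forall>F. (\<exists>r C. 0 < r \<and> NC.hol p r C F) \<longrightarrow>
     (\<exists>K. (\<forall>n. K n \<in> tensors_dual n) \<and>
       (\<forall>r C. 0 < r \<longrightarrow> NC.hol p r C F \<longrightarrow>
          (\<forall>n. \<forall>t\<in>tensors n. cmod (K n t) \<le> C * exp (real (n + 1)) * (c / r) ^ n * tensor_norm q n t) \<and>
          (\<forall>\<theta>\<in>nucC. nrmC p \<theta> < r \<longrightarrow> (\<lambda>n. K n (tensor_power n \<theta>)) sums F \<theta>)))"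
proof -
  obtain q c where q: "p < q" "0 \<le> c" "\<forall>E. finite E \<longrightarrow> orthonormal q E \<longrightarrow> (\<Sum>e\<in>E. (nrm p e)\<^sup>2) \<le> c\<^sup>2"
    using hilbert_schmidt_bound[of p] by blast
  obtain B where ex: "exhaustion q B" using exhaustion_exists by blast
  note B = exhaustionD[OF ex]
  define E where "E = (\<Union>N. B N)"
  show ?thesis
  proof (intro exI[of _ q] conjI exI[of _ c] allI impI)
    fix F assume "\<exists>r C. 0 < r \<and> NC.hol p r C F"
    then obtain r0 C0 where F0: "0 < r0" "NC.hol p r0 C0 F" by blast
    define f where "f n t es = (iterD F (map (\<lambda>e. (e, 0)) es) / fact n) * t (map (riesz q) es)" for n t es
    define K where "K n t = (if t \<in> tensors n then infsum (f n t) (lists_len E n) else 0)" for n t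
    have part: "(\<Sum>es\<in>lists_len (B N) n. cmod (f n t es)) \<le> C * exp (real (n + 1)) * (c / r) ^ n * tensor_norm q n t"
      if F: "NC.hol p r C F" "0 < r" and t: "t \<in> tensors n" for n t r C N
    proof (rule power2_le_imp_le)
      have C: "0 \<le> C" using NC.holD(1)[OF F(1) NC.X_zero] F(2) norm_ge_zero[of "F 0"] NC.N_zero by (metis order_trans)
      have "(\<Sum>es\<in>lists_len (B N) n. cmod (f n t es))\<^sup>2 \<le>
          (\<Sum>es\<in>lists_len (B N) n. (cmod (iterD F (map (\<lambda>e. (e, 0)) es) / fact n))\<^sup>2) * (\<Sum>es\<in>lists_len (B N) n. (cmod (t (map (riesz q) es)))\<^sup>2)"
        unfolding f_def norm_mult by (rule Cauchy_Schwarz_ineq_sum)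
      also have "\<dots> \<le> (C * exp (real (n + 1)) * (c / r) ^ n)\<^sup>2 * (tensor_norm q n t)\<^sup>2"
      proof (rule mult_mono)
        show "(\<Sum>es\<in>lists_len (B N) n. (cmod (iterD F (map (\<lambda>e. (e, 0)) es) / fact n))\<^sup>2) \<le> (C * exp (real (n + 1)) * (c / r) ^ n)\<^sup>2"
          using q(3) B(1,2) by (intro iterD_sum_bound[OF F B(1,3) q(2)]) simp
        show "(\<Sum>es\<in>lists_len (B N) n. (cmod (t (map (riesz q) es)))\<^sup>2) \<le> (tensor_norm q n t)\<^sup>2"
          using hsq_le_tensor_norm[of q n t "B N"] t B(1,2) by (simp add: tensors_iff hsq_def)
      qed (auto intro: sum_nonneg)
      finally show "(\<Sum>es\<in>lists_len (B N) n. cmod (f n t es))\<^sup>2 \<le> (C * exp (real (n + 1)) * (c / r) ^ n * tensor_norm q n t)\<^sup>2"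
        by (simp add: power_mult_distrib)
      show "0 \<le> C * exp (real (n + 1)) * (c / r) ^ n * tensor_norm q n t"
        using C q(2) F(2) tensor_norm_nonneg by simp
    qed
    \<comment> \<open>Every finite set of words lies in \<open>lists_len (B N) n\<close> for all
      large \<open>N\<close>. This bounds the finite partial sums by those over the exhaustion and
      identifies the unordered sum with the limit of the latter.\<close>
    have cover: "\<exists>N0. \<forall>N\<ge>N0. X \<subseteq> lists_len (B N) n" if X: "finite X" "X \<subseteq> lists_len E n" for X n
    proof -
      have "\<exists>N0. \<forall>N\<ge>N0. Y \<subseteq> B N" if "finite Y" "Y \<subseteq> E" for Y
        using that
      proof (induction Y)
        case (insert y Y)
        then obtain N1 where N1: "\<forall>N\<ge>N1. Y \<subseteq> B N" by auto
        obtain N2 where N2: "y \<in> B N2" using insert.prems by (auto simp: E_def)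
        have "insert y Y \<subseteq> B N" if "N \<ge> max N1 N2" for N
          using that N1 N2 monoD[OF B(4), of N2 N] by auto
        then show ?case by blast
      qed simp
      from this[of "\<Union>(set ` X)"] obtain N0 where "\<forall>N\<ge>N0. \<Union>(set ` X) \<subseteq> B N"
        using X by (auto simp: lists_len_def)
      then have "\<forall>N\<ge>N0. X \<subseteq> lists_len (B N) n" using X(2) by (auto simp: lists_len_def)
      then show ?thesis by blast
    qed
    have summable: "f n t summable_on lists_len E n" if t: "t \<in> tensors n" for n t
    proof (rule abs_summable_summable, rule nonneg_bdd_above_summable_on)
      show "bdd_above (sum (\<lambda>es. norm (f n t es)) ` {Y. Y \<subseteq> lists_len E n \<and> finite Y})"
      proof (rule bdd_aboveI2)
        fix Y assume Y: "Y \<in> {Y. Y \<subseteq> lists_len E n \<and> finite Y}"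
        then obtain N where "Y \<subseteq> lists_len (B N) n" using cover[of Y n] by blast
        then have "(\<Sum>es\<in>Y. norm (f n t es)) \<le> (\<Sum>es\<in>lists_len (B N) n. norm (f n t es))"
          using B(1) by (intro sum_mono2) auto
        also have "\<dots> \<le> C0 * exp (real (n + 1)) * (c / r0) ^ n * tensor_norm q n t" using part[OF F0(2,1) t] .
        finally show "(\<Sum>es\<in>Y. norm (f n t es)) \<le> C0 * exp (real (n + 1)) * (c / r0) ^ n * tensor_norm q n t" .
      qed
    qed simp
    have lim: "(\<lambda>N. \<Sum>es\<in>lists_len (B N) n. f n t es) \<longlonglongrightarrow> K n t" if t: "t \<in> tensors n" for n t
    proof -
      have "(sum (f n t) \<longlongrightarrow> infsum (f n t) (lists_len E n)) (finite_subsets_at_top (lists_len E n))"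
        using has_sum_infsum[OF summable[OF t]] by (simp add: has_sum_def)
      moreover have "filterlim (\<lambda>N. lists_len (B N) n) (finite_subsets_at_top (lists_len E n)) sequentially"
        unfolding filterlim_finite_subsets_at_top
      proof (intro allI impI)
        fix Y assume "finite Y \<and> Y \<subseteq> lists_len E n"
        then obtain N0 where "\<forall>N\<ge>N0. Y \<subseteq> lists_len (B N) n" using cover by blast
        moreover have "lists_len (B N) n \<subseteq> lists_len E n" for N by (intro lists_len_mono) (auto simp: E_def)
        ultimately show "\<forall>\<^sub>F N in sequentially. finite (lists_len (B N) n) \<and> Y \<subseteq> lists_len (B N) n \<and> lists_len (B N) n \<subseteq> lists_len E n"
          using B(1) unfolding eventually_sequentially by (intro exI[of _ N0]) simp
      qed
      ultimately have "((\<lambda>N. sum (f n t) (lists_len (B N) n)) \<longlongrightarrow> infsum (f n t) (lists_len E n)) sequentially"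
        by (rule filterlim_compose)
      then show ?thesis using t by (simp add: K_def)
    qed
    have bound: "cmod (K n t) \<le> C * exp (real (n + 1)) * (c / r) ^ n * tensor_norm q n t"
      if F: "NC.hol p r C F" "0 < r" and t: "t \<in> tensors n" for n t r C
    proof (rule LIMSEQ_le_const2[OF tendsto_norm[OF lim[OF t]]], intro exI allI impI)
      fix N show "cmod (\<Sum>es\<in>lists_len (B N) n. f n t es) \<le> C * exp (real (n + 1)) * (c / r) ^ n * tensor_norm q n t"
        using part[OF F t, of N] norm_sum[of "f n t" "lists_len (B N) n"] by linarith
    qed
    have Kd: "K n \<in> tensors_dual n" for n
    proof (rule tensors_dualI[where C = "C0 * exp (real (n + 1)) * (c / r0) ^ n" and p = q])
      have "0 \<le> C0" using NC.holD(1)[OF F0(2) NC.X_zero] F0(1) norm_ge_zero[of "F 0"] NC.N_zero by (metis order_trans)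
      then show "0 \<le> C0 * exp (real (n + 1)) * (c / r0) ^ n" using q(2) F0(1) by simp
      show "cmod (K n t) \<le> C0 * exp (real (n + 1)) * (c / r0) ^ n * tensor_norm q n t" if "t \<in> tensors n" for t
        using bound[OF F0(2,1) that] .
      fix s t a b assume st: "s \<in> tensors n" "t \<in> tensors n"
      have "(\<lambda>N. a * (\<Sum>es\<in>lists_len (B N) n. f n s es) + b * (\<Sum>es\<in>lists_len (B N) n. f n t es)) \<longlonglongrightarrow> a * K n s + b * K n t"
        by (intro tendsto_intros lim st)
      moreover have "a * (\<Sum>es\<in>lists_len (B N) n. f n s es) + b * (\<Sum>es\<in>lists_len (B N) n. f n t es) =
          (\<Sum>es\<in>lists_len (B N) n. f n (\<lambda>xs. a * s xs + b * t xs) es)" for N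
        by (simp add: f_def sum_distrib_left sum.distrib algebra_simps)
      ultimately show "K n (\<lambda>xs. a * s xs + b * t xs) = a * K n s + b * K n t"
        using LIMSEQ_unique[OF lim[OF tensors_combination[OF st, of a b]]] by simp
    qed (simp add: K_def)
    \<comment> \<open>By multilinearity the partial sum over \<open>B N\<close> is the differential
      at the projected point \<open>s N\<close>, and \<open>s N\<close> tends to
      \<open>\<theta>\<close> in \<open>nrmC q\<close>, hence in \<open>nrmC p\<close>.\<close>
    have val: "K n (tensor_power n \<theta>) = iterD F (replicate n \<theta>) / fact n" if th: "\<theta> \<in> nucC" for n \<theta>
    proof -
      define s where "s N = (proj q (B N) (fst \<theta>), proj q (B N) (snd \<theta>))" for N
      have sX: "s N \<in> nucC" for N
        unfolding s_def nucC_def using proj_in_subspace[OF subspace_nuc B(3)] by simp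
      note u = nucC_D[OF th] and uH = HC_D[OF nucC_D(3)[OF th, of q]]
      have "(\<lambda>N. nrmC p (s N - \<theta>)) \<longlonglongrightarrow> 0"
      proof (rule Lim_null_comparison)
        show "\<forall>\<^sub>F N in sequentially. norm (nrmC p (s N - \<theta>)) \<le> sqrt ((nrm q (fst \<theta> - proj q (B N) (fst \<theta>)))\<^sup>2 + (nrm q (snd \<theta> - proj q (B N) (snd \<theta>)))\<^sup>2)"
        proof (intro always_eventually allI)
          fix N
          have "nrmC p (s N - \<theta>) \<le> nrmC q (s N - \<theta>)"
            using q(1) NC.X_diff[OF sX th] by (intro nrmC_mono nucC_D(3)) auto
          also have "\<dots> = sqrt ((nrm q (fst \<theta> - proj q (B N) (fst \<theta>)))\<^sup>2 + (nrm q (snd \<theta> - proj q (B N) (snd \<theta>)))\<^sup>2)"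
            using uH proj_in_H[OF B(2)] by (simp add: nrmC_def s_def nrm_minus_commute[of _ q])
          finally show "norm (nrmC p (s N - \<theta>)) \<le> sqrt ((nrm q (fst \<theta> - proj q (B N) (fst \<theta>)))\<^sup>2 + (nrm q (snd \<theta> - proj q (B N) (snd \<theta>)))\<^sup>2)"
            by (simp add: nrmC_nonneg)
        qed
        have "(\<lambda>N. sqrt ((nrm q (fst \<theta> - proj q (B N) (fst \<theta>)))\<^sup>2 + (nrm q (snd \<theta> - proj q (B N) (snd \<theta>)))\<^sup>2)) \<longlonglongrightarrow> sqrt (0\<^sup>2 + 0\<^sup>2)"
          by (intro tendsto_intros B(5) uH)
        then show "(\<lambda>N. sqrt ((nrm q (fst \<theta> - proj q (B N) (fst \<theta>)))\<^sup>2 + (nrm q (snd \<theta> - proj q (B N) (snd \<theta>)))\<^sup>2)) \<longlonglongrightarrow> 0" by simp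
      qed
      then have "(\<lambda>N. iterD F (replicate n (s N)) / fact n) \<longlonglongrightarrow> iterD F (replicate n \<theta>) / fact n"
        by (intro tendsto_intros NC.iterD_tendsto[OF F0(2,1) th sX]) auto
      moreover have "iterD F (replicate n (s N)) / fact n = (\<Sum>es\<in>lists_len (B N) n. f n (tensor_power n \<theta>) es)" for N
      proof -
        have "iterD F (replicate n (s N)) = (\<Sum>es\<in>lists_len (B N) n. prod_list (map (\<lambda>e. pairing (riesz q e) \<theta>) es) * iterD F (map (\<lambda>e. (e, 0)) es))"
          unfolding s_def pairing_scale_sum[OF th B(1,3), symmetric]
          using B(3)[of N] subspace_0[OF subspace_nuc] by (intro NC.iterD_expand[OF F0]) (auto simp: nucC_def)
        also have "\<dots> / fact n = (\<Sum>es\<in>lists_len (B N) n. f n (tensor_power n \<theta>) es)"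
          unfolding sum_divide_distrib
        proof (rule sum.cong[OF refl])
          fix es assume es: "es \<in> lists_len (B N) n"
          have "set (map (riesz q) es) \<subseteq> nuc_dual" "length (map (riesz q) es) = n"
            using es riesz_in_dual[OF orthonormalD(2)[OF B(2)]] by (auto simp: lists_len_def)
          then show "prod_list (map (\<lambda>e. pairing (riesz q e) \<theta>) es) * iterD F (map (\<lambda>e. (e, 0)) es) / fact n = f n (tensor_power n \<theta>) es"
            by (simp add: f_def tensor_power_def o_def)
        qed
        finally show ?thesis .
      qed
      ultimately show ?thesis using LIMSEQ_unique[OF lim[OF tensor_power_in_tensors[OF th]]] by simp
    qed
    show "\<exists>K. (\<forall>n. K n \<in> tensors_dual n) \<and>
       (\<forall>r C. 0 < r \<longrightarrow> NC.hol p r C F \<longrightarrow>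
          (\<forall>n. \<forall>t\<in>tensors n. cmod (K n t) \<le> C * exp (real (n + 1)) * (c / r) ^ n * tensor_norm q n t) \<and>
          (\<forall>\<theta>\<in>nucC. nrmC p \<theta> < r \<longrightarrow> (\<lambda>n. K n (tensor_power n \<theta>)) sums F \<theta>))"
      using Kd bound val NC.hol_taylor by (intro exI[of _ K]) simp
  qed (use q in auto)
qed


subsection \<open>Contraction of tensors\<close>

lemma tensors_append:
  assumes "t \<in> tensors (length xs + m)" "set xs \<subseteq> nuc_dual"
  shows "(\<lambda>ys. t (xs @ ys)) \<in> tensors m"
  using assms
proof (induction xs arbitrary: t)
  case (Cons x xs)
  have "(\<lambda>zs. t (x # zs)) \<in> tensors (length xs + m)" using Cons.prems by (intro tensors_Cons) auto
  then show ?case using Cons.IH[of "\<lambda>zs. t (x # zs)"] Cons.prems by simp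
qed simp

text \<open>Each slice has its own nearly optimal system. One orthonormal \<open>B'\<close> that
  contains \<open>G\<close> and spans all of them serves every slice at once, and the sum over
  \<open>G\<close> is then completed to a sum over \<open>B'\<close>.\<close>

lemma tensor_norm_slices:
  assumes t: "t \<in> tensors (Suc n)" and G: "finite G" "orthonormal p G"
  shows "(\<Sum>g\<in>G. (tensor_norm p n (\<lambda>ys. t (riesz p g # ys)))\<^sup>2) \<le> (tensor_norm p (Suc n) t)\<^sup>2"
proof (rule field_le_epsilon)
  fix e :: real assume e: "0 < e"
  define d where "d = e / (real (card G) + 1)"
  have d: "0 < d" using e by (simp add: d_def)
  have dc: "d * real (card G) \<le> e" using e by (simp add: d_def field_simps)
  obtain B where ex: "exhaustion p B" using exhaustion_exists by blast
  note B = exhaustionD[OF ex]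
  have tg: "(\<lambda>ys. t (riesz p g # ys)) \<in> tensors n" if "g \<in> G" for g
    using tensors_Cons[OF t riesz_in_dual[OF orthonormalD(2)[OF G(2) that]]] .
  have "\<forall>g\<in>G. \<exists>k. (tensor_norm p n (\<lambda>ys. t (riesz p g # ys)))\<^sup>2 - d < hsq p (B k) n (\<lambda>ys. t (riesz p g # ys))"
    using hsq_exhaustion[OF ex tg d] by blast
  then obtain k where k: "\<forall>g\<in>G. (tensor_norm p n (\<lambda>ys. t (riesz p g # ys)))\<^sup>2 - d < hsq p (B (k g)) n (\<lambda>ys. t (riesz p g # ys))"
    by metis
  define W where "W = (\<Union>g\<in>G. B (k g))"
  have W: "finite W" "W \<subseteq> H p" using G(1) B(1) orthonormalD(1)[OF B(2)] by (auto simp: W_def)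
  obtain B' where B': "G \<subseteq> B'" "finite B'" "orthonormal p B'" "W \<subseteq> span B'"
    using orthonormal_extend_finite[OF W G(2,1)] by blast
  have "(\<Sum>g\<in>G. (tensor_norm p n (\<lambda>ys. t (riesz p g # ys)))\<^sup>2) \<le> (\<Sum>g\<in>G. hsq p B' n (\<lambda>ys. t (riesz p g # ys)) + d)"
  proof (rule sum_mono)
    fix g assume g: "g \<in> G"
    have "hsq p (B (k g)) n (\<lambda>ys. t (riesz p g # ys)) \<le> hsq p B' n (\<lambda>ys. t (riesz p g # ys))"
      using tg[OF g] B' B g by (intro hsq_span) (auto simp: tensors_iff W_def)
    then show "(tensor_norm p n (\<lambda>ys. t (riesz p g # ys)))\<^sup>2 \<le> hsq p B' n (\<lambda>ys. t (riesz p g # ys)) + d"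
      using k g by fastforce
  qed
  also have "\<dots> = (\<Sum>g\<in>G. hsq p B' n (\<lambda>ys. t (riesz p g # ys))) + d * real (card G)" by (simp add: sum.distrib)
  also have "\<dots> \<le> (\<Sum>g\<in>B'. hsq p B' n (\<lambda>ys. t (riesz p g # ys))) + e"
    using B' dc by (intro add_mono sum_mono2 hsq_nonneg) auto
  also have "\<dots> = hsq p B' (Suc n) t + e" by (simp add: hsq_Suc)
  also have "\<dots> \<le> (tensor_norm p (Suc n) t)\<^sup>2 + e"
    using hsq_le_tensor_norm[OF _ B'(2,3)] t by (simp add: tensors_iff)
  finally show "(\<Sum>g\<in>G. (tensor_norm p n (\<lambda>ys. t (riesz p g # ys)))\<^sup>2) \<le> (tensor_norm p (Suc n) t)\<^sup>2 + e" .
qed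

lemma tensor_norm_append:
  assumes "t \<in> tensors (k + m)" and G: "finite G" "orthonormal p G"
  shows "(\<Sum>gs\<in>lists_len G k. (tensor_norm p m (\<lambda>ys. t (map (riesz p) gs @ ys)))\<^sup>2) \<le> (tensor_norm p (k + m) t)\<^sup>2"
  using assms(1)
proof (induction k arbitrary: t)
  case (Suc k)
  have t: "t \<in> tensors (Suc (k + m))" using Suc.prems by simp
  have "(\<Sum>gs\<in>lists_len G (Suc k). (tensor_norm p m (\<lambda>ys. t (map (riesz p) gs @ ys)))\<^sup>2) =
      (\<Sum>g\<in>G. \<Sum>gs\<in>lists_len G k. (tensor_norm p m (\<lambda>ys. t (riesz p g # map (riesz p) gs @ ys)))\<^sup>2)"
    by (simp add: sum_lists_len_Suc)
  also have "\<dots> \<le> (\<Sum>g\<in>G. (tensor_norm p (k + m) (\<lambda>ys. t (riesz p g # ys)))\<^sup>2)"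
    using tensors_Cons[OF t riesz_in_dual[OF orthonormalD(2)[OF G(2)]]] by (intro sum_mono Suc.IH)
  also have "\<dots> \<le> (tensor_norm p (Suc (k + m)) t)\<^sup>2" using t G by (rule tensor_norm_slices)
  finally show ?case by simp
qed simp

text \<open>The contraction of the last slots of \<open>t\<close> with the functional
  \<open>K\<close>, which leaves a tensor of order \<open>k\<close>.\<close>

definition cut :: "((('h \<Rightarrow> real) list \<Rightarrow> complex) \<Rightarrow> complex) \<Rightarrow> nat \<Rightarrow> (('h \<Rightarrow> real) list \<Rightarrow> complex) \<Rightarrow> ('h \<Rightarrow> real) list \<Rightarrow> complex" where
  "cut K k t = (\<lambda>xs. if length xs = k \<and> set xs \<subseteq> nuc_dual then K (\<lambda>ys. t (xs @ ys)) else 0)"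

lemma cut_mtens:
  assumes K: "K \<in> tensors_dual m" and t: "t \<in> tensors (k + m)"
  shows "cut K k t \<in> mtens k"
proof (rule mtensI)
  have tm: "t \<in> mtens (k + m)" using t by (simp add: tensors_iff)
  fix xs i x y a b
  assume xs: "length xs = k" "set xs \<subseteq> nuc_dual" "i < k" "x \<in> nuc_dual" "y \<in> nuc_dual"
  have s: "set (xs[i := z]) \<subseteq> nuc_dual" if "z \<in> nuc_dual" for z
    using set_update_subset_insert[of xs i z] xs that by blast
  note sx = s[OF xs(4)] and sy = s[OF xs(5)] and sz = s[OF nuc_dual_combination[OF xs(4,5), of a b]]
  have e: "t (xs[i := \<lambda>u. a * x u + b * y u] @ ys) = complex_of_real a * t (xs[i := x] @ ys) + complex_of_real b * t (xs[i := y] @ ys)" for ys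
  proof (cases "length ys = m \<and> set ys \<subseteq> nuc_dual")
    case True
    then show ?thesis
      using mtensD(2)[OF tm, of "xs @ ys" i x y a b] xs by (simp add: list_update_append)
  next
    case False
    have "t (zs @ ys) = 0" if "length zs = k" for zs using False that by (intro mtensD(1)[OF tm]) auto
    then show ?thesis using xs by simp
  qed
  have "K (\<lambda>ys. complex_of_real a * t (xs[i := x] @ ys) + complex_of_real b * t (xs[i := y] @ ys)) =
     complex_of_real a * K (\<lambda>ys. t (xs[i := x] @ ys)) + complex_of_real b * K (\<lambda>ys. t (xs[i := y] @ ys))"
    using t xs sx sy by (intro tensors_dualD(1)[OF K] tensors_append) auto
  then show "cut K k t (xs[i := \<lambda>u. a * x u + b * y u]) = complex_of_real a * cut K k t (xs[i := x]) + complex_of_real b * cut K k t (xs[i := y])"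
    using xs(1) sx sy sz by (simp add: cut_def e)
next
  have tm: "t \<in> mtens (k + m)" using t by (simp add: tensors_iff)
  fix xs ys :: "('h \<Rightarrow> real) list" assume xs: "length xs = k" "set xs \<subseteq> nuc_dual" and ms: "mset xs = mset ys"
  have "length xs = length ys" "set xs = set ys" using ms by (metis size_mset, metis set_mset_mset)
  moreover have "t (xs @ zs) = t (ys @ zs)" for zs using ms by (intro mtensD(3)[OF tm]) simp
  ultimately show "cut K k t xs = cut K k t ys" by (simp add: cut_def)
next
  fix xs :: "('h \<Rightarrow> real) list" assume "\<not> (length xs = k \<and> set xs \<subseteq> nuc_dual)"
  then show "cut K k t xs = 0" unfolding cut_def by (rule if_not_P)
qed

text \<open>\<open>K\<close> is bounded by a single norm \<open>p0\<close>, and the norms of the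
  slices are square-summable by \<open>tensor_norm_append\<close>; hence the constants are
  independent of \<open>k\<close>. Below \<open>p0\<close> only finiteness is obtained, from a
  larger index.\<close>

lemma cut_bounded:
  assumes K: "K \<in> tensors_dual m"
  shows "\<exists>p0 C. 0 \<le> C \<and> (\<forall>k. \<forall>t\<in>tensors (k + m). cut K k t \<in> tensors k \<and> (\<forall>p\<ge>p0. tensor_norm p k (cut K k t) \<le> C * tensor_norm p (k + m) t))"
proof -
  obtain p0 C where C: "0 \<le> C" "\<forall>s\<in>tensors m. cmod (K s) \<le> C * tensor_norm p0 m s"
    using tensors_dual_bounded[OF K] by blast
  have h: "hsq p G k (cut K k t) \<le> (C * tensor_norm p (k + m) t)\<^sup>2"
    if t: "t \<in> tensors (k + m)" and p: "p0 \<le> p" and G: "finite G" "orthonormal p G" for p k t G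
  proof -
    have r: "riesz p g \<in> nuc_dual" if "g \<in> G" for g using riesz_in_dual[OF orthonormalD(2)[OF G(2) that]] .
    have "hsq p G k (cut K k t) \<le> (\<Sum>gs\<in>lists_len G k. C\<^sup>2 * (tensor_norm p m (\<lambda>ys. t (map (riesz p) gs @ ys)))\<^sup>2)"
      unfolding hsq_def
    proof (rule sum_mono)
      fix gs assume gs: "gs \<in> lists_len G k"
      have s: "set (map (riesz p) gs) \<subseteq> nuc_dual" "length (map (riesz p) gs) = k" using gs r by (auto simp: lists_len_def)
      have ts: "(\<lambda>ys. t (map (riesz p) gs @ ys)) \<in> tensors m" using t s by (intro tensors_append) auto
      have "cmod (cut K k t (map (riesz p) gs)) = cmod (K (\<lambda>ys. t (map (riesz p) gs @ ys)))"
        using s by (simp add: cut_def)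
      also have "\<dots> \<le> C * tensor_norm p0 m (\<lambda>ys. t (map (riesz p) gs @ ys))" using C(2) ts by blast
      also have "\<dots> \<le> C * tensor_norm p m (\<lambda>ys. t (map (riesz p) gs @ ys))"
        using tensor_norm_mono[OF ts p] C(1) by (rule mult_left_mono)
      finally have "(cmod (cut K k t (map (riesz p) gs)))\<^sup>2 \<le> (C * tensor_norm p m (\<lambda>ys. t (map (riesz p) gs @ ys)))\<^sup>2"
        by (rule power_mono) simp
      then show "(cmod (cut K k t (map (riesz p) gs)))\<^sup>2 \<le> C\<^sup>2 * (tensor_norm p m (\<lambda>ys. t (map (riesz p) gs @ ys)))\<^sup>2"
        by (simp add: power_mult_distrib)
    qed
    also have "\<dots> \<le> C\<^sup>2 * (tensor_norm p (k + m) t)\<^sup>2"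
      unfolding sum_distrib_left[symmetric] using tensor_norm_append[OF t G] by (rule mult_left_mono) simp
    finally show ?thesis by (simp add: power_mult_distrib)
  qed
  have fin: "tensor_norm_sq p k (cut K k t) < \<infinity>" if t: "t \<in> tensors (k + m)" for p k t
  proof -
    have "tensor_norm_sq (max p p0) k (cut K k t) < \<infinity>"
      by (rule tensor_bounded(1)[where c = "(C * tensor_norm (max p p0) (k + m) t)\<^sup>2"]) (use h[OF t] in auto)
    then show ?thesis using tensor_norm_mono_mtens(1)[OF cut_mtens[OF K t], of p "max p p0"] by simp
  qed
  have "tensor_norm p k (cut K k t) \<le> C * tensor_norm p (k + m) t" if "t \<in> tensors (k + m)" "p0 \<le> p" for p k t
    using h[OF that] C(1) tensor_norm_nonneg by (intro tensor_norm_leI) auto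
  then show ?thesis using C(1) fin cut_mtens[OF K]
    by (intro exI[of _ p0] exI[of _ C]) (simp add: tensors_iff)
qed

lemma cut_in_tensors: "K \<in> tensors_dual m \<Longrightarrow> t \<in> tensors (k + m) \<Longrightarrow> cut K k t \<in> tensors k"
  using cut_bounded[of K m] by blast

lemma cut_combination:
  assumes K: "K \<in> tensors_dual m" and st: "s \<in> tensors (k + m)" "t \<in> tensors (k + m)"
  shows "cut K k (\<lambda>xs. a * s xs + b * t xs) = (\<lambda>xs. a * cut K k s xs + b * cut K k t xs)"
proof
  fix xs
  show "cut K k (\<lambda>xs. a * s xs + b * t xs) xs = a * cut K k s xs + b * cut K k t xs"
  proof (cases "length xs = k \<and> set xs \<subseteq> nuc_dual")
    case True
    then have "K (\<lambda>ys. a * s (xs @ ys) + b * t (xs @ ys)) = a * K (\<lambda>ys. s (xs @ ys)) + b * K (\<lambda>ys. t (xs @ ys))"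
      using st by (intro tensors_dualD(1)[OF K] tensors_append) auto
    then show ?thesis using True by (simp add: cut_def)
  qed (auto simp: cut_def)
qed

lemma tensors_dual_combination:
  assumes "K \<in> tensors_dual n" "L \<in> tensors_dual n"
  shows "(\<lambda>t. a * K t + b * L t) \<in> tensors_dual n"
proof -
  obtain p C where 1: "0 \<le> C" "\<forall>t\<in>tensors n. cmod (K t) \<le> C * tensor_norm p n t"
    using tensors_dual_bounded[OF assms(1)] by blast
  obtain q D where 2: "0 \<le> D" "\<forall>t\<in>tensors n. cmod (L t) \<le> D * tensor_norm q n t"
    using tensors_dual_bounded[OF assms(2)] by blast
  show ?thesis
  proof (rule tensors_dualI[where C = "cmod a * C + cmod b * D" and p = "max p q"])
    fix t assume t: "t \<in> tensors n"
    have "cmod (K t) \<le> C * tensor_norm (max p q) n t"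
      using 1 t tensor_norm_mono[OF t, of p "max p q"] by (meson max.cobounded1 mult_left_mono order_trans)
    moreover have "cmod (L t) \<le> D * tensor_norm (max p q) n t"
      using 2 t tensor_norm_mono[OF t, of q "max p q"] by (meson max.cobounded2 mult_left_mono order_trans)
    ultimately have "cmod a * cmod (K t) + cmod b * cmod (L t) \<le> cmod a * (C * tensor_norm (max p q) n t) + cmod b * (D * tensor_norm (max p q) n t)"
      by (intro add_mono mult_left_mono) auto
    then show "cmod (a * K t + b * L t) \<le> (cmod a * C + cmod b * D) * tensor_norm (max p q) n t"
      using norm_triangle_ineq[of "a * K t" "b * L t"] by (simp add: norm_mult algebra_simps)
  qed (use 1(1) 2(1) tensors_dualD[OF assms(1)] tensors_dualD[OF assms(2)] in \<open>simp_all add: algebra_simps\<close>)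
qed

lemma zero_in_tensors_dual: "(\<lambda>_. 0) \<in> tensors_dual n"
  by (rule tensors_dualI[where C = 0]) auto

lemma tensors_dual_sum:
  assumes "\<And>i. i \<in> I \<Longrightarrow> K i \<in> tensors_dual n"
  shows "(\<lambda>t. \<Sum>i\<in>I. c i * K i t) \<in> tensors_dual n"
  using assms
proof (induction I rule: infinite_finite_induct)
  case (insert i I)
  then show ?case using tensors_dual_combination[of "K i" n "\<lambda>t. \<Sum>i\<in>I. c i * K i t" "c i" 1] by simp
qed (auto simp: zero_in_tensors_dual)

text \<open>This is the functional \<open>L \<otimes> K\<close> on tensors of order
  \<open>k + m\<close>.\<close>

lemma tensors_dual_cut:
  assumes K: "K \<in> tensors_dual m" and L: "L \<in> tensors_dual k"
  shows "(\<lambda>t. if t \<in> tensors (k + m) then L (cut K k t) else 0) \<in> tensors_dual (k + m)"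
proof -
  obtain p0 C where C: "0 \<le> C" "\<forall>k. \<forall>t\<in>tensors (k + m). cut K k t \<in> tensors k \<and> (\<forall>p\<ge>p0. tensor_norm p k (cut K k t) \<le> C * tensor_norm p (k + m) t)"
    using cut_bounded[OF K] by blast
  obtain q D where D: "0 \<le> D" "\<forall>t\<in>tensors k. cmod (L t) \<le> D * tensor_norm q k t"
    using tensors_dual_bounded[OF L] by blast
  show ?thesis
  proof (rule tensors_dualI[where C = "D * C" and p = "max p0 q"])
    fix t assume t: "t \<in> tensors (k + m)"
    have ct: "cut K k t \<in> tensors k" using C(2) t by blast
    have "cmod (L (cut K k t)) \<le> D * tensor_norm q k (cut K k t)" using D(2) ct by blast
    also have "\<dots> \<le> D * tensor_norm (max p0 q) k (cut K k t)" using tensor_norm_mono[OF ct] D(1) by (intro mult_left_mono) auto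
    also have "\<dots> \<le> D * (C * tensor_norm (max p0 q) (k + m) t)" using C(2) t D(1) by (intro mult_left_mono) auto
    finally show "cmod (if t \<in> tensors (k + m) then L (cut K k t) else 0) \<le> D * C * tensor_norm (max p0 q) (k + m) t"
      using t by (simp add: mult_ac)
  next
    fix s t a b assume st: "s \<in> tensors (k + m)" "t \<in> tensors (k + m)"
    have "L (\<lambda>xs. a * cut K k s xs + b * cut K k t xs) = a * L (cut K k s) + b * L (cut K k t)"
      using st C(2) by (intro tensors_dualD(1)[OF L]) auto
    then show "(if (\<lambda>xs. a * s xs + b * t xs) \<in> tensors (k + m) then L (cut K k (\<lambda>xs. a * s xs + b * t xs)) else 0) =
        a * (if s \<in> tensors (k + m) then L (cut K k s) else 0) + b * (if t \<in> tensors (k + m) then L (cut K k t) else 0)"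
      using st tensors_combination[OF st, of a b] cut_combination[OF K st, of a b] by simp
  qed (use C(1) D(1) in auto)
qed

text \<open>All entries of \<open>xs\<close> are represented by vectors of one common
  \<open>H p\<close>, and \<open>tensor_riesz_bound\<close> gives the continuity.\<close>

lemma evaluation_in_dual:
  assumes "set xs \<subseteq> nuc_dual"
  shows "(\<lambda>t. if t \<in> tensors (length xs) then t xs else 0) \<in> tensors_dual (length xs)"
proof -
  have "\<exists>p0. \<forall>p\<ge>p0. \<exists>hs. set hs \<subseteq> H p \<and> xs = map (riesz p) hs"
    using assms
  proof (induction xs)
    case Nil
    show ?case by (intro exI[of _ 0] allI impI exI[of _ "[]"]) simp
  next
    case (Cons x xs)
    then obtain p1 where p1: "\<forall>p\<ge>p1. \<exists>hs. set hs \<subseteq> H p \<and> xs = map (riesz p) hs" by auto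
    obtain p2 where p2: "\<forall>p\<ge>p2. \<exists>h\<in>H p. x = riesz p h" using riesz_representation_large[of x] Cons.prems by auto
    have "\<exists>hs. set hs \<subseteq> H p \<and> x # xs = map (riesz p) hs" if p: "p \<ge> max p1 p2" for p
    proof -
      obtain hs where "set hs \<subseteq> H p" "xs = map (riesz p) hs" using p1 p by auto
      moreover obtain h where "h \<in> H p" "x = riesz p h" using p2 p by auto
      ultimately show ?thesis by (intro exI[of _ "h # hs"]) simp
    qed
    then show ?case by blast
  qed
  then obtain p hs where hs: "set hs \<subseteq> H p" "xs = map (riesz p) hs" by blast
  have n: "0 \<le> prod_list (map (nrm p) hs)" using hs(1) by (intro prod_list_nonneg) (auto intro: nrm_nonneg)
  show ?thesis
  proof (rule tensors_dualI[where C = "prod_list (map (nrm p) hs)" and p = p])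
    fix t assume t: "t \<in> tensors (length xs)"
    have "cmod (t (map (riesz p) hs)) \<le> tensor_norm p (length xs) t * prod_list (map (nrm p) hs)"
      using hs by (intro tensor_riesz_bound[OF t]) auto
    then show "cmod (if t \<in> tensors (length xs) then t xs else 0) \<le> prod_list (map (nrm p) hs) * tensor_norm p (length xs) t"
      using t hs(2) by (simp add: mult.commute)
  qed (use n in \<open>auto intro: tensors_combination\<close>)
qed

subsection \<open>Uniqueness of power series in tensor powers\<close>

lemma pairing_cscale:
  assumes "x \<in> nuc_dual" "\<theta> \<in> nucC"
  shows "pairing x (cscale c \<theta>) = c * pairing x \<theta>"
proof -
  note u = nucC_D(1,2)[OF assms(2)] and s = subspace_scale[OF subspace_nuc]
  show ?thesis
    using u s assms(1)
    by (simp add: pairing_def cscale_def complex_eq_iff nuc_dual_diff nuc_dual_add nuc_dual_scale algebra_simps)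
qed

lemma tensor_power_cscale:
  assumes "\<theta> \<in> nucC"
  shows "tensor_power n (cscale c \<theta>) = (\<lambda>xs. c ^ n * tensor_power n \<theta> xs)"
proof
  fix xs
  have "prod_list (map (\<lambda>x. pairing x (cscale c \<theta>)) xs) = c ^ length xs * prod_list (map (\<lambda>x. pairing x \<theta>) xs)" if "set xs \<subseteq> nuc_dual"
    using that by (induction xs) (auto simp: pairing_cscale[OF _ assms])
  then show "tensor_power n (cscale c \<theta>) xs = c ^ n * tensor_power n \<theta> xs" by (auto simp: tensor_power_def)
qed

lemma tensors_dual_power_cscale:
  "K \<in> tensors_dual n \<Longrightarrow> \<theta> \<in> nucC \<Longrightarrow> K (tensor_power n (cscale c \<theta>)) = c ^ n * K (tensor_power n \<theta>)"
  by (simp add: tensor_power_cscale tensors_dual_scale tensor_power_in_tensors)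

lemma nucC_ball_open: "openin nucC_topology {\<theta> \<in> nucC. nrmC p \<theta> < r}"
  unfolding nucC_topology_def openin_seminorm_topology
proof (intro conjI ballI)
  fix f assume f: "f \<in> {\<theta> \<in> nucC. nrmC p \<theta> < r}"
  show "\<exists>F \<epsilon>. finite F \<and> F \<subseteq> range nrmC \<and> 0 < \<epsilon> \<and> (\<forall>g\<in>nucC. (\<forall>q\<in>F. q (g - f) < \<epsilon>) \<longrightarrow> g \<in> {\<theta> \<in> nucC. nrmC p \<theta> < r})"
  proof (intro exI[of _ "{nrmC p}"] exI[of _ "r - nrmC p f"] conjI ballI impI)
    fix g assume g: "g \<in> nucC" "\<forall>q\<in>{nrmC p}. q (g - f) < r - nrmC p f"
    have "nrmC p g \<le> nrmC p (g - f) + nrmC p f"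
      using NC.N_triangle[OF NC.X_diff[OF g(1)], of f f p] f by simp
    then show "g \<in> {\<theta> \<in> nucC. nrmC p \<theta> < r}" using g by auto
  qed (use f in auto)
qed auto

lemma nucC_nhd:
  assumes "openin nucC_topology U" "0 \<in> U"
  shows "\<exists>p r. 0 < r \<and> (\<forall>\<theta>\<in>nucC. nrmC p \<theta> < r \<longrightarrow> \<theta> \<in> U)"
  using assms(1) unfolding nucC_topology_def
  by (rule seminorm_topology_nhd[OF _ assms(2)]) (auto intro: nrmC_mono nucC_D)

text \<open>On the complex line through a real vector the series becomes a power series in
  \<open>z\<close> that vanishes near 0. Its coefficients are the values of the \<open>K n\<close>
  at the tensor powers of that vector, and these powers are total.\<close>

lemma power_kernels_zero:
  assumes K: "\<And>n. K n \<in> tensors_dual n" and U: "openin nucC_topology U" "0 \<in> U"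
    and s: "\<And>\<theta>. \<theta> \<in> U \<Longrightarrow> (\<lambda>n. K n (tensor_power n \<theta>)) sums 0"
  shows "K n t = 0"
proof (rule tensors_dual_eq_0[OF K])
  obtain p r where r: "0 < r" "\<forall>\<theta>\<in>nucC. nrmC p \<theta> < r \<longrightarrow> \<theta> \<in> U" using nucC_nhd[OF U] by blast
  fix u assume "u \<in> nuc"
  define \<theta> where "\<theta> = (u, 0::'h)"
  have th: "\<theta> \<in> nucC" using \<open>u \<in> nuc\<close> subspace_0[OF subspace_nuc] by (simp add: \<theta>_def nucC_def)
  define a where "a n = K n (tensor_power n \<theta>)" for n
  define R where "R = r / (nrmC p \<theta> + 1)"
  have R: "0 < R" using r(1) nrmC_nonneg[of p \<theta>] by (simp add: R_def)
  have sm: "(\<lambda>n. a n * (z - 0) ^ n) sums 0" if "norm (z - 0) < R" for z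
  proof -
    have "cmod z * (nrmC p \<theta> + 1) < r" using that nrmC_nonneg[of p \<theta>] by (simp add: R_def pos_less_divide_eq)
    then have "nrmC p (cscale z \<theta>) < r"
      using NC.N_scale[OF th, of p z] norm_ge_zero[of z] by (simp add: algebra_simps del: norm_ge_zero)
    then have "cscale z \<theta> \<in> U" using r(2) NC.X_scale[OF th] by blast
    from s[OF this] show ?thesis by (simp add: a_def tensors_dual_power_cscale[OF K th] mult.commute)
  qed
  have "a m = 0" for m
  proof (rule ccontr)
    assume m: "a m \<noteq> 0"
    have "norm ((0::complex) - 0) < R" using R by simp
    from sm[OF this] have "(\<lambda>n. a n * 0 ^ n) sums 0" by (simp only: diff_zero)
    then have "a 0 = 0" using sums_unique2 powser_sums_zero[of a] by blast
    then have "m > 0" using m by (cases m) auto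
    show False
    \<comment> \<open>This rule provides a punctured disc on which the sum function has no zero,
      whereas here the sum function is constantly 0.\<close>
    proof (rule powser_0_nonzero[OF R sm _ m \<open>m > 0\<close>])
      fix \<rho> :: real assume rho: "0 < \<rho>" and nz: "\<And>z::complex. z \<in> cball 0 \<rho> - {0} \<Longrightarrow> (0::complex) \<noteq> 0"
      have "complex_of_real \<rho> \<in> cball 0 \<rho> - {0}" using rho by simp
      from nz[OF this] show False by simp
    qed simp_all
  qed
  then show "K n (tensor_power n (u, 0)) = 0" by (simp add: a_def \<theta>_def)
qed

lemma power_kernels_unique:
  assumes "\<And>n. K n \<in> tensors_dual n" "\<And>n. L n \<in> tensors_dual n"
    and "openin nucC_topology U" "0 \<in> U" "\<And>\<theta>. \<theta> \<in> U \<Longrightarrow> (\<lambda>n. K n (tensor_power n \<theta>)) sums G \<theta>"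
    and "openin nucC_topology V" "0 \<in> V" "\<And>\<theta>. \<theta> \<in> V \<Longrightarrow> (\<lambda>n. L n (tensor_power n \<theta>)) sums G \<theta>"
  shows "K = L"
proof (intro ext)
  fix n t
  have "1 * K n t + (- 1) * L n t = 0"
  proof (rule power_kernels_zero[where K = "\<lambda>n t. 1 * K n t + (- 1) * L n t" and U = "U \<inter> V"])
    show "(\<lambda>t. 1 * K n t + (- 1) * L n t) \<in> tensors_dual n" for n using assms(1,2) by (rule tensors_dual_combination)
    show "openin nucC_topology (U \<inter> V)" using assms by (intro openin_Int)
    show "(\<lambda>n. 1 * K n (tensor_power n \<theta>) + (- 1) * L n (tensor_power n \<theta>)) sums 0" if "\<theta> \<in> U \<inter> V" for \<theta>
      using sums_diff[OF assms(5) assms(8), of \<theta> \<theta>] that by simp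
  qed (use assms in auto)
  then show "K n t = L n t" by simp
qed

end

lemma lc_inductive_continuous:
  fixes K :: "('x \<Rightarrow> complex) \<Rightarrow> complex"
  assumes V: "\<And>f g a b. f \<in> V \<Longrightarrow> g \<in> V \<Longrightarrow> (\<lambda>x. a * f x + b * g x) \<in> V"
    and lin: "\<And>f g a b. f \<in> V \<Longrightarrow> g \<in> V \<Longrightarrow> K (\<lambda>x. a * f x + b * g x) = a * K f + b * K g"
    and top: "topspace (lc_inductive_topology V T j) = V"
    and nhd: "\<And>i \<epsilon>. 0 < \<epsilon> \<Longrightarrow> \<exists>G. openin (T i) G \<and> (\<lambda>_. 0) \<in> G \<and> (\<forall>g\<in>G. j i g \<in> V \<and> cmod (K (j i g)) < \<epsilon>)"
  shows "continuous_map (lc_inductive_topology V T j) euclidean K"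
  unfolding continuous_map
proof (intro conjI allI impI)
  fix W :: "complex set" assume "openin euclidean W"
  then have W: "open W" by simp
  show "openin (lc_inductive_topology V T j) {x \<in> topspace (lc_inductive_topology V T j). K x \<in> W}"
    unfolding top openin_lc_inductive_topology
  proof (intro conjI ballI)
    fix f assume f: "f \<in> {x \<in> V. K x \<in> W}"
    obtain e where e: "0 < e" "\<And>y. dist y (K f) < e \<Longrightarrow> y \<in> W" using W f unfolding open_dist by auto
    let ?U = "{u \<in> V. cmod (K u) < e}"
    have "absolutely_convex ?U"
      unfolding absolutely_convex_def
    proof (intro ballI allI impI)
      fix u v a b assume u: "u \<in> ?U" and v: "v \<in> ?U" and ab: "cmod a + cmod b \<le> 1"
      have "cmod (a * K u + b * K v) \<le> cmod a * cmod (K u) + cmod b * cmod (K v)"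
        by (rule order_trans[OF norm_triangle_ineq]) (simp add: norm_mult)
      also have "\<dots> \<le> cmod a * max (cmod (K u)) (cmod (K v)) + cmod b * max (cmod (K u)) (cmod (K v))"
        by (intro add_mono mult_left_mono) auto
      also have "\<dots> = (cmod a + cmod b) * max (cmod (K u)) (cmod (K v))" by (simp add: algebra_simps)
      also have "\<dots> \<le> 1 * max (cmod (K u)) (cmod (K v))" using ab by (intro mult_right_mono) (auto simp: le_max_iff_disj)
      also have "\<dots> < e" using u v by simp
      finally show "(\<lambda>x. a * u x + b * v x) \<in> ?U" using u v V lin by simp
    qed
    moreover have "\<forall>i. \<exists>G. openin (T i) G \<and> (\<lambda>_. 0) \<in> G \<and> j i ` G \<subseteq> ?U"
    proof
      fix i
      obtain G where "openin (T i) G" "(\<lambda>_. 0) \<in> G" "\<forall>g\<in>G. j i g \<in> V \<and> cmod (K (j i g)) < e"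
        using nhd[OF e(1), of i] by blast
      then show "\<exists>G. openin (T i) G \<and> (\<lambda>_. 0) \<in> G \<and> j i ` G \<subseteq> ?U" by (intro exI[of _ G]) auto
    qed
    moreover have "\<forall>g\<in>V. g - f \<in> ?U \<longrightarrow> g \<in> {x \<in> V. K x \<in> W}"
    proof (intro ballI impI)
      fix g assume g: "g \<in> V" "g - f \<in> ?U"
      have "K (g - f) = K g - K f" using lin[of g f 1 "-1"] g f by (simp add: fun_diff_def)
      then have "dist (K g) (K f) < e" using g by (simp add: dist_norm)
      then show "g \<in> {x \<in> V. K x \<in> W}" using e(2) g by simp
    qed
    ultimately show "\<exists>U\<subseteq>V. absolutely_convex U \<and> (\<forall>i. \<exists>G. openin (T i) G \<and> (\<lambda>_. 0) \<in> G \<and> j i ` G \<subseteq> U) \<and>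
        (\<forall>g\<in>V. g - f \<in> U \<longrightarrow> g \<in> {x \<in> V. K x \<in> W})"
      by (intro exI[of _ ?U]) auto
  qed auto
qed auto

context nuclear_triple
begin

subsection \<open>Polynomials\<close>

lemma monomial_combination: "monomial n (\<lambda>xs. a * s xs + b * t xs) = (\<lambda>x. a * monomial n s x + b * monomial n t x)"
  by (auto simp: monomial_def)

lemma monomial_zero: "monomial n (\<lambda>_. 0) = (\<lambda>_. 0)"
  by (auto simp: monomial_def)

text \<open>Zero coefficients are appended, so that polynomials of different degrees can be compared
  at one common upper limit \<open>m\<close>.\<close>

lemma polynomials_pad:
  assumes "\<phi> \<in> polynomials"
  shows "\<exists>m0 c. (\<forall>n. c n \<in> tensors n) \<and> (\<forall>m\<ge>m0. \<phi> = (\<lambda>x. \<Sum>n\<le>m. monomial n (c n) x))"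
proof -
  obtain m0 c where c: "\<forall>n\<le>m0. c n \<in> tensors n" "\<phi> = (\<lambda>x. \<Sum>n\<le>m0. monomial n (c n) x)"
    using assms by (auto simp: polynomials_def)
  define d where "d n = (if n \<le> m0 then c n else (\<lambda>_. 0))" for n
  have "\<phi> = (\<lambda>x. \<Sum>n\<le>m. monomial n (d n) x)" if m: "m \<ge> m0" for m
  proof
    fix x
    have "(\<Sum>n\<le>m. monomial n (d n) x) = (\<Sum>n\<le>m0. monomial n (d n) x)"
      using m by (intro sum.mono_neutral_right) (auto simp: d_def monomial_zero)
    then show "\<phi> x = (\<Sum>n\<le>m. monomial n (d n) x)" using c(2) by (simp add: d_def)
  qed
  moreover have "\<forall>n. d n \<in> tensors n" using c(1) by (simp add: d_def)
  ultimately show ?thesis by blast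
qed

lemma polynomials_combination:
  assumes "\<phi> \<in> polynomials" "\<psi> \<in> polynomials"
  shows "(\<lambda>x. a * \<phi> x + b * \<psi> x) \<in> polynomials"
proof -
  obtain m1 c where c: "\<forall>n. c n \<in> tensors n" "\<forall>m\<ge>m1. \<phi> = (\<lambda>x. \<Sum>n\<le>m. monomial n (c n) x)"
    using polynomials_pad[OF assms(1)] by blast
  obtain m2 d where d: "\<forall>n. d n \<in> tensors n" "\<forall>m\<ge>m2. \<psi> = (\<lambda>x. \<Sum>n\<le>m. monomial n (d n) x)"
    using polynomials_pad[OF assms(2)] by blast
  let ?m = "max m1 m2"
  have "\<phi> = (\<lambda>x. \<Sum>n\<le>?m. monomial n (c n) x)" "\<psi> = (\<lambda>x. \<Sum>n\<le>?m. monomial n (d n) x)"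
    using c(2) d(2) max.cobounded1[of m1 m2] max.cobounded2[of m2 m1] by blast+
  then have "(\<lambda>x. a * \<phi> x + b * \<psi> x) = (\<lambda>x. \<Sum>n\<le>?m. monomial n (\<lambda>xs. a * c n xs + b * d n xs) x)"
    by (simp add: monomial_combination sum.distrib sum_distrib_left fun_eq_iff)
  moreover have "\<forall>n\<le>?m. (\<lambda>xs. a * c n xs + b * d n xs) \<in> tensors n" using c(1) d(1) tensors_combination by blast
  ultimately show ?thesis
    unfolding polynomials_def by (intro CollectI exI[of _ ?m] exI[of _ "\<lambda>n xs. a * c n xs + b * d n xs"] conjI)
qed

lemma monomial_in_polynomials: "t \<in> tensors n \<Longrightarrow> monomial n t \<in> polynomials"
  unfolding polynomials_def mem_Collect_eq
proof (intro exI[of _ n] exI[of _ "\<lambda>i. if i = n then t else (\<lambda>_. 0)"] conjI)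
  show "monomial n t = (\<lambda>x. \<Sum>i\<le>n. monomial i (if i = n then t else (\<lambda>_. 0)) x)"
    by (auto simp: fun_eq_iff if_distrib[of "monomial _"] monomial_zero if_distribR cong: if_cong)
qed auto

lemma polynomials_sum:
  assumes "\<And>i. i \<in> I \<Longrightarrow> \<phi> i \<in> polynomials"
  shows "(\<lambda>x. \<Sum>i\<in>I. c i * \<phi> i x) \<in> polynomials"
  using assms
proof (induction I rule: infinite_finite_induct)
  case (insert i I)
  then show ?case using polynomials_combination[of "\<phi> i" "\<lambda>x. \<Sum>i\<in>I. c i * \<phi> i x" "c i" 1] by simp
qed (use monomial_in_polynomials[OF zero_in_tensors[of 0]] in \<open>simp_all add: monomial_zero\<close>)

lemma topspace_polynomials: "topspace polynomials_topology = polynomials"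
  unfolding polynomials_topology_def
proof (rule topspace_lc_inductive_topology)
  show "absolutely_convex polynomials" using polynomials_combination by (simp add: absolutely_convex_def)
qed (auto simp: tensors_topology_def monomial_in_polynomials)

lemma polynomials_dualD:
  assumes "\<Phi> \<in> polynomials_dual"
  shows "\<phi> \<in> polynomials \<Longrightarrow> \<psi> \<in> polynomials \<Longrightarrow> \<Phi> (\<lambda>x. a * \<phi> x + b * \<psi> x) = a * \<Phi> \<phi> + b * \<Phi> \<psi>"
    and "\<phi> \<notin> polynomials \<Longrightarrow> \<Phi> \<phi> = 0"
    and "continuous_map polynomials_topology euclidean \<Phi>"
  using assms by (simp_all add: polynomials_dual_def dual_space_def topspace_polynomials)

lemma polynomials_dual_sum:
  assumes \<Phi>: "\<Phi> \<in> polynomials_dual" and "\<And>i. i \<in> I \<Longrightarrow> \<phi> i \<in> polynomials"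
  shows "\<Phi> (\<lambda>x. \<Sum>i\<in>I. c i * \<phi> i x) = (\<Sum>i\<in>I. c i * \<Phi> (\<phi> i))"
proof -
  have z: "\<Phi> (\<lambda>_. 0) = 0"
    using polynomials_dualD(1)[OF \<Phi>, of "monomial 0 (\<lambda>_. 0)" "monomial 0 (\<lambda>_. 0)" 0 0] monomial_in_polynomials[OF zero_in_tensors[of 0]] by simp
  show ?thesis using assms(2)
  proof (induction I rule: infinite_finite_induct)
    case (insert i I)
    then show ?case using polynomials_dualD(1)[OF \<Phi>, of "\<phi> i" "\<lambda>x. \<Sum>i\<in>I. c i * \<phi> i x" "c i" 1] polynomials_sum[of I \<phi> c] by simp
  qed (use z in simp_all)
qed

lemma mtens_replicate_scale:
  assumes "t \<in> mtens n" "x \<in> nuc_dual"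
  shows "t (replicate n (\<lambda>u. a * x u)) = of_real a ^ n * t (replicate n x)"
  using assms(1)
proof (induction n arbitrary: t)
  case (Suc n)
  let ?y = "\<lambda>u. a * x u"
  have y: "?y \<in> nuc_dual" using nuc_dual_combination[OF assms(2,2), of a 0] by simp
  have "t (?y # replicate n ?y) = of_real a * t (x # replicate n ?y)"
    using mtens_slot[OF Suc.prems assms(2,2), of "replicate n ?y" a 0] y by (simp add: set_replicate_conv_if)
  then show ?case using Suc.IH[OF mtens_Cons[OF Suc.prems assms(2)]] by simp
qed simp

text \<open>Along the real multiples \<open>a * x\<close> the sum is a polynomial in
  \<open>a\<close> with infinitely many zeros. Hence every diagonal value of \<open>c n\<close>
  vanishes, and polarization yields the rest.\<close>

lemma monomials_independent:
  assumes c: "\<And>n. n \<le> m \<Longrightarrow> c n \<in> tensors n" and z: "\<And>x. (\<Sum>n\<le>m. monomial n (c n) x) = 0" and n: "n \<le> m"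
  shows "c n = (\<lambda>_. 0)"
proof
  fix xs
  show "c n xs = 0"
  proof (rule mtens_polarization[of _ n])
    show "c n \<in> mtens n" using c[OF n] by (simp add: tensors_iff)
    fix x assume x: "x \<in> nuc_dual"
    let ?Z = "{w. (\<Sum>i\<le>m. c i (replicate i x) * w ^ i) = 0}"
    have "complex_of_real a \<in> ?Z" for a
    proof -
      have y: "(\<lambda>u. a * x u) \<in> nuc_dual" using nuc_dual_combination[OF x x, of a 0] by simp
      have "(\<Sum>i\<le>m. c i (replicate i x) * complex_of_real a ^ i) = (\<Sum>i\<le>m. monomial i (c i) (\<lambda>u. a * x u))"
      proof (rule sum.cong[OF refl])
        fix i assume "i \<in> {..m}"
        then have "c i \<in> mtens i" using c by (simp add: tensors_iff)
        then show "c i (replicate i x) * complex_of_real a ^ i = monomial i (c i) (\<lambda>u. a * x u)"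
          using y mtens_replicate_scale[OF \<open>c i \<in> mtens i\<close> x, of a] by (simp add: monomial_def)
      qed
      then show ?thesis using z by simp
    qed
    then have "range complex_of_real \<subseteq> ?Z" by blast
    moreover have "infinite (range complex_of_real)" using infinite_UNIV_char_0 by (simp add: finite_image_iff inj_of_real)
    ultimately have "infinite ?Z" using finite_subset by blast
    then show "c n (replicate n x) = 0" using polyfun_finite_roots[of "\<lambda>i. c i (replicate i x)" m] n by blast
  qed
qed

text \<open>Polynomials form an algebraic direct sum of the tensor spaces, so the functionals
  \<open>L n\<close> can be prescribed independently; in the inductive topology continuity has to be
  checked on each summand only.\<close>

lemma polynomials_functional:
  assumes L: "\<And>n. L n \<in> tensors_dual n"
  shows "\<exists>\<Phi>\<in>polynomials_dual. \<forall>n. \<forall>t\<in>tensors n. \<Phi> (monomial n t) = L n t"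
proof -
  \<comment> \<open>The value \<open>w\<close> is read off from a coefficient sequence that is
    defined for all \<open>n\<close> and represents \<open>\<phi>\<close> at every large
    \<open>m\<close>, so that no degree has to be fixed.\<close>
  define R where "R \<phi> w \<longleftrightarrow> (\<exists>m0 c. (\<forall>n. c n \<in> tensors n) \<and> (\<forall>m\<ge>m0. \<phi> = (\<lambda>x. \<Sum>n\<le>m. monomial n (c n) x) \<and> w = (\<Sum>n\<le>m. L n (c n))))" for \<phi> w
  have L0: "L n (\<lambda>_. 0) = 0" for n using tensors_dual_zero[OF L] .
  have uniq: "w = w'" if R1: "R \<phi> w" and R2: "R \<phi> w'" for \<phi> w w'
  proof -
    obtain m1 c where c: "\<forall>n. c n \<in> tensors n" "\<forall>m\<ge>m1. \<phi> = (\<lambda>x. \<Sum>n\<le>m. monomial n (c n) x) \<and> w = (\<Sum>n\<le>m. L n (c n))"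
      using R1 unfolding R_def by blast
    obtain m2 d where d: "\<forall>n. d n \<in> tensors n" "\<forall>m\<ge>m2. \<phi> = (\<lambda>x. \<Sum>n\<le>m. monomial n (d n) x) \<and> w' = (\<Sum>n\<le>m. L n (d n))"
      using R2 unfolding R_def by blast
    let ?m = "max m1 m2"
    have m: "?m \<ge> m1" "?m \<ge> m2" by auto
    have e: "\<phi> = (\<lambda>x. \<Sum>n\<le>?m. monomial n (c n) x)" "\<phi> = (\<lambda>x. \<Sum>n\<le>?m. monomial n (d n) x)"
      using c(2) d(2) m by blast+
    have "(\<lambda>xs. 1 * c n xs + (- 1) * d n xs) = (\<lambda>_. 0)" if "n \<le> ?m" for n
    proof (rule monomials_independent[where m = ?m and c = "\<lambda>n xs. 1 * c n xs + (- 1) * d n xs", OF _ _ that])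
      show "(\<lambda>xs. 1 * c n xs + (- 1) * d n xs) \<in> tensors n" for n using c(1) d(1) tensors_combination by blast
      show "(\<Sum>n\<le>?m. monomial n (\<lambda>xs. 1 * c n xs + (- 1) * d n xs) x) = 0" for x
        using fun_cong[OF e(1), of x] fun_cong[OF e(2), of x] unfolding monomial_combination by (simp add: sum_subtractf)
    qed
    then have "c n = d n" if "n \<le> ?m" for n using that by (simp add: fun_eq_iff)
    moreover have "w = (\<Sum>n\<le>?m. L n (c n))" "w' = (\<Sum>n\<le>?m. L n (d n))" using c(2) d(2) m by blast+
    ultimately show ?thesis by simp
  qed
  have ex: "\<exists>w. R \<phi> w" if pol: "\<phi> \<in> polynomials" for \<phi>
  proof -
    obtain m0 c where c: "\<forall>n\<le>m0. c n \<in> tensors n" "\<phi> = (\<lambda>x. \<Sum>n\<le>m0. monomial n (c n) x)"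
      using pol by (auto simp: polynomials_def)
    define d where "d n = (if n \<le> m0 then c n else (\<lambda>_. 0))" for n
    have "\<phi> = (\<lambda>x. \<Sum>n\<le>m. monomial n (d n) x) \<and> (\<Sum>n\<le>m0. L n (c n)) = (\<Sum>n\<le>m. L n (d n))" if m: "m \<ge> m0" for m
    proof -
      have "(\<Sum>n\<le>m. monomial n (d n) x) = (\<Sum>n\<le>m0. monomial n (d n) x)" for x
        using m by (intro sum.mono_neutral_right) (auto simp: d_def monomial_zero)
      moreover have "(\<Sum>n\<le>m. L n (d n)) = (\<Sum>n\<le>m0. L n (d n))"
        using m by (intro sum.mono_neutral_right) (auto simp: d_def L0)
      ultimately show ?thesis using c(2) by (simp add: d_def)
    qed
    moreover have "\<forall>n. d n \<in> tensors n" using c(1) by (simp add: d_def)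
    ultimately show ?thesis unfolding R_def by blast
  qed
  define \<Phi> where "\<Phi> \<phi> = (if \<phi> \<in> polynomials then (THE w. R \<phi> w) else 0)" for \<phi>
  have val: "\<Phi> \<phi> = w" if "\<phi> \<in> polynomials" "R \<phi> w" for \<phi> w
    unfolding \<Phi>_def using that uniq by auto
  have rel: "R \<phi> (\<Phi> \<phi>)" if "\<phi> \<in> polynomials" for \<phi> using ex[OF that] val[OF that] by blast
  have lin: "\<Phi> (\<lambda>x. a * \<phi> x + b * \<psi> x) = a * \<Phi> \<phi> + b * \<Phi> \<psi>" if p: "\<phi> \<in> polynomials" "\<psi> \<in> polynomials" for \<phi> \<psi> a b
  proof (rule val[OF polynomials_combination[OF p]])
    obtain m1 c where c: "\<forall>n. c n \<in> tensors n" "\<forall>m\<ge>m1. \<phi> = (\<lambda>x. \<Sum>n\<le>m. monomial n (c n) x) \<and> \<Phi> \<phi> = (\<Sum>n\<le>m. L n (c n))"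
      using rel[OF p(1)] unfolding R_def by blast
    obtain m2 d where d: "\<forall>n. d n \<in> tensors n" "\<forall>m\<ge>m2. \<psi> = (\<lambda>x. \<Sum>n\<le>m. monomial n (d n) x) \<and> \<Phi> \<psi> = (\<Sum>n\<le>m. L n (d n))"
      using rel[OF p(2)] unfolding R_def by blast
    show "R (\<lambda>x. a * \<phi> x + b * \<psi> x) (a * \<Phi> \<phi> + b * \<Phi> \<psi>)"
      unfolding R_def
    proof (intro exI[of _ "max m1 m2"] exI[of _ "\<lambda>n xs. a * c n xs + b * d n xs"] conjI allI impI)
      show "(\<lambda>xs. a * c n xs + b * d n xs) \<in> tensors n" for n using c(1) d(1) tensors_combination by blast
      fix m assume "max m1 m2 \<le> m"
      then have m: "m1 \<le> m" "m2 \<le> m" by auto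
      have e: "\<phi> = (\<lambda>x. \<Sum>n\<le>m. monomial n (c n) x)" "\<psi> = (\<lambda>x. \<Sum>n\<le>m. monomial n (d n) x)"
          "\<Phi> \<phi> = (\<Sum>n\<le>m. L n (c n))" "\<Phi> \<psi> = (\<Sum>n\<le>m. L n (d n))"
        using c(2) d(2) m by blast+
      have "a * \<phi> x + b * \<psi> x = (\<Sum>n\<le>m. monomial n (\<lambda>xs. a * c n xs + b * d n xs) x)" for x
        using fun_cong[OF e(1), of x] fun_cong[OF e(2), of x]
        by (simp add: monomial_combination sum.distrib sum_distrib_left)
      then show "(\<lambda>x. a * \<phi> x + b * \<psi> x) = (\<lambda>x. \<Sum>n\<le>m. monomial n (\<lambda>xs. a * c n xs + b * d n xs) x)" by blast
      show "a * \<Phi> \<phi> + b * \<Phi> \<psi> = (\<Sum>n\<le>m. L n (\<lambda>xs. a * c n xs + b * d n xs))"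
        using e(3,4) tensors_dualD(1)[OF L] c(1) d(1) by (simp add: sum.distrib sum_distrib_left)
    qed
  qed
  have mon: "\<Phi> (monomial n t) = L n t" if t: "t \<in> tensors n" for n t
  proof (rule val[OF monomial_in_polynomials[OF t]])
    show "R (monomial n t) (L n t)"
      unfolding R_def
    proof (intro exI[of _ n] exI[of _ "\<lambda>i. if i = n then t else (\<lambda>_. 0)"] conjI allI impI)
      fix m assume m: "n \<le> m"
      have "(\<Sum>i\<le>m. monomial i (if i = n then t else (\<lambda>_. 0)) x) = (\<Sum>i\<le>m. if i = n then monomial n t x else 0)" for x
        by (intro sum.cong refl) (auto simp: monomial_zero)
      then show "monomial n t = (\<lambda>x. \<Sum>i\<le>m. monomial i (if i = n then t else (\<lambda>_. 0)) x)" using m by (simp add: fun_eq_iff)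
      have "(\<Sum>i\<le>m. L i (if i = n then t else (\<lambda>_. 0))) = (\<Sum>i\<le>m. if i = n then L n t else 0)"
        by (intro sum.cong refl) (auto simp: L0)
      then show "L n t = (\<Sum>i\<le>m. L i (if i = n then t else (\<lambda>_. 0)))" using m by simp
    qed (use t in auto)
  qed
  have "continuous_map polynomials_topology euclidean \<Phi>"
    unfolding polynomials_topology_def
  proof (rule lc_inductive_continuous)
    show "topspace (lc_inductive_topology polynomials tensors_topology monomial) = polynomials"
      using topspace_polynomials by (simp add: polynomials_topology_def)
    fix n and \<epsilon> :: real assume e: "0 < \<epsilon>"
    have cL: "continuous_map (tensors_topology n) euclidean (L n)"
      using L by (simp add: tensors_dual_def dual_space_def)
    have "openin (tensors_topology n) {t \<in> topspace (tensors_topology n). L n t \<in> ball 0 \<epsilon>}"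
      by (rule openin_continuous_map_preimage[OF cL]) simp
    then show "\<exists>G. openin (tensors_topology n) G \<and> (\<lambda>_. 0) \<in> G \<and> (\<forall>g\<in>G. monomial n g \<in> polynomials \<and> cmod (\<Phi> (monomial n g)) < \<epsilon>)"
      using e by (intro exI[of _ "{t \<in> topspace (tensors_topology n). L n t \<in> ball 0 \<epsilon>}"])
        (auto simp: tensors_topology_def L0 mon monomial_in_polynomials)
  qed (use lin polynomials_combination in auto)
  then have "\<Phi> \<in> polynomials_dual"
    using lin unfolding polynomials_dual_def dual_space_def topspace_polynomials by (auto simp: \<Phi>_def)
  then show ?thesis using mon by blast
qed

lemma polynomials_dual_monomial:
  assumes \<Phi>: "\<Phi> \<in> polynomials_dual"
  shows "(\<lambda>t. if t \<in> tensors n then \<Phi> (monomial n t) else 0) \<in> tensors_dual n"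
proof -
  have "continuous_map (tensors_topology n) polynomials_topology (monomial n)"
    unfolding continuous_map
  proof (intro conjI allI impI)
    show "monomial n ` topspace (tensors_topology n) \<subseteq> topspace polynomials_topology"
      by (auto simp: tensors_topology_def topspace_polynomials monomial_in_polynomials)
    fix W assume W: "openin polynomials_topology W"
    show "openin (tensors_topology n) {t \<in> topspace (tensors_topology n). monomial n t \<in> W}"
      unfolding tensors_topology_def openin_seminorm_topology topspace_seminorm_topology
    proof (intro conjI ballI)
      fix t0 assume t0: "t0 \<in> {t \<in> tensors n. monomial n t \<in> W}"
      obtain U where U: "\<forall>i. \<exists>G. openin (tensors_topology i) G \<and> (\<lambda>_. 0) \<in> G \<and> monomial i ` G \<subseteq> U"
          "\<forall>g\<in>polynomials. g - monomial n t0 \<in> U \<longrightarrow> g \<in> W"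
        using W t0 unfolding polynomials_topology_def openin_lc_inductive_topology by blast
      obtain G where G: "openin (tensors_topology n) G" "(\<lambda>_. 0) \<in> G" "monomial n ` G \<subseteq> U" using U(1) by blast
      obtain F \<epsilon> where F: "finite F" "F \<subseteq> range (\<lambda>p. tensor_norm p n)" "0 < \<epsilon>"
          "\<forall>g\<in>tensors n. (\<forall>q\<in>F. q (g - (\<lambda>_. 0)) < \<epsilon>) \<longrightarrow> g \<in> G"
        using G(1,2) unfolding tensors_topology_def openin_seminorm_topology by blast
      have "g \<in> {t \<in> tensors n. monomial n t \<in> W}" if g: "g \<in> tensors n" "\<forall>q\<in>F. q (g - t0) < \<epsilon>" for g
      proof -
        have d: "g - t0 \<in> tensors n" using g t0 tensors_diff by blast
        have "(g - t0) - (\<lambda>_. 0) = g - t0" by (simp add: fun_diff_def)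
        then have "g - t0 \<in> G" using F(4) d g(2) by simp
        then have "monomial n (g - t0) \<in> U" using G(3) by blast
        moreover have "monomial n (g - t0) = monomial n g - monomial n t0" by (auto simp: monomial_def fun_eq_iff)
        ultimately have "monomial n g \<in> W" using U(2) monomial_in_polynomials[OF g(1)] by simp
        then show ?thesis using g by simp
      qed
      then show "\<exists>F \<epsilon>. finite F \<and> F \<subseteq> range (\<lambda>p. tensor_norm p n) \<and> 0 < \<epsilon> \<and>
          (\<forall>g\<in>tensors n. (\<forall>q\<in>F. q (g - t0) < \<epsilon>) \<longrightarrow> g \<in> {t \<in> tensors n. monomial n t \<in> W})"
        using F(1-3) by (intro exI[of _ F] exI[of _ \<epsilon>]) simp
    qed auto
  qed
  then have "continuous_map (tensors_topology n) euclidean (\<Phi> \<circ> monomial n)"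
    using polynomials_dualD(3)[OF \<Phi>] by (rule continuous_map_compose)
  then have "continuous_map (tensors_topology n) euclidean (\<lambda>t. if t \<in> tensors n then \<Phi> (monomial n t) else 0)"
    by (rule continuous_map_eq) (auto simp: tensors_topology_def)
  moreover have "\<Phi> (monomial n (\<lambda>xs. a * s xs + b * t xs)) = a * \<Phi> (monomial n s) + b * \<Phi> (monomial n t)"
    if "s \<in> tensors n" "t \<in> tensors n" for s t a b
    unfolding monomial_combination using that by (intro polynomials_dualD(1)[OF \<Phi>] monomial_in_polynomials)
  ultimately show ?thesis
    unfolding tensors_dual_def dual_space_def using tensors_combination
    by (auto simp: tensors_topology_def)
qed

subsection \<open>Distributions and their kernels\<close>

text \<open>Here \<open>A m\<close> is \<open>m!\<close> times the \<open>m\<close>-th Taylor kernel of \<open>1 / l\<^sub>\<mu>\<close>, and \<open>cut (A m)\<close> applies it to the last \<open>m\<close> slots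
  of a tensor: multiplying the series of \<open>1 / l\<^sub>\<mu>(\<theta>)\<close> and of \<open>e\<^bsup>\<langle>x, \<theta>\<rangle>\<^esup>\<close> gives the binomial formula for \<open>P\<^sub>n(x)\<close>.\<close>

definition appell_data :: "('h \<Rightarrow> real) measure \<Rightarrow> (nat \<Rightarrow> (('h \<Rightarrow> real) list \<Rightarrow> complex) \<Rightarrow> complex) \<Rightarrow> bool" where
  "appell_data \<mu> A \<longleftrightarrow> (\<forall>m. A m \<in> tensors_dual m) \<and> (\<forall>t\<in>tensors 0. A 0 t = t []) \<and>
     (\<forall>n. \<forall>t\<in>tensors n. appell_monomial \<mu> n t =
        (\<lambda>x. \<Sum>k\<le>n. of_nat (n choose k) * monomial k (cut (A (n - k)) k t) x))"

context
  fixes \<mu> A assumes appell: "appell_data \<mu> A"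
begin

lemma appell_dual: "A m \<in> tensors_dual m"
  using appell by (simp add: appell_data_def)

lemma appell_cut: "t \<in> tensors n \<Longrightarrow> k \<le> n \<Longrightarrow> cut (A (n - k)) k t \<in> tensors k"
  using cut_in_tensors[OF appell_dual, of t k "n - k"] by simp

text \<open>The term \<open>k = n\<close> of the binomial formula is the monomial of
  \<open>t\<close> itself; this makes the passage from monomials to Appell polynomials
  unitriangular.\<close>

lemma appell_cut_0: assumes t: "t \<in> tensors n" shows "cut (A 0) n t = t"
proof
  fix xs
  show "cut (A 0) n t xs = t xs"
  proof (cases "length xs = n \<and> set xs \<subseteq> nuc_dual")
    case True
    then have "(\<lambda>ys. t (xs @ ys)) \<in> tensors 0" using t by (intro tensors_append) auto
    then show ?thesis using True appell by (simp add: cut_def appell_data_def)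
  next
    case False
    have "t xs = 0" using mtensD(1)[OF _ False] t by (simp add: tensors_iff)
    then show ?thesis using False by (auto simp: cut_def)
  qed
qed

lemma appell_monomial_eq:
  "t \<in> tensors n \<Longrightarrow> appell_monomial \<mu> n t = (\<lambda>x. \<Sum>k\<le>n. of_nat (n choose k) * monomial k (cut (A (n - k)) k t) x)"
  using appell by (simp add: appell_data_def)

lemma appell_monomial_in_polynomials: "t \<in> tensors n \<Longrightarrow> appell_monomial \<mu> n t \<in> polynomials"
  unfolding appell_monomial_eq by (intro polynomials_sum monomial_in_polynomials appell_cut) auto

lemma dual_appell_monomial:
  assumes "\<Phi> \<in> polynomials_dual" "t \<in> tensors n"
  shows "\<Phi> (appell_monomial \<mu> n t) = (\<Sum>k\<le>n. of_nat (n choose k) * \<Phi> (monomial k (cut (A (n - k)) k t)))"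
  unfolding appell_monomial_eq[OF assms(2)]
  using assms(2) by (intro polynomials_dual_sum[OF assms(1)] monomial_in_polynomials appell_cut) auto

text \<open>The definite description is resolved by testing with a single nonzero coefficient, which
  forces the candidate. The candidate is continuous because the binomial formula composes the
  functionals \<open>\<Phi> (monomial k _)\<close> with contractions.\<close>

lemma kernels_eq:
  assumes \<Phi>: "\<Phi> \<in> polynomials_dual"
  shows "kernels \<mu> \<Phi> = (\<lambda>n t. if t \<in> tensors n then \<Phi> (appell_monomial \<mu> n t) / fact n else 0)"
    and "kernels \<mu> \<Phi> n \<in> tensors_dual n"
proof -
  define K where "K n t = (if t \<in> tensors n then \<Phi> (appell_monomial \<mu> n t) / fact n else 0)" for n t
  have Kd: "K n \<in> tensors_dual n" for n
  proof -
    let ?L = "\<lambda>k t. if t \<in> tensors n then (if cut (A (n - k)) k t \<in> tensors k then \<Phi> (monomial k (cut (A (n - k)) k t)) else 0) else 0"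
    have "?L k \<in> tensors_dual n" if "k \<le> n" for k
    proof -
      have n: "k + (n - k) = n" using that by simp
      show ?thesis using tensors_dual_cut[OF appell_dual polynomials_dual_monomial[OF \<Phi>], of k "n - k"] unfolding n .
    qed
    then have "(\<lambda>t. \<Sum>k\<le>n. (of_nat (n choose k) / fact n) * ?L k t) \<in> tensors_dual n"
      by (intro tensors_dual_sum) auto
    also have "(\<lambda>t. \<Sum>k\<le>n. (of_nat (n choose k) / fact n) * ?L k t) = K n"
    proof
      fix t
      show "(\<Sum>k\<le>n. (of_nat (n choose k) / fact n) * ?L k t) = K n t"
      proof (cases "t \<in> tensors n")
        case True
        have "(\<Sum>k\<le>n. (of_nat (n choose k) / fact n) * ?L k t) = (\<Sum>k\<le>n. of_nat (n choose k) * \<Phi> (monomial k (cut (A (n - k)) k t)) / fact n)"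
          using True appell_cut[OF True] by (intro sum.cong refl) auto
        then show ?thesis using True dual_appell_monomial[OF \<Phi> True] by (simp add: K_def sum_divide_distrib)
      qed (simp add: K_def)
    qed
    finally show ?thesis .
  qed
  have char: "\<Phi> (\<lambda>x. \<Sum>n\<le>m. appell_monomial \<mu> n (c n) x) = (\<Sum>n\<le>m. \<Phi> (appell_monomial \<mu> n (c n)))" if "\<forall>n\<le>m. c n \<in> tensors n" for m c
    using polynomials_dual_sum[OF \<Phi>, of "{..m}" "\<lambda>n. appell_monomial \<mu> n (c n)" "\<lambda>_. 1"] that appell_monomial_in_polynomials by simp
  have kK: "kernels \<mu> \<Phi> = K"
    unfolding kernels_def
  proof (rule the_equality)
    show "(\<forall>n. K n \<in> tensors_dual n) \<and> (\<forall>m c. (\<forall>n\<le>m. c n \<in> tensors n) \<longrightarrow>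
        \<Phi> (\<lambda>x. \<Sum>n\<le>m. appell_monomial \<mu> n (c n) x) = (\<Sum>n\<le>m. fact n * K n (c n)))"
      using Kd char by (auto simp: K_def intro!: sum.cong)
    fix K' assume K': "(\<forall>n. K' n \<in> tensors_dual n) \<and> (\<forall>m c. (\<forall>n\<le>m. c n \<in> tensors n) \<longrightarrow>
        \<Phi> (\<lambda>x. \<Sum>n\<le>m. appell_monomial \<mu> n (c n) x) = (\<Sum>n\<le>m. fact n * K' n (c n)))"
    show "K' = K"
    proof (intro ext)
      fix n t
      show "K' n t = K n t"
      proof (cases "t \<in> tensors n")
        case True
        define c where "c i = (if i = n then t else (\<lambda>_. 0))" for i
        have ct: "\<forall>i\<le>n. c i \<in> tensors i" using True by (simp add: c_def)
        have sel: "(\<Sum>i\<le>n. fact i * K0 i (c i)) = fact n * K0 n t" if "\<forall>i. K0 i \<in> tensors_dual i" for K0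
        proof -
          have "(\<Sum>i\<le>n. fact i * K0 i (c i)) = (\<Sum>i\<le>n. if i = n then fact n * K0 n t else 0)"
            using tensors_dual_zero that by (intro sum.cong refl) (auto simp: c_def)
          then show ?thesis by simp
        qed
        have "(\<Sum>i\<le>n. fact i * K' i (c i)) = (\<Sum>i\<le>n. \<Phi> (appell_monomial \<mu> i (c i)))" using K' char[OF ct] ct by simp
        also have "\<dots> = (\<Sum>i\<le>n. fact i * K i (c i))" using ct by (auto simp: K_def intro!: sum.cong)
        finally show ?thesis using sel[of K'] sel[of K] K' Kd by simp
      next
        case False
        have "K' n \<in> tensors_dual n" using K' by blast
        then show ?thesis using tensors_dualD(2)[OF _ False, of "K' n"] tensors_dualD(2)[OF Kd False] by simp
      qed
    qed
  qed
  show "kernels \<mu> \<Phi> = (\<lambda>n t. if t \<in> tensors n then \<Phi> (appell_monomial \<mu> n t) / fact n else 0)"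
    unfolding kK by (simp add: K_def fun_eq_iff)
  show "kernels \<mu> \<Phi> n \<in> tensors_dual n" unfolding kK by (rule Kd)
qed

text \<open>The condition \<open>\<Phi> (appell_monomial \<mu> n t) = fact n * K n t\<close> is
  solved recursively in \<open>n\<close> for the value of \<open>\<Phi>\<close> on monomials, whose
  top coefficient is 1; \<open>polynomials_functional\<close> then glues these values to one
  functional.\<close>

lemma kernels_surj:
  assumes K: "\<And>n. K n \<in> tensors_dual n"
  shows "\<exists>\<Phi>\<in>polynomials_dual. kernels \<mu> \<Phi> = K"
proof -
  define P where "P f n r \<longleftrightarrow> r \<in> tensors_dual n \<and>
     (\<forall>t\<in>tensors n. r t = fact n * K n t - (\<Sum>k<n. of_nat (n choose k) * f k (cut (A (n - k)) k t)))" for f n r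
  have "\<exists>L. \<forall>n. P L n (L n)"
  proof (rule dependent_wellorder_choice)
    show "P f n r = P g n r" if "\<And>y. y < n \<Longrightarrow> f y = g y" for r f g n
    proof -
      have "(\<Sum>k<n. of_nat (n choose k) * f k (cut (A (n - k)) k t)) = (\<Sum>k<n. of_nat (n choose k) * g k (cut (A (n - k)) k t))" for t
        using that by (intro sum.cong refl) simp
      then show ?thesis by (simp only: P_def)
    qed
    show "\<exists>r. P f n r" if IH: "\<And>y. y < n \<Longrightarrow> P f y (f y)" for n f
    proof -
      have f: "f k \<in> tensors_dual k" if "k < n" for k using IH[OF that] unfolding P_def by (rule conjunct1)
      let ?L = "\<lambda>k t. if t \<in> tensors n then f k (cut (A (n - k)) k t) else 0"
      have "?L k \<in> tensors_dual n" if "k < n" for k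
      proof -
        have n: "k + (n - k) = n" using that by simp
        show ?thesis using tensors_dual_cut[OF appell_dual f[OF that], of "n - k"] unfolding n .
      qed
      then have "(\<lambda>t. \<Sum>k<n. of_nat (n choose k) * ?L k t) \<in> tensors_dual n" by (intro tensors_dual_sum) auto
      then have "(\<lambda>t. fact n * K n t + (- 1) * (\<Sum>k<n. of_nat (n choose k) * ?L k t)) \<in> tensors_dual n"
        by (rule tensors_dual_combination[OF K])
      then show ?thesis unfolding P_def by (intro exI conjI) auto
    qed
  qed
  then obtain L where L: "\<forall>n. P L n (L n)" by blast
  have Ld: "L n \<in> tensors_dual n" for n using L by (simp add: P_def)
  obtain \<Phi> where \<Phi>: "\<Phi> \<in> polynomials_dual" "\<forall>n. \<forall>t\<in>tensors n. \<Phi> (monomial n t) = L n t"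
    using polynomials_functional[of L, OF Ld] by blast
  have "\<Phi> (appell_monomial \<mu> n t) = fact n * K n t" if t: "t \<in> tensors n" for n t
  proof -
    have "\<Phi> (appell_monomial \<mu> n t) = (\<Sum>k\<le>n. of_nat (n choose k) * L k (cut (A (n - k)) k t))"
      unfolding dual_appell_monomial[OF \<Phi>(1) t] using \<Phi>(2) appell_cut[OF t] by (intro sum.cong refl) auto
    also have "\<dots> = (\<Sum>k<n. of_nat (n choose k) * L k (cut (A (n - k)) k t)) + L n t"
      using appell_cut_0[OF t] by (simp flip: lessThan_Suc_atMost)
    also have "\<dots> = fact n * K n t" using L t by (simp add: P_def)
    finally show ?thesis .
  qed
  then have "kernels \<mu> \<Phi> = K"
    unfolding kernels_eq(1)[OF \<Phi>(1)] using tensors_dualD(2)[OF K] by (auto simp: fun_eq_iff)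
  then show ?thesis using \<Phi>(1) by blast
qed

text \<open>By the same triangular recursion the values on Appell polynomials determine those on
  monomials.\<close>

lemma kernels_inj:
  assumes \<Phi>: "\<Phi> \<in> polynomials_dual" "\<Psi> \<in> polynomials_dual" and eq: "kernels \<mu> \<Phi> = kernels \<mu> \<Psi>"
  shows "\<Phi> = \<Psi>"
proof -
  have ap: "\<Phi> (appell_monomial \<mu> n t) = \<Psi> (appell_monomial \<mu> n t)" if "t \<in> tensors n" for n t
    using fun_cong[OF fun_cong[OF eq, of n], of t] that
    unfolding kernels_eq(1)[OF \<Phi>(1)] kernels_eq(1)[OF \<Phi>(2)] by simp
  have mon: "\<Phi> (monomial n t) = \<Psi> (monomial n t)" if "t \<in> tensors n" for n t
    using that
  proof (induction n arbitrary: t rule: less_induct)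
    case (less n)
    have e: "X (monomial n t) = X (appell_monomial \<mu> n t) - (\<Sum>k<n. of_nat (n choose k) * X (monomial k (cut (A (n - k)) k t)))"
      if "X \<in> polynomials_dual" for X
      unfolding dual_appell_monomial[OF that less.prems] using appell_cut_0[OF less.prems]
      by (simp flip: lessThan_Suc_atMost)
    have "(\<Sum>k<n. of_nat (n choose k) * \<Phi> (monomial k (cut (A (n - k)) k t))) = (\<Sum>k<n. of_nat (n choose k) * \<Psi> (monomial k (cut (A (n - k)) k t)))"
      using less.IH appell_cut[OF less.prems] by (intro sum.cong refl) auto
    then show ?case using e[OF \<Phi>(1)] e[OF \<Phi>(2)] ap[OF less.prems] by simp
  qed
  show ?thesis
  proof
    fix \<phi>
    show "\<Phi> \<phi> = \<Psi> \<phi>"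
    proof (cases "\<phi> \<in> polynomials")
      case True
      then obtain m c where c: "\<forall>n\<le>m. c n \<in> tensors n" "\<phi> = (\<lambda>x. \<Sum>n\<le>m. monomial n (c n) x)"
        by (auto simp: polynomials_def)
      have e: "X \<phi> = (\<Sum>n\<le>m. X (monomial n (c n)))" if "X \<in> polynomials_dual" for X
        using polynomials_dual_sum[OF that, of "{..m}" "\<lambda>n. monomial n (c n)" "\<lambda>_. 1"] c monomial_in_polynomials by simp
      have "(\<Sum>n\<le>m. \<Phi> (monomial n (c n))) = (\<Sum>n\<le>m. \<Psi> (monomial n (c n)))"
        using mon c(1) by (intro sum.cong refl) auto
      then show ?thesis using e[OF \<Phi>(1)] e[OF \<Phi>(2)] by simp
    qed (use polynomials_dualD(2)[OF \<Phi>(1)] polynomials_dualD(2)[OF \<Phi>(2)] in simp)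
  qed
qed

end


subsection \<open>The Appell system\<close>

lemma topspace_nucC: "topspace nucC_topology = nucC"
  by (simp add: nucC_topology_def)

lemma laplace_hol:
  assumes "\<mu> \<in> analytic_measures"
  shows "\<exists>p r C. 0 < r \<and> NC.hol p r C (laplace \<mu>)"
proof -
  obtain U where U: "0 \<in> U" "holomorphic_in nucC_topology U (laplace \<mu>)" using assms by (auto simp: analytic_measures_def)
  then obtain G where G: "openin nucC_topology G" "0 \<in> G" "G \<subseteq> U" "bounded (laplace \<mu> ` G)"
    unfolding holomorphic_in_def by blast
  obtain C where C: "\<forall>z\<in>laplace \<mu> ` G. norm z \<le> C" using G(4) by (auto simp: bounded_iff)
  obtain p r where r: "0 < r" "\<forall>\<theta>\<in>nucC. nrmC p \<theta> < r \<longrightarrow> \<theta> \<in> G" using nucC_nhd[OF G(1,2)] by blast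
  have "NC.hol p r C (laplace \<mu>)"
    unfolding NC.hol_def
  proof (intro conjI ballI impI)
    show "cmod (laplace \<mu> \<theta>) \<le> C" if "\<theta> \<in> nucC" "nrmC p \<theta> < r" for \<theta> using that r(2) C by blast
    fix \<theta> \<eta> assume t: "\<theta> \<in> nucC" "\<eta> \<in> nucC" "nrmC p \<theta> < r"
    then have "\<theta> \<in> U" using r(2) G(3) by blast
    then obtain \<rho> where "0 < \<rho>" "(\<lambda>\<zeta>. laplace \<mu> (\<theta> + cscale \<zeta> \<eta>)) holomorphic_on ball 0 \<rho>"
      using U(2) t(2) unfolding holomorphic_in_def topspace_nucC by blast
    then show "(\<lambda>\<zeta>. laplace \<mu> (\<theta> + cscale \<zeta> \<eta>)) field_differentiable at 0"
      by (intro holomorphic_on_imp_differentiable_at[of _ "ball 0 \<rho>"]) auto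
  qed
  then show ?thesis using r(1) by blast
qed

lemma laplace_0:
  assumes "\<mu> \<in> analytic_measures" "prob_space \<mu>"
  shows "laplace \<mu> 0 = 1"
proof -
  interpret prob_space \<mu> by fact
  have "laplace \<mu> 0 = (LINT x|\<mu>. 1)"
    unfolding laplace_def
  proof (rule Bochner_Integration.integral_cong[OF refl])
    fix x assume "x \<in> space \<mu>"
    then have "x \<in> nuc_dual" using assms(1) by (simp add: analytic_measures_def)
    then have "x 0 = 0" by (rule nuc_dual_zero)
    then show "exp (pairing x 0) = 1" by (simp add: pairing_def zero_complex.code[symmetric])
  qed
  then show ?thesis by (simp add: prob_space)
qed

text \<open>Near 0 the Lipschitz estimate keeps \<open>laplace \<mu>\<close> within
  \<open>1 / 2\<close> of its value 1 at 0.\<close>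

lemma inverse_laplace_hol:
  assumes "\<mu> \<in> analytic_measures" "prob_space \<mu>"
  shows "\<exists>p r. 0 < r \<and> NC.hol p r 2 (\<lambda>\<theta>. 1 / laplace \<mu> \<theta>)"
proof -
  obtain p r C where F: "0 < r" "NC.hol p r C (laplace \<mu>)" using laplace_hol[OF assms(1)] by blast
  have l0: "laplace \<mu> 0 = 1" using laplace_0[OF assms] .
  have "cmod (laplace \<mu> 0) \<le> C" using NC.holD(1)[OF F(2) NC.X_zero] F(1) by simp
  then have C: "1 \<le> C" using l0 by simp
  \<comment> \<open>\<open>C / (r / 2)\<close> times this radius is \<open>1 / 2\<close>, and
    \<open>1 \<le> C\<close> gives \<open>r1 \<le> r / 4\<close>, which leaves the margin
    \<open>r / 2\<close> for \<open>hol_lipschitz\<close>.\<close>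
  define r1 where "r1 = r / (4 * C)"
  have r1: "0 < r1" "r1 \<le> r / 4" using F(1) C by (auto simp: r1_def field_simps)
  have half: "1 / 2 \<le> cmod (laplace \<mu> \<theta>)" if t: "\<theta> \<in> nucC" "nrmC p \<theta> < r1" for \<theta>
  proof -
    have "cmod (laplace \<mu> 0 - laplace \<mu> \<theta>) \<le> C / (r / 2) * nrmC p (0 - \<theta>)"
      using t r1 F(1) by (intro NC.hol_lipschitz[OF F(2) NC.X_zero]) auto
    also have "nrmC p (0 - \<theta>) = nrmC p \<theta>" using NC.N_minus_commute[OF NC.X_zero t(1), of p] by simp
    also have "C / (r / 2) * nrmC p \<theta> \<le> C / (r / 2) * r1" using t(2) C F(1) by (intro mult_left_mono) auto
    also have "\<dots> = 1 / 2" using C F(1) by (simp add: r1_def)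
    finally have "cmod (1 - laplace \<mu> \<theta>) \<le> 1 / 2" using l0 by simp
    then show ?thesis using norm_triangle_ineq2[of 1 "1 - laplace \<mu> \<theta>"] by simp
  qed
  have "NC.hol p r1 2 (\<lambda>\<theta>. 1 / laplace \<mu> \<theta>)"
    unfolding NC.hol_def
  proof (intro conjI ballI impI)
    show "cmod (1 / laplace \<mu> \<theta>) \<le> 2" if "\<theta> \<in> nucC" "nrmC p \<theta> < r1" for \<theta>
    proof -
      have "0 < cmod (laplace \<mu> \<theta>)" using half[OF that] by linarith
      then show ?thesis using half[OF that] by (simp add: norm_divide divide_le_eq)
    qed
    fix \<theta> \<eta> assume t: "\<theta> \<in> nucC" "\<eta> \<in> nucC" "nrmC p \<theta> < r1"
    have nz: "laplace \<mu> (\<theta> + cscale 0 \<eta>) \<noteq> 0" using half[OF t(1,3)] by auto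
    have "nrmC p \<theta> < r" using t(3) r1 F(1) by linarith
    then have d: "(\<lambda>\<zeta>. laplace \<mu> (\<theta> + cscale \<zeta> \<eta>)) field_differentiable at 0"
      using NC.holD(2)[OF F(2) t(1) _ t(2)] by blast
    show "(\<lambda>\<zeta>. 1 / laplace \<mu> (\<theta> + cscale \<zeta> \<eta>)) field_differentiable at 0"
      by (rule field_differentiable_divide[OF field_differentiable_const d nz])
  qed
  then show ?thesis using r1(1) by blast
qed

lemma tensor_power_append:
  assumes "x \<in> nuc_dual"
  shows "tensor_power (k + m) \<theta> (replicate k x @ ys) = pairing x \<theta> ^ k * tensor_power m \<theta> ys"
  using assms by (auto simp: tensor_power_def map_replicate_const prod_list_replicate)

lemma tensor_power_zero: "0 < n \<Longrightarrow> tensor_power n 0 = (\<lambda>_. 0)"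
proof
  fix xs assume n: "0 < n"
  show "tensor_power n 0 xs = 0"
  proof (cases "length xs = n \<and> set xs \<subseteq> nuc_dual")
    case True
    then obtain x ys where xs: "xs = x # ys" using n by (cases xs) auto
    have "x 0 = 0" using True xs nuc_dual_zero by simp
    then show ?thesis using True xs by (simp add: tensor_power_def pairing_def zero_complex.code[symmetric])
  qed (auto simp: tensor_power_def)
qed

text \<open>Absolute convergence is assumed because the generating function arises as a Cauchy
  product with the exponential series. The uniqueness demanded by the definite description is
  \<open>power_kernels_unique\<close>.\<close>

lemma appell_kernels:
  assumes A: "\<And>m. A m \<in> tensors_dual m" and U: "openin nucC_topology U" "0 \<in> U"
    and s: "\<And>\<theta>. \<theta> \<in> U \<Longrightarrow> (\<lambda>m. A m (tensor_power m \<theta>) / fact m) sums (1 / laplace \<mu> \<theta>)"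
    and ab: "\<And>\<theta>. \<theta> \<in> U \<Longrightarrow> summable (\<lambda>m. cmod (A m (tensor_power m \<theta>) / fact m))"
    and x: "x \<in> nuc_dual"
  shows "appell \<mu> (x, \<lambda>_. 0) = (\<lambda>n t. \<Sum>k\<le>n. of_nat (n choose k) * (if t \<in> tensors n then cut (A (n - k)) k t (replicate k x) else 0))"
    (is "_ = ?P")
proof -
  have UN: "\<theta> \<in> nucC" if "\<theta> \<in> U" for \<theta> using openin_subset[OF U(1)] that topspace_nucC by blast
  have Pd: "?P n \<in> tensors_dual n" for n
  proof (rule tensors_dual_sum)
    fix k assume "k \<in> {..n}"
    then have n: "k + (n - k) = n" by simp
    have "(\<lambda>t. if t \<in> tensors (length (replicate k x)) then t (replicate k x) else 0) \<in> tensors_dual (length (replicate k x))"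
      using x by (intro evaluation_in_dual) (auto simp: set_replicate_conv_if)
    then have e: "(\<lambda>t. if t \<in> tensors k then t (replicate k x) else 0) \<in> tensors_dual k" by simp
    have "(\<lambda>t. if t \<in> tensors n then (if cut (A (n - k)) k t \<in> tensors k then cut (A (n - k)) k t (replicate k x) else 0) else 0) \<in> tensors_dual n"
      using tensors_dual_cut[OF A[of "n - k"] e] unfolding n .
    also have "(\<lambda>t. if t \<in> tensors n then (if cut (A (n - k)) k t \<in> tensors k then cut (A (n - k)) k t (replicate k x) else 0) else 0) =
       (\<lambda>t. if t \<in> tensors n then cut (A (n - k)) k t (replicate k x) else 0)"
      using cut_in_tensors[OF A[of "n - k"], of _ k] unfolding n by (auto simp: fun_eq_iff)
    finally show "(\<lambda>t. if t \<in> tensors n then cut (A (n - k)) k t (replicate k x) else 0) \<in> tensors_dual n" .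
  qed
  have gen: "(\<lambda>n. ?P n (tensor_power n \<theta>) / fact n) sums normalized_exponential \<mu> \<theta> (x, \<lambda>_. 0)" if t: "\<theta> \<in> U" for \<theta>
  proof -
    have th: "\<theta> \<in> nucC" using UN[OF t] .
    let ?z = "pairing x \<theta>"
    define a where "a k = ?z ^ k / fact k" for k
    define b where "b m = A m (tensor_power m \<theta>) / fact m" for m
    have tm: "cut (A (n - k)) k (tensor_power n \<theta>) (replicate k x) = ?z ^ k * A (n - k) (tensor_power (n - k) \<theta>)" if "k \<le> n" for n k
    proof -
      have n: "k + (n - k) = n" using that by simp
      have "(\<lambda>ys. tensor_power n \<theta> (replicate k x @ ys)) = (\<lambda>ys. ?z ^ k * tensor_power (n - k) \<theta> ys)"
        using tensor_power_append[OF x, of k "n - k" \<theta>] unfolding n by blast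
      then have "cut (A (n - k)) k (tensor_power n \<theta>) (replicate k x) = A (n - k) (\<lambda>ys. ?z ^ k * tensor_power (n - k) \<theta> ys)"
        using x by (simp add: cut_def set_replicate_conv_if)
      also have "\<dots> = ?z ^ k * A (n - k) (tensor_power (n - k) \<theta>)"
        by (rule tensors_dual_scale[OF A tensor_power_in_tensors[OF th]])
      finally show ?thesis .
    qed
    have eq: "?P n (tensor_power n \<theta>) / fact n = (\<Sum>k\<le>n. a k * b (n - k))" for n
    proof -
      have "?P n (tensor_power n \<theta>) / fact n = (\<Sum>k\<le>n. of_nat (n choose k) * (?z ^ k * A (n - k) (tensor_power (n - k) \<theta>)) / fact n)"
        unfolding sum_divide_distrib using tensor_power_in_tensors[OF th, of n] tm by (intro sum.cong refl) auto
      also have "\<dots> = (\<Sum>k\<le>n. a k * b (n - k))"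
        by (intro sum.cong refl) (auto simp: a_def b_def binomial_fact field_simps)
      finally show ?thesis .
    qed
    have ae: "a = (\<lambda>k. ?z ^ k /\<^sub>R fact k)"
      by (simp add: a_def fun_eq_iff scaleR_conv_of_real divide_inverse mult.commute)
    have as: "a sums exp ?z" unfolding ae by (rule exp_converges)
    have "summable (\<lambda>k. norm (a k))" unfolding ae by (rule summable_norm_exp)
    moreover have "summable (\<lambda>k. norm (b k))" using ab[OF t] by (simp add: b_def)
    ultimately have "(\<lambda>n. \<Sum>k\<le>n. a k * b (n - k)) sums ((\<Sum>k. a k) * (\<Sum>k. b k))" by (rule Cauchy_product_sums)
    also have "(\<Sum>k. a k) = exp ?z" using sums_unique[OF as] by simp
    also have "(\<Sum>k. b k) = 1 / laplace \<mu> \<theta>" using sums_unique[OF s[OF t]] by (simp add: b_def)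
    also have "exp ?z * (1 / laplace \<mu> \<theta>) = normalized_exponential \<mu> \<theta> (x, \<lambda>_. 0)"
      by (simp add: normalized_exponential_def pairingC_def) (simp add: pairing_def zero_complex.code[symmetric])
    finally show ?thesis unfolding eq .
  qed
  show ?thesis
    unfolding appell_def
  proof (rule the_equality)
    show "(\<forall>n. ?P n \<in> tensors_dual n) \<and> (\<exists>U. openin nucC_topology U \<and> 0 \<in> U \<and>
        (\<forall>\<theta>\<in>U. (\<lambda>n. ?P n (tensor_power n \<theta>) / fact n) sums normalized_exponential \<mu> \<theta> (x, \<lambda>_. 0)))"
      using Pd U gen by (intro conjI allI exI[of _ U] ballI)
    fix P assume P: "(\<forall>n. P n \<in> tensors_dual n) \<and> (\<exists>U. openin nucC_topology U \<and> 0 \<in> U \<and>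
        (\<forall>\<theta>\<in>U. (\<lambda>n. P n (tensor_power n \<theta>) / fact n) sums normalized_exponential \<mu> \<theta> (x, \<lambda>_. 0)))"
    then obtain V where V: "openin nucC_topology V" "0 \<in> V"
      "\<forall>\<theta>\<in>V. (\<lambda>n. P n (tensor_power n \<theta>) / fact n) sums normalized_exponential \<mu> \<theta> (x, \<lambda>_. 0)" by blast
    have sc: "(\<lambda>t. Q n t / fact n) \<in> tensors_dual n" if "Q n \<in> tensors_dual n" for Q :: "nat \<Rightarrow> _ \<Rightarrow> complex" and n
      using tensors_dual_combination[OF that that, of "1 / fact n" 0] by simp
    have "(\<lambda>n t. P n t / fact n) = (\<lambda>n t. ?P n t / fact n)"
    proof (rule power_kernels_unique[where U = V and V = U and G = "\<lambda>\<theta>. normalized_exponential \<mu> \<theta> (x, \<lambda>_. 0)"])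
      show "(\<lambda>t. P n t / fact n) \<in> tensors_dual n" for n using P by (intro sc) blast
      show "(\<lambda>t. ?P n t / fact n) \<in> tensors_dual n" for n using Pd by (rule sc)
    qed (use V U gen in blast)+
    then have "P n t / fact n = ?P n t / fact n" for n t by (simp add: fun_eq_iff)
    then show "P = ?P" by (simp add: fun_eq_iff)
  qed
qed

lemma appell_data_exists:
  assumes "\<mu> \<in> analytic_measures" "prob_space \<mu>"
  shows "\<exists>A. appell_data \<mu> A"
proof -
  obtain p r where F: "0 < r" "NC.hol p r 2 (\<lambda>\<theta>. 1 / laplace \<mu> \<theta>)" using inverse_laplace_hol[OF assms] by blast
  obtain q c where q: "p < q" "0 \<le> c" and KT: "\<forall>F. (\<exists>r C. 0 < r \<and> NC.hol p r C F) \<longrightarrow>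
     (\<exists>K. (\<forall>n. K n \<in> tensors_dual n) \<and>
       (\<forall>r C. 0 < r \<longrightarrow> NC.hol p r C F \<longrightarrow>
          (\<forall>n. \<forall>t\<in>tensors n. cmod (K n t) \<le> C * exp (real (n + 1)) * (c / r) ^ n * tensor_norm q n t) \<and>
          (\<forall>\<theta>\<in>nucC. nrmC p \<theta> < r \<longrightarrow> (\<lambda>n. K n (tensor_power n \<theta>)) sums F \<theta>)))"
    using kernel_theorem[of p] by blast
  obtain K where K: "\<forall>n. K n \<in> tensors_dual n"
      and Kr: "\<forall>r C. 0 < r \<longrightarrow> NC.hol p r C (\<lambda>\<theta>. 1 / laplace \<mu> \<theta>) \<longrightarrow>
          (\<forall>n. \<forall>t\<in>tensors n. cmod (K n t) \<le> C * exp (real (n + 1)) * (c / r) ^ n * tensor_norm q n t) \<and>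
          (\<forall>\<theta>\<in>nucC. nrmC p \<theta> < r \<longrightarrow> (\<lambda>n. K n (tensor_power n \<theta>)) sums (1 / laplace \<mu> \<theta>))"
    using KT F by blast
  have Kb: "\<forall>n. \<forall>t\<in>tensors n. cmod (K n t) \<le> 2 * exp (real (n + 1)) * (c / r) ^ n * tensor_norm q n t"
    and Ks: "\<forall>\<theta>\<in>nucC. nrmC p \<theta> < r \<longrightarrow> (\<lambda>n. K n (tensor_power n \<theta>)) sums (1 / laplace \<mu> \<theta>)"
    using Kr F by blast+
  define A where "A m t = fact m * K m t" for m t
  have Ad: "A m \<in> tensors_dual m" for m
    unfolding A_def using tensors_dual_combination[of "K m" m "K m" "fact m" 0] K by simp
  have AK: "A m t / fact m = K m t" for m t by (simp add: A_def)
  \<comment> \<open>The geometric rate of the kernel bound, the exponential contributing a factor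
    \<open>exp 1\<close> per order. The radius \<open>r2\<close> ensures
    \<open>\<kappa> * nrmC q \<theta> \<le> 1 / 2\<close>; its \<open>+ 1\<close> avoids a division
    by 0 when \<open>c = 0\<close>.\<close>
  define \<kappa> where "\<kappa> = exp 1 * (c / r)"
  have kap: "0 \<le> \<kappa>" using q(2) F(1) by (simp add: \<kappa>_def)
  define r2 where "r2 = min r (1 / (2 * (\<kappa> + 1)))"
  have r2: "0 < r2" using F(1) kap by (simp add: r2_def)
  let ?U = "{\<theta> \<in> nucC. nrmC q \<theta> < r2}"
  have U: "openin nucC_topology ?U" "0 \<in> ?U" using nucC_ball_open r2 NC.X_zero NC.N_zero by auto
  have s: "(\<lambda>m. A m (tensor_power m \<theta>) / fact m) sums (1 / laplace \<mu> \<theta>)" if "\<theta> \<in> ?U" for \<theta>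
  proof -
    have "nrmC p \<theta> \<le> nrmC q \<theta>" using that q(1) by (intro nrmC_mono nucC_D(3)) auto
    then have "nrmC p \<theta> < r" using that by (simp add: r2_def)
    then show ?thesis unfolding AK using Ks that by blast
  qed
  have ab: "summable (\<lambda>m. cmod (A m (tensor_power m \<theta>) / fact m))" if t: "\<theta> \<in> ?U" for \<theta>
  proof (rule summable_comparison_test')
    show "summable (\<lambda>m. 2 * exp 1 * (1 / 2) ^ m :: real)" by (intro summable_mult summable_geometric) simp
    fix m
    have "nrmC q \<theta> \<le> 1 / (2 * (\<kappa> + 1))" using t by (simp add: r2_def)
    then have "nrmC q \<theta> * (2 * (\<kappa> + 1)) \<le> 1" using kap by (simp add: pos_le_divide_eq)
    then have half: "\<kappa> * nrmC q \<theta> \<le> 1 / 2" using nrmC_nonneg[of q \<theta>] by (simp add: algebra_simps)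
    have "cmod (K m (tensor_power m \<theta>)) \<le> 2 * exp (real (m + 1)) * (c / r) ^ m * tensor_norm q m (tensor_power m \<theta>)"
      using Kb tensor_power_in_tensors t by blast
    also have "\<dots> \<le> 2 * exp (real (m + 1)) * (c / r) ^ m * nrmC q \<theta> ^ m"
      using t q(2) F(1) by (intro mult_left_mono tensor_norm_tensor_power) auto
    also have "\<dots> = 2 * exp 1 * (\<kappa> * nrmC q \<theta>) ^ m"
    proof -
      have "exp (real (m + 1)) = exp 1 * exp 1 ^ m" using exp_of_nat_mult[of m "1::real"] by (simp add: exp_add)
      then show ?thesis unfolding \<kappa>_def power_mult_distrib by simp
    qed
    also have "\<dots> \<le> 2 * exp 1 * (1 / 2) ^ m"
      using half kap nrmC_nonneg by (intro mult_left_mono power_mono) auto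
    finally show "norm (cmod (A m (tensor_power m \<theta>) / fact m)) \<le> 2 * exp 1 * (1 / 2) ^ m" by (simp add: AK)
  qed
  \<comment> \<open>At \<open>\<theta> = 0\<close> only the term of order 0 survives, so
    \<open>A 0\<close> takes the value \<open>1 / laplace \<mu> 0 = 1\<close> on the power of order
    0, of which all tensors of order 0 are multiples.\<close>
  have A0: "A 0 t = t []" if t: "t \<in> tensors 0" for t
  proof -
    have "(\<lambda>m. A m (tensor_power m 0) / fact m) sums (1 / laplace \<mu> 0)" using s U(2) by blast
    moreover have "(\<lambda>m. A m (tensor_power m 0) / fact m) sums (\<Sum>m\<in>{0}. A m (tensor_power m 0) / fact m)"
    proof (rule sums_finite)
      fix n :: nat assume n: "n \<notin> {0}"
      then have "A n (tensor_power n 0) = 0" using tensors_dual_zero[OF Ad] tensor_power_zero[of n] by simp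
      then show "A n (tensor_power n 0) / fact n = 0" by simp
    qed simp
    ultimately have one: "A 0 (tensor_power 0 0) = 1" using sums_unique2 laplace_0[OF assms] by force
    have "t = (\<lambda>xs. t [] * tensor_power 0 0 xs)"
    proof
      fix xs show "t xs = t [] * tensor_power 0 0 xs"
        using t mtensD(1)[of t 0 xs] by (cases xs) (auto simp: tensor_power_def tensors_iff)
    qed
    then have "A 0 t = A 0 (\<lambda>xs. t [] * tensor_power 0 0 xs)" by simp
    also have "\<dots> = t [] * A 0 (tensor_power 0 0)" by (rule tensors_dual_scale[OF Ad tensor_power_in_tensors[OF NC.X_zero]])
    finally show ?thesis using one by simp
  qed
  have "appell_monomial \<mu> n t = (\<lambda>x. \<Sum>k\<le>n. of_nat (n choose k) * monomial k (cut (A (n - k)) k t) x)" if t: "t \<in> tensors n" for n t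
  proof
    fix x
    show "appell_monomial \<mu> n t x = (\<Sum>k\<le>n. of_nat (n choose k) * monomial k (cut (A (n - k)) k t) x)"
    proof (cases "x \<in> nuc_dual")
      case True
      have "appell \<mu> (x, \<lambda>_. 0) = (\<lambda>n t. \<Sum>k\<le>n. of_nat (n choose k) * (if t \<in> tensors n then cut (A (n - k)) k t (replicate k x) else 0))"
        by (rule appell_kernels[where U = ?U]) (fact Ad U s ab True)+
      then have "appell \<mu> (x, \<lambda>_. 0) n t = (\<Sum>k\<le>n. of_nat (n choose k) * cut (A (n - k)) k t (replicate k x))"
        using t by simp
      then show ?thesis using True by (simp add: appell_monomial_def monomial_def)
    qed (simp add: appell_monomial_def monomial_def)
  qed
  then show ?thesis using Ad A0 by (intro exI[of _ A]) (simp add: appell_data_def)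
qed

subsection \<open>Dual norms\<close>

lemma tensor_dual_norm_bound:
  assumes K: "K \<in> tensors_dual n" and c: "tensor_dual_norm p n K \<le> ennreal c" "0 \<le> c" and t: "t \<in> tensors n"
  shows "cmod (K t) \<le> c * tensor_norm p n t"
proof (rule field_le_epsilon)
  fix e :: real assume e: "0 < e"
  define \<delta> where "\<delta> = e / (c + 1)"
  have d: "0 < \<delta>" using e c(2) by (simp add: \<delta>_def)
  define a where "a = 1 / (tensor_norm p n t + \<delta>)"
  have s: "0 < tensor_norm p n t + \<delta>" using d tensor_norm_nonneg[of p n t] by simp
  then have a: "0 < a" by (simp add: a_def)
  have "tensor_norm p n (\<lambda>xs. complex_of_real a * t xs) \<le> a * tensor_norm p n t"
    using tensor_norm_scale_le[OF t, of p "complex_of_real a"] a by simp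
  also have "\<dots> \<le> a * (tensor_norm p n t + \<delta>)" using a d by simp
  also have "\<dots> = 1" using s by (simp add: a_def)
  finally have "(\<lambda>xs. complex_of_real a * t xs) \<in> {t \<in> tensors n. tensor_norm p n t \<le> 1}" using tensors_scale[OF t] by simp
  then have "ennreal (cmod (K (\<lambda>xs. complex_of_real a * t xs))) \<le> tensor_dual_norm p n K"
    unfolding tensor_dual_norm_def by (rule SUP_upper)
  then have "ennreal (cmod (K (\<lambda>xs. complex_of_real a * t xs))) \<le> ennreal c" using c(1) by (rule order_trans)
  then have "a * cmod (K t) \<le> c" using tensors_dual_scale[OF K t] a c(2) by (simp add: norm_mult)
  then have "cmod (K t) \<le> c * (tensor_norm p n t + \<delta>)" using s by (simp add: a_def divide_le_eq)
  also have "\<dots> \<le> c * tensor_norm p n t + e" using e c(2) by (simp add: \<delta>_def field_simps)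
  finally show "cmod (K t) \<le> c * tensor_norm p n t + e" .
qed

lemma tensor_dual_norm_leI:
  assumes "\<And>t. t \<in> tensors n \<Longrightarrow> cmod (K t) \<le> c * tensor_norm p n t" "0 \<le> c"
  shows "tensor_dual_norm p n K \<le> ennreal c"
  unfolding tensor_dual_norm_def
proof (rule SUP_least)
  fix t assume t: "t \<in> {t \<in> tensors n. tensor_norm p n t \<le> 1}"
  then have "cmod (K t) \<le> c * tensor_norm p n t" using assms(1) by blast
  also have "\<dots> \<le> c * 1" using t assms(2) by (intro mult_left_mono) auto
  finally show "ennreal (cmod (K t)) \<le> ennreal c" by (intro ennreal_leI) simp
qed

lemma tensor_dual_norm_mono:
  assumes "p \<le> q" shows "tensor_dual_norm q n K \<le> tensor_dual_norm p n K"
  unfolding tensor_dual_norm_def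
proof (rule SUP_subset_mono)
  show "{t \<in> tensors n. tensor_norm q n t \<le> 1} \<subseteq> {t \<in> tensors n. tensor_norm p n t \<le> 1}"
    using tensor_norm_mono[OF _ assms] by force
qed simp

lemma tensor_dual_norm_combination:
  "tensor_dual_norm p n (\<lambda>t. a * K t + b * L t) \<le> ennreal (cmod a) * tensor_dual_norm p n K + ennreal (cmod b) * tensor_dual_norm p n L"
  unfolding tensor_dual_norm_def[of p n "\<lambda>t. a * K t + b * L t"]
proof (rule SUP_least)
  fix t assume t: "t \<in> {t \<in> tensors n. tensor_norm p n t \<le> 1}"
  have "ennreal (cmod (a * K t + b * L t)) \<le> ennreal (cmod a * cmod (K t) + cmod b * cmod (L t))"
    using norm_triangle_ineq[of "a * K t" "b * L t"] by (intro ennreal_leI) (simp add: norm_mult)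
  also have "\<dots> = ennreal (cmod a) * ennreal (cmod (K t)) + ennreal (cmod b) * ennreal (cmod (L t))"
    by (simp add: ennreal_mult)
  also have "\<dots> \<le> ennreal (cmod a) * tensor_dual_norm p n K + ennreal (cmod b) * tensor_dual_norm p n L"
    unfolding tensor_dual_norm_def using t by (intro add_mono mult_left_mono SUP_upper) auto
  finally show "ennreal (cmod (a * K t + b * L t)) \<le> ennreal (cmod a) * tensor_dual_norm p n K + ennreal (cmod b) * tensor_dual_norm p n L" .
qed

end

subsection \<open>Lagrange interpolation and factorials\<close>

text \<open>Prepares the expansion of a tensor power of \<open>\<theta> + \<zeta> \<eta>\<close>:
  with the nodes \<open>0, ..., n\<close> it becomes a combination of honest tensor powers, where a
  binomial expansion would produce symmetrised mixed tensors.\<close>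

lemma lagrange_interpolation:
  fixes p :: "complex poly"
  assumes "degree p \<le> n"
  shows "poly p z = (\<Sum>j\<le>n. poly p (of_nat j) * (\<Prod>i\<in>{..n} - {j}. (z - of_nat i) / (of_nat j - of_nat i)))"
proof -
  define l where "l j = (\<Prod>i\<in>{..n} - {j}. [: - of_nat i / (of_nat j - of_nat i), 1 / (of_nat j - of_nat i) :] :: complex poly)" for j
  have lv: "poly (l j) w = (\<Prod>i\<in>{..n} - {j}. (w - of_nat i) / (of_nat j - of_nat i))" for j w
    unfolding l_def poly_prod by (intro prod.cong refl) (simp add: diff_divide_distrib)
  define q where "q = (\<Sum>j\<le>n. smult (poly p (of_nat j)) (l j))"
  have "degree (l j) \<le> n" if "j \<le> n" for j
  proof -
    have "degree (l j) \<le> (\<Sum>i\<in>{..n} - {j}. degree [: - of_nat i / (of_nat j - of_nat i), 1 / (of_nat j - of_nat i) :: complex :])"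
      unfolding l_def using degree_prod_sum_le[of "{..n} - {j}" "\<lambda>i. [: - of_nat i / (of_nat j - of_nat i), 1 / (of_nat j - of_nat i) :: complex :]"]
      by (simp add: o_def)
    also have "\<dots> \<le> (\<Sum>i\<in>{..n} - {j}. 1)" by (intro sum_mono) simp
    also have "\<dots> = n" using that by simp
    finally show ?thesis .
  qed
  then have dq: "degree q \<le> n"
    unfolding q_def by (intro degree_sum_le) (auto intro: order_trans[OF degree_smult_le])
  have "p = q"
  proof (rule poly_eqI_degree[where A = "of_nat ` {..n}"])
    have "card (of_nat ` {..n} :: complex set) = Suc n" by (subst card_image) (auto simp: inj_on_def)
    then show "degree p < card (of_nat ` {..n} :: complex set)" "degree q < card (of_nat ` {..n} :: complex set)"
      using assms dq by simp_all
    fix x :: complex assume "x \<in> of_nat ` {..n}"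
    then obtain k where k: "k \<le> n" "x = of_nat k" by auto
    have "poly q x = (\<Sum>j\<le>n. poly p (of_nat j) * poly (l j) x)" by (simp add: q_def poly_sum)
    also have "\<dots> = (\<Sum>j\<le>n. if j = k then poly p x else 0)"
    proof (rule sum.cong[OF refl])
      fix j assume "j \<in> {..n}"
      show "poly p (of_nat j) * poly (l j) x = (if j = k then poly p x else 0)"
      proof (cases "j = k")
        case True
        have "poly (l j) x = (\<Prod>i\<in>{..n} - {j}. 1)" unfolding lv using True k by (intro prod.cong refl) auto
        then show ?thesis using True k by simp
      next
        case False
        have "poly (l j) x = 0" unfolding lv using False k by (intro prod_zero) auto
        then show ?thesis using False by simp
      qed
    qed
    finally show "poly p x = poly q x" using k by simp
  qed
  then have "poly p z = poly q z" by simp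
  also have "\<dots> = (\<Sum>j\<le>n. poly p (of_nat j) * (\<Prod>i\<in>{..n} - {j}. (z - of_nat i) / (of_nat j - of_nat i)))"
    by (simp add: q_def poly_sum lv)
  finally show ?thesis .
qed

lemma lagrange_prod_list:
  fixes \<alpha> \<gamma> :: "'a \<Rightarrow> complex"
  assumes "length xs = n"
  shows "prod_list (map (\<lambda>x. \<alpha> x + z * \<gamma> x) xs) =
    (\<Sum>j\<le>n. (\<Prod>i\<in>{..n} - {j}. (z - of_nat i) / (of_nat j - of_nat i)) * prod_list (map (\<lambda>x. \<alpha> x + of_nat j * \<gamma> x) xs))"
proof -
  define p where "p ys = prod_list (map (\<lambda>x. [: \<alpha> x, \<gamma> x :]) ys)" for ys
  have v: "poly (p ys) w = prod_list (map (\<lambda>x. \<alpha> x + w * \<gamma> x) ys)" for ys w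
    by (induction ys) (simp_all add: p_def algebra_simps)
  have "degree (p ys) \<le> length ys" for ys
  proof (induction ys)
    case (Cons y ys)
    have "degree (p (y # ys)) \<le> degree [: \<alpha> y, \<gamma> y :] + degree (p ys)"
      unfolding p_def by (simp only: list.map prod_list.Cons degree_mult_le)
    also have "\<dots> \<le> 1 + length ys" using Cons.IH by (intro add_mono) auto
    finally show ?case by simp
  qed (simp add: p_def)
  then have "degree (p xs) \<le> n" using assms by metis
  from lagrange_interpolation[OF this, of z] show ?thesis unfolding v by (simp add: mult.commute)
qed

text \<open>The inequality that ties the factorial weight to the order of growth. With
  \<open>y = x powr (2 / s)\<close> the left side is \<open>(y ^ n / fact n) powr (s / 2)\<close>,
  and \<open>(2 * y) ^ n / fact n \<le> exp (2 * y)\<close>. Doubling \<open>y\<close> yields the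
  geometric factor on the right, which makes the bound summable over \<open>n\<close>.\<close>

lemma fact_powr_bound:
  fixes s x :: real
  assumes "0 < s" "0 \<le> x"
  shows "fact n powr (- (s / 2)) * x ^ n \<le> exp (s * x powr (2 / s)) * (2 powr (- (s / 2))) ^ n"
proof (cases "x = 0")
  case True
  then show ?thesis by (cases n) auto
next
  case False
  then have x: "0 < x" using assms(2) by simp
  define y where "y = x powr (2 / s)"
  have y: "0 < y" using x by (simp add: y_def)
  have xy: "x ^ n = (y ^ n) powr (s / 2)"
  proof -
    have "(y ^ n) powr (s / 2) = (y powr (s / 2)) ^ n" using y by (simp add: powr_power powr_powr mult.commute flip: powr_realpow)
    also have "y powr (s / 2) = x" using x assms(1) by (simp add: y_def powr_powr)
    finally show ?thesis by simp
  qed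
  have e: "(2 * y) ^ n / fact n \<le> exp (2 * y)"
  proof -
    have sm: "(\<lambda>k. (2 * y) ^ k / fact k) sums exp (2 * y)"
      using exp_converges[of "2 * y"] by (simp add: divide_inverse mult.commute scaleR_conv_of_real)
    have "(\<Sum>k\<in>{n}. (2 * y) ^ k / fact k) \<le> (\<Sum>k. (2 * y) ^ k / fact k)"
      using y by (intro sum_le_suminf[OF sums_summable[OF sm]]) auto
    then show ?thesis using sums_unique[OF sm] by simp
  qed
  have "fact n powr (- (s / 2)) * x ^ n = (y ^ n / fact n) powr (s / 2)"
    unfolding xy using y by (simp add: powr_divide powr_minus_divide)
  also have "\<dots> = ((2 * y) ^ n / fact n) powr (s / 2) * ((1 / 2) ^ n) powr (s / 2)"
    using y by (subst powr_mult[symmetric]) (auto simp: power_mult_distrib power_divide)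
  also have "\<dots> \<le> exp (2 * y) powr (s / 2) * ((1 / 2) ^ n) powr (s / 2)"
    using e y assms(1) by (intro mult_right_mono powr_mono2) auto
  also have "exp (2 * y) powr (s / 2) = exp (s * y)" by (simp add: exp_powr_real)
  also have "((1 / 2 :: real) ^ n) powr (s / 2) = (2 powr (- (s / 2))) ^ n"
  proof -
    have "((1 / 2 :: real) ^ n) powr (s / 2) = ((1 / 2) powr (s / 2)) ^ n" by (simp add: powr_power powr_powr mult.commute flip: powr_realpow)
    also have "(1 / 2 :: real) powr (s / 2) = 2 powr (- (s / 2))" by (simp add: powr_divide powr_minus_divide)
    finally show ?thesis .
  qed
  finally show ?thesis by (simp add: y_def)
qed

lemma ennreal_sq_add_le: "(x + y)\<^sup>2 \<le> 2 * x\<^sup>2 + 2 * (y\<^sup>2 :: ennreal)"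
proof (cases "x = \<top> \<or> y = \<top>")
  case True
  then show ?thesis by (auto simp: ennreal_mult_eq_top_iff power2_eq_square)
next
  case False
  then obtain a b where ab: "x = ennreal a" "y = ennreal b" "0 \<le> a" "0 \<le> b"
    by (metis enn2real_nonneg ennreal_enn2real top.not_eq_extremum)
  have "(x + y)\<^sup>2 = ennreal ((a + b)\<^sup>2)" using ab by (simp add: ennreal_power flip: ennreal_plus)
  also have "\<dots> \<le> ennreal (2 * a\<^sup>2 + 2 * b\<^sup>2)"
    using sum_squares_bound[of a b] by (intro ennreal_leI) (simp add: power2_sum)
  also have "\<dots> = 2 * x\<^sup>2 + 2 * y\<^sup>2" using ab by (simp add: ennreal_power ennreal_mult flip: ennreal_numeral)
  finally show ?thesis .
qed

context nuclear_triple
begin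

lemma pairing_add: "x \<in> nuc_dual \<Longrightarrow> \<theta> \<in> nucC \<Longrightarrow> \<eta> \<in> nucC \<Longrightarrow> pairing x (\<theta> + \<eta>) = pairing x \<theta> + pairing x \<eta>"
  by (simp add: pairing_def complex_eq_iff nuc_dual_add nucC_D(1,2))

text \<open>Interpolation writes the argument of \<open>K\<close> as a combination of
  \<open>n + 1\<close> fixed tensor powers whose coefficients are polynomials in
  \<open>\<zeta>\<close>, and \<open>K\<close> acts on the fixed ones.\<close>

lemma tensor_power_line_holomorphic:
  assumes K: "K \<in> tensors_dual n" and X: "\<theta> \<in> nucC" "\<eta> \<in> nucC"
  shows "(\<lambda>\<zeta>. K (tensor_power n (\<theta> + cscale \<zeta> \<eta>))) holomorphic_on S"
proof -
  define l where "l j \<zeta> = (\<Prod>i\<in>{..n} - {j}. (\<zeta> - of_nat i) / (of_nat j - of_nat i) :: complex)" for j \<zeta>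
  have v: "tensor_power n (\<theta> + cscale \<zeta> \<eta>) xs = (if length xs = n \<and> set xs \<subseteq> nuc_dual then prod_list (map (\<lambda>x. pairing x \<theta> + \<zeta> * pairing x \<eta>) xs) else 0)" for \<zeta> xs
    unfolding tensor_power_def using X
    by (auto simp: pairing_add NC.X_scale pairing_cscale subset_iff intro!: arg_cong[where f = prod_list])
  have e: "tensor_power n (\<theta> + cscale \<zeta> \<eta>) = (\<lambda>xs. \<Sum>j\<le>n. l j \<zeta> * tensor_power n (\<theta> + cscale (of_nat j) \<eta>) xs)" for \<zeta>
  proof
    fix xs
    show "tensor_power n (\<theta> + cscale \<zeta> \<eta>) xs = (\<Sum>j\<le>n. l j \<zeta> * tensor_power n (\<theta> + cscale (of_nat j) \<eta>) xs)"
    proof (cases "length xs = n \<and> set xs \<subseteq> nuc_dual")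
      case True
      show ?thesis unfolding v if_P[OF True] l_def using True by (intro lagrange_prod_list) simp
    next
      case False
      show ?thesis unfolding v if_not_P[OF False] by simp
    qed
  qed
  have Ke: "K (tensor_power n (\<theta> + cscale \<zeta> \<eta>)) = (\<Sum>j\<le>n. l j \<zeta> * K (tensor_power n (\<theta> + cscale (of_nat j) \<eta>)))" for \<zeta>
    by (rule trans[OF arg_cong[OF e[of \<zeta>], of K] tensors_dual_lincomb[OF K]])
      (rule tensor_power_in_tensors[OF NC.X_line[OF X]])
  have l: "(\<lambda>\<zeta>. l j \<zeta>) holomorphic_on S" for j
    unfolding l_def by (intro holomorphic_intros) auto
  have "(\<lambda>\<zeta>. \<Sum>j\<le>n. l j \<zeta> * K (tensor_power n (\<theta> + cscale (of_nat j) \<eta>))) holomorphic_on S"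
    by (intro holomorphic_on_sum holomorphic_on_mult holomorphic_on_const l)
  moreover have "(\<lambda>\<zeta>. K (tensor_power n (\<theta> + cscale \<zeta> \<eta>))) = (\<lambda>\<zeta>. \<Sum>j\<le>n. l j \<zeta> * K (tensor_power n (\<theta> + cscale (of_nat j) \<eta>)))"
    by (rule ext) (rule Ke)
  ultimately show ?thesis by (rule ssubst[rotated])
qed

subsection \<open>Norms of distributions\<close>

lemma dist_norm_sq_mono:
  assumes "p \<le> p'" "q \<le> q'"
  shows "dist_norm_sq \<mu> \<beta> p' q' \<Phi> \<le> dist_norm_sq \<mu> \<beta> p q \<Phi>"
  unfolding dist_norm_sq_def
proof (rule suminf_le)
  fix n :: nat
  have "q * n \<le> q' * n" using assms(2) by simp
  then have "real (q * n) \<le> real (q' * n)" by (rule of_nat_mono)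
  then have "fact n powr (1 - \<beta>) * 2 powr - real (q' * n) \<le> fact n powr (1 - \<beta>) * 2 powr - real (q * n)"
    by (intro mult_left_mono powr_mono) auto
  then show "ennreal (fact n powr (1 - \<beta>) * 2 powr - real (q' * n)) * (tensor_dual_norm p' n (kernels \<mu> \<Phi> n))\<^sup>2 \<le>
      ennreal (fact n powr (1 - \<beta>) * 2 powr - real (q * n)) * (tensor_dual_norm p n (kernels \<mu> \<Phi> n))\<^sup>2"
    by (rule mult_mono[OF ennreal_leI power_mono[OF tensor_dual_norm_mono[OF assms(1)]]]) auto
qed auto

context
  fixes \<mu> A assumes appell: "appell_data \<mu> A"
begin

lemma polynomials_dual_combination:
  assumes "\<Phi> \<in> polynomials_dual" "\<Psi> \<in> polynomials_dual"
  shows "(\<lambda>\<phi>. a * \<Phi> \<phi> + b * \<Psi> \<phi>) \<in> polynomials_dual"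
proof -
  have m: "continuous_map polynomials_topology euclidean (\<lambda>\<phi>. c * X \<phi>)" if "X \<in> polynomials_dual" for X and c :: complex
  proof -
    have "continuous_map euclidean euclidean ((*) c)" by (simp add: continuous_intros)
    from continuous_map_compose[OF polynomials_dualD(3)[OF that] this] show ?thesis by (simp add: o_def)
  qed
  have "continuous_map polynomials_topology euclidean (\<lambda>\<phi>. a * \<Phi> \<phi> + b * \<Psi> \<phi>)"
    by (intro continuous_map_add m assms)
  then show ?thesis
    using polynomials_dualD(1,2)[OF assms(1)] polynomials_dualD(1,2)[OF assms(2)]
    unfolding polynomials_dual_def dual_space_def topspace_polynomials by (simp add: algebra_simps)
qed

lemma kernels_combination:
  assumes "\<Phi> \<in> polynomials_dual" "\<Psi> \<in> polynomials_dual"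
  shows "kernels \<mu> (\<lambda>\<phi>. a * \<Phi> \<phi> + b * \<Psi> \<phi>) n t = a * kernels \<mu> \<Phi> n t + b * kernels \<mu> \<Psi> n t"
  unfolding kernels_eq(1)[OF appell assms(1)] kernels_eq(1)[OF appell assms(2)]
    kernels_eq(1)[OF appell polynomials_dual_combination[OF assms]]
  by (simp add: add_divide_distrib)

lemma dist_norm_sq_combination:
  assumes "\<Phi> \<in> polynomials_dual" "\<Psi> \<in> polynomials_dual"
  shows "dist_norm_sq \<mu> \<beta> p q (\<lambda>\<phi>. a * \<Phi> \<phi> + b * \<Psi> \<phi>) \<le>
    2 * (ennreal (cmod a))\<^sup>2 * dist_norm_sq \<mu> \<beta> p q \<Phi> + 2 * (ennreal (cmod b))\<^sup>2 * dist_norm_sq \<mu> \<beta> p q \<Psi>"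
proof -
  define w where "w n = ennreal (fact n powr (1 - \<beta>) * 2 powr (- real (q * n)))" for n :: nat
  let ?k = "\<lambda>X n. tensor_dual_norm p n (kernels \<mu> X n)"
  have "dist_norm_sq \<mu> \<beta> p q (\<lambda>\<phi>. a * \<Phi> \<phi> + b * \<Psi> \<phi>) \<le> (\<Sum>n. 2 * (ennreal (cmod a))\<^sup>2 * (w n * (?k \<Phi> n)\<^sup>2) + 2 * (ennreal (cmod b))\<^sup>2 * (w n * (?k \<Psi> n)\<^sup>2))"
    unfolding dist_norm_sq_def w_def[symmetric]
  proof (rule suminf_le)
    fix n
    have "kernels \<mu> (\<lambda>\<phi>. a * \<Phi> \<phi> + b * \<Psi> \<phi>) n = (\<lambda>t. a * kernels \<mu> \<Phi> n t + b * kernels \<mu> \<Psi> n t)"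
      using kernels_combination[OF assms] by blast
    then have "(?k (\<lambda>\<phi>. a * \<Phi> \<phi> + b * \<Psi> \<phi>) n)\<^sup>2 \<le> (ennreal (cmod a) * ?k \<Phi> n + ennreal (cmod b) * ?k \<Psi> n)\<^sup>2"
      using tensor_dual_norm_combination by (intro power_mono) auto
    also have "\<dots> \<le> 2 * (ennreal (cmod a) * ?k \<Phi> n)\<^sup>2 + 2 * (ennreal (cmod b) * ?k \<Psi> n)\<^sup>2" by (rule ennreal_sq_add_le)
    finally have "w n * (?k (\<lambda>\<phi>. a * \<Phi> \<phi> + b * \<Psi> \<phi>) n)\<^sup>2 \<le> w n * (2 * (ennreal (cmod a) * ?k \<Phi> n)\<^sup>2 + 2 * (ennreal (cmod b) * ?k \<Psi> n)\<^sup>2)"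
      by (rule mult_left_mono) simp
    then show "w n * (?k (\<lambda>\<phi>. a * \<Phi> \<phi> + b * \<Psi> \<phi>) n)\<^sup>2 \<le> 2 * (ennreal (cmod a))\<^sup>2 * (w n * (?k \<Phi> n)\<^sup>2) + 2 * (ennreal (cmod b))\<^sup>2 * (w n * (?k \<Psi> n)\<^sup>2)"
      by (simp add: power_mult_distrib distrib_left mult_ac)
  qed auto
  also have "\<dots> = 2 * (ennreal (cmod a))\<^sup>2 * dist_norm_sq \<mu> \<beta> p q \<Phi> + 2 * (ennreal (cmod b))\<^sup>2 * dist_norm_sq \<mu> \<beta> p q \<Psi>"
    unfolding dist_norm_sq_def w_def[symmetric] by (simp add: suminf_add[symmetric])
  finally show ?thesis .
qed

definition dist_norm :: "real \<Rightarrow> nat \<Rightarrow> nat \<Rightarrow> ((('h \<Rightarrow> real) \<Rightarrow> complex) \<Rightarrow> complex) \<Rightarrow> real" where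
  "dist_norm \<beta> p q \<Phi> = sqrt (enn2real (dist_norm_sq \<mu> \<beta> p q \<Phi>))"

lemma dist_norm_nonneg: "0 \<le> dist_norm \<beta> p q \<Phi>"
  by (simp add: dist_norm_def)

lemma dist_stepD:
  assumes "\<Phi> \<in> dist_step \<mu> \<beta> p q"
  shows "\<Phi> \<in> polynomials_dual" "dist_norm_sq \<mu> \<beta> p q \<Phi> = ennreal ((dist_norm \<beta> p q \<Phi>)\<^sup>2)"
proof -
  show "\<Phi> \<in> polynomials_dual" using assms unfolding dist_step_def by blast
  have "dist_norm_sq \<mu> \<beta> p q \<Phi> < top" using assms unfolding dist_step_def by simp
  then show "dist_norm_sq \<mu> \<beta> p q \<Phi> = ennreal ((dist_norm \<beta> p q \<Phi>)\<^sup>2)"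
    unfolding dist_norm_def by (simp add: ennreal_enn2real)
qed

text \<open>A triangle inequality up to the factor \<open>2\<close> suffices to see that the balls are neighbourhoods of zero.\<close>

lemma dist_step_combination:
  assumes "\<Phi> \<in> dist_step \<mu> \<beta> p q" "\<Psi> \<in> dist_step \<mu> \<beta> p q"
  shows "(\<lambda>\<phi>. a * \<Phi> \<phi> + b * \<Psi> \<phi>) \<in> dist_step \<mu> \<beta> p q"
    and "dist_norm \<beta> p q (\<lambda>\<phi>. a * \<Phi> \<phi> + b * \<Psi> \<phi>) \<le> 2 * (cmod a * dist_norm \<beta> p q \<Phi> + cmod b * dist_norm \<beta> p q \<Psi>)"
proof -
  note 1 = dist_stepD[OF assms(1)] and 2 = dist_stepD[OF assms(2)]
  let ?x = "cmod a * dist_norm \<beta> p q \<Phi>" and ?y = "cmod b * dist_norm \<beta> p q \<Psi>"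
  have le: "dist_norm_sq \<mu> \<beta> p q (\<lambda>\<phi>. a * \<Phi> \<phi> + b * \<Psi> \<phi>) \<le> ennreal (2 * ?x\<^sup>2 + 2 * ?y\<^sup>2)"
    using dist_norm_sq_combination[OF 1(1) 2(1), of \<beta> p q a b] unfolding 1(2) 2(2)
    by (simp add: ennreal_power ennreal_mult power_mult_distrib mult.assoc flip: ennreal_numeral)
  then have "dist_norm_sq \<mu> \<beta> p q (\<lambda>\<phi>. a * \<Phi> \<phi> + b * \<Psi> \<phi>) < \<infinity>" by (rule order_le_less_trans) simp
  then show "(\<lambda>\<phi>. a * \<Phi> \<phi> + b * \<Psi> \<phi>) \<in> dist_step \<mu> \<beta> p q"
    using polynomials_dual_combination[OF 1(1) 2(1)] by (simp add: dist_step_def)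
  have xy: "0 \<le> ?x" "0 \<le> ?y" by (simp_all add: dist_norm_nonneg)
  have "enn2real (dist_norm_sq \<mu> \<beta> p q (\<lambda>\<phi>. a * \<Phi> \<phi> + b * \<Psi> \<phi>)) \<le> 2 * ?x\<^sup>2 + 2 * ?y\<^sup>2"
    using enn2real_mono[OF le ennreal_less_top] by (subst (asm) enn2real_ennreal) auto
  also have "\<dots> \<le> (2 * (?x + ?y))\<^sup>2"
  proof -
    have "2 * x\<^sup>2 + 2 * y\<^sup>2 \<le> (2 * (x + y))\<^sup>2" if "0 \<le> x" "0 \<le> y" for x y :: real
    proof -
      have "0 \<le> 2 * x\<^sup>2 + 2 * y\<^sup>2 + 8 * (x * y)" using that by simp
      then show ?thesis by (simp add: power2_eq_square algebra_simps)
    qed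
    then show ?thesis using xy .
  qed
  finally have "dist_norm \<beta> p q (\<lambda>\<phi>. a * \<Phi> \<phi> + b * \<Psi> \<phi>) \<le> sqrt ((2 * (?x + ?y))\<^sup>2)"
    unfolding dist_norm_def by (rule real_sqrt_le_mono)
  then show "dist_norm \<beta> p q (\<lambda>\<phi>. a * \<Phi> \<phi> + b * \<Psi> \<phi>) \<le> 2 * (?x + ?y)" using xy unfolding real_sqrt_abs by simp
qed

text \<open>Read off from a single term of the series for the squared norm; \<open>v\<close> is the
  square root of its weight, hence the halved exponents.\<close>

lemma kernel_bound:
  assumes \<Phi>: "\<Phi> \<in> dist_step \<mu> \<beta> p q" and t: "t \<in> tensors n"
  shows "cmod (kernels \<mu> \<Phi> n t) \<le> dist_norm \<beta> p q \<Phi> * (fact n powr (- ((1 - \<beta>) / 2)) * (2 powr (real q / 2)) ^ n) * tensor_norm p n t"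
proof -
  let ?d = "dist_norm \<beta> p q \<Phi>"
  define w :: real where "w = fact n powr (1 - \<beta>) * 2 powr (- real (q * n))"
  define v :: real where "v = fact n powr ((1 - \<beta>) / 2) * 2 powr (- (real (q * n) / 2))"
  have v: "0 < v" by (simp add: v_def)
  have "(fact n powr ((1 - \<beta>) / 2))\<^sup>2 = (fact n powr (1 - \<beta>) :: real)"
    unfolding power2_eq_square powr_add[symmetric] by simp
  moreover have "(2 powr (- (real (q * n) / 2)))\<^sup>2 = (2 powr (- real (q * n)) :: real)"
    unfolding power2_eq_square powr_add[symmetric] by (simp add: mult.commute)
  ultimately have wv: "w = v\<^sup>2" unfolding w_def v_def power_mult_distrib by simp
  let ?k = "\<lambda>n. tensor_dual_norm p n (kernels \<mu> \<Phi> n)"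
  have "(\<Sum>i\<in>{n}. ennreal (fact i powr (1 - \<beta>) * 2 powr - real (q * i)) * (?k i)\<^sup>2) \<le> dist_norm_sq \<mu> \<beta> p q \<Phi>"
    unfolding dist_norm_sq_def by (intro sum_le_suminf) auto
  then have le: "ennreal w * (?k n)\<^sup>2 \<le> ennreal (?d\<^sup>2)" unfolding dist_stepD(2)[OF \<Phi>] by (simp add: w_def)
  have "?k n \<noteq> \<top>"
  proof
    assume "?k n = \<top>"
    then have "ennreal w * (?k n)\<^sup>2 = \<top>" using v wv by (simp add: power2_eq_square ennreal_mult_top)
    then show False using le by (simp add: top_unique)
  qed
  then obtain \<kappa> where k: "?k n = ennreal \<kappa>" "0 \<le> \<kappa>" by (cases "?k n") auto
  have "ennreal (w * \<kappa>\<^sup>2) \<le> ennreal (?d\<^sup>2)" using le k v wv by (simp add: ennreal_power ennreal_mult)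
  then have "(v * \<kappa>)\<^sup>2 \<le> ?d\<^sup>2" using wv by (simp add: power_mult_distrib)
  then have "v * \<kappa> \<le> ?d" by (rule power2_le_imp_le) (rule dist_norm_nonneg)
  then have "\<kappa> \<le> ?d / v" using v by (simp add: pos_le_divide_eq mult.commute)
  also have "?d / v = ?d * (fact n powr (- ((1 - \<beta>) / 2)) * (2 powr (real q / 2)) ^ n)"
    by (simp add: v_def powr_minus field_simps powr_power)
  finally have kle: "\<kappa> \<le> ?d * (fact n powr (- ((1 - \<beta>) / 2)) * (2 powr (real q / 2)) ^ n)" .
  have "cmod (kernels \<mu> \<Phi> n t) \<le> \<kappa> * tensor_norm p n t"
    using kernels_eq(2)[OF appell dist_stepD(1)[OF \<Phi>]] k t by (intro tensor_dual_norm_bound) auto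
  also have "\<dots> \<le> ?d * (fact n powr (- ((1 - \<beta>) / 2)) * (2 powr (real q / 2)) ^ n) * tensor_norm p n t"
    using kle tensor_norm_nonneg by (rule mult_right_mono)
  finally show ?thesis .
qed

text \<open>The condition \<open>2 * R\<^sup>2 \<le> 2 ^ q\<close> turns the series of the squared
  norm into one dominated by a geometric series of ratio \<open>1 / 2\<close>, with sum
  \<open>C\<^sup>2 * 2\<close>; the constant \<open>2 * C\<close> rounds up its root.\<close>

lemma dist_stepI:
  assumes \<Phi>: "\<Phi> \<in> polynomials_dual" and C: "0 \<le> C" "0 \<le> R" "2 * R\<^sup>2 \<le> 2 ^ q"
    and le: "\<And>n t. t \<in> tensors n \<Longrightarrow> cmod (kernels \<mu> \<Phi> n t) \<le> C * (fact n powr (- ((1 - \<beta>) / 2)) * R ^ n) * tensor_norm p n t"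
  shows "\<Phi> \<in> dist_step \<mu> \<beta> p q" "dist_norm \<beta> p q \<Phi> \<le> 2 * C"
proof -
  have "dist_norm_sq \<mu> \<beta> p q \<Phi> \<le> (\<Sum>n. ennreal (C\<^sup>2 * (1 / 2) ^ n))"
    unfolding dist_norm_sq_def
  proof (rule suminf_le)
    fix n
    let ?c = "C * (fact n powr (- ((1 - \<beta>) / 2)) * R ^ n)"
    have c: "0 \<le> ?c" using C by simp
    have "ennreal (fact n powr (1 - \<beta>) * 2 powr - real (q * n)) * (tensor_dual_norm p n (kernels \<mu> \<Phi> n))\<^sup>2 \<le>
        ennreal (fact n powr (1 - \<beta>) * 2 powr - real (q * n)) * (ennreal ?c)\<^sup>2"
      using le c by (intro mult_left_mono power_mono tensor_dual_norm_leI) auto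
    also have "\<dots> = ennreal (fact n powr (1 - \<beta>) * 2 powr - real (q * n) * ?c\<^sup>2)"
      using c by (simp add: ennreal_power flip: ennreal_mult)
    also have "fact n powr (1 - \<beta>) * 2 powr - real (q * n) * ?c\<^sup>2 = C\<^sup>2 * (R\<^sup>2 / 2 ^ q) ^ n"
    proof -
      have f: "(fact n powr (- ((1 - \<beta>) / 2)))\<^sup>2 * fact n powr (1 - \<beta>) = (1 :: real)"
        by (simp add: power2_eq_square flip: powr_add)
      have g: "2 powr - real (q * n) = 1 / (2 ^ q) ^ n"
        by (simp add: powr_minus powr_realpow divide_inverse power_mult del: of_nat_mult)
      have "fact n powr (1 - \<beta>) * 2 powr - real (q * n) * ?c\<^sup>2 =
          ((fact n powr (- ((1 - \<beta>) / 2)))\<^sup>2 * fact n powr (1 - \<beta>)) * (C\<^sup>2 * (R ^ n)\<^sup>2 * 2 powr - real (q * n))"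
        by (simp add: power_mult_distrib mult_ac)
      also have "\<dots> = C\<^sup>2 * (R\<^sup>2 / 2 ^ q) ^ n"
        unfolding f g by (simp add: power_divide mult.commute flip: power_mult)
      finally show ?thesis .
    qed
    also have "ennreal (C\<^sup>2 * (R\<^sup>2 / 2 ^ q) ^ n) \<le> ennreal (C\<^sup>2 * (1 / 2) ^ n)"
      using C by (intro ennreal_leI mult_left_mono power_mono) (auto simp: field_simps)
    finally show "ennreal (fact n powr (1 - \<beta>) * 2 powr - real (q * n)) * (tensor_dual_norm p n (kernels \<mu> \<Phi> n))\<^sup>2 \<le> ennreal (C\<^sup>2 * (1 / 2) ^ n)" .
  qed auto
  also have "\<dots> = ennreal (C\<^sup>2 * 2)"
  proof (rule suminf_ennreal_eq)
    show "(\<lambda>n. C\<^sup>2 * (1 / 2) ^ n) sums (C\<^sup>2 * 2)" using geometric_sums[of "1 / 2 :: real"] by (intro sums_mult) simp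
  qed simp
  finally have l: "dist_norm_sq \<mu> \<beta> p q \<Phi> \<le> ennreal (C\<^sup>2 * 2)" .
  then have "dist_norm_sq \<mu> \<beta> p q \<Phi> < \<infinity>" by (rule order_le_less_trans) simp
  then show "\<Phi> \<in> dist_step \<mu> \<beta> p q" using \<Phi> by (simp add: dist_step_def)
  have "enn2real (dist_norm_sq \<mu> \<beta> p q \<Phi>) \<le> C\<^sup>2 * 2" using enn2real_mono[OF l ennreal_less_top] by simp
  also have "\<dots> \<le> (2 * C)\<^sup>2" by (simp add: power2_eq_square)
  finally have "dist_norm \<beta> p q \<Phi> \<le> sqrt ((2 * C)\<^sup>2)" unfolding dist_norm_def by (rule real_sqrt_le_mono)
  then show "dist_norm \<beta> p q \<Phi> \<le> 2 * C" using C(1) unfolding real_sqrt_abs by simp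
qed

subsection \<open>The S-transform\<close>

context
  fixes \<beta> :: real assumes \<beta>: "0 \<le> \<beta>" "\<beta> < 1"
begin

text \<open>The geometric factor that \<open>fact_powr_bound\<close> leaves for
  \<open>s = 1 - \<beta>\<close>; it is below 1 because \<open>\<beta> < 1\<close>.\<close>

definition ratio :: real where "ratio = 2 powr (- ((1 - \<beta>) / 2))"

lemma ratio: "0 < ratio" "ratio < 1"
proof -
  show "0 < ratio" unfolding ratio_def by simp
  have "2 powr (- ((1 - \<beta>) / 2)) < (2::real) powr 0" using \<beta> by (intro powr_less_mono) auto
  then show "ratio < 1" unfolding ratio_def by simp
qed

lemma S_term_bound:
  assumes \<Phi>: "\<Phi> \<in> dist_step \<mu> \<beta> p q" and th: "\<theta> \<in> nucC" and r: "nrmC p \<theta> \<le> r"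
  shows "cmod (kernels \<mu> \<Phi> n (tensor_power n \<theta>)) \<le>
    dist_norm \<beta> p q \<Phi> * exp ((1 - \<beta>) * (2 powr (real q / 2) * r) powr (2 / (1 - \<beta>))) * ratio ^ n"
proof -
  let ?d = "dist_norm \<beta> p q \<Phi>" and ?g = "fact n powr (- ((1 - \<beta>) / 2)) :: real"
  have r0: "0 \<le> r" using r nrmC_nonneg[of p \<theta>] by linarith
  have "tensor_norm p n (tensor_power n \<theta>) \<le> r ^ n"
    using tensor_norm_tensor_power[OF th] power_mono[OF r nrmC_nonneg] by (rule order_trans)
  then have "?d * (?g * (2 powr (real q / 2)) ^ n) * tensor_norm p n (tensor_power n \<theta>) \<le> ?d * (?g * (2 powr (real q / 2)) ^ n) * r ^ n"
    by (intro mult_left_mono) (auto simp: dist_norm_nonneg)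
  also have "\<dots> = ?d * (?g * (2 powr (real q / 2) * r) ^ n)" by (simp add: power_mult_distrib)
  also have "\<dots> \<le> ?d * (exp ((1 - \<beta>) * (2 powr (real q / 2) * r) powr (2 / (1 - \<beta>))) * ratio ^ n)"
    unfolding ratio_def using \<beta> r0 by (intro mult_left_mono fact_powr_bound) (auto simp: dist_norm_nonneg)
  finally show ?thesis using kernel_bound[OF \<Phi> tensor_power_in_tensors[OF th], of n] by (simp add: mult.assoc)
qed

lemma S_summable:
  assumes \<Phi>: "\<Phi> \<in> dist_step \<mu> \<beta> p q" and th: "\<theta> \<in> nucC"
  shows "summable (\<lambda>n. kernels \<mu> \<Phi> n (tensor_power n \<theta>))"
proof (rule summable_comparison_test')
  show "summable (\<lambda>n. dist_norm \<beta> p q \<Phi> * exp ((1 - \<beta>) * (2 powr (real q / 2) * nrmC p \<theta>) powr (2 / (1 - \<beta>))) * ratio ^ n)"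
    using ratio by (intro summable_mult summable_geometric) auto
  show "norm (kernels \<mu> \<Phi> n (tensor_power n \<theta>)) \<le> dist_norm \<beta> p q \<Phi> * exp ((1 - \<beta>) * (2 powr (real q / 2) * nrmC p \<theta>) powr (2 / (1 - \<beta>))) * ratio ^ n" for n
    using S_term_bound[OF \<Phi> th] by simp
qed

lemma S_bound:
  assumes \<Phi>: "\<Phi> \<in> dist_step \<mu> \<beta> p q" and th: "\<theta> \<in> nucC" and r: "nrmC p \<theta> \<le> r"
  shows "cmod (S_transform \<mu> \<Phi> \<theta>) \<le> dist_norm \<beta> p q \<Phi> / (1 - ratio) * exp ((1 - \<beta>) * (2 powr (real q / 2) * r) powr (2 / (1 - \<beta>)))"
proof -
  let ?M = "dist_norm \<beta> p q \<Phi> * exp ((1 - \<beta>) * (2 powr (real q / 2) * r) powr (2 / (1 - \<beta>)))"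
  have g: "(\<lambda>n. ?M * ratio ^ n) sums (?M * (1 / (1 - ratio)))" using ratio by (intro sums_mult geometric_sums) auto
  have "cmod (\<Sum>n. kernels \<mu> \<Phi> n (tensor_power n \<theta>)) \<le> (\<Sum>n. ?M * ratio ^ n)"
    using S_term_bound[OF \<Phi> th r] sums_summable[OF g] by (intro norm_suminf_le) auto
  then show ?thesis using th sums_unique[OF g] by (simp add: S_transform_def mult_ac)
qed

text \<open>On the unit disc of any complex line the terms have a common summable majorant, so the
  partial sums, which are polynomial along the line, converge uniformly. As \<open>r\<close> is
  arbitrary, the function is bounded on every ball.\<close>

lemma S_hol:
  assumes \<Phi>: "\<Phi> \<in> dist_step \<mu> \<beta> p q"
  shows "NC.hol p r (dist_norm \<beta> p q \<Phi> / (1 - ratio) * exp ((1 - \<beta>) * (2 powr (real q / 2) * r) powr (2 / (1 - \<beta>)))) (S_transform \<mu> \<Phi>)"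
  unfolding NC.hol_def
proof (intro conjI ballI impI)
  show "cmod (S_transform \<mu> \<Phi> \<theta>) \<le> dist_norm \<beta> p q \<Phi> / (1 - ratio) * exp ((1 - \<beta>) * (2 powr (real q / 2) * r) powr (2 / (1 - \<beta>)))"
    if "\<theta> \<in> nucC" "nrmC p \<theta> < r" for \<theta> using S_bound[OF \<Phi> that(1)] that(2) by simp
  fix \<theta> \<eta> assume X: "\<theta> \<in> nucC" "\<eta> \<in> nucC"
  define f where "f n \<zeta> = kernels \<mu> \<Phi> n (tensor_power n (\<theta> + cscale \<zeta> \<eta>))" for n \<zeta>
  define R where "R = nrmC p \<theta> + nrmC p \<eta>"
  let ?M = "\<lambda>n. dist_norm \<beta> p q \<Phi> * exp ((1 - \<beta>) * (2 powr (real q / 2) * R) powr (2 / (1 - \<beta>))) * ratio ^ n"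
  have ul: "uniform_limit (cball 0 1) (\<lambda>m \<zeta>. \<Sum>n<m. f n \<zeta>) (\<lambda>\<zeta>. \<Sum>n. f n \<zeta>) sequentially"
  proof (rule Weierstrass_m_test)
    show "summable ?M" using ratio by (intro summable_mult summable_geometric) auto
    fix n and \<zeta> :: complex assume "\<zeta> \<in> cball 0 1"
    then have "cmod \<zeta> * nrmC p \<eta> \<le> 1 * nrmC p \<eta>" by (intro mult_right_mono) (auto simp: nrmC_nonneg)
    then have "nrmC p (\<theta> + cscale \<zeta> \<eta>) \<le> R" using NC.N_line[OF X, of p \<zeta>] by (simp add: R_def)
    then show "norm (f n \<zeta>) \<le> ?M n" unfolding f_def using X by (intro S_term_bound[OF \<Phi>] NC.X_line)
  qed
  have h: "(\<lambda>\<zeta>. \<Sum>n<m. f n \<zeta>) holomorphic_on S" for m S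
    unfolding f_def using X kernels_eq(2)[OF appell dist_stepD(1)[OF \<Phi>]]
    by (intro holomorphic_on_sum tensor_power_line_holomorphic)
  have "(\<lambda>\<zeta>. \<Sum>n. f n \<zeta>) holomorphic_on ball 0 1"
  proof (rule holomorphic_uniform_limit[OF _ ul])
    show "\<forall>\<^sub>F m in sequentially. continuous_on (cball 0 1) (\<lambda>\<zeta>. \<Sum>n<m. f n \<zeta>) \<and> (\<lambda>\<zeta>. \<Sum>n<m. f n \<zeta>) holomorphic_on ball 0 1"
      using h holomorphic_on_imp_continuous_on by (intro always_eventually) blast
  qed auto
  moreover have "(\<lambda>\<zeta>. S_transform \<mu> \<Phi> (\<theta> + cscale \<zeta> \<eta>)) = (\<lambda>\<zeta>. \<Sum>n. f n \<zeta>)"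
    using NC.X_line[OF X] by (simp add: S_transform_def f_def)
  ultimately show "(\<lambda>\<zeta>. S_transform \<mu> \<Phi> (\<theta> + cscale \<zeta> \<eta>)) field_differentiable at 0"
    by (intro holomorphic_on_imp_differentiable_at[of _ "ball 0 1"]) auto
qed

lemma distributions_combination:
  assumes "\<Phi> \<in> distributions \<mu> \<beta>" "\<Psi> \<in> distributions \<mu> \<beta>"
  shows "(\<lambda>\<phi>. a * \<Phi> \<phi> + b * \<Psi> \<phi>) \<in> distributions \<mu> \<beta>"
proof -
  obtain p q p' q' where 1: "\<Phi> \<in> dist_step \<mu> \<beta> p q" and 2: "\<Psi> \<in> dist_step \<mu> \<beta> p' q'"
    using assms by (auto simp: distributions_def)
  have "X \<in> dist_step \<mu> \<beta> (max p p') (max q q')" if "X \<in> dist_step \<mu> \<beta> p1 q1" "p1 \<le> max p p'" "q1 \<le> max q q'" for X p1 q1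
    using that dist_norm_sq_mono[OF that(2,3), of \<mu> \<beta> X] by (auto simp: dist_step_def intro: order_le_less_trans)
  from this[OF 1] this[OF 2] have "(\<lambda>\<phi>. a * \<Phi> \<phi> + b * \<Psi> \<phi>) \<in> dist_step \<mu> \<beta> (max p p') (max q q')"
    by (intro dist_step_combination(1)) auto
  then show ?thesis unfolding distributions_def by blast
qed

lemma distributions_dual: "\<Phi> \<in> distributions \<mu> \<beta> \<Longrightarrow> \<Phi> \<in> polynomials_dual"
  unfolding distributions_def dist_step_def by blast

lemma S_linear:
  assumes "\<Phi> \<in> distributions \<mu> \<beta>" "\<Psi> \<in> distributions \<mu> \<beta>"
  shows "S_transform \<mu> (\<lambda>\<phi>. a * \<Phi> \<phi> + b * \<Psi> \<phi>) = (\<lambda>\<theta>. a * S_transform \<mu> \<Phi> \<theta> + b * S_transform \<mu> \<Psi> \<theta>)"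
proof
  fix \<theta>
  show "S_transform \<mu> (\<lambda>\<phi>. a * \<Phi> \<phi> + b * \<Psi> \<phi>) \<theta> = a * S_transform \<mu> \<Phi> \<theta> + b * S_transform \<mu> \<Psi> \<theta>"
  proof (cases "\<theta> \<in> nucC")
    case True
    have s: "summable (\<lambda>n. kernels \<mu> X n (tensor_power n \<theta>))" if "X \<in> distributions \<mu> \<beta>" for X
      using that S_summable[OF _ True] by (auto simp: distributions_def)
    have "(\<Sum>n. a * kernels \<mu> \<Phi> n (tensor_power n \<theta>) + b * kernels \<mu> \<Psi> n (tensor_power n \<theta>)) =
        a * (\<Sum>n. kernels \<mu> \<Phi> n (tensor_power n \<theta>)) + b * (\<Sum>n. kernels \<mu> \<Psi> n (tensor_power n \<theta>))"
      using s[OF assms(1)] s[OF assms(2)]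
      by (simp add: suminf_mult summable_mult flip: suminf_add)
    then show ?thesis
      using True kernels_combination[OF distributions_dual[OF assms(1)] distributions_dual[OF assms(2)]]
      by (simp add: S_transform_def)
  qed (simp add: S_transform_def)
qed

lemma S_inj:
  assumes "\<Phi> \<in> distributions \<mu> \<beta>" "\<Psi> \<in> distributions \<mu> \<beta>" and eq: "S_transform \<mu> \<Phi> = S_transform \<mu> \<Psi>"
  shows "\<Phi> = \<Psi>"
proof (rule kernels_inj[OF appell distributions_dual[OF assms(1)] distributions_dual[OF assms(2)]])
  have sm: "(\<lambda>n. kernels \<mu> X n (tensor_power n \<theta>)) sums S_transform \<mu> X \<theta>" if "X \<in> distributions \<mu> \<beta>" "\<theta> \<in> nucC" for X \<theta>
  proof -
    have "summable (\<lambda>n. kernels \<mu> X n (tensor_power n \<theta>))"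
      using that(1) S_summable[OF _ that(2)] by (auto simp: distributions_def)
    then show ?thesis using that(2) by (simp add: S_transform_def summable_sums)
  qed
  have N: "openin nucC_topology nucC" using openin_topspace[of nucC_topology] by (simp add: topspace_nucC)
  show "kernels \<mu> \<Phi> = kernels \<mu> \<Psi>"
  proof (rule power_kernels_unique[where U = nucC and V = nucC and G = "S_transform \<mu> \<Phi>"])
    show "kernels \<mu> \<Phi> n \<in> tensors_dual n" "kernels \<mu> \<Psi> n \<in> tensors_dual n" for n
      using kernels_eq(2)[OF appell] distributions_dual assms by auto
    show "(\<lambda>n. kernels \<mu> \<Psi> n (tensor_power n \<theta>)) sums S_transform \<mu> \<Phi> \<theta>" if "\<theta> \<in> nucC" for \<theta>
      using sm[OF assms(2) that] eq by simp
  qed (use N sm assms(1) NC.X_zero in auto)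
qed

end

end

end

subsection \<open>Maps between inductive limits\<close>

lemma seminorm_topology_single_nhd:
  fixes N :: "('x \<Rightarrow> complex) \<Rightarrow> real"
  assumes "openin (seminorm_topology X {N}) G" "(\<lambda>_. 0) \<in> G"
  shows "\<exists>\<epsilon>>0. \<forall>g\<in>X. N g < \<epsilon> \<longrightarrow> g \<in> G"
proof -
  obtain F \<epsilon> where F: "F \<subseteq> {N}" "0 < \<epsilon>" "\<forall>g\<in>X. (\<forall>q\<in>F. q (g - (\<lambda>_. 0)) < \<epsilon>) \<longrightarrow> g \<in> G"
    using assms unfolding openin_seminorm_topology by blast
  have z: "g - (\<lambda>_. 0) = g" for g :: "'x \<Rightarrow> complex" by (simp add: fun_diff_def)
  have "g \<in> G" if "g \<in> X" "N g < \<epsilon>" for g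
  proof -
    have "\<forall>q\<in>F. q (g - (\<lambda>_. 0)) < \<epsilon>" unfolding z using that(2) F(1) by blast
    then show ?thesis using F(3) that(1) by blast
  qed
  then show ?thesis using F(2) by blast
qed

text \<open>Under a quasi-triangle inequality balls need not be open, so \<open>G\<close> consists
  of the points around which some smaller ball stays inside. Two steps of size
  \<open>\<delta> / 4\<close> and the factor 2 add up to \<open>\<delta>\<close>.\<close>

lemma seminorm_topology_ball:
  fixes N :: "('x \<Rightarrow> complex) \<Rightarrow> real"
  assumes X: "(\<lambda>_. 0) \<in> X" "N (\<lambda>_. 0) = 0" and e: "0 < \<epsilon>"
    and quasi: "\<And>f g h. f \<in> X \<Longrightarrow> g \<in> X \<Longrightarrow> h \<in> X \<Longrightarrow> N (h - f) \<le> 2 * (N (h - g) + N (g - f))"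
  shows "\<exists>G. openin (seminorm_topology X {N}) G \<and> (\<lambda>_. 0) \<in> G \<and> (\<forall>g\<in>G. g \<in> X \<and> N g < \<epsilon>)"
proof -
  have z: "g - (\<lambda>_. 0) = g" "g - g = (\<lambda>_. 0)" for g :: "'x \<Rightarrow> complex" by (simp_all add: fun_diff_def)
  define G where "G = {f \<in> X. \<exists>\<delta>>0. \<forall>g\<in>X. N (g - f) < \<delta> \<longrightarrow> N g < \<epsilon>}"
  have "openin (seminorm_topology X {N}) G"
    unfolding openin_seminorm_topology
  proof (intro conjI ballI)
    fix f assume f: "f \<in> G"
    then obtain \<delta> where d: "0 < \<delta>" "\<forall>g\<in>X. N (g - f) < \<delta> \<longrightarrow> N g < \<epsilon>" by (auto simp: G_def)
    have fX: "f \<in> X" using f by (simp add: G_def)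
    have "g \<in> G" if g: "g \<in> X" "N (g - f) < \<delta> / 4" for g
    proof -
      have "N h < \<epsilon>" if h: "h \<in> X" "N (h - g) < \<delta> / 4" for h
      proof -
        have "2 * (N (h - g) + N (g - f)) < 2 * (\<delta> / 4 + \<delta> / 4)"
          by (intro mult_strict_left_mono add_strict_mono g(2) h(2)) simp
        with quasi[OF fX g(1) h(1)] have "N (h - f) < 2 * (\<delta> / 4 + \<delta> / 4)" by (rule order_le_less_trans)
        then have "N (h - f) < \<delta>" by simp
        then show ?thesis using d(2) h(1) by blast
      qed
      then show ?thesis using g(1) d(1) unfolding G_def by (intro CollectI conjI exI[of _ "\<delta> / 4"]) auto
    qed
    then show "\<exists>F \<epsilon>. finite F \<and> F \<subseteq> {N} \<and> 0 < \<epsilon> \<and> (\<forall>g\<in>X. (\<forall>q\<in>F. q (g - f) < \<epsilon>) \<longrightarrow> g \<in> G)"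
      using d(1) by (intro exI[of _ "{N}"] exI[of _ "\<delta> / 4"]) simp
  qed (simp add: G_def)
  moreover have "(\<lambda>_. 0) \<in> G"
    unfolding G_def
  proof (intro CollectI conjI exI[of _ \<epsilon>] ballI impI)
    show "N g < \<epsilon>" if "N (g - (\<lambda>_. 0)) < \<epsilon>" for g using that unfolding z .
  qed (use X e in auto)
  moreover have "\<forall>g\<in>G. g \<in> X \<and> N g < \<epsilon>"
  proof
    fix g assume "g \<in> G"
    then obtain \<delta> where "g \<in> X" "0 < \<delta>" "\<forall>h\<in>X. N (h - g) < \<delta> \<longrightarrow> N h < \<epsilon>" by (auto simp: G_def)
    then show "g \<in> X \<and> N g < \<epsilon>" using X(2) z(2)[of g] by auto
  qed
  ultimately show ?thesis by blast
qed

text \<open>\<open>j\<close> maps the target step into its limit space, so the estimate asks only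
  for some preimage of \<open>L f\<close> under \<open>j\<close> with controlled norm.\<close>

lemma seminorm_topology_step_nhd:
  fixes N :: "('x \<Rightarrow> complex) \<Rightarrow> real" and N' :: "('y \<Rightarrow> complex) \<Rightarrow> real"
  assumes X: "(\<lambda>_. 0) \<in> X" "N (\<lambda>_. 0) = 0"
    and quasi: "\<And>f g h. f \<in> X \<Longrightarrow> g \<in> X \<Longrightarrow> h \<in> X \<Longrightarrow> N (h - f) \<le> 2 * (N (h - g) + N (g - f))"
    and C: "0 \<le> C" "\<forall>f\<in>X. \<exists>g\<in>X'. j g = L f \<and> N' g \<le> C * N f"
    and G': "openin (seminorm_topology X' {N'}) G'" "(\<lambda>_. 0) \<in> G'"
  shows "\<exists>G. openin (seminorm_topology X {N}) G \<and> (\<lambda>_. 0) \<in> G \<and> (\<forall>f\<in>G. L f \<in> j ` G')"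
proof -
  obtain \<epsilon> where e: "0 < \<epsilon>" "\<forall>g\<in>X'. N' g < \<epsilon> \<longrightarrow> g \<in> G'"
    using seminorm_topology_single_nhd[OF G'] by auto
  have e': "0 < \<epsilon> / (C + 1)" using e(1) C(1) by simp
  have "\<exists>G. openin (seminorm_topology X {N}) G \<and> (\<lambda>_. 0) \<in> G \<and> (\<forall>g\<in>G. g \<in> X \<and> N g < \<epsilon> / (C + 1))"
    by (rule seminorm_topology_ball[where N = N, OF X e']) (rule quasi)
  then obtain G where G: "openin (seminorm_topology X {N}) G" "(\<lambda>_. 0) \<in> G" "\<forall>g\<in>G. g \<in> X \<and> N g < \<epsilon> / (C + 1)"
    by (elim exE conjE) (rule that)
  have "L f \<in> j ` G'" if "f \<in> G" for f
  proof -
    have f: "f \<in> X" "N f < \<epsilon> / (C + 1)" using bspec[OF G(3) that] by (rule conjunct1, rule conjunct2)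
    obtain g where g: "g \<in> X'" "j g = L f" "N' g \<le> C * N f" using C(2) f(1) by blast
    have "C * N f \<le> C * (\<epsilon> / (C + 1))" using C(1) f(2) by (intro mult_left_mono) auto
    also have "\<dots> < \<epsilon>" using e(1) C(1) by (simp add: field_simps)
    finally have "g \<in> G'" using g(1,3) e(2) by auto
    then show ?thesis unfolding g(2)[symmetric] by (rule imageI)
  qed
  then show ?thesis using G(1,2) by blast
qed

text \<open>The preimage of an absolutely convex set under a linear map is absolutely convex.
  Continuity therefore reduces to the steps: each step of the source has to be mapped, continuously
  at 0, into some step of the target.\<close>

lemma lc_inductive_map_continuous:
  fixes L :: "('x \<Rightarrow> complex) \<Rightarrow> ('y \<Rightarrow> complex)"
  assumes V: "\<And>f g a b. f \<in> V \<Longrightarrow> g \<in> V \<Longrightarrow> (\<lambda>x. a * f x + b * g x) \<in> V"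
    and lin: "\<And>f g a b. f \<in> V \<Longrightarrow> g \<in> V \<Longrightarrow> L (\<lambda>x. a * f x + b * g x) = (\<lambda>y. a * L f y + b * L g y)"
    and LV: "\<And>f. f \<in> V \<Longrightarrow> L f \<in> V'"
    and top: "topspace (lc_inductive_topology V T j) = V" "topspace (lc_inductive_topology V' T' j') = V'"
    and T: "\<And>i. (\<lambda>_. 0) \<in> topspace (T i)" "\<And>i. j i ` topspace (T i) \<subseteq> V"
    and step: "\<And>i. \<exists>i'. \<forall>G'. openin (T' i') G' \<longrightarrow> (\<lambda>_. 0) \<in> G' \<longrightarrow>
        (\<exists>G. openin (T i) G \<and> (\<lambda>_. 0) \<in> G \<and> (\<forall>g\<in>G. L (j i g) \<in> j' i' ` G'))"
  shows "continuous_map (lc_inductive_topology V T j) (lc_inductive_topology V' T' j') L"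
  unfolding continuous_map
proof (intro conjI allI impI)
  show "L ` topspace (lc_inductive_topology V T j) \<subseteq> topspace (lc_inductive_topology V' T' j')"
    unfolding top using LV by blast
  fix W assume W: "openin (lc_inductive_topology V' T' j') W"
  show "openin (lc_inductive_topology V T j) {x \<in> topspace (lc_inductive_topology V T j). L x \<in> W}"
    unfolding top openin_lc_inductive_topology
  proof (intro conjI ballI)
    fix f assume f: "f \<in> {x \<in> V. L x \<in> W}"
    obtain U' where U': "U' \<subseteq> V'" "absolutely_convex U'"
        "\<forall>i. \<exists>G. openin (T' i) G \<and> (\<lambda>_. 0) \<in> G \<and> j' i ` G \<subseteq> U'" "\<forall>g\<in>V'. g - L f \<in> U' \<longrightarrow> g \<in> W"
      using W f unfolding openin_lc_inductive_topology by blast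
    let ?U = "{u \<in> V. L u \<in> U'}"
    have "absolutely_convex ?U"
      using U'(2) V lin unfolding absolutely_convex_def by simp
    moreover have "\<exists>G. openin (T i) G \<and> (\<lambda>_. 0) \<in> G \<and> j i ` G \<subseteq> ?U" for i
    proof -
      obtain i' where i': "\<forall>G'. openin (T' i') G' \<longrightarrow> (\<lambda>_. 0) \<in> G' \<longrightarrow> (\<exists>G. openin (T i) G \<and> (\<lambda>_. 0) \<in> G \<and> (\<forall>g\<in>G. L (j i g) \<in> j' i' ` G'))"
        using step[of i] by blast
      obtain G' where G': "openin (T' i') G'" "(\<lambda>_. 0) \<in> G'" "j' i' ` G' \<subseteq> U'" using U'(3) by blast
      obtain G where G: "openin (T i) G" "(\<lambda>_. 0) \<in> G" "\<forall>g\<in>G. L (j i g) \<in> j' i' ` G'" using i' G'(1,2) by blast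
      have "j i ` G \<subseteq> ?U" using G(3) G'(3) T(2)[of i] openin_subset[OF G(1)] by blast
      then show ?thesis using G(1,2) by blast
    qed
    moreover have "\<forall>g\<in>V. g - f \<in> ?U \<longrightarrow> g \<in> {x \<in> V. L x \<in> W}"
    proof (intro ballI impI)
      fix g assume g: "g \<in> V" "g - f \<in> ?U"
      have "L (g - f) = L g - L f" using lin[of g f 1 "-1"] g f by (simp add: fun_diff_def)
      then show "g \<in> {x \<in> V. L x \<in> W}" using g U'(4) LV by auto
    qed
    ultimately show "\<exists>U\<subseteq>V. absolutely_convex U \<and> (\<forall>i. \<exists>G. openin (T i) G \<and> (\<lambda>_. 0) \<in> G \<and> j i ` G \<subseteq> U) \<and>
        (\<forall>g\<in>V. g - f \<in> U \<longrightarrow> g \<in> {x \<in> V. L x \<in> W})"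
      by (intro exI[of _ ?U]) blast
  qed auto
qed

context nuclear_triple
begin

subsection \<open>Entire functions on the Hilbert spaces of the chain\<close>

lemma entire_norm_bound:
  assumes "F \<in> entire_step k p l" "\<theta> \<in> HC p"
  shows "cmod (F \<theta>) \<le> entire_norm k p l F * exp (2 ^ l * nrmC p \<theta> powr k)"
proof -
  have "cmod (F \<theta>) * exp (- (2 ^ l * nrmC p \<theta> powr k)) \<le> entire_norm k p l F"
    unfolding entire_norm_def using assms by (intro cSUP_upper) (auto simp: entire_step_def)
  then show ?thesis by (simp add: exp_minus field_simps)
qed

lemma entire_norm_leI:
  assumes "\<And>\<theta>. \<theta> \<in> HC p \<Longrightarrow> cmod (F \<theta>) \<le> M * exp (2 ^ l * nrmC p \<theta> powr k)"
  shows "bdd_above ((\<lambda>\<theta>. cmod (F \<theta>) * exp (- (2 ^ l * nrmC p \<theta> powr k))) ` HC p)" "entire_norm k p l F \<le> M"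
proof -
  have le: "cmod (F \<theta>) * exp (- (2 ^ l * nrmC p \<theta> powr k)) \<le> M" if "\<theta> \<in> HC p" for \<theta>
    using assms[OF that] by (simp add: exp_minus field_simps)
  show "bdd_above ((\<lambda>\<theta>. cmod (F \<theta>) * exp (- (2 ^ l * nrmC p \<theta> powr k))) ` HC p)"
    using le by (intro bdd_aboveI2)
  show "entire_norm k p l F \<le> M"
    unfolding entire_norm_def using le HC_closed(1) by (intro cSUP_least) auto
qed

lemma entire_norm_nonneg: "F \<in> entire_step k p l \<Longrightarrow> 0 \<le> entire_norm k p l F"
proof -
  assume F: "F \<in> entire_step k p l"
  have "0 \<le> entire_norm k p l F * exp (2 ^ l * nrmC p 0 powr k)"
    by (rule order_trans[OF norm_ge_zero entire_norm_bound[OF F HC_closed(1)]])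
  then show ?thesis by (simp add: zero_le_mult_iff)
qed

lemma topspace_HC: "topspace (HC_topology p) = HC p"
  by (simp add: HC_topology_def)

lemma HC_open: "openin (HC_topology p) (HC p)"
  using openin_topspace[of "HC_topology p"] by (simp add: topspace_HC)

lemma entire_step_diff:
  assumes "f \<in> entire_step k p l" "g \<in> entire_step k p l"
  shows "g - f \<in> entire_step k p l" "entire_norm k p l (g - f) \<le> entire_norm k p l g + entire_norm k p l f"
proof -
  note 1 = entire_norm_bound[OF assms(1)] and 2 = entire_norm_bound[OF assms(2)]
  have b: "cmod ((g - f) \<theta>) \<le> (entire_norm k p l g + entire_norm k p l f) * exp (2 ^ l * nrmC p \<theta> powr k)" if "\<theta> \<in> HC p" for \<theta>
    using norm_triangle_ineq4[of "g \<theta>" "f \<theta>"] 1[OF that] 2[OF that] by (simp add: distrib_right)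
  have hf: "holomorphic_in (HC_topology p) (HC p) f" and hg: "holomorphic_in (HC_topology p) (HC p) g"
    using assms by (auto simp: entire_step_def)
  have "holomorphic_in (HC_topology p) (HC p) (g - f)"
    unfolding holomorphic_in_def topspace_HC
  proof (intro conjI ballI HC_open)
    fix \<theta> \<eta> assume X: "\<theta> \<in> HC p" "\<eta> \<in> HC p"
    obtain r where r: "0 < r" "(\<lambda>\<zeta>. f (\<theta> + cscale \<zeta> \<eta>)) holomorphic_on ball 0 r"
      using hf X unfolding holomorphic_in_def topspace_HC by blast
    obtain r' where r': "0 < r'" "(\<lambda>\<zeta>. g (\<theta> + cscale \<zeta> \<eta>)) holomorphic_on ball 0 r'"
      using hg X unfolding holomorphic_in_def topspace_HC by blast
    have "(\<lambda>\<zeta>. (g - f) (\<theta> + cscale \<zeta> \<eta>)) holomorphic_on ball 0 (min r r')"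
      unfolding minus_apply using r(2) r'(2) by (intro holomorphic_on_diff) (auto elim: holomorphic_on_subset)
    then show "\<exists>r>0. (\<lambda>\<zeta>. (g - f) (\<theta> + cscale \<zeta> \<eta>)) holomorphic_on ball 0 r" using r(1) r'(1) by (intro exI[of _ "min r r'"]) simp
  next
    fix \<theta> assume X: "\<theta> \<in> HC p"
    obtain G where G: "openin (HC_topology p) G" "\<theta> \<in> G" "G \<subseteq> HC p" "bounded (f ` G)"
      using hf X unfolding holomorphic_in_def by blast
    obtain G' where G': "openin (HC_topology p) G'" "\<theta> \<in> G'" "G' \<subseteq> HC p" "bounded (g ` G')"
      using hg X unfolding holomorphic_in_def by blast
    have "bounded (f ` (G \<inter> G'))" "bounded (g ` (G \<inter> G'))" using G(4) G'(4) by (auto elim: bounded_subset)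
    then have "bounded ((\<lambda>x. g x - f x) ` (G \<inter> G'))" by (intro bounded_minus_comp)
    then have "bounded ((g - f) ` (G \<inter> G'))" by (simp add: fun_diff_def)
    then show "\<exists>G. openin (HC_topology p) G \<and> \<theta> \<in> G \<and> G \<subseteq> HC p \<and> bounded ((g - f) ` G)"
      using G(1-3) G'(1,2) by (intro exI[of _ "G \<inter> G'"]) (auto intro: openin_Int)
  qed
  moreover have "\<forall>\<theta>. \<theta> \<notin> HC p \<longrightarrow> (g - f) \<theta> = 0" using assms by (auto simp: entire_step_def)
  ultimately show "g - f \<in> entire_step k p l" using entire_norm_leI(1)[OF b] by (simp add: entire_step_def)
  show "entire_norm k p l (g - f) \<le> entire_norm k p l g + entire_norm k p l f" using entire_norm_leI(2)[OF b] .
qed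

lemma entire_step_zero: "(\<lambda>_. 0) \<in> entire_step k p l" "entire_norm k p l (\<lambda>_. 0) = 0"
proof -
  have b: "cmod ((\<lambda>_. 0) \<theta>) \<le> 0 * exp (2 ^ l * nrmC p \<theta> powr k)" for \<theta> :: "'h \<times> 'h" by simp
  have "holomorphic_in (HC_topology p) (HC p) (\<lambda>_. 0)"
    unfolding holomorphic_in_def
  proof (intro conjI ballI HC_open)
    show "\<exists>r>0. (\<lambda>\<zeta>. 0::complex) holomorphic_on ball 0 r" by (intro exI[of _ 1]) simp
    have "bounded ((\<lambda>_. 0::complex) ` HC p)" by (rule bounded_subset[of "{0}"]) auto
    then show "\<exists>G. openin (HC_topology p) G \<and> \<theta> \<in> G \<and> G \<subseteq> HC p \<and> bounded ((\<lambda>_. 0::complex) ` G)" if "\<theta> \<in> HC p" for \<theta>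
      using HC_open that by (intro exI[of _ "HC p"]) simp
  qed
  then show z: "(\<lambda>_. 0) \<in> entire_step k p l" using entire_norm_leI(1)[of p "\<lambda>_. 0" 0, OF b] by (simp add: entire_step_def)
  show "entire_norm k p l (\<lambda>_. 0) = 0"
    using entire_norm_leI(2)[of p "\<lambda>_. 0" 0, OF b] entire_norm_nonneg[OF z] by linarith
qed

lemma HC_approx:
  assumes "\<theta> \<in> HC p" "0 < \<epsilon>"
  shows "\<exists>\<sigma>\<in>nucC. nrmC p (\<theta> - \<sigma>) < \<epsilon>"
proof -
  obtain u where u: "u \<in> nuc" "nrm p (fst \<theta> - u) < \<epsilon> / 2" using nuc_dense_H[OF HC_D(1)[OF assms(1)], of "\<epsilon> / 2"] assms(2) by auto
  obtain v where v: "v \<in> nuc" "nrm p (snd \<theta> - v) < \<epsilon> / 2" using nuc_dense_H[OF HC_D(2)[OF assms(1)], of "\<epsilon> / 2"] assms(2) by auto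
  have n: "0 \<le> nrm p (fst \<theta> - u)" "0 \<le> nrm p (snd \<theta> - v)"
    using u(1) v(1) nuc_sub_H[of p] HC_D[OF assms(1)] by (auto intro!: nrm_nonneg H_diff)
  have "nrmC p (\<theta> - (u, v)) \<le> nrm p (fst \<theta> - u) + nrm p (snd \<theta> - v)"
    unfolding nrmC_def using sqrt_sum_squares_le_sum[OF n] by simp
  then show ?thesis using u v by (intro bexI[of _ "(u, v)"]) (auto simp: nucC_def)
qed

lemma entire_extension:
  assumes hol: "\<And>r. \<exists>C. NC.hol p r C F"
    and growth: "\<And>\<theta>. \<theta> \<in> nucC \<Longrightarrow> cmod (F \<theta>) \<le> M * exp (2 ^ l * nrmC p \<theta> powr k)"
    and k: "0 < k" and out: "\<And>\<theta>. \<theta> \<notin> nucC \<Longrightarrow> F \<theta> = 0"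
  shows "\<exists>G\<in>entire_step k p l. restrict_nucC G = F \<and> entire_norm k p l G \<le> M"
proof -
  \<comment> \<open>The explicit rate serves twice: it is at most 1, so the approximants stay in the
    ball of radius \<open>nrmC p \<theta> + 1\<close>, where one Lipschitz constant works, and it
    gives uniform convergence along lines.\<close>
  define \<sigma> where "\<sigma> \<theta> m = (SOME s. s \<in> nucC \<and> nrmC p (\<theta> - s) < inverse (real (Suc m)))" for \<theta> m
  have sig: "\<sigma> \<theta> m \<in> nucC" "nrmC p (\<theta> - \<sigma> \<theta> m) < inverse (real (Suc m))" if "\<theta> \<in> HC p" for \<theta> m
  proof -
    have "\<exists>s. s \<in> nucC \<and> nrmC p (\<theta> - s) < inverse (real (Suc m))" using HC_approx[OF that, of "inverse (real (Suc m))"] by auto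
    from someI_ex[OF this] show "\<sigma> \<theta> m \<in> nucC" "nrmC p (\<theta> - \<sigma> \<theta> m) < inverse (real (Suc m))" by (auto simp: \<sigma>_def)
  qed
  have nH: "\<theta> \<in> HC p" if "\<theta> \<in> nucC" for \<theta> using nucC_D(3)[OF that] .
  have inv1: "inverse (real (Suc m)) \<le> 1" for m by (simp add: inverse_le_1_iff)
  have inv0: "(\<lambda>m. inverse (real (Suc m))) \<longlonglongrightarrow> 0" by (rule LIMSEQ_inverse_real_of_nat)
  have tri: "nrmC p (a - c) \<le> nrmC p (a - b) + nrmC p (b - c)" if "a \<in> HC p" "b \<in> HC p" "c \<in> HC p" for a b c
    using HC.N_triangle[OF HC.X_diff[OF that(1,2)] HC.X_diff[OF that(2,3)]] by simp
  have nle: "nrmC p a \<le> nrmC p b + nrmC p (b - a)" if "a \<in> HC p" "b \<in> HC p" for a b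
    using tri[OF that HC_closed(1)] HC.N_minus_commute[OF that] by simp
  have nsig: "nrmC p (\<sigma> \<theta> m) \<le> nrmC p \<theta> + 1" if "\<theta> \<in> HC p" for \<theta> m
    using nle[OF nH[OF sig(1)[OF that]] that, of m] sig(2)[OF that, of m] inv1[of m] by linarith
  have lip: "\<exists>C\<ge>0. \<forall>a\<in>nucC. \<forall>b\<in>nucC. nrmC p a \<le> R \<longrightarrow> nrmC p b \<le> R \<longrightarrow> cmod (F a - F b) \<le> C * nrmC p (a - b)" for R
  proof -
    \<comment> \<open>The radius \<open>R + 2\<close> leaves room for the margin 1 with strict
      inequality.\<close>
    obtain C where C: "NC.hol p (R + 2) C F" using hol by blast
    have "cmod (F a - F b) \<le> \<bar>C\<bar> * nrmC p (a - b)" if "a \<in> nucC" "b \<in> nucC" "nrmC p a \<le> R" "nrmC p b \<le> R" for a b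
    proof -
      have "cmod (F a - F b) \<le> C / 1 * nrmC p (a - b)" using that by (intro NC.hol_lipschitz[OF C]) auto
      also have "\<dots> \<le> \<bar>C\<bar> * nrmC p (a - b)" by (intro mult_right_mono) (auto simp: nrmC_nonneg)
      finally show ?thesis .
    qed
    then show ?thesis by (intro exI[of _ "\<bar>C\<bar>"]) auto
  qed
  define G where "G \<theta> = (if \<theta> \<in> HC p then lim (\<lambda>m. F (\<sigma> \<theta> m)) else 0)" for \<theta>
  have conv: "(\<lambda>m. F (\<sigma> \<theta> m)) \<longlonglongrightarrow> G \<theta>" if th: "\<theta> \<in> HC p" for \<theta>
  proof -
    obtain C where C: "0 \<le> C" "\<forall>a\<in>nucC. \<forall>b\<in>nucC. nrmC p a \<le> nrmC p \<theta> + 1 \<longrightarrow> nrmC p b \<le> nrmC p \<theta> + 1 \<longrightarrow> cmod (F a - F b) \<le> C * nrmC p (a - b)"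
      using lip by blast
    have "Cauchy (\<lambda>m. F (\<sigma> \<theta> m))"
    proof (rule metric_CauchyI)
      fix e :: real assume e: "0 < e"
      have "(\<lambda>m. (2 * C) * inverse (real (Suc m))) \<longlonglongrightarrow> 0" using tendsto_mult_right_zero[OF inv0] .
      then obtain M0 where M0: "\<And>m. m \<ge> M0 \<Longrightarrow> (2 * C) * inverse (real (Suc m)) < e"
        using order_tendstoD(2)[of _ 0 sequentially e] e by (auto simp: eventually_sequentially)
      show "\<exists>M. \<forall>m\<ge>M. \<forall>n\<ge>M. dist (F (\<sigma> \<theta> m)) (F (\<sigma> \<theta> n)) < e"
      proof (intro exI[of _ M0] allI impI)
        fix m n assume mn: "M0 \<le> m" "M0 \<le> n"
        note s = sig(1)[OF th]
        have "nrmC p (\<sigma> \<theta> m - \<sigma> \<theta> n) \<le> nrmC p (\<sigma> \<theta> m - \<theta>) + nrmC p (\<theta> - \<sigma> \<theta> n)"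
          by (rule tri[OF nH[OF s] th nH[OF s]])
        also have "nrmC p (\<sigma> \<theta> m - \<theta>) = nrmC p (\<theta> - \<sigma> \<theta> m)" by (rule HC.N_minus_commute[OF nH[OF s] th])
        finally have "nrmC p (\<sigma> \<theta> m - \<sigma> \<theta> n) \<le> inverse (real (Suc m)) + inverse (real (Suc n))"
          using sig(2)[OF th, of m] sig(2)[OF th, of n] by linarith
        also have "\<dots> \<le> inverse (real (Suc M0)) + inverse (real (Suc M0))"
          using mn by (intro add_mono le_imp_inverse_le) auto
        finally have d: "nrmC p (\<sigma> \<theta> m - \<sigma> \<theta> n) \<le> 2 * inverse (real (Suc M0))" by simp
        have "cmod (F (\<sigma> \<theta> m) - F (\<sigma> \<theta> n)) \<le> C * nrmC p (\<sigma> \<theta> m - \<sigma> \<theta> n)" using C(2) s nsig[OF th] by blast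
        also have "\<dots> \<le> C * (2 * inverse (real (Suc M0)))" using d C(1) by (rule mult_left_mono)
        also have "\<dots> < e" using M0[of M0] by (simp add: mult_ac)
        finally show "dist (F (\<sigma> \<theta> m)) (F (\<sigma> \<theta> n)) < e" by (simp add: dist_norm)
      qed
    qed
    then have "convergent (\<lambda>m. F (\<sigma> \<theta> m))" by (rule Cauchy_convergent)
    then show ?thesis using th by (simp add: G_def convergent_LIMSEQ_iff)
  qed
  \<comment> \<open>The Lipschitz estimate between \<open>F\<close> on \<open>nucC\<close> and its
    limit \<open>G\<close> on \<open>HC p\<close>; it yields both the agreement on
    \<open>nucC\<close> and the uniform approximation of \<open>G\<close> along lines.\<close>
  have close: "\<exists>C\<ge>0. \<forall>a\<in>nucC. \<forall>b\<in>HC p. nrmC p a \<le> R \<longrightarrow> nrmC p b \<le> R \<longrightarrow> cmod (F a - G b) \<le> C * nrmC p (a - b)" for R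
  proof -
    obtain C where C: "0 \<le> C" "\<forall>a\<in>nucC. \<forall>b\<in>nucC. nrmC p a \<le> R + 1 \<longrightarrow> nrmC p b \<le> R + 1 \<longrightarrow> cmod (F a - F b) \<le> C * nrmC p (a - b)"
      using lip by blast
    have "cmod (F a - G b) \<le> C * nrmC p (a - b)" if ab: "a \<in> nucC" "b \<in> HC p" "nrmC p a \<le> R" "nrmC p b \<le> R" for a b
    proof (rule LIMSEQ_le)
      show "(\<lambda>m. cmod (F a - F (\<sigma> b m))) \<longlonglongrightarrow> cmod (F a - G b)" by (intro tendsto_intros conv ab)
      have "(\<lambda>m. C * (nrmC p (a - b) + inverse (real (Suc m)))) \<longlonglongrightarrow> C * (nrmC p (a - b) + 0)" by (intro tendsto_intros inv0)
      then show "(\<lambda>m. C * (nrmC p (a - b) + inverse (real (Suc m)))) \<longlonglongrightarrow> C * nrmC p (a - b)" by simp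
      have "cmod (F a - F (\<sigma> b m)) \<le> C * (nrmC p (a - b) + inverse (real (Suc m)))" for m
      proof -
        have "cmod (F a - F (\<sigma> b m)) \<le> C * nrmC p (a - \<sigma> b m)"
          using C(2) ab sig(1)[OF ab(2)] nsig[OF ab(2), of m] by force
        also have "\<dots> \<le> C * (nrmC p (a - b) + inverse (real (Suc m)))"
          using tri[OF nH[OF ab(1)] ab(2) nH[OF sig(1)[OF ab(2)]], of m] sig(2)[OF ab(2), of m] C(1)
          by (intro mult_left_mono) auto
        finally show ?thesis .
      qed
      then show "\<exists>N. \<forall>m\<ge>N. cmod (F a - F (\<sigma> b m)) \<le> C * (nrmC p (a - b) + inverse (real (Suc m)))" by blast
    qed
    then show ?thesis using C(1) by blast
  qed
  have GF: "G \<theta> = F \<theta>" if "\<theta> \<in> nucC" for \<theta>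
  proof -
    obtain C where "\<forall>a\<in>nucC. \<forall>b\<in>HC p. nrmC p a \<le> nrmC p \<theta> \<longrightarrow> nrmC p b \<le> nrmC p \<theta> \<longrightarrow> cmod (F a - G b) \<le> C * nrmC p (a - b)"
      using close by blast
    then have "cmod (F \<theta> - G \<theta>) \<le> C * nrmC p (\<theta> - \<theta>)" using that nH by blast
    then show ?thesis using NC.N_zero by simp
  qed
  have bound: "cmod (G \<theta>) \<le> M * exp (2 ^ l * nrmC p \<theta> powr k)" if th: "\<theta> \<in> HC p" for \<theta>
  proof (rule LIMSEQ_le)
    show "(\<lambda>m. cmod (F (\<sigma> \<theta> m))) \<longlonglongrightarrow> cmod (G \<theta>)" by (intro tendsto_intros conv th)
    have "(\<lambda>m. nrmC p (\<sigma> \<theta> m)) \<longlonglongrightarrow> nrmC p \<theta>"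
    proof (rule Lim_null_comparison[THEN LIM_zero_cancel])
      show "\<forall>\<^sub>F m in sequentially. norm (nrmC p (\<sigma> \<theta> m) - nrmC p \<theta>) \<le> inverse (real (Suc m))"
      proof (intro always_eventually allI)
        fix m
        have "nrmC p (\<sigma> \<theta> m) \<le> nrmC p \<theta> + nrmC p (\<theta> - \<sigma> \<theta> m)" by (rule nle[OF nH[OF sig(1)[OF th]] th])
        moreover have "nrmC p \<theta> \<le> nrmC p (\<sigma> \<theta> m) + nrmC p (\<sigma> \<theta> m - \<theta>)" by (rule nle[OF th nH[OF sig(1)[OF th]]])
        moreover have "nrmC p (\<sigma> \<theta> m - \<theta>) = nrmC p (\<theta> - \<sigma> \<theta> m)" by (rule HC.N_minus_commute[OF nH[OF sig(1)[OF th]] th])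
        ultimately show "norm (nrmC p (\<sigma> \<theta> m) - nrmC p \<theta>) \<le> inverse (real (Suc m))" using sig(2)[OF th, of m] by simp
      qed
    qed (rule inv0)
    then show "(\<lambda>m. M * exp (2 ^ l * nrmC p (\<sigma> \<theta> m) powr k)) \<longlonglongrightarrow> M * exp (2 ^ l * nrmC p \<theta> powr k)"
      using k by (intro tendsto_intros tendsto_powr') (auto simp: nrmC_nonneg)
    show "\<exists>N. \<forall>m\<ge>N. cmod (F (\<sigma> \<theta> m)) \<le> M * exp (2 ^ l * nrmC p (\<sigma> \<theta> m) powr k)" using growth sig(1)[OF th] by blast
  qed
  have M0: "0 \<le> M"
  proof -
    have "0 \<le> M * exp (2 ^ l * nrmC p 0 powr k)" by (rule order_trans[OF norm_ge_zero bound[OF HC_closed(1)]])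
    then show ?thesis by (simp add: zero_le_mult_iff)
  qed
  have "holomorphic_in (HC_topology p) (HC p) G"
    unfolding holomorphic_in_def topspace_HC
  proof (intro conjI ballI HC_open)
    fix \<theta> \<eta> assume X: "\<theta> \<in> HC p" "\<eta> \<in> HC p"
    define R where "R = nrmC p \<theta> + nrmC p \<eta> + 2"
    obtain C where C: "0 \<le> C" "\<forall>a\<in>nucC. \<forall>b\<in>HC p. nrmC p a \<le> R \<longrightarrow> nrmC p b \<le> R \<longrightarrow> cmod (F a - G b) \<le> C * nrmC p (a - b)"
      using close by blast
    obtain D where D: "NC.hol p (R + 1) D F" using hol by blast
    \<comment> \<open>Base point and direction are both replaced by approximants in
      \<open>nucC\<close>, where the holomorphy of \<open>F\<close> is known; the uniform limit of
      these functions is \<open>G\<close> along the given line.\<close>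
    define f where "f m \<zeta> = F (\<sigma> \<theta> m + cscale \<zeta> (\<sigma> \<eta> m))" for m \<zeta>
    note s = sig(1)[OF X(1)] and t = sig(1)[OF X(2)]
    have small: "cmod \<zeta> * x \<le> x" if "\<zeta> \<in> cball 0 1" "0 \<le> x" for \<zeta> :: complex and x :: real
      using that mult_right_mono[of "cmod \<zeta>" 1 x] by simp
    have n1: "nrmC p (\<sigma> \<theta> m + cscale \<zeta> (\<sigma> \<eta> m)) \<le> R" if "\<zeta> \<in> cball 0 1" for m \<zeta>
      using NC.N_line[OF s t, of p m \<zeta> m] small[OF that nrmC_nonneg[of p "\<sigma> \<eta> m"]] nsig[OF X(1), of m] nsig[OF X(2), of m]
      by (simp add: R_def)
    have n2: "nrmC p (\<theta> + cscale \<zeta> \<eta>) \<le> R" if "\<zeta> \<in> cball 0 1" for \<zeta>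
      using HC.N_line[OF X, of \<zeta>] small[OF that nrmC_nonneg[of p \<eta>]] by (simp add: R_def)
    have ev: "\<forall>\<^sub>F m in sequentially. continuous_on (cball 0 1) (f m) \<and> f m holomorphic_on ball 0 1"
    proof (intro always_eventually allI)
      fix m
      have "f m holomorphic_on cball 0 1"
        unfolding f_def
      proof (rule NC.hol_line[OF D s t])
        show "nrmC p (\<sigma> \<theta> m + cscale \<zeta> (\<sigma> \<eta> m)) < R + 1" if "\<zeta> \<in> cball 0 1" for \<zeta>
          using n1[OF that, of m] by linarith
      qed
      then show "continuous_on (cball 0 1) (f m) \<and> f m holomorphic_on ball 0 1"
        using holomorphic_on_imp_continuous_on holomorphic_on_subset ball_subset_cball by blast
    qed
    have ul: "uniform_limit (cball 0 1) f (\<lambda>\<zeta>. G (\<theta> + cscale \<zeta> \<eta>)) sequentially"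
    proof (rule uniform_limitI)
      fix e :: real assume e: "0 < e"
      have "(\<lambda>m. (2 * C) * inverse (real (Suc m))) \<longlonglongrightarrow> 0" using tendsto_mult_right_zero[OF inv0] .
      then have "\<forall>\<^sub>F m in sequentially. (2 * C) * inverse (real (Suc m)) < e" using e by (rule order_tendstoD(2))
      then show "\<forall>\<^sub>F m in sequentially. \<forall>\<zeta>\<in>cball 0 1. dist (f m \<zeta>) (G (\<theta> + cscale \<zeta> \<eta>)) < e"
      proof eventually_elim
        case (elim m)
        show ?case
        proof
          fix \<zeta> :: complex assume z: "\<zeta> \<in> cball 0 1"
          have a: "\<sigma> \<theta> m + cscale \<zeta> (\<sigma> \<eta> m) \<in> nucC" using s t by (intro NC.X_line)
          have b: "\<theta> + cscale \<zeta> \<eta> \<in> HC p" using X by (intro HC.X_line)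
          have e1: "(\<sigma> \<theta> m + cscale \<zeta> (\<sigma> \<eta> m)) - (\<theta> + cscale \<zeta> \<eta>) = (\<sigma> \<theta> m - \<theta>) + cscale \<zeta> (\<sigma> \<eta> m - \<eta>)"
            by (simp add: cscale_diff_right)
          have "nrmC p ((\<sigma> \<theta> m + cscale \<zeta> (\<sigma> \<eta> m)) - (\<theta> + cscale \<zeta> \<eta>)) \<le> nrmC p (\<sigma> \<theta> m - \<theta>) + cmod \<zeta> * nrmC p (\<sigma> \<eta> m - \<eta>)"
            unfolding e1 by (rule HC.N_line[OF HC.X_diff[OF nH[OF s] X(1)] HC.X_diff[OF nH[OF t] X(2)]])
          also have "\<dots> \<le> nrmC p (\<sigma> \<theta> m - \<theta>) + nrmC p (\<sigma> \<eta> m - \<eta>)" using small[OF z] nrmC_nonneg by simp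
          also have "nrmC p (\<sigma> \<theta> m - \<theta>) = nrmC p (\<theta> - \<sigma> \<theta> m)" by (rule HC.N_minus_commute[OF nH[OF s] X(1)])
          also have "nrmC p (\<sigma> \<eta> m - \<eta>) = nrmC p (\<eta> - \<sigma> \<eta> m)" by (rule HC.N_minus_commute[OF nH[OF t] X(2)])
          finally have d: "nrmC p ((\<sigma> \<theta> m + cscale \<zeta> (\<sigma> \<eta> m)) - (\<theta> + cscale \<zeta> \<eta>)) \<le> 2 * inverse (real (Suc m))"
            using sig(2)[OF X(1), of m] sig(2)[OF X(2), of m] by linarith
          have "cmod (f m \<zeta> - G (\<theta> + cscale \<zeta> \<eta>)) \<le> C * nrmC p ((\<sigma> \<theta> m + cscale \<zeta> (\<sigma> \<eta> m)) - (\<theta> + cscale \<zeta> \<eta>))"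
            unfolding f_def using C(2) a b n1[OF z] n2[OF z] by blast
          also have "\<dots> \<le> C * (2 * inverse (real (Suc m)))" using d C(1) by (rule mult_left_mono)
          also have "\<dots> < e" using elim by (simp add: mult_ac)
          finally show "dist (f m \<zeta>) (G (\<theta> + cscale \<zeta> \<eta>)) < e" by (simp add: dist_norm)
        qed
      qed
    qed
    have "(\<lambda>\<zeta>. G (\<theta> + cscale \<zeta> \<eta>)) holomorphic_on ball 0 1"
      by (rule holomorphic_uniform_limit[OF ev ul]) auto
    then show "\<exists>r>0. (\<lambda>\<zeta>. G (\<theta> + cscale \<zeta> \<eta>)) holomorphic_on ball 0 r" by (intro exI[of _ 1]) simp
  next
    fix \<theta> assume X: "\<theta> \<in> HC p"
    let ?B = "{\<eta> \<in> HC p. nrmC p \<eta> < nrmC p \<theta> + 1}"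
    have "openin (HC_topology p) ?B"
      unfolding HC_topology_def openin_seminorm_topology
    proof (intro conjI ballI)
      fix f assume f: "f \<in> ?B"
      show "\<exists>F \<epsilon>. finite F \<and> F \<subseteq> {nrmC p} \<and> 0 < \<epsilon> \<and> (\<forall>g\<in>HC p. (\<forall>q\<in>F. q (g - f) < \<epsilon>) \<longrightarrow> g \<in> ?B)"
      proof (intro exI[of _ "{nrmC p}"] exI[of _ "nrmC p \<theta> + 1 - nrmC p f"] conjI ballI impI)
        fix g assume g: "g \<in> HC p" "\<forall>q\<in>{nrmC p}. q (g - f) < nrmC p \<theta> + 1 - nrmC p f"
        have "nrmC p g \<le> nrmC p (g - f) + nrmC p (f - 0)" using tri[OF g(1) _ HC_closed(1), of f] f by simp
        then show "g \<in> ?B" using g by auto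
      qed (use f in auto)
    qed auto
    moreover have "bounded (G ` ?B)"
      unfolding bounded_iff
    proof (intro exI ballI)
      fix y assume "y \<in> G ` ?B"
      then obtain \<eta> where e: "\<eta> \<in> HC p" "nrmC p \<eta> < nrmC p \<theta> + 1" "y = G \<eta>" by auto
      have "cmod y \<le> M * exp (2 ^ l * nrmC p \<eta> powr k)" using bound[OF e(1)] e(3) by simp
      also have "\<dots> \<le> M * exp (2 ^ l * (nrmC p \<theta> + 1) powr k)"
        using e(2) k M0 nrmC_nonneg[of p \<eta>] by (intro mult_left_mono iffD2[OF exp_le_cancel_iff] powr_mono2) auto
      finally show "norm y \<le> M * exp (2 ^ l * (nrmC p \<theta> + 1) powr k)" .
    qed
    ultimately show "\<exists>U. openin (HC_topology p) U \<and> \<theta> \<in> U \<and> U \<subseteq> HC p \<and> bounded (G ` U)"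
      using X by (intro exI[of _ ?B]) auto
  qed
  then have "G \<in> entire_step k p l"
    using entire_norm_leI(1)[of p G M l k, OF bound] by (simp add: entire_step_def G_def)
  moreover have "restrict_nucC G = F" using GF out by (auto simp: restrict_nucC_def fun_eq_iff)
  ultimately show ?thesis using entire_norm_leI(2)[of p G M l k, OF bound] by blast
qed


subsection \<open>Growth of the S-transform and of its inverse\<close>

lemma fact_le_Suc_power: "fact n \<le> (real n + 1) ^ n"
proof -
  have "(fact n :: real) \<le> real n ^ n" using fact_le_power[of n, where ?'a = real] by simp
  also have "\<dots> \<le> (real n + 1) ^ n" by (intro power_mono) auto
  finally show ?thesis .
qed

lemma entire_step_hol:
  assumes F: "F \<in> entire_step k p l" and k: "0 < k"
  shows "NC.hol p r (entire_norm k p l F * exp (2 ^ l * r powr k)) (restrict_nucC F)"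
  unfolding NC.hol_def
proof (intro conjI ballI impI)
  fix \<theta> assume X: "\<theta> \<in> nucC" "nrmC p \<theta> < r"
  have "cmod (F \<theta>) \<le> entire_norm k p l F * exp (2 ^ l * nrmC p \<theta> powr k)"
    by (rule entire_norm_bound[OF F nucC_D(3)[OF X(1)]])
  also have "\<dots> \<le> entire_norm k p l F * exp (2 ^ l * r powr k)"
    using X(2) k nrmC_nonneg[of p \<theta>] entire_norm_nonneg[OF F]
    by (intro mult_left_mono iffD2[OF exp_le_cancel_iff] powr_mono2) auto
  finally show "cmod (restrict_nucC F \<theta>) \<le> entire_norm k p l F * exp (2 ^ l * r powr k)"
    using X(1) by (simp add: restrict_nucC_def)
next
  fix \<theta> \<eta> assume X: "\<theta> \<in> nucC" "\<eta> \<in> nucC"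
  have "holomorphic_in (HC_topology p) (HC p) F" using F by (simp add: entire_step_def)
  then obtain \<rho> where rho: "0 < \<rho>" "(\<lambda>\<zeta>. F (\<theta> + cscale \<zeta> \<eta>)) holomorphic_on ball 0 \<rho>"
    using nucC_D(3)[OF X(1)] nucC_D(3)[OF X(2)] unfolding holomorphic_in_def topspace_HC by blast
  have e: "restrict_nucC F (\<theta> + cscale \<zeta> \<eta>) = F (\<theta> + cscale \<zeta> \<eta>)" for \<zeta>
    using NC.X_line[OF X] by (simp add: restrict_nucC_def)
  show "(\<lambda>\<zeta>. restrict_nucC F (\<theta> + cscale \<zeta> \<eta>)) field_differentiable at 0"
    unfolding e using rho by (intro holomorphic_on_imp_differentiable_at[OF rho(2)]) auto
qed

context
  fixes \<mu> A and \<beta> :: real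
  assumes appell: "appell_data \<mu> A" and \<beta>: "0 \<le> \<beta>" "\<beta> < 1"
begin

text \<open>The exponent in \<open>S_bound\<close> is a constant multiple of
  \<open>nrmC p \<theta> powr \<kappa>\<close>, and \<open>l\<close> is chosen so that
  \<open>2 ^ l\<close> exceeds this constant. The index \<open>p\<close> is preserved.\<close>

lemma S_step:
  "\<exists>l. \<exists>C\<ge>0. \<forall>\<Phi>\<in>dist_step \<mu> \<beta> p q. \<exists>G\<in>entire_step (2 / (1 - \<beta>)) p l.
     restrict_nucC G = S_transform \<mu> \<Phi> \<and> entire_norm (2 / (1 - \<beta>)) p l G \<le> C * dist_norm \<mu> \<beta> p q \<Phi>"
proof -
  define \<kappa> where "\<kappa> = 2 / (1 - \<beta>)"
  have k: "0 < \<kappa>" using \<beta> by (simp add: \<kappa>_def)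
  obtain l where l: "(1 - \<beta>) * (2 powr (real q / 2)) powr \<kappa> < 2 ^ l"
    using real_arch_pow[of 2 "(1 - \<beta>) * (2 powr (real q / 2)) powr \<kappa>"] by auto
  have rt: "0 < 1 - ratio \<beta>" using ratio(2)[OF appell \<beta>] by simp
  have "\<exists>G\<in>entire_step \<kappa> p l. restrict_nucC G = S_transform \<mu> \<Phi> \<and> entire_norm \<kappa> p l G \<le> dist_norm \<mu> \<beta> p q \<Phi> / (1 - ratio \<beta>)"
    if \<Phi>: "\<Phi> \<in> dist_step \<mu> \<beta> p q" for \<Phi>
  proof (rule entire_extension)
    show "\<exists>C. NC.hol p r C (S_transform \<mu> \<Phi>)" for r using S_hol[OF appell \<beta> \<Phi>, of r] by (rule exI)
    show "cmod (S_transform \<mu> \<Phi> \<theta>) \<le> dist_norm \<mu> \<beta> p q \<Phi> / (1 - ratio \<beta>) * exp (2 ^ l * nrmC p \<theta> powr \<kappa>)" if th: "\<theta> \<in> nucC" for \<theta>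
    proof -
      have "(1 - \<beta>) * (2 powr (real q / 2) * nrmC p \<theta>) powr \<kappa> = ((1 - \<beta>) * (2 powr (real q / 2)) powr \<kappa>) * nrmC p \<theta> powr \<kappa>"
        by (simp add: powr_mult nrmC_nonneg)
      also have "\<dots> \<le> 2 ^ l * nrmC p \<theta> powr \<kappa>" using l by (intro mult_right_mono) auto
      finally have le: "(1 - \<beta>) * (2 powr (real q / 2) * nrmC p \<theta>) powr \<kappa> \<le> 2 ^ l * nrmC p \<theta> powr \<kappa>" .
      have "cmod (S_transform \<mu> \<Phi> \<theta>) \<le> dist_norm \<mu> \<beta> p q \<Phi> / (1 - ratio \<beta>) * exp ((1 - \<beta>) * (2 powr (real q / 2) * nrmC p \<theta>) powr \<kappa>)"
        unfolding \<kappa>_def by (rule S_bound[OF appell \<beta> \<Phi> th order_refl])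
      also have "\<dots> \<le> dist_norm \<mu> \<beta> p q \<Phi> / (1 - ratio \<beta>) * exp (2 ^ l * nrmC p \<theta> powr \<kappa>)"
        using le rt dist_norm_nonneg[OF appell, of \<beta> p q \<Phi>] by (intro mult_left_mono) auto
      finally show ?thesis .
    qed
    show "S_transform \<mu> \<Phi> \<theta> = 0" if "\<theta> \<notin> nucC" for \<theta> using that by (simp add: S_transform_def)
  qed (rule k)
  then have "\<forall>\<Phi>\<in>dist_step \<mu> \<beta> p q. \<exists>G\<in>entire_step \<kappa> p l. restrict_nucC G = S_transform \<mu> \<Phi> \<and> entire_norm \<kappa> p l G \<le> (1 / (1 - ratio \<beta>)) * dist_norm \<mu> \<beta> p q \<Phi>"
    by simp
  then show ?thesis unfolding \<kappa>_def[symmetric] using rt by (intro exI[of _ l] exI[of _ "1 / (1 - ratio \<beta>)"]) simp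
qed

text \<open>Passing from \<open>p\<close> to \<open>p'\<close> is the price of the Hilbert-Schmidt
  embedding in \<open>kernel_theorem\<close>. Neither \<open>p'\<close> nor \<open>q\<close> nor
  \<open>C\<close> depends on \<open>G\<close>, which is what continuity of the inverse on the step
  requires.\<close>

lemma inverse_S_step:
  "\<exists>p' q. \<exists>C\<ge>0. \<forall>G\<in>entire_step (2 / (1 - \<beta>)) p l. \<exists>\<Phi>\<in>dist_step \<mu> \<beta> p' q.
     S_transform \<mu> \<Phi> = restrict_nucC G \<and> dist_norm \<mu> \<beta> p' q \<Phi> \<le> C * entire_norm (2 / (1 - \<beta>)) p l G"
proof -
  define \<kappa> where "\<kappa> = 2 / (1 - \<beta>)"
  have k: "0 < \<kappa>" and ik: "1 / \<kappa> = (1 - \<beta>) / 2" using \<beta> by (simp_all add: \<kappa>_def)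
  obtain p' c where c: "0 \<le> c" and KT: "\<forall>F. (\<exists>r C. 0 < r \<and> NC.hol p r C F) \<longrightarrow>
     (\<exists>K. (\<forall>n. K n \<in> tensors_dual n) \<and>
       (\<forall>r C. 0 < r \<longrightarrow> NC.hol p r C F \<longrightarrow>
          (\<forall>n. \<forall>t\<in>tensors n. cmod (K n t) \<le> C * exp (real (n + 1)) * (c / r) ^ n * tensor_norm p' n t) \<and>
          (\<forall>\<theta>\<in>nucC. nrmC p \<theta> < r \<longrightarrow> (\<lambda>n. K n (tensor_power n \<theta>)) sums F \<theta>)))"
    using kernel_theorem[of p] by blast
  \<comment> \<open>When \<open>r powr \<kappa> = n + 1\<close>, the growth factor and the factor
    \<open>exp (n + 1)\<close> of the kernel bound multiply to \<open>E ^ (n + 1)\<close>.\<close>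
  define E :: real where "E = exp (2 ^ l + 1)"
  have E: "0 < E" by (simp add: E_def)
  \<comment> \<open>Provides the hypothesis of \<open>dist_stepI\<close> for the rate
    \<open>R = c * E\<close>.\<close>
  obtain q where q: "2 * (c * E)\<^sup>2 < 2 ^ q" using real_arch_pow[of 2 "2 * (c * E)\<^sup>2"] by auto
  have "\<exists>\<Phi>\<in>dist_step \<mu> \<beta> p' q. S_transform \<mu> \<Phi> = restrict_nucC G \<and> dist_norm \<mu> \<beta> p' q \<Phi> \<le> (2 * E) * entire_norm \<kappa> p l G"
    if G: "G \<in> entire_step \<kappa> p l" for G
  proof -
    let ?M = "entire_norm \<kappa> p l G"
    have M: "0 \<le> ?M" by (rule entire_norm_nonneg[OF G])
    have hol: "NC.hol p r (?M * exp (2 ^ l * r powr \<kappa>)) (restrict_nucC G)" for r by (rule entire_step_hol[OF G k])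
    have "\<exists>r C. 0 < r \<and> NC.hol p r C (restrict_nucC G)" using hol[of 1] by (intro exI[of _ 1] exI conjI) auto
    then obtain K where K: "\<forall>n. K n \<in> tensors_dual n" and Kr: "\<forall>r C. 0 < r \<longrightarrow> NC.hol p r C (restrict_nucC G) \<longrightarrow>
          (\<forall>n. \<forall>t\<in>tensors n. cmod (K n t) \<le> C * exp (real (n + 1)) * (c / r) ^ n * tensor_norm p' n t) \<and>
          (\<forall>\<theta>\<in>nucC. nrmC p \<theta> < r \<longrightarrow> (\<lambda>n. K n (tensor_power n \<theta>)) sums restrict_nucC G \<theta>)"
      using KT by blast
    have Kb: "cmod (K n t) \<le> (?M * E) * (fact n powr (- ((1 - \<beta>) / 2)) * (c * E) ^ n) * tensor_norm p' n t" if t: "t \<in> tensors n" for n t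
    proof -
      \<comment> \<open>The radius that balances the growth of \<open>G\<close> against the factor \<open>r ^ n\<close> of the Cauchy estimate.\<close>
      define r where "r = (real n + 1) powr (1 / \<kappa>)"
      have r: "0 < r" by (simp add: r_def)
      have rk: "r powr \<kappa> = real n + 1" using k by (simp add: r_def powr_powr)
      have "cmod (K n t) \<le> ?M * exp (2 ^ l * r powr \<kappa>) * exp (real (n + 1)) * (c / r) ^ n * tensor_norm p' n t"
        using Kr r hol t by blast
      also have "\<dots> = ?M * (exp (2 ^ l * (real n + 1)) * exp (real n + 1)) * (c ^ n * (1 / r ^ n)) * tensor_norm p' n t"
        unfolding rk by (simp add: power_divide add.commute mult.assoc)
      also have "exp (2 ^ l * (real n + 1)) * exp (real n + 1) = E * E ^ n"
      proof -
        have "exp (2 ^ l * (real n + 1)) * exp (real n + 1) = exp (of_nat (Suc n) * (2 ^ l + 1))"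
          by (simp add: exp_add[symmetric] algebra_simps)
        also have "\<dots> = E ^ Suc n" unfolding E_def by (rule exp_of_nat_mult)
        finally show ?thesis by simp
      qed
      also have "?M * (E * E ^ n) * (c ^ n * (1 / r ^ n)) * tensor_norm p' n t \<le>
          ?M * (E * E ^ n) * (c ^ n * fact n powr (- ((1 - \<beta>) / 2))) * tensor_norm p' n t"
      proof -
        \<comment> \<open>Here the power of the radius is traded for the factorial weight, using
          \<open>1 / \<kappa> = (1 - \<beta>) / 2\<close>.\<close>
        have "fact n powr (1 / \<kappa>) \<le> ((real n + 1) ^ n) powr (1 / \<kappa>)" using k fact_le_Suc_power[of n] by (intro powr_mono2) auto
        also have "\<dots> = r ^ n" unfolding r_def by (simp add: powr_realpow[symmetric] powr_powr mult.commute)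
        finally have "1 / r ^ n \<le> 1 / fact n powr (1 / \<kappa>)" using r by (intro divide_left_mono) auto
        also have "\<dots> = fact n powr (- ((1 - \<beta>) / 2))" unfolding ik by (simp add: powr_minus_divide)
        finally show ?thesis using M E c tensor_norm_nonneg[of p' n t] by (intro mult_right_mono mult_left_mono) auto
      qed
      also have "\<dots> = (?M * E) * (fact n powr (- ((1 - \<beta>) / 2)) * (c * E) ^ n) * tensor_norm p' n t"
        by (simp add: power_mult_distrib)
      finally show ?thesis .
    qed
    obtain \<Phi> where \<Phi>: "\<Phi> \<in> polynomials_dual" "kernels \<mu> \<Phi> = K" using kernels_surj[OF appell, of K] K by blast
    have *: "\<Phi> \<in> dist_step \<mu> \<beta> p' q" "dist_norm \<mu> \<beta> p' q \<Phi> \<le> 2 * (?M * E)"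
      using Kb M E c q by (auto intro!: dist_stepI[OF appell \<Phi>(1), of "?M * E" "c * E"] simp: \<Phi>(2))
    have "S_transform \<mu> \<Phi> \<theta> = restrict_nucC G \<theta>" for \<theta>
    proof (cases "\<theta> \<in> nucC")
      case True
      have "0 < nrmC p \<theta> + 1" using nrmC_nonneg[of p \<theta>] by linarith
      then have "(\<lambda>n. K n (tensor_power n \<theta>)) sums restrict_nucC G \<theta>" using Kr hol[of "nrmC p \<theta> + 1"] True by force
      then show ?thesis using True \<Phi>(2) by (simp add: S_transform_def sums_unique[symmetric])
    qed (simp add: S_transform_def restrict_nucC_def)
    then show ?thesis using * by (intro bexI[of _ \<Phi>]) (auto simp: mult_ac)
  qed
  then show ?thesis unfolding \<kappa>_def[symmetric] using E by (intro exI[of _ p'] exI[of _ q] exI[of _ "2 * E"]) simp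
qed

section \<open>Passage to the inductive limits\<close>

lemma dist_step_zero: "(\<lambda>_. 0) \<in> dist_step \<mu> \<beta> p q" "dist_norm \<mu> \<beta> p q (\<lambda>_. 0) = 0"
proof -
  have d: "(\<lambda>_. 0) \<in> polynomials_dual" by (simp add: polynomials_dual_def dual_space_def)
  have b: "cmod (kernels \<mu> (\<lambda>_. 0) n t) \<le> 0 * (fact n powr (- ((1 - \<beta>) / 2)) * 0 ^ n) * tensor_norm p n t" for n t
    by (simp add: kernels_eq(1)[OF appell d])
  have z: "0 \<le> (0::real)" "2 * (0::real)\<^sup>2 \<le> 2 ^ q" by auto
  show "(\<lambda>_. 0) \<in> dist_step \<mu> \<beta> p q" by (rule dist_stepI(1)[OF appell d z(1) z(1) z(2) b])
  show "dist_norm \<mu> \<beta> p q (\<lambda>_. 0) = 0"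
    using dist_stepI(2)[OF appell d z(1) z(1) z(2) b] dist_norm_nonneg[OF appell, of \<beta> p q "\<lambda>_. 0"] by simp
qed

lemma dist_step_quasi:
  assumes "f \<in> dist_step \<mu> \<beta> p q" "g \<in> dist_step \<mu> \<beta> p q" "h \<in> dist_step \<mu> \<beta> p q"
  shows "dist_norm \<mu> \<beta> p q (h - f) \<le> 2 * (dist_norm \<mu> \<beta> p q (h - g) + dist_norm \<mu> \<beta> p q (g - f))"
proof -
  have d: "x - y \<in> dist_step \<mu> \<beta> p q" if "x \<in> dist_step \<mu> \<beta> p q" "y \<in> dist_step \<mu> \<beta> p q" for x y
    using dist_step_combination(1)[OF appell that, of 1 "-1"] by (simp add: fun_diff_def)
  have "(\<lambda>\<phi>. 1 * (h - g) \<phi> + 1 * (g - f) \<phi>) = h - f" by (simp add: fun_eq_iff)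
  then show ?thesis
    using dist_step_combination(2)[OF appell d[OF assms(3,2)] d[OF assms(2,1)], of 1 1] by simp
qed

lemma entire_max_eq: "entire_max (2 / (1 - \<beta>)) = S_transform \<mu> ` distributions \<mu> \<beta>"
proof (intro equalityI subsetI)
  fix F assume "F \<in> entire_max (2 / (1 - \<beta>))"
  then obtain p l G where G: "G \<in> entire_step (2 / (1 - \<beta>)) p l" "F = restrict_nucC G" by (auto simp: entire_max_def)
  obtain p' q \<Phi> where "\<Phi> \<in> dist_step \<mu> \<beta> p' q" "S_transform \<mu> \<Phi> = restrict_nucC G"
    using inverse_S_step[of p l] G(1) by blast
  then show "F \<in> S_transform \<mu> ` distributions \<mu> \<beta>" using G(2) by (intro image_eqI[of _ _ \<Phi>]) (auto simp: distributions_def)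
next
  fix F assume "F \<in> S_transform \<mu> ` distributions \<mu> \<beta>"
  then obtain p q \<Phi> where \<Phi>: "\<Phi> \<in> dist_step \<mu> \<beta> p q" "F = S_transform \<mu> \<Phi>" by (auto simp: distributions_def)
  obtain l G where "G \<in> entire_step (2 / (1 - \<beta>)) p l" "restrict_nucC G = S_transform \<mu> \<Phi>"
    using S_step[of p q] \<Phi>(1) by blast
  then have "F \<in> restrict_nucC ` entire_step (2 / (1 - \<beta>)) p l" using \<Phi>(2) by (intro image_eqI[of _ _ G]) auto
  then show "F \<in> entire_max (2 / (1 - \<beta>))" unfolding entire_max_def by (intro UN_I UNIV_I)
qed

lemma S_topological_isomorphism:
  "topological_isomorphism (distributions \<mu> \<beta>) (distributions_topology \<mu> \<beta>)
     (entire_max (2 / (1 - \<beta>))) (entire_max_topology (2 / (1 - \<beta>))) (S_transform \<mu>)"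
proof -
  define \<kappa> where "\<kappa> = 2 / (1 - \<beta>)"
  let ?S = "S_transform \<mu>" and ?D = "distributions \<mu> \<beta>" and ?V = "entire_max \<kappa>"
  note Dc = distributions_combination[OF appell \<beta>] and Sl = S_linear[OF appell \<beta>]
  have Veq: "?V = ?S ` ?D" unfolding \<kappa>_def by (rule entire_max_eq)
  have inj: "inj_on ?S ?D" using S_inj[OF appell \<beta>] by (auto intro: inj_onI)
  \<comment> \<open>Linearity and continuity of the inverse are established like those of the
    transform, with the roles of the two inductive limits exchanged.\<close>
  define J where "J = inv_into ?D ?S"
  have JS: "J (?S f) = f" if "f \<in> ?D" for f unfolding J_def by (rule inv_into_f_f[OF inj that])
  have SJ: "?S (J F) = F" "J F \<in> ?D" if "F \<in> ?V" for F
    using that unfolding Veq J_def by (rule f_inv_into_f, rule inv_into_into)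
  have Vc: "(\<lambda>x. a * F x + b * G x) \<in> ?V" and Jl: "J (\<lambda>x. a * F x + b * G x) = (\<lambda>y. a * J F y + b * J G y)"
    if "F \<in> ?V" "G \<in> ?V" for F G a b
  proof -
    have e: "?S (\<lambda>y. a * J F y + b * J G y) = (\<lambda>x. a * F x + b * G x)"
      using Sl[OF SJ(2)[OF that(1)] SJ(2)[OF that(2)]] SJ(1)[OF that(1)] SJ(1)[OF that(2)] by simp
    have m: "(\<lambda>y. a * J F y + b * J G y) \<in> ?D" by (rule Dc[OF SJ(2)[OF that(1)] SJ(2)[OF that(2)]])
    show "(\<lambda>x. a * F x + b * G x) \<in> ?V" unfolding Veq e[symmetric] using m by (rule imageI)
    show "J (\<lambda>x. a * F x + b * G x) = (\<lambda>y. a * J F y + b * J G y)" unfolding e[symmetric] by (rule JS[OF m])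
  qed
  let ?T = "\<lambda>(p, q). dist_step_topology \<mu> \<beta> p q" and ?T' = "\<lambda>(p, l). entire_step_topology \<kappa> p l"
  have zD: "(\<lambda>_. 0) \<in> topspace (?T i)" for i
    using dist_step_zero(1) by (simp add: dist_step_topology_def split: prod.split)
  have zV: "(\<lambda>_. 0) \<in> topspace (?T' i)" for i
    using entire_step_zero(1) by (simp add: entire_step_topology_def split: prod.split)
  have sD: "(\<lambda>\<Phi>. \<Phi>) ` topspace (?T i) \<subseteq> ?D" for i
    by (auto simp: dist_step_topology_def distributions_def split: prod.split)
  have sV: "restrict_nucC ` topspace (?T' i) \<subseteq> ?V" for i
    by (auto simp: entire_step_topology_def entire_max_def split: prod.split)
  have tD: "topspace (lc_inductive_topology ?D ?T (\<lambda>_ \<Phi>. \<Phi>)) = ?D"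
    using Dc by (intro topspace_lc_inductive_topology zD sD) (simp add: absolutely_convex_def)
  have tV: "topspace (lc_inductive_topology ?V ?T' (\<lambda>_. restrict_nucC)) = ?V"
    using Vc by (intro topspace_lc_inductive_topology zV sV) (simp add: absolutely_convex_def)
  have cS: "continuous_map (lc_inductive_topology ?D ?T (\<lambda>_ \<Phi>. \<Phi>)) (lc_inductive_topology ?V ?T' (\<lambda>_. restrict_nucC)) ?S"
  proof (rule lc_inductive_map_continuous[OF Dc Sl _ tD tV zD sD])
    show "?S f \<in> ?V" if "f \<in> ?D" for f using that Veq by blast
    fix i :: "nat \<times> nat"
    obtain p q where i: "i = (p, q)" by (cases i)
    obtain l C where C: "0 \<le> C" "\<forall>\<Phi>\<in>dist_step \<mu> \<beta> p q. \<exists>G\<in>entire_step \<kappa> p l. restrict_nucC G = ?S \<Phi> \<and> entire_norm \<kappa> p l G \<le> C * dist_norm \<mu> \<beta> p q \<Phi>"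
      using S_step[of p q] unfolding \<kappa>_def by blast
    have d: "?T i = seminorm_topology (dist_step \<mu> \<beta> p q) {dist_norm \<mu> \<beta> p q}"
      by (simp add: i dist_step_topology_def dist_norm_def[OF appell, abs_def])
    have e: "?T' (p, l) = seminorm_topology (entire_step \<kappa> p l) {entire_norm \<kappa> p l}" by (simp add: entire_step_topology_def)
    have "\<exists>G. openin (?T i) G \<and> (\<lambda>_. 0) \<in> G \<and> (\<forall>g\<in>G. ?S g \<in> restrict_nucC ` G')" if "openin (?T' (p, l)) G'" "(\<lambda>_. 0) \<in> G'" for G'
      unfolding d
      by (rule seminorm_topology_step_nhd[where L = ?S and j = restrict_nucC, OF dist_step_zero dist_step_quasi C that[unfolded e]])
    then show "\<exists>i'. \<forall>G'. openin (?T' i') G' \<longrightarrow> (\<lambda>_. 0) \<in> G' \<longrightarrow> (\<exists>G. openin (?T i) G \<and> (\<lambda>_. 0) \<in> G \<and> (\<forall>g\<in>G. ?S g \<in> restrict_nucC ` G'))"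
      by (intro exI[of _ "(p, l)"]) blast
  qed
  have cJ: "continuous_map (lc_inductive_topology ?V ?T' (\<lambda>_. restrict_nucC)) (lc_inductive_topology ?D ?T (\<lambda>_ \<Phi>. \<Phi>)) J"
  proof (rule lc_inductive_map_continuous[OF Vc Jl SJ(2) tV tD zV sV])
    fix i :: "nat \<times> nat"
    obtain p l where i: "i = (p, l)" by (cases i)
    obtain p' q C where C: "0 \<le> C" "\<forall>G\<in>entire_step \<kappa> p l. \<exists>\<Phi>\<in>dist_step \<mu> \<beta> p' q. ?S \<Phi> = restrict_nucC G \<and> dist_norm \<mu> \<beta> p' q \<Phi> \<le> C * entire_norm \<kappa> p l G"
      using inverse_S_step[of p l] unfolding \<kappa>_def by blast
    have C': "\<forall>G\<in>entire_step \<kappa> p l. \<exists>\<Phi>\<in>dist_step \<mu> \<beta> p' q. \<Phi> = J (restrict_nucC G) \<and> dist_norm \<mu> \<beta> p' q \<Phi> \<le> C * entire_norm \<kappa> p l G"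
    proof
      fix G assume "G \<in> entire_step \<kappa> p l"
      then obtain \<Phi> where \<Phi>: "\<Phi> \<in> dist_step \<mu> \<beta> p' q" "?S \<Phi> = restrict_nucC G" "dist_norm \<mu> \<beta> p' q \<Phi> \<le> C * entire_norm \<kappa> p l G" using C(2) by blast
      have "\<Phi> \<in> ?D" using \<Phi>(1) unfolding distributions_def by blast
      then have "\<Phi> = J (restrict_nucC G)" using JS \<Phi>(2) by metis
      then show "\<exists>\<Phi>\<in>dist_step \<mu> \<beta> p' q. \<Phi> = J (restrict_nucC G) \<and> dist_norm \<mu> \<beta> p' q \<Phi> \<le> C * entire_norm \<kappa> p l G" using \<Phi>(1,3) by blast
    qed
    have d: "?T (p', q) = seminorm_topology (dist_step \<mu> \<beta> p' q) {dist_norm \<mu> \<beta> p' q}"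
      by (simp add: dist_step_topology_def dist_norm_def[OF appell, abs_def])
    have e: "?T' i = seminorm_topology (entire_step \<kappa> p l) {entire_norm \<kappa> p l}" by (simp add: i entire_step_topology_def)
    \<comment> \<open>The available bound concerns differences, so \<open>h - f\<close> is written
      as \<open>(h - g) - (f - g)\<close>, and the norm of \<open>f - g\<close> is compared with
      that of \<open>g - f\<close> by subtracting the latter from 0.\<close>
    have quasi: "entire_norm \<kappa> p l (h - f) \<le> 2 * (entire_norm \<kappa> p l (h - g) + entire_norm \<kappa> p l (g - f))"
      if fgh: "f \<in> entire_step \<kappa> p l" "g \<in> entire_step \<kappa> p l" "h \<in> entire_step \<kappa> p l" for f g h
    proof -
      note hg = entire_step_diff(1)[OF fgh(2,3)] and gf = entire_step_diff(1)[OF fgh(1,2)] and fg = entire_step_diff(1)[OF fgh(2,1)]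
      have z: "(\<lambda>_. 0) - (g - f) = f - g" "(h - g) - (f - g) = h - f" by (simp_all add: fun_eq_iff)
      have "entire_norm \<kappa> p l (f - g) \<le> entire_norm \<kappa> p l (g - f)"
        using entire_step_diff(2)[OF gf entire_step_zero(1)] unfolding z entire_step_zero(2) by simp
      moreover have "entire_norm \<kappa> p l (h - f) \<le> entire_norm \<kappa> p l (h - g) + entire_norm \<kappa> p l (f - g)"
        using entire_step_diff(2)[OF fg hg] unfolding z .
      moreover have "x \<le> 2 * (b + d)" if "a \<le> d" "x \<le> b + a" "0 \<le> b" "0 \<le> d" for a b d x :: real using that unfolding distrib_left by linarith
      ultimately show ?thesis using entire_norm_nonneg[OF hg] entire_norm_nonneg[OF gf] by blast
    qed
    have "\<exists>G. openin (?T' i) G \<and> (\<lambda>_. 0) \<in> G \<and> (\<forall>g\<in>G. J (restrict_nucC g) \<in> (\<lambda>\<Phi>. \<Phi>) ` G')" if "openin (?T (p', q)) G'" "(\<lambda>_. 0) \<in> G'" for G'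
      unfolding e
      by (rule seminorm_topology_step_nhd[where L = "\<lambda>G. J (restrict_nucC G)" and j = "\<lambda>\<Phi>. \<Phi>", OF entire_step_zero quasi C(1) C' that[unfolded d]])
    then show "\<exists>i'. \<forall>G'. openin (?T i') G' \<longrightarrow> (\<lambda>_. 0) \<in> G' \<longrightarrow> (\<exists>G. openin (?T' i) G \<and> (\<lambda>_. 0) \<in> G \<and> (\<forall>g\<in>G. J (restrict_nucC g) \<in> (\<lambda>\<Phi>. \<Phi>) ` G'))"
      by (intro exI[of _ "(p', q)"]) blast
  qed
  have "homeomorphic_map (lc_inductive_topology ?D ?T (\<lambda>_ \<Phi>. \<Phi>)) (lc_inductive_topology ?V ?T' (\<lambda>_. restrict_nucC)) ?S"
    unfolding homeomorphic_map_maps homeomorphic_maps_def tD tV using cS cJ JS SJ(1) by blast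
  moreover have "bij_betw ?S ?D ?V" using inj Veq by (simp add: bij_betw_def)
  moreover have "complex_linear_on ?D ?S" unfolding complex_linear_on_def using Sl by blast
  ultimately show ?thesis
    unfolding topological_isomorphism_def distributions_topology_def entire_max_topology_def \<kappa>_def[symmetric] tD tV by blast
qed

end

end

theorem theorem36:
  fixes H :: "nat \<Rightarrow> 'h::{real_inner, banach, second_countable_topology} set"
    and ip :: "nat \<Rightarrow> 'h \<Rightarrow> 'h \<Rightarrow> real"
    and \<mu> :: "('h \<Rightarrow> real) measure"
    and \<beta> :: real
  assumes "nuclear_triple H ip"
    and "\<mu> \<in> hilbert_chain.analytic_measures H ip"
    and "prob_space \<mu>"
    and "hilbert_chain.nondegenerate H ip \<mu>"
    and "0 \<le> \<beta>" and "\<beta> < 1"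
  shows "topological_isomorphism
           (hilbert_chain.distributions H ip \<mu> \<beta>)
           (hilbert_chain.distributions_topology H ip \<mu> \<beta>)
           (hilbert_chain.entire_max H ip (2 / (1 - \<beta>)))
           (hilbert_chain.entire_max_topology H ip (2 / (1 - \<beta>)))
           (hilbert_chain.S_transform H ip \<mu>)"
proof -
  interpret nuclear_triple H ip by fact
  obtain A where "appell_data \<mu> A" using appell_data_exists[OF assms(2,3)] by blast
  then show ?thesis using assms(5,6) by (rule S_topological_isomorphism)
qed

end
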